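(* Let $\mathbf{K}$ be a finite field with $q$ elements and characteristic $p$, and let $n\geqslant 2$ be an integer. Let $Y$ be an elliptic curve over $\mathbf{K}$ having a $\mathbf{K}$-rational point $t$ of order $n$. Let $C$ be the group generated by $t$ (acting on $Y$ by translations), let $X=Y/C$ and let $\rho:Y\to X$ be the quotient isogeny, with dual isogeny $\hat\rho$. Let $a\in X(\mathbf{K})$, let $n_1$ be the inertial degree of $\rho$ at $a$ and $n_2=n/n_1$. Let $u$ be a non-zero point in $\rho(Y(\mathbf{K}))$ and let $v\in X(\mathbf{K})$. Assume that neither $v-a$ nor $u-2v$ lies in the kernel of $\hat\rho$. Then $\nu_q^{sym}(n_1,n_2)\leqslant 2$. If moreover $n_2=1$, then $\nu_q^{sym}(n)=2$.
   Context: Equivariant symmetric complexity: for a field $\mathbf{K}$ and finite group $C$, identify $\mathbf{K}[C]$ with maps $C\to\mathbf{K}$ and let $\diamond$ be the componentwise product $(\sum a_c c)\diamond(\sum b_c c)=\sum a_cb_c c$, with $\diamond_k$ its componentwise extension to $\mathbf{K}[C]^k$. For finitely generated $\mathbf{K}[C]$-modules $L,M$ and a symmetric $C$-equivariant $\mathbf{K}$-bilinear map $t:L\times L\to M$, $S_{\mathbf{K},C}(t)$ is the least $k$ such that $t(l_1,l_2)=\bot(\top(l_1)\diamond_k\top(l_2))$ for some $\mathbf{K}[C]$-linear $\top:L\to\mathbf{K}[C]^k$, $\bot:\mathbf{K}[C]^k\to M$. $\nu_q^{sym}(n_1,n_2)$: with $\mathbf{K}$ of $q$ elements, $\mathbf{L}$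 a degree $n_1$ extension with Frobenius $F_q$, $\mathbf{M}=\mathbf{L}^{n_2}$ and $C$ the cyclic group of order $n_1n_2$ generated by $(x_0,\dots,x_{n_2-1})\mapsto(x_1,\dots,x_{n_2-1},F_q(x_0))$, $\nu_q^{sym}(n_1,n_2)=S_{\mathbf{K},C}(\text{multiplication } \mathbf{M}\times\mathbf{M}\to\mathbf{M})$. $\nu_q^{sym}(n)$: with $\mathbf{L}$ a degree $n$ extension of $\mathbf{K}$ and $C=\mathrm{Gal}(\mathbf{L}/\mathbf{K})$, $\nu_q^{sym}(n)=S_{\mathbf{K},C}(\text{multiplication } \mathbf{L}\times\mathbf{L}\to\mathbf{L})$ (so $\nu_q^{sym}(n)=\nu_q^{sym}(n,1)$). The inertial degree of $\rho$ at $a$ is $n_1$ means the fiber $\rho^{-1}(a)$ consists of $n/n_1$ closed points each of degree $n_1$ over $a$. *)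

theory Defs
  imports
    "HOL-Algebra.Algebraic_Closure_Type"
    "HOL-Algebra.Bij"
    "HOL-Algebra.Generated_Groups"
    "HOL-Algebra.Multiplicative_Group"
    "HOL-Algebra.Module"
    "HOL-Algebra.Embedded_Algebras"
    "HOL-Library.Cardinality"
    "HOL-Library.Extended_Nat"
begin

section \<open>Equivariant symmetric bilinear complexity\<close>

definition group_algebra :: "('c, 'z) monoid_scheme \<Rightarrow> ('c \<Rightarrow> 'k::field) ring" where
  "group_algebra C =
    \<lparr>carrier = carrier C \<rightarrow>\<^sub>E UNIV,
     monoid.mult = (\<lambda>f g. \<lambda>c\<in>carrier C. \<Sum>d\<in>carrier C. f d * g (inv\<^bsub>C\<^esub> d \<otimes>\<^bsub>C\<^esub> c)),
     one = (\<lambda>c\<in>carrier C. if c = \<one>\<^bsub>C\<^esub> then 1 else 0),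
     ring.zero = (\<lambda>c\<in>carrier C. 0),
     add = (\<lambda>f g. \<lambda>c\<in>carrier C. f c + g c)\<rparr>"

definition diamond ::
    "('c, 'z) monoid_scheme \<Rightarrow> ('c \<Rightarrow> 'k::field) \<Rightarrow> ('c \<Rightarrow> 'k) \<Rightarrow> ('c \<Rightarrow> 'k)" where
  "diamond C f g = (\<lambda>c\<in>carrier C. f c * g c)"

definition diamond_pow ::
    "('c, 'z) monoid_scheme \<Rightarrow> nat \<Rightarrow> (nat \<Rightarrow> 'c \<Rightarrow> 'k::field) \<Rightarrow> (nat \<Rightarrow> 'c \<Rightarrow> 'k)
      \<Rightarrow> (nat \<Rightarrow> 'c \<Rightarrow> 'k)" where
  "diamond_pow C k f g = (\<lambda>i\<in>{..<k}. diamond C (f i) (g i))"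

text \<open>
  The module \<open>K[C]^k\<close>. A module record also carries a ring multiplication; here it is
  \<^const>\<open>diamond_pow\<close> (not convolution). Only the additive structure and the scalar
  multiplication matter for linear maps.
\<close>
definition group_algebra_pow ::
    "('c, 'z) monoid_scheme \<Rightarrow> nat \<Rightarrow> ('c \<Rightarrow> 'k::field, nat \<Rightarrow> 'c \<Rightarrow> 'k) module" where
  "group_algebra_pow C k =
    \<lparr>carrier = {..<k} \<rightarrow>\<^sub>E carrier (group_algebra C),
     monoid.mult = diamond_pow C k,
     one = (\<lambda>i\<in>{..<k}. \<lambda>c\<in>carrier C. 1),
     ring.zero = (\<lambda>i\<in>{..<k}. \<zero>\<^bsub>group_algebra C\<^esub>),
     add = (\<lambda>f g. \<lambda>i\<in>{..<k}. f i \<oplus>\<^bsub>group_algebra C\<^esub> g i),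
     module.smult = (\<lambda>r f. \<lambda>i\<in>{..<k}. r \<otimes>\<^bsub>group_algebra C\<^esub> f i)\<rparr>"

definition module_homs ::
    "('r, 'z) ring_scheme \<Rightarrow> ('r, 'a) module \<Rightarrow> ('r, 'b) module \<Rightarrow> ('a \<Rightarrow> 'b) set" where
  "module_homs R M N = {h \<in> carrier M \<rightarrow> carrier N.
     (\<forall>x\<in>carrier M. \<forall>y\<in>carrier M. h (x \<oplus>\<^bsub>M\<^esub> y) = h x \<oplus>\<^bsub>N\<^esub> h y) \<and>
     (\<forall>r\<in>carrier R. \<forall>x\<in>carrier M. h (r \<odot>\<^bsub>M\<^esub> x) = r \<odot>\<^bsub>N\<^esub> h x)}"

text \<open>
  The least length of a decomposition. The field is the type \<open>'k\<close>. The value is taken in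
  \<^typ>\<open>enat\<close>, so that it would be infinite, rather than some arbitrary number, if there were
  no decomposition.
\<close>
definition sym_complexity ::
    "('c, 'z) monoid_scheme \<Rightarrow> ('c \<Rightarrow> 'k::field, 'l) module \<Rightarrow> ('c \<Rightarrow> 'k, 'm) module
      \<Rightarrow> ('l \<Rightarrow> 'l \<Rightarrow> 'm) \<Rightarrow> enat" where
  "sym_complexity C L M t = (INF k \<in> {k.
     \<exists>top \<in> module_homs (group_algebra C) L (group_algebra_pow C k).
     \<exists>bot \<in> module_homs (group_algebra C) (group_algebra_pow C k) M.
       \<forall>x\<in>carrier L. \<forall>y\<in>carrier L. t x y = bot (diamond_pow C k (top x) (top y))}. enat k)"


section \<open>Multiplication in extensions of a finite field and in their powers\<close>

text \<open>
  The extension of degree \<open>n\<close> of the finite field \<open>'k\<close>, inside a fixed algebraic closure.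
  The lemmas \<open>subfield_ext_field\<close> and \<open>dimension_ext_field\<close> below justify this description.
\<close>
definition ext_field :: "nat \<Rightarrow> 'k::finite_field alg_closure set" where
  "ext_field n = {x. x ^ (CARD('k) ^ n) = x}"

lemma dimension_finite_field_extension:
  fixes R :: "'a ring"
  assumes "field R" and K: "subfield K R" and L: "subfield L R" and "K \<subseteq> L" and fin: "finite L"
  obtains d where "ring.dimension R d K L" "card L = card K ^ d"
proof -
  interpret field R by fact
  obtain Us where Us: "set Us = L"
    using finite_list[OF fin] by blast
  have Lc: "L \<subseteq> carrier R" using subfieldE(3)[OF L] .
  have "Span K Us = L"
  proof
    show "L \<subseteq> Span K Us"
      using Span_base_incl[OF K, of Us] Us Lc by auto
    have "subgroup L (add_monoid R)"
      using subring.axioms(1)[OF subfieldE(1)[OF L]] .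
    moreover have "K <#>\<^bsub>R\<^esub> set Us \<subseteq> L"
      using subringE(6)[OF subfieldE(1)[OF L]] Us \<open>K \<subseteq> L\<close>
      by (auto simp: set_mult_def)
    ultimately show "Span K Us \<subseteq> L"
      using Span_min[OF K, of Us L] Us Lc by auto
  qed
  then obtain d where d: "dimension d K L"
    using Span_finite_dimension[OF K, of Us] Us Lc by (auto simp: finite_dimension_def)
  then obtain Vs where Vs: "set Vs \<subseteq> carrier R" "independent K Vs" "length Vs = d" "Span K Vs = L"
    using exists_base[OF K] by blast
  have mem: "x \<in> L \<longleftrightarrow> (\<exists>Ks. set Ks \<subseteq> K \<and> length Ks = d \<and> x = combine Ks Vs)" for x
    using Span_mem_iff_length_version[OF K Vs(1), of x] Vs by simp
  have "bij_betw (\<lambda>Ks. combine Ks Vs) {Ks. set Ks \<subseteq> K \<and> length Ks = d} L"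
  proof (rule bij_betw_imageI)
    show "(\<lambda>Ks. combine Ks Vs) ` {Ks. set Ks \<subseteq> K \<and> length Ks = d} = L"
      using mem by auto
    show "inj_on (\<lambda>Ks. combine Ks Vs) {Ks. set Ks \<subseteq> K \<and> length Ks = d}"
    proof (rule inj_onI)
      fix Ks Ks' assume *: "Ks \<in> {Ks. set Ks \<subseteq> K \<and> length Ks = d}"
        "Ks' \<in> {Ks. set Ks \<subseteq> K \<and> length Ks = d}" "combine Ks Vs = combine Ks' Vs"
      hence "combine Ks Vs \<in> Span K Vs"
        unfolding Vs(4) by (subst mem) auto
      from unique_decomposition[OF K Vs(2) this] obtain K0 where
        K0: "\<forall>Js. set Js \<subseteq> K \<and> length Js = length Vs \<and> combine Ks Vs = combine Js Vs \<longrightarrow> Js = K0"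
        by (rule ex1E)
      have "Ks = K0" using * Vs(3) by (intro K0[rule_format]) auto
      moreover have "Ks' = K0" using * Vs(3) by (intro K0[rule_format]) auto
      ultimately show "Ks = Ks'" by simp
    qed
  qed
  hence "card L = card {Ks. set Ks \<subseteq> K \<and> length Ks = d}"
    by (rule bij_betw_same_card[symmetric])
  also have "\<dots> = card K ^ d"
    using finite_subset[OF \<open>K \<subseteq> L\<close> fin] by (rule card_lists_length_eq)
  finally show ?thesis by (rule that[OF d])
qed

lemma card_finite_field_eq_power_CHAR:
  obtains r where "CARD('k::finite_field) = CHAR('k) ^ r"
proof -
  let ?R = "ring_of_type_algebra :: 'k ring"
  let ?P = "range (of_nat :: nat \<Rightarrow> 'k)"
  interpret field ?R by (rule field_from_type_algebra)
  have simps [simp]: "carrier ?R = UNIV" "x \<otimes>\<^bsub>?R\<^esub> y = x * y" "x \<oplus>\<^bsub>?R\<^esub> y = x + y"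
    "\<one>\<^bsub>?R\<^esub> = 1" "\<zero>\<^bsub>?R\<^esub> = 0" for x y
    by (simp_all add: ring_of_type_algebra_def)
  have [simp]: "\<ominus>\<^bsub>?R\<^esub> x = - x" for x
    by (rule minus_equality) auto
  have [simp]: "inv\<^bsub>?R\<^esub> x = inverse x" if "x \<noteq> 0" for x
    by (rule inv_char) (use that in auto)
  have q2: "CARD('k) \<ge> 2"
    using card_mono[of "UNIV :: 'k set" "{0, 1}"] by simp
  have "subfield ?P ?R"
  proof (rule subfieldI', rule subringI)
    show "\<one>\<^bsub>?R\<^esub> \<in> ?P" using of_nat_1 by (metis rangeI simps(4))
    fix h assume h: "h \<in> ?P"
    then obtain m where m: "h = of_nat m" by blast
    have "of_nat m + of_nat (m * (CHAR('k) - 1)) = (of_nat (m * CHAR('k)) :: 'k)"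
      by (metis CHAR_pos Suc_diff_1 mult_Suc_right of_nat_add)
    also have "\<dots> = 0" by simp
    finally have "- h = of_nat (m * (CHAR('k) - 1))"
      unfolding m by (rule Groups.minus_unique)
    thus "\<ominus>\<^bsub>?R\<^esub> h \<in> ?P" by (metis rangeI \<open>\<And>x. \<ominus>\<^bsub>?R\<^esub> x = - x\<close>)
  next
    fix h assume "h \<in> ?P - {\<zero>\<^bsub>?R\<^esub>}"
    then obtain m where m: "h = of_nat m" and h: "h \<noteq> 0" by auto
    have "h * (h * h ^ (CARD('k) - 2)) = h ^ Suc (Suc (CARD('k) - 2))" by simp
    also have "Suc (Suc (CARD('k) - 2)) = CARD('k)" using q2 by simp
    also have "h ^ CARD('k) = h" by (rule finite_field_power_card_eq_same)
    finally have "h * h ^ (CARD('k) - 2) = 1" using h by simp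
    hence "inverse h = of_nat (m ^ (CARD('k) - 2))"
      using inverse_unique m by (metis of_nat_power)
    thus "inv\<^bsub>?R\<^esub> h \<in> ?P" using h by (metis rangeI \<open>\<And>x. x \<noteq> 0 \<Longrightarrow> inv\<^bsub>?R\<^esub> x = inverse x\<close>)
  next
    fix h1 h2 assume "h1 \<in> ?P" "h2 \<in> ?P"
    then obtain i j where "h1 = of_nat i" "h2 = of_nat j" by blast
    hence "h1 \<otimes>\<^bsub>?R\<^esub> h2 = of_nat (i * j)" "h1 \<oplus>\<^bsub>?R\<^esub> h2 = of_nat (i + j)" by simp_all
    thus "h1 \<otimes>\<^bsub>?R\<^esub> h2 \<in> ?P" "h1 \<oplus>\<^bsub>?R\<^esub> h2 \<in> ?P" by (metis rangeI)+
  qed auto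
  moreover have "subfield UNIV ?R"
    by (rule subfieldI', rule subringI) auto
  ultimately obtain d where d: "CARD('k) = card ?P ^ d"
    by (rule dimension_finite_field_extension[OF field_axioms]) auto
  have "?P = of_nat ` {..<CHAR('k)}"
  proof safe
    fix m
    have "of_nat m = (of_nat (m mod CHAR('k)) :: 'k)"
    proof -
      have "of_nat m = (of_nat (m mod CHAR('k) + CHAR('k) * (m div CHAR('k))) :: 'k)"
        by simp
      thus ?thesis
        by (simp only: of_nat_add of_nat_mult of_nat_CHAR) simp
    qed
    thus "of_nat m \<in> (of_nat ` {..<CHAR('k)} :: 'k set)"
      by auto
  qed auto
  moreover have "inj_on (of_nat :: nat \<Rightarrow> 'k) {..<CHAR('k)}"
  proof (rule linorder_inj_onI')
    fix i j assume ij: "i \<in> {..<CHAR('k)}" "j \<in> {..<CHAR('k)}" "i < j"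
    have "\<not> CHAR('k) dvd (j - i)"
      using ij by (auto dest: dvd_imp_le)
    hence "of_nat (j - i) \<noteq> (0 :: 'k)"
      by (simp add: of_nat_eq_0_iff_char_dvd)
    thus "of_nat i \<noteq> (of_nat j :: 'k)"
      using ij by (simp add: of_nat_diff)
  qed
  ultimately have "card ?P = CHAR('k)"
    by (simp add: card_image)
  thus ?thesis using d that by metis
qed

lemma q_power_add:
  fixes x y :: "'k::finite_field alg_closure"
  shows "(x + y) ^ (CARD('k) ^ n) = x ^ (CARD('k) ^ n) + y ^ (CARD('k) ^ n)"
proof -
  obtain r where "CARD('k) = CHAR('k) ^ r"
    by (rule card_finite_field_eq_power_CHAR)
  hence "CARD('k) ^ n = CHAR('k alg_closure) ^ (r * n)"
    by (simp add: power_mult)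
  thus ?thesis
    by (intro freshmans_dream') auto
qed

lemma q_power_minus:
  fixes x :: "'k::finite_field alg_closure"
  shows "(- x) ^ (CARD('k) ^ n) = - (x ^ (CARD('k) ^ n))"
  using q_power_add[of x "- x" n] by (simp add: zero_power add_eq_0_iff)

lemma to_ac_in_ext_field: "to_ac a \<in> ext_field n"
  by (simp add: ext_field_def finite_field_power_card_power_eq_same flip: to_ac_power)

lemma card_ext_field:
  assumes "n > 0"
  shows "card (ext_field n :: 'k::finite_field alg_closure set) = CARD('k) ^ n"
proof -
  define N where "N = CARD('k) ^ n"
  define p :: "'k alg_closure poly" where "p = monom 1 N - monom 1 1"
  have "CARD('k) > 1"
    using card_mono[of "UNIV :: 'k set" "{0, 1}"] by simp
  hence N: "N > 1"
    using assms unfolding N_def by (metis one_less_power)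
  have p_deg: "degree p = N"
    unfolding p_def using N by (subst diff_conv_add_uminus, subst degree_add_eq_left) (auto simp: degree_monom_eq)
  have "of_nat CHAR('k alg_closure) = (0 :: 'k alg_closure)"
    by (rule of_nat_CHAR)
  obtain r where r: "CARD('k) = CHAR('k) ^ r"
    by (rule card_finite_field_eq_power_CHAR)
  hence "r > 0"
    using \<open>CARD('k) > 1\<close> by (cases r) auto
  hence "CHAR('k) dvd CARD('k)"
    by (simp add: r)
  hence "CHAR('k alg_closure) dvd N"
    using assms by (simp add: N_def dvd_power_iff_le dvd_trans[OF _ dvd_power])
  hence "of_nat N = (0 :: 'k alg_closure)"
    by (simp add: of_nat_eq_0_iff_char_dvd)
  hence pd: "pderiv p = - 1"
    by (simp add: p_def pderiv_diff pderiv_monom)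
  have p0: "p \<noteq> 0"
    using p_deg N by auto
  obtain A where A: "size A = degree p" "p = smult (lead_coeff p) (\<Prod>x\<in>#A. [:-x, 1:])"
    using alg_closed_imp_factorization[OF p0] by blast
  have roots: "set_mset A = {x. poly p x = 0}"
  proof -
    have "poly p x = lead_coeff p * (\<Prod>y\<in>#A. x - y)" for x
      by (subst A(2)) (simp add: poly_prod_mset)
    thus ?thesis using p0 by auto
  qed
  have "count A x \<le> 1" for x
  proof (rule ccontr)
    assume "\<not> count A x \<le> 1"
    hence "{#x, x#} \<subseteq># A"
      by (auto simp: subseteq_mset_def)
    then obtain B where "A = {#x, x#} + B"
      by (metis mset_subset_eq_exists_conv)
    hence "p = [:-x, 1:] * ([:-x, 1:] * smult (lead_coeff p) (\<Prod>x\<in>#B. [:-x, 1:]))"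
      using A(2) by (simp add: mult_ac)
    then obtain r where "p = [:-x, 1:] * ([:-x, 1:] * r)" by blast
    hence "poly (pderiv p) x = 0"
      by (simp only: pderiv_mult poly_add poly_mult) simp
    thus False by (simp add: pd)
  qed
  hence "A = mset_set (set_mset A)"
    by (intro multiset_eqI) (auto simp: count_mset_set' le_Suc_eq count_eq_zero_iff simp flip: not_in_iff)
  hence "card (set_mset A) = N"
    using A(1) p_deg by (metis size_mset_set)
  also have "set_mset A = ext_field n"
    by (auto simp: roots ext_field_def p_def poly_monom N_def)
  finally show ?thesis by (simp add: N_def)
qed

lemma subfield_ext_field:
  "subfield (ext_field n) (ring_of_type_algebra :: 'k::finite_field alg_closure ring)"
proof -
  let ?R = "ring_of_type_algebra :: 'k alg_closure ring"
  interpret field ?R by (rule field_from_type_algebra)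
  have [simp]: "carrier ?R = UNIV" "x \<otimes>\<^bsub>?R\<^esub> y = x * y" "x \<oplus>\<^bsub>?R\<^esub> y = x + y"
    "\<one>\<^bsub>?R\<^esub> = 1" "\<zero>\<^bsub>?R\<^esub> = 0" for x y
    by (simp_all add: ring_of_type_algebra_def)
  have [simp]: "\<ominus>\<^bsub>?R\<^esub> x = - x" for x
    by (rule minus_equality) auto
  have [simp]: "inv\<^bsub>?R\<^esub> x = inverse x" if "x \<noteq> 0" for x
    by (rule inv_char) (use that in auto)
  show ?thesis
    by (rule subfieldI', rule subringI)
       (auto simp: ext_field_def q_power_add q_power_minus power_mult_distrib power_inverse)
qed

lemma dimension_ext_field:
  assumes "n > 0"
  shows "ring.dimension (ring_of_type_algebra :: 'k::finite_field alg_closure ring)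
           n (range to_ac) (ext_field n)"
proof -
  let ?R = "ring_of_type_algebra :: 'k alg_closure ring"
  let ?K = "range to_ac :: 'k alg_closure set"
  let ?L = "ext_field n :: 'k alg_closure set"
  interpret field ?R by (rule field_from_type_algebra)
  have [simp]: "carrier ?R = UNIV"
    by (simp add: ring_of_type_algebra_def)
  have q: "CARD('k) > 1"
    using card_mono[of "UNIV :: 'k set" "{0, 1}"] by simp
  have "ext_field 1 = ?K"
  proof (rule sym, rule card_subset_eq)
    show "finite (ext_field 1 :: 'k alg_closure set)"
      by (rule card_ge_0_finite) (simp add: card_ext_field)
    show "?K \<subseteq> ext_field 1" using to_ac_in_ext_field by blast
    show "card ?K = card (ext_field 1 :: 'k alg_closure set)"
      by (simp add: card_ext_field card_image[OF inj_to_ac])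
  qed
  hence K: "subfield ?K ?R"
    using subfield_ext_field[of 1, where ?'k = 'k] by simp
  have card_K: "card ?K = CARD('k)"
    by (simp add: card_image[OF inj_to_ac])
  have "card ?L = CARD('k) ^ n"
    by (rule card_ext_field[OF assms])
  moreover from this have "finite ?L"
    using q by (intro card_ge_0_finite) simp
  then obtain d where "dimension d ?K ?L" "card ?L = card ?K ^ d"
    using dimension_finite_field_extension[OF field_axioms K subfield_ext_field, of n]
      to_ac_in_ext_field by blast
  ultimately show ?thesis
    using card_K q by simp
qed

definition twisted_carrier :: "nat \<Rightarrow> nat \<Rightarrow> (nat \<Rightarrow> 'k::finite_field alg_closure) set" where
  "twisted_carrier n1 n2 = {..<n2} \<rightarrow>\<^sub>E ext_field n1"

text \<open>\<open>(x\<^sub>0, \<dots>, x\<^bsub>n2-1\<^esub>) \<mapsto> (x\<^sub>1, \<dots>, x\<^bsub>n2-1\<^esub>, x\<^sub>0\<^sup>q)\<close>\<close>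
definition twisted_shift ::
    "nat \<Rightarrow> nat \<Rightarrow> (nat \<Rightarrow> 'k::finite_field alg_closure) \<Rightarrow> (nat \<Rightarrow> 'k alg_closure)" where
  "twisted_shift n1 n2 = (\<lambda>x\<in>twisted_carrier n1 n2.
     \<lambda>i\<in>{..<n2}. if Suc i < n2 then x (Suc i) else x 0 ^ CARD('k))"

definition twisted_group ::
    "nat \<Rightarrow> nat \<Rightarrow> ((nat \<Rightarrow> 'k::finite_field alg_closure) \<Rightarrow> (nat \<Rightarrow> 'k alg_closure)) monoid" where
  "twisted_group n1 n2 = (BijGroup (twisted_carrier n1 n2))
     \<lparr>carrier := generate (BijGroup (twisted_carrier n1 n2)) {twisted_shift n1 n2}\<rparr>"

definition twisted_module :: "nat \<Rightarrow> nat \<Rightarrow>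
    (((nat \<Rightarrow> 'k alg_closure) \<Rightarrow> (nat \<Rightarrow> 'k alg_closure)) \<Rightarrow> 'k::finite_field,
     nat \<Rightarrow> 'k alg_closure) module" where
  "twisted_module n1 n2 =
    \<lparr>carrier = twisted_carrier n1 n2,
     monoid.mult = (\<lambda>x y. \<lambda>i\<in>{..<n2}. x i * y i),
     one = (\<lambda>i\<in>{..<n2}. 1),
     ring.zero = (\<lambda>i\<in>{..<n2}. 0),
     add = (\<lambda>x y. \<lambda>i\<in>{..<n2}. x i + y i),
     module.smult = (\<lambda>r x. \<lambda>i\<in>{..<n2}. \<Sum>c\<in>carrier (twisted_group n1 n2). to_ac (r c) * c x i)\<rparr>"

text \<open>\<open>\<nu>\<^sub>q\<^sup>s\<^sup>y\<^sup>m(n\<^sub>1, n\<^sub>2)\<close>, where \<open>q\<close> is the number of elements of the finite field \<open>'k\<close>\<close>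
definition nu_sym_twisted :: "'k::finite_field itself \<Rightarrow> nat \<Rightarrow> nat \<Rightarrow> enat" where
  "nu_sym_twisted _ n1 n2 =
     (let M = (twisted_module n1 n2 ::
           (((nat \<Rightarrow> 'k alg_closure) \<Rightarrow> (nat \<Rightarrow> 'k alg_closure)) \<Rightarrow> 'k, nat \<Rightarrow> 'k alg_closure) module)
      in sym_complexity (twisted_group n1 n2) M M (\<otimes>\<^bsub>M\<^esub>))"

definition ext_galois_group ::
    "nat \<Rightarrow> ('k::finite_field alg_closure \<Rightarrow> 'k alg_closure) monoid" where
  "ext_galois_group n = (BijGroup (ext_field n))
     \<lparr>carrier := {\<sigma> \<in> Bij (ext_field n).
        (\<forall>x\<in>ext_field n. \<forall>y\<in>ext_field n. \<sigma> (x + y) = \<sigma> x + \<sigma> y \<and> \<sigma> (x * y) = \<sigma> x * \<sigma> y) \<and>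
        (\<forall>a. \<sigma> (to_ac a) = to_ac a)}\<rparr>"

definition ext_module :: "nat \<Rightarrow>
    (('k alg_closure \<Rightarrow> 'k alg_closure) \<Rightarrow> 'k::finite_field, 'k alg_closure) module" where
  "ext_module n =
    \<lparr>carrier = ext_field n,
     monoid.mult = (*),
     one = 1,
     ring.zero = 0,
     add = (+),
     module.smult = (\<lambda>r x. \<Sum>\<sigma>\<in>carrier (ext_galois_group n). to_ac (r \<sigma>) * \<sigma> x)\<rparr>"

text \<open>\<open>\<nu>\<^sub>q\<^sup>s\<^sup>y\<^sup>m(n)\<close>\<close>
definition nu_sym :: "'k::finite_field itself \<Rightarrow> nat \<Rightarrow> enat" where
  "nu_sym _ n =
     (let L = (ext_module n ::
           (('k alg_closure \<Rightarrow> 'k alg_closure) \<Rightarrow> 'k, 'k alg_closure) module)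
      in sym_complexity (ext_galois_group n) L L (\<otimes>\<^bsub>L\<^esub>))"


section \<open>Elliptic curves\<close>

text \<open>
  Elliptic curves are given by Weierstrass equations
  \<open>y\<^sup>2 + a\<^sub>1 x y + a\<^sub>3 y = x\<^sup>3 + a\<^sub>2 x\<^sup>2 + a\<^sub>4 x + a\<^sub>6\<close>, in any characteristic.
\<close>
datatype 'f weierstrass =
  Weierstrass (wa1: 'f) (wa2: 'f) (wa3: 'f) (wa4: 'f) (wa6: 'f)

datatype 'f ec_point = Infinity | Affine 'f 'f

fun on_curve :: "'f::field weierstrass \<Rightarrow> 'f ec_point \<Rightarrow> bool" where
  "on_curve E Infinity = True"
| "on_curve E (Affine x y) =
    (y^2 + wa1 E * x * y + wa3 E * y = x^3 + wa2 E * x^2 + wa4 E * x + wa6 E)"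

definition curve_points :: "'f::field weierstrass \<Rightarrow> 'f ec_point set" where
  "curve_points E = {P. on_curve E P}"

text \<open>The point at infinity of a Weierstrass curve is always smooth.\<close>
definition smooth_curve :: "'f::field weierstrass \<Rightarrow> bool" where
  "smooth_curve E \<longleftrightarrow> (\<forall>x y. on_curve E (Affine x y) \<longrightarrow>
     2 * y + wa1 E * x + wa3 E \<noteq> 0 \<or> wa1 E * y \<noteq> 3 * x^2 + 2 * wa2 E * x + wa4 E)"

fun ec_neg :: "'f::field weierstrass \<Rightarrow> 'f ec_point \<Rightarrow> 'f ec_point" where
  "ec_neg E Infinity = Infinity"
| "ec_neg E (Affine x y) = Affine x (- y - wa1 E * x - wa3 E)"

fun ec_add :: "'f::field weierstrass \<Rightarrow> 'f ec_point \<Rightarrow> 'f ec_point \<Rightarrow> 'f ec_point" where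
  "ec_add E Infinity Q = Q"
| "ec_add E P Infinity = P"
| "ec_add E (Affine x1 y1) (Affine x2 y2) =
    (if Affine x2 y2 = ec_neg E (Affine x1 y1) then Infinity
     else let l = (if x1 \<noteq> x2 then (y2 - y1) / (x2 - x1)
                   else (3 * x1^2 + 2 * wa2 E * x1 + wa4 E - wa1 E * y1) /
                        (2 * y1 + wa1 E * x1 + wa3 E));
              x3 = l^2 + wa1 E * l - wa2 E - x1 - x2
          in Affine x3 (- (l + wa1 E) * x3 - (y1 - l * x1) - wa3 E))"

definition ec_group :: "'f::field weierstrass \<Rightarrow> 'f ec_point monoid" where
  "ec_group E = \<lparr>carrier = curve_points E, monoid.mult = ec_add E, one = Infinity\<rparr>"

text \<open>
  For a curve over \<open>'k\<close>, points are points over the algebraic closure, and rational points are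
  those with coordinates in \<open>'k\<close>.
\<close>
abbreviation geom :: "'k::field weierstrass \<Rightarrow> 'k alg_closure weierstrass" where
  "geom E \<equiv> map_weierstrass to_ac E"

abbreviation geom_points :: "'k::field weierstrass \<Rightarrow> 'k alg_closure ec_point set" where
  "geom_points E \<equiv> curve_points (geom E)"

abbreviation geom_group :: "'k::field weierstrass \<Rightarrow> 'k alg_closure ec_point monoid" where
  "geom_group E \<equiv> ec_group (geom E)"

definition rat_points :: "'k::field weierstrass \<Rightarrow> 'k alg_closure ec_point set" where
  "rat_points E = map_ec_point to_ac ` curve_points E"

definition elliptic_curve :: "'k::field weierstrass \<Rightarrow> bool" where
  "elliptic_curve E \<longleftrightarrow> smooth_curve (geom E)"


section \<open>Rational functions and isogenies\<close>

fun hcoords :: "'f::field ec_point \<Rightarrow> 'f \<times> 'f \<times> 'f" where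
  "hcoords Infinity = (0, 1, 0)"
| "hcoords (Affine x y) = (x, y, 1)"

text \<open>
  The value at a point of the form of degree \<open>d\<close> over \<open>'k\<close> with coefficient \<open>c i j\<close> at
  \<open>X\<^sup>i Y\<^sup>j Z\<^bsup>d-i-j\<^esup>\<close>
\<close>
fun form_at :: "nat \<Rightarrow> (nat \<Rightarrow> nat \<Rightarrow> 'k::field) \<Rightarrow> 'k alg_closure ec_point \<Rightarrow> 'k alg_closure" where
  "form_at d c P = (case hcoords P of (x, y, z) \<Rightarrow>
     \<Sum>i\<le>d. \<Sum>j\<le>d - i. to_ac (c i j) * x ^ i * y ^ j * z ^ (d - i - j))"

text \<open>
  A function on points represents an element of the function field \<open>K(E)\<close> if it is given by a
  quotient of two forms of the same degree where the denominator does not vanish. Two functions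
  represent the same element iff they agree at all but finitely many points.
\<close>
definition rational_fun ::
    "'k::field weierstrass \<Rightarrow> ('k alg_closure ec_point \<Rightarrow> 'k alg_closure) \<Rightarrow> bool" where
  "rational_fun E f \<longleftrightarrow> (\<exists>d F G. (\<exists>P\<in>geom_points E. form_at d G P \<noteq> 0) \<and>
     (\<forall>P\<in>geom_points E. form_at d G P \<noteq> 0 \<longrightarrow> f P = form_at d F P / form_at d G P))"

definition generically_eq ::
    "'k::field weierstrass \<Rightarrow> ('k alg_closure ec_point \<Rightarrow> 'k alg_closure)
      \<Rightarrow> ('k alg_closure ec_point \<Rightarrow> 'k alg_closure) \<Rightarrow> bool" where
  "generically_eq E f g \<longleftrightarrow> finite {P \<in> geom_points E. f P \<noteq> g P}"

text \<open>
  Morphisms of projective curves, defined over \<open>'k\<close>: around every point, the map is given by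
  three forms of the same degree over \<open>'k\<close>, wherever these do not vanish simultaneously.
\<close>
definition curve_morphism ::
    "'k::field weierstrass \<Rightarrow> 'k weierstrass
      \<Rightarrow> ('k alg_closure ec_point \<Rightarrow> 'k alg_closure ec_point) \<Rightarrow> bool" where
  "curve_morphism E E' \<phi> \<longleftrightarrow> \<phi> \<in> geom_points E \<rightarrow> geom_points E' \<and>
     (\<forall>P\<in>geom_points E. \<exists>d F G H.
        (form_at d F P, form_at d G P, form_at d H P) \<noteq> (0, 0, 0) \<and>
        (\<forall>Q\<in>geom_points E. (form_at d F Q, form_at d G Q, form_at d H Q) \<noteq> (0, 0, 0) \<longrightarrow>
           (case hcoords (\<phi> Q) of (x, y, z) \<Rightarrow>
              \<exists>s. form_at d F Q = s * x \<and> form_at d G Q = s * y \<and> form_at d H Q = s * z)))"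

definition isogeny ::
    "'k::field weierstrass \<Rightarrow> 'k weierstrass
      \<Rightarrow> ('k alg_closure ec_point \<Rightarrow> 'k alg_closure ec_point) \<Rightarrow> bool" where
  "isogeny E E' \<phi> \<longleftrightarrow> curve_morphism E E' \<phi> \<and> \<phi> Infinity = Infinity \<and>
     (\<exists>P\<in>geom_points E. \<phi> P \<noteq> Infinity)"

definition isogeny_kernel ::
    "'k::field weierstrass \<Rightarrow> ('k alg_closure ec_point \<Rightarrow> 'k alg_closure ec_point)
      \<Rightarrow> 'k alg_closure ec_point set" where
  "isogeny_kernel E \<phi> = {P \<in> geom_points E. \<phi> P = Infinity}"

text \<open>
  \<open>X'\<close> is the quotient of \<open>Y\<close> by the finite group \<open>C\<close> of translations, with quotient isogeny \<open>\<rho>\<close>: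
  \<open>\<rho>\<close> is surjective, its fibres are the \<open>C\<close>-orbits, and \<open>\<rho>\<^sup>* K(X') = K(Y)\<^sup>C\<close>. The last condition
  (whose inclusion from left to right follows from the description of the fibres) excludes
  compositions of the quotient map with a purely inseparable isogeny. The points of \<open>C\<close> are
  assumed to be rational, so that \<open>C\<close> acts on \<open>K(Y)\<close>.
\<close>
definition quotient_isogeny ::
    "'k::field weierstrass \<Rightarrow> 'k alg_closure ec_point set \<Rightarrow> 'k weierstrass
      \<Rightarrow> ('k alg_closure ec_point \<Rightarrow> 'k alg_closure ec_point) \<Rightarrow> bool" where
  "quotient_isogeny Y C X' \<rho> \<longleftrightarrow> isogeny Y X' \<rho> \<and>
     \<rho> ` geom_points Y = geom_points X' \<and>
     (\<forall>P\<in>geom_points Y. \<forall>Q\<in>geom_points Y.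
        \<rho> P = \<rho> Q \<longleftrightarrow> (\<exists>c\<in>C. Q = P \<otimes>\<^bsub>geom_group Y\<^esub> c)) \<and>
     (\<forall>f. rational_fun Y f \<and> (\<forall>c\<in>C. generically_eq Y (\<lambda>P. f (P \<otimes>\<^bsub>geom_group Y\<^esub> c)) f) \<longrightarrow>
        (\<exists>g. rational_fun X' g \<and> generically_eq Y f (\<lambda>P. g (\<rho> P))))"

text \<open>
  The dual of an isogeny \<open>\<phi>\<close> of degree \<open>m\<close> is the unique isogeny in the opposite direction whose
  composition with \<open>\<phi>\<close> is multiplication by \<open>m\<close>.
\<close>
definition dual_isogeny ::
    "'k::field weierstrass \<Rightarrow> 'k weierstrass \<Rightarrow> nat
      \<Rightarrow> ('k alg_closure ec_point \<Rightarrow> 'k alg_closure ec_point)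
      \<Rightarrow> ('k alg_closure ec_point \<Rightarrow> 'k alg_closure ec_point) \<Rightarrow> bool" where
  "dual_isogeny E E' m \<phi> \<psi> \<longleftrightarrow> isogeny E' E \<psi> \<and>
     (\<forall>P\<in>geom_points E. \<psi> (\<phi> P) = P [^]\<^bsub>geom_group E\<^esub> m)"

definition absolute_galois :: "('k::field alg_closure \<Rightarrow> 'k alg_closure) set" where
  "absolute_galois = {\<sigma>. bij \<sigma> \<and> (\<forall>x y. \<sigma> (x + y) = \<sigma> x + \<sigma> y) \<and> (\<forall>x y. \<sigma> (x * y) = \<sigma> x * \<sigma> y) \<and>
     (\<forall>a. \<sigma> (to_ac a) = to_ac a)}"

text \<open>
  Over a perfect field, closed points are the Galois orbits of points over the algebraic closure,
  and the degree of a closed point is the size of the orbit.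
\<close>
definition closed_point :: "'k::finite_field alg_closure ec_point \<Rightarrow> 'k alg_closure ec_point set" where
  "closed_point P = {map_ec_point \<sigma> P |\<sigma>. \<sigma> \<in> absolute_galois}"

definition fiber_closed_points ::
    "'k::finite_field weierstrass \<Rightarrow> ('k alg_closure ec_point \<Rightarrow> 'k alg_closure ec_point)
      \<Rightarrow> 'k alg_closure ec_point \<Rightarrow> 'k alg_closure ec_point set set" where
  "fiber_closed_points Y \<rho> a = closed_point ` {P \<in> geom_points Y. \<rho> P = a}"

text \<open>
  The inertial degree of a quotient isogeny \<open>\<rho>\<close> of degree \<open>n\<close> at the rational point \<open>a\<close>
  (so that the degree over \<open>a\<close> is the degree over \<open>'k\<close>) is \<open>n1\<close>.
\<close>
definition inertial_degree ::
    "'k::finite_field weierstrass \<Rightarrow> ('k alg_closure ec_point \<Rightarrow> 'k alg_closure ec_point)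
      \<Rightarrow> nat \<Rightarrow> 'k alg_closure ec_point \<Rightarrow> nat \<Rightarrow> bool" where
  "inertial_degree Y \<rho> n a n1 \<longleftrightarrow> n1 dvd n \<and>
     card (fiber_closed_points Y \<rho> a) = n div n1 \<and>
     (\<forall>z\<in>fiber_closed_points Y \<rho> a. card z = n1)"

end

theory Submission imports Defs begin

text \<open>
  The functions with at most simple poles on the fibre of \<open>v\<close> form a space of dimension \<open>n\<close>. Since
  \<open>v - a\<close> is not in the kernel of the dual isogeny, the divisor \<open>\<rho>\<^sup>*v - \<rho>\<^sup>*a\<close> of degree 0 is not
  principal, so such a function is determined by its values on the fibre of \<open>a\<close>, and these can be
  prescribed. The values on the fibre of \<open>a\<close> compatible with the Frobenius are the elements of
  \<open>L\<^bsup>n2\<^esup>\<close>, where the generator of \<open>C\<close> acts by translation. A product of two such functions has at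
  most double poles on the fibre of \<open>v\<close>, and since \<open>u - 2v\<close> is not in the kernel either, it is
  determined by its values on the fibres of \<open>0\<close> and \<open>u\<close>. These fibres consist of rational points, so
  evaluation there is a map to \<open>K[C]\<^sup>2\<close>, and evaluation, componentwise product, and interpolation
  followed by evaluation on the fibre of \<open>a\<close> give a decomposition of length 2.
\<close>

section \<open>Functions on a Weierstrass curve\<close>

text \<open>The kernel hypotheses become sums of points. The fibre of \<open>\<rho>\<close> through
  b has the sum n b + s, with s the sum of \<open>C\<close>, and the dual isogeny sends the image of
  b to n b. So \<open>v - a\<close> lies in the kernel exactly if the fibres of \<open>v\<close> and
  \<open>a\<close> have equal sums, and \<open>u - 2v\<close> does exactly if the fibre of
  \<open>v\<close> taken twice has the same sum as the fibres of 0 and \<open>u\<close> together. By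
  Abel's theorem, a divisor of degree 0 is principal iff its points sum to 0. Existence of functions
  comes from multiplying functions with two simple poles; nonexistence reduces to the fact that no
  function has a single simple pole. This fact also yields associativity of the addition of points
  and, as an isogeny is only assumed to be a morphism fixing infinity, that \<open>\<rho>\<close> is
  a homomorphism. Equivariance and rationality follow from uniqueness: translating or conjugating an
  interpolating function interpolates the translated or conjugated data. Frobenius moves the fibre
  of \<open>a\<close> by some element of \<open>C\<close>; the generator is changed so that this
  element is n2 times the generator.\<close>

fun xc :: "'f::field ec_point \<Rightarrow> 'f" where
  "xc Infinity = 0" | "xc (Affine x y) = x"

fun yc :: "'f::field ec_point \<Rightarrow> 'f" where
  "yc Infinity = 0" | "yc (Affine x y) = y"

text \<open>A filter lets the finitely many exceptional points of each step accumulate without being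
  named; functions that agree along it are the same element of the function field.\<close>

definition generic :: "'f::field weierstrass \<Rightarrow> 'f ec_point filter" where
  "generic E = inf cofinite (principal (curve_points E))"

lemma eventually_generic:
  "(\<forall>\<^sub>F P in generic E. \<phi> P) \<longleftrightarrow> finite {P \<in> curve_points E. \<not> \<phi> P}"
proof -
  have "{P. \<not> (P \<in> curve_points E \<longrightarrow> \<phi> P)} = {P \<in> curve_points E. \<not> \<phi> P}" by auto
  thus ?thesis
    by (simp add: generic_def eventually_inf_principal eventually_cofinite)
qed

text \<open>
  A function on points stands for the rational function with which it agrees at almost all points.
  Its value at \<open>P\<close> as a rational function is unrelated to \<open>f P\<close>, in particular at infinity, where
  \<^const>\<open>xc\<close> and \<^const>\<open>yc\<close> have junk values.
\<close>
inductive has_val :: "'f::field weierstrass \<Rightarrow> 'f ec_point \<Rightarrow> ('f ec_point \<Rightarrow> 'f) \<Rightarrow> 'f \<Rightarrow> bool"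
  for E P where
  const: "has_val E P (\<lambda>_. c) c"
| xc: "P = Affine x y \<Longrightarrow> has_val E P xc x"
| yc: "P = Affine x y \<Longrightarrow> has_val E P yc y"
| x_over_y: "P = Infinity \<Longrightarrow> has_val E P (\<lambda>Q. xc Q / yc Q) 0"
| one_over_y: "P = Infinity \<Longrightarrow> has_val E P (\<lambda>Q. 1 / yc Q) 0"
| add: "has_val E P f c \<Longrightarrow> has_val E P g d \<Longrightarrow> has_val E P (\<lambda>Q. f Q + g Q) (c + d)"
| mult: "has_val E P f c \<Longrightarrow> has_val E P g d \<Longrightarrow> has_val E P (\<lambda>Q. f Q * g Q) (c * d)"
| inverse: "has_val E P f c \<Longrightarrow> c \<noteq> 0 \<Longrightarrow> has_val E P (\<lambda>Q. inverse (f Q)) (inverse c)"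
| cong: "has_val E P f c \<Longrightarrow> \<forall>\<^sub>F Q in generic E. f Q = g Q \<Longrightarrow> has_val E P g c"

lemma has_val_uminus: "has_val E P f c \<Longrightarrow> has_val E P (\<lambda>Q. - f Q) (- c)"
  using has_val.mult[OF has_val.const[of E P "-1"], of f c] by simp

lemma has_val_diff:
  "has_val E P f c \<Longrightarrow> has_val E P g d \<Longrightarrow> has_val E P (\<lambda>Q. f Q - g Q) (c - d)"
  using has_val.add[OF _ has_val_uminus, of E P f c g d] by simp

lemma has_val_divide:
  "has_val E P f c \<Longrightarrow> has_val E P g d \<Longrightarrow> d \<noteq> 0 \<Longrightarrow> has_val E P (\<lambda>Q. f Q / g Q) (c / d)"
  using has_val.mult[OF _ has_val.inverse, of E P f c g d] by (simp add: divide_inverse)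

lemma has_val_power: "has_val E P f c \<Longrightarrow> has_val E P (\<lambda>Q. f Q ^ n) (c ^ n)"
  by (induction n) (auto intro: has_val.mult has_val.const)

lemma has_val_sum:
  "(\<And>i. i \<in> I \<Longrightarrow> has_val E P (f i) (c i)) \<Longrightarrow>
    has_val E P (\<lambda>Q. \<Sum>i\<in>I. f i Q) (\<Sum>i\<in>I. c i)"
  by (induction I rule: infinite_finite_induct) (auto intro: has_val.const has_val.add)

lemma has_val_poly:
  "has_val E P f c \<Longrightarrow> has_val E P (\<lambda>Q. poly p (f Q)) (poly p c)"
  by (induction p) (auto intro: has_val.const has_val.add has_val.mult)

lemma has_val_power_int:
  assumes "has_val E P f c" "c \<noteq> 0"
  shows "has_val E P (\<lambda>Q. f Q powi k) (c powi k)"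
  using has_val_power[OF assms(1), of "nat k"] has_val_power[OF has_val.inverse[OF assms], of "nat (- k)"]
  by (cases "k \<ge> 0") (auto simp: power_int_def)

lemma has_val_cong':
  assumes "has_val E P f c" "\<forall>\<^sub>F Q in generic E. f Q = g Q" "c = d"
  shows "has_val E P g d"
  using has_val.cong[OF assms(1,2)] assms(3) by simp

text \<open>The coordinate ring of the affine curve is free over the polynomials in x with basis 1,
  y; this is its general element.\<close>

definition reg_fun :: "'f::field poly \<Rightarrow> 'f poly \<Rightarrow> 'f ec_point \<Rightarrow> 'f" where
  "reg_fun a b P = poly a (xc P) + poly b (xc P) * yc P"

locale smooth_weierstrass =
  fixes E :: "'f::alg_closed_field weierstrass"
  assumes smooth: "smooth_curve E"
begin

abbreviation "a\<^sub>1 \<equiv> wa1 E"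
abbreviation "a\<^sub>2 \<equiv> wa2 E"
abbreviation "a\<^sub>3 \<equiv> wa3 E"
abbreviation "a\<^sub>4 \<equiv> wa4 E"
abbreviation "a\<^sub>6 \<equiv> wa6 E"
abbreviation "pts \<equiv> curve_points E"

definition lin :: "'f poly" where "lin = [:a\<^sub>3, a\<^sub>1:]"
definition cubic :: "'f poly" where "cubic = [:a\<^sub>6, a\<^sub>4, a\<^sub>2, 1:]"

lemma poly_lin: "poly lin x = a\<^sub>1 * x + a\<^sub>3"
  by (simp add: lin_def)

lemma poly_cubic: "poly cubic x = x^3 + a\<^sub>2 * x^2 + a\<^sub>4 * x + a\<^sub>6"
  by (simp add: cubic_def algebra_simps power2_eq_square power3_eq_cube)

lemma degree_cubic: "degree cubic = 3" "lead_coeff cubic = 1"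
  by (auto simp: cubic_def)

lemma degree_lin: "degree lin \<le> 1"
  by (simp add: lin_def)

lemma Affine_in_pts:
  "Affine x y \<in> pts \<longleftrightarrow> y^2 + poly lin x * y = poly cubic x"
  by (simp add: curve_points_def poly_lin poly_cubic algebra_simps)

lemma Infinity_in_pts [simp]: "Infinity \<in> pts"
  by (simp add: curve_points_def)

lemma finite_affine_x: "finite {P \<in> pts. \<exists>y. P = Affine x y}"
proof -
  define q where "q = [:- poly cubic x, poly lin x, 1:]"
  have "q \<noteq> 0" by (simp add: q_def)
  hence "finite (Affine x ` {y. poly q y = 0})"
    by (intro finite_imageI poly_roots_finite)
  moreover have "{P \<in> pts. \<exists>y. P = Affine x y} \<subseteq> Affine x ` {y. poly q y = 0}"
    by (auto simp: Affine_in_pts q_def algebra_simps power2_eq_square)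
  ultimately show ?thesis by (rule rev_finite_subset)
qed

lemma point_above: "\<exists>y. Affine x y \<in> pts"
proof -
  have "\<exists>y. poly [:- poly cubic x, poly lin x, 1:] y = 0"
    by (rule alg_closed_imp_poly_has_root) simp
  thus ?thesis by (auto simp: Affine_in_pts algebra_simps power2_eq_square)
qed

lemma eventually_x_not_in: assumes "finite S" shows "\<forall>\<^sub>F P in generic E. P \<noteq> Infinity \<and> xc P \<notin> S"
proof -
  have "finite (insert Infinity (\<Union>x\<in>S. {P \<in> pts. \<exists>y. P = Affine x y}))"
    using assms finite_affine_x by auto
  moreover have "{P \<in> pts. \<not> (P \<noteq> Infinity \<and> xc P \<notin> S)} \<subseteq> \<dots>"
    by (auto elim: xc.elims) (metis ec_point.exhaust xc.simps(2))
  ultimately show ?thesis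
    unfolding eventually_generic by (rule rev_finite_subset)
qed

lemma eventually_poly_x: assumes "p \<noteq> 0" shows "\<forall>\<^sub>F P in generic E. poly p (xc P) \<noteq> 0"
  using eventually_x_not_in[OF poly_roots_finite[OF assms]] by (rule eventually_mono) auto

lemma eventually_x_neq: "\<forall>\<^sub>F P in generic E. P \<noteq> Infinity \<and> xc P \<noteq> x"
  using eventually_x_not_in[of "{x}"] by simp

lemma eventually_in_pts: "\<forall>\<^sub>F P in generic E. P \<in> pts"
  by (simp add: eventually_generic)

lemma eventually_neq: "\<forall>\<^sub>F P in generic E. P \<noteq> Q"
  by (simp add: eventually_generic)

text \<open>Otherwise 1 plus the product of all \<open>X - x\<close> would be a nonconstant
  polynomial without a root.\<close>

lemma infinite_field: "infinite (UNIV :: 'f set)"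
proof
  assume fin: "finite (UNIV :: 'f set)"
  define p where "p = (\<Prod>x\<in>(UNIV::'f set). [:-x, 1:]) + 1"
  have "poly p x = 1" for x
    unfolding p_def using fin by (simp add: poly_prod prod_zero_iff)
  moreover have "degree (\<Prod>x\<in>(UNIV::'f set). [:-x, 1:]) = card (UNIV :: 'f set)"
    by (subst degree_prod_eq_sum_degree) auto
  hence "degree p > 0"
    using fin finite_UNIV_card_ge_0 unfolding p_def
    by (subst degree_add_eq_left) auto
  hence "\<exists>x. poly p x = 0" by (rule alg_closed_imp_poly_has_root)
  ultimately show False by simp
qed

lemma poly_x_zeroI:
  assumes "\<forall>\<^sub>F P in generic E. poly p (xc P) = 0"
  shows "p = 0"
proof (rule ccontr)
  assume "p \<noteq> 0"
  from eventually_conj[OF assms eventually_poly_x[OF this]] have "finite pts"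
    by (simp add: eventually_generic)
  hence "finite (xc ` pts)" by simp
  moreover have "xc ` pts = UNIV" 
  proof safe
    fix x obtain y where "Affine x y \<in> pts" using point_above by blast
    thus "x \<in> xc ` pts" by (intro image_eqI[of _ _ "Affine x y"]) auto
  qed auto
  ultimately show False using infinite_field by simp
qed

lemma infinite_pts: "infinite pts"
proof
  assume "finite pts"
  hence "\<forall>\<^sub>F P in generic E. poly 1 (xc P) = 0" by (simp add: eventually_generic)
  thus False using poly_x_zeroI by fastforce
qed

lemma eventually_generic_ex: "\<forall>\<^sub>F P in generic E. \<phi> P \<Longrightarrow> \<exists>P\<in>pts. \<phi> P"
  using infinite_pts unfolding eventually_generic
  by (metis (mono_tags, lifting) Collect_cong Collect_mem_eq)

text \<open>The norm of \<open>a + b y\<close> over the polynomials in x. Conjugation replaces y by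
  the other root \<open>- y - lin\<close> of the curve equation, so the conjugate is
  \<open>(a - b * lin) - b y\<close>, as in \<open>reg_fun_mult_conj\<close>.\<close>

definition norm_poly :: "'f poly \<Rightarrow> 'f poly \<Rightarrow> 'f poly" where
  "norm_poly a b = a^2 - a * b * lin - b^2 * cubic"

text \<open>Parity of degrees: \<open>a^2\<close> has even degree and \<open>b^2 * cubic\<close> odd
  degree, so one of them is larger, and it also exceeds the degree of the mixed term.\<close>

lemma norm_poly_nonzero:
  assumes "a \<noteq> 0 \<or> b \<noteq> 0"
  shows "norm_poly a b \<noteq> 0"
proof (cases "b = 0")
  case True
  thus ?thesis using assms by (simp add: norm_poly_def)
next
  case b: False
  have c0: "cubic \<noteq> 0" using degree_cubic by auto
  have db: "degree (b^2 * cubic) = 2 * degree b + 3"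
    using b c0 degree_cubic by (simp add: degree_mult_eq degree_power_eq)
  have dabl: "degree (a * b * lin) \<le> degree a + degree b + 1"
    using degree_mult_le[of "a * b" lin] degree_mult_le[of a b] degree_lin by linarith
  show ?thesis
  proof (cases "degree a \<ge> degree b + 2")
    case True
    hence a: "a \<noteq> 0" by auto
    have da: "degree (a^2) = 2 * degree a" using a by (simp add: degree_power_eq)
    have "degree (a * b * lin + b^2 * cubic) < degree (a^2)"
      using degree_add_le_max[of "a * b * lin" "b^2 * cubic"] dabl db da True by linarith
    hence "a^2 \<noteq> a * b * lin + b^2 * cubic" by auto
    thus ?thesis by (auto simp: norm_poly_def algebra_simps)
  next
    case False
    have "degree (a^2) \<le> 2 * degree a" by (simp add: degree_power_le mult.commute)
    hence "degree (a^2 - a * b * lin) < degree (b^2 * cubic)"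
      using degree_diff_le_max[of "a^2" "a * b * lin"] dabl db False by linarith
    hence "a^2 - a * b * lin \<noteq> b^2 * cubic" by auto
    thus ?thesis by (auto simp: norm_poly_def)
  qed
qed

lemma reg_fun_mult_conj:
  assumes "P \<in> pts" "P \<noteq> Infinity"
  shows "reg_fun a b P * reg_fun (a - b * lin) (- b) P = poly (norm_poly a b) (xc P)"
proof -
  obtain x y where P: "P = Affine x y" using assms(2) by (cases P) auto
  have "y^2 + poly lin x * y = poly cubic x" using assms P by (simp add: Affine_in_pts)
  thus ?thesis
    unfolding P reg_fun_def norm_poly_def
    by (simp add: algebra_simps power2_eq_square flip: \<open>y^2 + poly lin x * y = poly cubic x\<close>)
qed

lemma reg_fun_zeroD:
  assumes "\<forall>\<^sub>F P in generic E. reg_fun a b P = 0"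
  shows "a = 0" "b = 0"
proof -
  have "\<forall>\<^sub>F P in generic E. poly (norm_poly a b) (xc P) = 0"
    using assms eventually_in_pts eventually_neq[of Infinity]
    by eventually_elim (metis reg_fun_mult_conj mult_zero_left)
  hence "norm_poly a b = 0" by (rule poly_x_zeroI)
  thus "a = 0" "b = 0" using norm_poly_nonzero by blast+
qed

lemma eventually_reg_fun_nonzero:
  assumes "a \<noteq> 0 \<or> b \<noteq> 0"
  shows "\<forall>\<^sub>F P in generic E. reg_fun a b P \<noteq> 0"
  using eventually_poly_x[OF norm_poly_nonzero[OF assms]] eventually_in_pts eventually_neq[of Infinity]
  by eventually_elim (metis reg_fun_mult_conj mult_zero_left)

lemma eventually_reg_fun_nonzero':
  assumes "reg_fun a b P \<noteq> 0"
  shows "\<forall>\<^sub>F P in generic E. reg_fun a b P \<noteq> 0"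
  using assms by (intro eventually_reg_fun_nonzero) (auto simp: reg_fun_def)

lemma reg_fun_mult:
  assumes "P \<in> pts" "P \<noteq> Infinity"
  shows "reg_fun a b P * reg_fun a' b' P =
    reg_fun (a * a' + b * b' * cubic) (a * b' + b * a' - b * b' * lin) P"
proof -
  obtain x y where P: "P = Affine x y" using assms(2) by (cases P) auto
  have "y^2 + poly lin x * y = poly cubic x" using assms P by (simp add: Affine_in_pts)
  thus ?thesis
    unfolding P reg_fun_def
    by (simp add: algebra_simps power2_eq_square flip: \<open>y^2 + poly lin x * y = poly cubic x\<close>)
qed

lemma eventually_reg_fun_mult:
  "\<forall>\<^sub>F P in generic E. reg_fun a b P * reg_fun a' b' P =
    reg_fun (a * a' + b * b' * cubic) (a * b' + b * a' - b * b' * lin) P"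
  using eventually_in_pts eventually_neq[of Infinity] by eventually_elim (rule reg_fun_mult)

lemma reg_fun_add: "reg_fun a b P + reg_fun a' b' P = reg_fun (a + a') (b + b') P"
  by (simp add: reg_fun_def algebra_simps)

lemma reg_fun_poly: "reg_fun p 0 P = poly p (xc P)"
  by (simp add: reg_fun_def)

lemma has_val_reg_fun:
  "has_val E (Affine x y) (reg_fun a b) (reg_fun a b (Affine x y))"
  unfolding reg_fun_def[abs_def] xc.simps yc.simps
  by (intro has_val.add has_val.mult has_val_poly has_val.xc[OF refl] has_val.yc[OF refl])

text \<open>Each rule keeps the function within the fractions whose denominator is nonzero at
  \<open>P\<close>, that is, within the local ring of an affine point. Passing to this normal form
  is what makes values unique.\<close>

lemma has_val_affineE:
  assumes "has_val E P f c" "P \<in> pts" "P \<noteq> Infinity"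
  obtains a b a' b' where "reg_fun a' b' P \<noteq> 0" "c = reg_fun a b P / reg_fun a' b' P"
    "\<forall>\<^sub>F Q in generic E. f Q = reg_fun a b Q / reg_fun a' b' Q"
proof -
  have one: "reg_fun 1 0 Q = 1" for Q :: "'f ec_point" by (simp add: reg_fun_def)
  from assms(1) have "\<exists>a b a' b'. reg_fun a' b' P \<noteq> 0 \<and> c = reg_fun a b P / reg_fun a' b' P \<and>
    (\<forall>\<^sub>F Q in generic E. f Q = reg_fun a b Q / reg_fun a' b' Q)"
  proof induction
    case (const c)
    show ?case
      by (rule exI[of _ "[:c:]"], rule exI[of _ 0], rule exI[of _ 1], rule exI[of _ 0])
         (simp add: reg_fun_def)
  next
    case (xc x y)
    show ?case
      by (rule exI[of _ "[:0,1:]"], rule exI[of _ 0], rule exI[of _ 1], rule exI[of _ 0])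
         (simp add: reg_fun_def xc)
  next
    case (yc x y)
    show ?case
      by (rule exI[of _ "0"], rule exI[of _ 1], rule exI[of _ 1], rule exI[of _ 0])
         (simp add: reg_fun_def yc)
  next
    case x_over_y thus ?case using assms(3) by simp
  next
    case one_over_y thus ?case using assms(3) by simp
  next
    case (add f c g d)
    then obtain a b a' b' r s r' s' where
      1: "reg_fun a' b' P \<noteq> 0" "c = reg_fun a b P / reg_fun a' b' P"
        "\<forall>\<^sub>F Q in generic E. f Q = reg_fun a b Q / reg_fun a' b' Q" and
      2: "reg_fun r' s' P \<noteq> 0" "d = reg_fun r s P / reg_fun r' s' P"
        "\<forall>\<^sub>F Q in generic E. g Q = reg_fun r s Q / reg_fun r' s' Q" by auto
    obtain u v where uv: "reg_fun u v Q = reg_fun a b Q * reg_fun r' s' Q + reg_fun r s Q * reg_fun a' b' Q"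
      if "Q \<in> pts" "Q \<noteq> Infinity" for Q
      using reg_fun_mult reg_fun_add by metis
    obtain u' v' where uv': "reg_fun u' v' Q = reg_fun a' b' Q * reg_fun r' s' Q"
      if "Q \<in> pts" "Q \<noteq> Infinity" for Q
      using reg_fun_mult by metis
    have "\<forall>\<^sub>F Q in generic E. f Q + g Q = reg_fun u v Q / reg_fun u' v' Q"
      using 1(3) 2(3) eventually_reg_fun_nonzero'[OF 1(1)] eventually_reg_fun_nonzero'[OF 2(1)]
        eventually_in_pts eventually_neq[of Infinity]
      by eventually_elim (simp add: uv uv' field_simps)
    moreover have "reg_fun u' v' P \<noteq> 0" "c + d = reg_fun u v P / reg_fun u' v' P"
      using 1(1,2) 2(1,2) assms(2,3) by (simp_all add: uv uv' add_frac_eq)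
    ultimately show ?case by blast
  next
    case (mult f c g d)
    then obtain a b a' b' r s r' s' where
      1: "reg_fun a' b' P \<noteq> 0" "c = reg_fun a b P / reg_fun a' b' P"
        "\<forall>\<^sub>F Q in generic E. f Q = reg_fun a b Q / reg_fun a' b' Q" and
      2: "reg_fun r' s' P \<noteq> 0" "d = reg_fun r s P / reg_fun r' s' P"
        "\<forall>\<^sub>F Q in generic E. g Q = reg_fun r s Q / reg_fun r' s' Q" by auto
    obtain u v where uv: "reg_fun u v Q = reg_fun a b Q * reg_fun r s Q"
      if "Q \<in> pts" "Q \<noteq> Infinity" for Q
      using reg_fun_mult by metis
    obtain u' v' where uv': "reg_fun u' v' Q = reg_fun a' b' Q * reg_fun r' s' Q"
      if "Q \<in> pts" "Q \<noteq> Infinity" for Q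
      using reg_fun_mult by metis
    have "\<forall>\<^sub>F Q in generic E. f Q * g Q = reg_fun u v Q / reg_fun u' v' Q"
      using 1(3) 2(3) eventually_in_pts eventually_neq[of Infinity]
      by eventually_elim (simp add: uv uv' field_simps)
    moreover have "reg_fun u' v' P \<noteq> 0" "c * d = reg_fun u v P / reg_fun u' v' P"
      using 1(1,2) 2(1,2) assms(2,3) by (simp_all add: uv uv')
    ultimately show ?case by blast
  next
    case (inverse f c)
    then obtain a b a' b' where
      1: "reg_fun a' b' P \<noteq> 0" "c = reg_fun a b P / reg_fun a' b' P"
        "\<forall>\<^sub>F Q in generic E. f Q = reg_fun a b Q / reg_fun a' b' Q" by auto
    have "\<forall>\<^sub>F Q in generic E. inverse (f Q) = reg_fun a' b' Q / reg_fun a b Q"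
      using 1(3) by eventually_elim simp
    thus ?case using 1 inverse.hyps(2)
      by (intro exI[of _ a'] exI[of _ b'] exI[of _ a] exI[of _ b]) auto
  next
    case (cong f c g)
    then obtain a b a' b' where
      1: "reg_fun a' b' P \<noteq> 0" "c = reg_fun a b P / reg_fun a' b' P"
        "\<forall>\<^sub>F Q in generic E. f Q = reg_fun a b Q / reg_fun a' b' Q" by auto
    have "\<forall>\<^sub>F Q in generic E. g Q = reg_fun a b Q / reg_fun a' b' Q"
      using 1(3) cong.hyps(2) by eventually_elim simp
    thus ?case using 1 by blast
  qed
  thus ?thesis using that by blast
qed

subsection \<open>Weights at infinity\<close>

text \<open>\<open>x\<close> has weight 2 and \<open>y\<close> has weight 3; these are their pole orders at infinity.\<close>
definition weight_coeff :: "nat \<Rightarrow> 'f poly \<Rightarrow> 'f poly \<Rightarrow> 'f" where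
  "weight_coeff d a b =
    (if even d then coeff a (d div 2) else if d \<ge> 3 then coeff b ((d - 3) div 2) else 0)"

text \<open>A weight bound together with the coefficient in weight exactly \<open>d\<close>, which
  may be 0. Keeping both in one relation makes it additive for fixed \<open>d\<close> and
  multiplicative when weights are added.\<close>

definition weight_le :: "nat \<Rightarrow> ('f ec_point \<Rightarrow> 'f) \<Rightarrow> 'f \<Rightarrow> bool" where
  "weight_le d f c \<longleftrightarrow> (\<exists>a b. (\<forall>\<^sub>F P in generic E. f P = reg_fun a b P) \<and>
     2 * degree a \<le> d \<and> (b \<noteq> 0 \<longrightarrow> 2 * degree b + 3 \<le> d) \<and> c = weight_coeff d a b)"

lemma weight_leI:
  assumes "\<forall>\<^sub>F P in generic E. f P = reg_fun a b P" "2 * degree a \<le> d"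
    "b \<noteq> 0 \<Longrightarrow> 2 * degree b + 3 \<le> d" "c = weight_coeff d a b"
  shows "weight_le d f c"
  using assms unfolding weight_le_def by blast

lemma weight_le_cong:
  assumes "weight_le d f c" "\<forall>\<^sub>F P in generic E. f P = g P"
  shows "weight_le d g c"
proof -
  from assms(1) obtain a b where ab: "\<forall>\<^sub>F P in generic E. f P = reg_fun a b P"
     "2 * degree a \<le> d" "b \<noteq> 0 \<longrightarrow> 2 * degree b + 3 \<le> d" "c = weight_coeff d a b"
    unfolding weight_le_def by blast
  have "\<forall>\<^sub>F P in generic E. g P = reg_fun a b P"
    using ab(1) assms(2) by eventually_elim simp
  thus ?thesis using ab by (intro weight_leI) auto
qed

lemma weight_le_const: "weight_le 0 (\<lambda>_. c) c"
  by (rule weight_leI[of _ "[:c:]" 0]) (auto simp: reg_fun_def weight_coeff_def)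

lemma weight_le_x: "weight_le 2 xc 1"
  by (rule weight_leI[of _ "[:0,1:]" 0]) (auto simp: reg_fun_def weight_coeff_def)

lemma weight_le_y: "weight_le 3 yc 1"
  by (rule weight_leI[of _ 0 1]) (auto simp: reg_fun_def weight_coeff_def)

lemma weight_le_mono:
  assumes "weight_le d f c" "d < d'"
  shows "weight_le d' f 0"
proof -
  from assms(1) obtain a b where ab: "\<forall>\<^sub>F P in generic E. f P = reg_fun a b P"
     "2 * degree a \<le> d" "b \<noteq> 0 \<longrightarrow> 2 * degree b + 3 \<le> d" "c = weight_coeff d a b"
    unfolding weight_le_def by blast
  have "weight_coeff d' a b = 0"
  proof (cases "even d'")
    case True
    hence "degree a < d' div 2" using ab(2) assms(2) by (auto elim!: evenE)
    thus ?thesis using True by (simp add: weight_coeff_def coeff_eq_0)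
  next
    case False
    have "coeff b ((d' - 3) div 2) = 0"
    proof (cases "b = 0")
      case b: False
      hence "degree b < (d' - 3) div 2" using False ab(3) assms(2) by auto presburger
      thus ?thesis by (rule coeff_eq_0)
    qed auto
    thus ?thesis using False by (simp add: weight_coeff_def)
  qed
  thus ?thesis using ab assms(2) by (intro weight_leI) auto
qed

lemma weight_le_add:
  assumes "weight_le d f c" "weight_le d g c'"
  shows "weight_le d (\<lambda>P. f P + g P) (c + c')"
proof -
  from assms(1) obtain a b where ab: "\<forall>\<^sub>F P in generic E. f P = reg_fun a b P"
     "2 * degree a \<le> d" "b \<noteq> 0 \<longrightarrow> 2 * degree b + 3 \<le> d" "c = weight_coeff d a b"
    unfolding weight_le_def by blast
  from assms(2) obtain a' b' where ab': "\<forall>\<^sub>F P in generic E. g P = reg_fun a' b' P"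
     "2 * degree a' \<le> d" "b' \<noteq> 0 \<longrightarrow> 2 * degree b' + 3 \<le> d" "c' = weight_coeff d a' b'"
    unfolding weight_le_def by blast
  show ?thesis
  proof (rule weight_leI)
    show "\<forall>\<^sub>F P in generic E. f P + g P = reg_fun (a + a') (b + b') P"
      using ab(1) ab'(1) by eventually_elim (simp add: reg_fun_add)
    show "2 * degree (a + a') \<le> d"
      using degree_add_le_max[of a a'] ab(2) ab'(2) by linarith
    show "2 * degree (b + b') + 3 \<le> d" if "b + b' \<noteq> 0"
      using degree_add_le_max[of b b'] ab(3) ab'(3) that
      by (cases "b = 0"; cases "b' = 0"; force)
    show "c + c' = weight_coeff d (a + a') (b + b')"
      using ab(4) ab'(4) by (simp add: weight_coeff_def)
  qed
qed

lemma coeff_mult_le: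
  fixes p q :: "'a::comm_ring poly"
  assumes "degree p \<le> i" "degree q \<le> j"
  shows "coeff (p * q) (i + j) = coeff p i * coeff q j"
proof (cases "degree p = i \<and> degree q = j")
  case True thus ?thesis using coeff_mult_degree_sum[of p q] by auto
next
  case False
  hence "degree (p * q) < i + j" using degree_mult_le[of p q] assms by linarith
  moreover have "coeff p i * coeff q j = 0"
  proof (cases "degree p = i")
    case True
    thus ?thesis using False assms by (simp add: coeff_eq_0)
  qed (use assms in \<open>simp add: coeff_eq_0\<close>)
  ultimately show ?thesis by (simp add: coeff_eq_0)
qed

lemma odd_ge_3E:
  fixes m :: nat
  assumes "odd m" "m \<ge> 3"
  obtains i where "m = 2 * i + 3"
proof -
  have "m = 2 * ((m - 3) div 2) + 3" using assms by presburger
  thus ?thesis by (rule that)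
qed

text \<open>The curve equation replaces \<open>y^2\<close>, of weight 6, by \<open>x^3\<close> plus
  terms of lower weight, so leading coefficients multiply. Even weights sit in the first polynomial
  and odd weights in the second, hence the split by parity.\<close>

lemma weight_le_mult:
  assumes "weight_le d f c" "weight_le e g c'"
  shows "weight_le (d + e) (\<lambda>P. f P * g P) (c * c')"
proof -
  from assms(1) obtain a b where ab: "\<forall>\<^sub>F P in generic E. f P = reg_fun a b P"
     "2 * degree a \<le> d" "b \<noteq> 0 \<longrightarrow> 2 * degree b + 3 \<le> d" "c = weight_coeff d a b"
    unfolding weight_le_def by blast
  from assms(2) obtain a' b' where ab': "\<forall>\<^sub>F P in generic E. g P = reg_fun a' b' P"
     "2 * degree a' \<le> e" "b' \<noteq> 0 \<longrightarrow> 2 * degree b' + 3 \<le> e" "c' = weight_coeff e a' b'"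
    unfolding weight_le_def by blast
  define r where "r = a * a' + b * b' * cubic"
  define s where "s = a * b' + b * a' - b * b' * lin"
  have half: "(2 * m - 2) div 2 = m - Suc 0" for m :: nat by (cases m) auto
  have d1: "degree (a * a') \<le> degree a + degree a'" by (rule degree_mult_le)
  have d2: "degree (b * b' * cubic) \<le> degree b + degree b' + 3"
    using degree_mult_le[of "b * b'" cubic] degree_mult_le[of b b'] degree_cubic by linarith
  have d3: "degree (b * b' * lin) \<le> degree b + degree b' + 1"
    using degree_mult_le[of "b * b'" lin] degree_mult_le[of b b'] degree_lin by linarith
  have b0: "b * b' \<noteq> 0 \<Longrightarrow> 2 * (degree b + degree b') + 6 \<le> d + e" using ab(3) ab'(3) by auto
  have ab0: "a * b' \<noteq> 0 \<Longrightarrow> 2 * degree (a * b') + 3 \<le> d + e"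
    using ab(2) ab'(3) degree_mult_le[of a b'] by auto
  have ba0: "b * a' \<noteq> 0 \<Longrightarrow> 2 * degree (b * a') + 3 \<le> d + e"
    using ab(3) ab'(2) degree_mult_le[of b a'] by auto
  have bbl: "b * b' * lin \<noteq> 0 \<Longrightarrow> 2 * degree (b * b' * lin) + 4 \<le> d + e"
    using b0 d3 by fastforce
  have bbc: "b * b' * cubic \<noteq> 0 \<Longrightarrow> 2 * degree (b * b' * cubic) \<le> d + e"
    using b0 d2 by fastforce
  show ?thesis
  proof (rule weight_leI)
    show "\<forall>\<^sub>F P in generic E. f P * g P = reg_fun r s P"
      using ab(1) ab'(1) eventually_reg_fun_mult[of a b a' b']
      by eventually_elim (simp add: r_def s_def)
    show "2 * degree r \<le> d + e"
      using degree_add_le_max[of "a * a'" "b * b' * cubic"] bbc d1 ab(2) ab'(2)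
      unfolding r_def by (cases "b * b' * cubic = 0") auto
    show "2 * degree s + 3 \<le> d + e" if "s \<noteq> 0"
    proof -
      have *: "p \<noteq> 0 \<or> q \<noteq> 0 \<Longrightarrow> (p \<noteq> 0 \<Longrightarrow> 2 * degree p + 3 \<le> d + e) \<Longrightarrow> (q \<noteq> 0 \<Longrightarrow> 2 * degree q + 3 \<le> d + e) \<Longrightarrow>
         2 * degree (p + q) + 3 \<le> d + e" for p q :: "'f poly"
        using degree_add_le_max[of p q] by (cases "p = 0"; cases "q = 0"; force)
      have bbl': "- (b * b' * lin) \<noteq> 0 \<Longrightarrow> 2 * degree (- (b * b' * lin)) + 3 \<le> d + e"
        using bbl by simp
      have "2 * degree ((a * b' + b * a') + (- (b * b' * lin))) + 3 \<le> d + e"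
      proof (rule *)
        show "a * b' + b * a' \<noteq> 0 \<or> - (b * b' * lin) \<noteq> 0" using that by (auto simp: s_def)
        show "2 * degree (a * b' + b * a') + 3 \<le> d + e" if "a * b' + b * a' \<noteq> 0"
          using that ab0 ba0 by (intro *) auto
      qed (rule bbl')
      thus ?thesis by (simp add: s_def)
    qed
    show "c * c' = weight_coeff (d + e) r s"
    proof (cases "even d"; cases "even e")
      assume "even d" "even e"
      then obtain i j where ij: "d = 2 * i" "e = 2 * j" by (elim evenE)
      have "coeff (a * a') (i + j) = coeff a i * coeff a' j"
        using ab(2) ab'(2) ij by (intro coeff_mult_le) auto
      moreover have "coeff (b * b' * cubic) (i + j) = 0"
      proof (cases "b * b' = 0")
        case False
        hence "2 * degree b + 3 \<le> 2 * i" "2 * degree b' + 3 \<le> 2 * j" using ab(3) ab'(3) ij by auto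
        hence "degree b + degree b' + 3 < i + j" by presburger
        thus ?thesis using d2 by (intro coeff_eq_0) linarith
      qed auto
      ultimately show ?thesis using ij ab(4) ab'(4) by (auto simp: weight_coeff_def r_def)
    next
      assume de: "even d" "odd e"
      obtain i where i: "d = 2 * i" using de(1) by (elim evenE)
      show ?thesis
      proof (cases "e \<ge> 3")
        case True
        then obtain j where j: "e = 2 * j + 3" using odd_ge_3E de(2) by blast
        have "coeff (a * b') (i + j) = coeff a i * coeff b' j"
          using ab(2) ab'(3) i j by (cases "b' = 0") (auto intro!: coeff_mult_le)
        moreover have "coeff (b * a') (i + j) = 0"
        proof (cases "b * a' = 0")
          case False
          hence "2 * degree b + 3 \<le> 2 * i" "2 * degree a' \<le> 2 * j + 3" using ab(3) ab'(2) i j by auto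
          hence "degree b + degree a' < i + j" by presburger
          thus ?thesis using degree_mult_le[of b a'] by (intro coeff_eq_0) linarith
        qed auto
        moreover have "coeff (b * b' * lin) (i + j) = 0"
        proof (cases "b * b' = 0")
          case False
          hence "2 * degree b + 3 \<le> 2 * i" "2 * degree b' + 3 \<le> 2 * j + 3" using ab(3) ab'(3) i j by auto
          hence "degree b + degree b' + 1 < i + j" by presburger
          thus ?thesis using d3 by (intro coeff_eq_0) linarith
        qed auto
        ultimately show ?thesis using i j ab(4) ab'(4) by (auto simp: weight_coeff_def s_def)
      next
        case False
        \<comment> \<open>No monomial has weight 1: a function of weight at most 1 is constant, and
          its coefficient in weight 1 is 0.\<close>
        hence e: "e = 1" using de by (cases e) (auto simp: numeral_3_eq_3 less_Suc_eq)
        hence "b' = 0" "degree a' = 0" using ab'(2,3) by auto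
        moreover have "coeff (b * a') (i - 1) = 0" if "i > 0" "b \<noteq> 0"
        proof -
          have "degree b < i - 1" using ab(3) that i by auto
          thus ?thesis using degree_mult_le[of b a'] \<open>degree a' = 0\<close> by (intro coeff_eq_0) linarith
        qed
        ultimately show ?thesis using i e ab'(4) by (cases "b = 0") (auto simp: weight_coeff_def s_def half)
      qed
    next
      assume de: "odd d" "even e"
      obtain j where j: "e = 2 * j" using de(2) by (elim evenE)
      show ?thesis
      proof (cases "d \<ge> 3")
        case True
        then obtain i where i: "d = 2 * i + 3" using odd_ge_3E de(1) by blast
        have "coeff (b * a') (i + j) = coeff b i * coeff a' j"
          using ab(3) ab'(2) i j by (cases "b = 0") (auto intro!: coeff_mult_le)
        moreover have "coeff (a * b') (i + j) = 0"
        proof (cases "a * b' = 0")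
          case False
          hence "2 * degree b' + 3 \<le> 2 * j" "2 * degree a \<le> 2 * i + 3" using ab'(3) ab(2) i j by auto
          hence "degree a + degree b' < i + j" by presburger
          thus ?thesis using degree_mult_le[of a b'] by (intro coeff_eq_0) linarith
        qed auto
        moreover have "coeff (b * b' * lin) (i + j) = 0"
        proof (cases "b * b' = 0")
          case False
          hence "2 * degree b + 3 \<le> 2 * i + 3" "2 * degree b' + 3 \<le> 2 * j" using ab(3) ab'(3) i j by auto
          hence "degree b + degree b' + 1 < i + j" by presburger
          thus ?thesis using d3 by (intro coeff_eq_0) linarith
        qed auto
        ultimately show ?thesis using i j ab(4) ab'(4) by (auto simp: weight_coeff_def s_def)
      next
        case False
        hence d: "d = 1" using de by (cases d) (auto simp: numeral_3_eq_3 less_Suc_eq)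
        hence "b = 0" "degree a = 0" using ab(2,3) by auto
        moreover have "coeff (a * b') (j - 1) = 0" if "j > 0" "b' \<noteq> 0"
        proof -
          have "degree b' < j - 1" using ab'(3) that j by auto
          thus ?thesis using degree_mult_le[of a b'] \<open>degree a = 0\<close> by (intro coeff_eq_0) linarith
        qed
        ultimately show ?thesis using j d ab(4) by (cases "b' = 0") (auto simp: weight_coeff_def s_def half)
      qed
    next
      assume de: "odd d" "odd e"
      show ?thesis
      proof (cases "d \<ge> 3 \<and> e \<ge> 3")
        case True
        then obtain i j where ij: "d = 2 * i + 3" "e = 2 * j + 3" using odd_ge_3E de by metis
        have "coeff (a * a') (i + j + 3) = 0"
        proof -
          have "2 * degree a \<le> 2 * i + 3" "2 * degree a' \<le> 2 * j + 3" using ab(2) ab'(2) ij by auto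
          hence "degree a + degree a' < i + j + 3" by presburger
          thus ?thesis using d1 by (intro coeff_eq_0) linarith
        qed
        moreover have "coeff (b * b' * cubic) (i + j + 3) = coeff b i * coeff b' j"
        proof -
          have "degree b \<le> i" "degree b' \<le> j" using ab(3) ab'(3) ij by (auto intro: ccontr)
          moreover from this have "degree (b * b') \<le> i + j" using degree_mult_le[of b b'] by linarith
          moreover have "coeff cubic 3 = 1" using degree_cubic by simp
          ultimately show ?thesis using degree_cubic by (subst coeff_mult_le) (auto simp: coeff_mult_le)
        qed
        moreover have "(d + e) div 2 = i + j + 3" using ij by simp
        ultimately show ?thesis using ij ab(4) ab'(4) de
          by (auto simp: weight_coeff_def r_def add.commute[of 3])
      next
        case False
        have "coeff r ((d + e) div 2) = 0"
        proof -
          have "b * b' = 0" using False ab(3) ab'(3) by auto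
          hence "r = a * a'" by (simp add: r_def)
          moreover have "2 * degree a < d" "2 * degree a' < e"
            using ab(2) ab'(2) de by (metis dvd_triv_left le_neq_implies_less)+
          hence "degree a + degree a' < (d + e) div 2" using de by (auto elim!: oddE)
          ultimately show ?thesis using d1 by (intro coeff_eq_0) simp
        qed
        moreover have "c * c' = 0" using False ab(4) ab'(4) de by (auto simp: weight_coeff_def)
        ultimately show ?thesis using de by (simp add: weight_coeff_def)
      qed
    qed
  qed
qed

lemma weight_le_zeroD:
  assumes "weight_le d f c" "\<forall>\<^sub>F P in generic E. f P = 0"
  shows "c = 0"
proof -
  from assms(1) obtain a b where ab: "\<forall>\<^sub>F P in generic E. f P = reg_fun a b P" "c = weight_coeff d a b"
    unfolding weight_le_def by blast
  have "\<forall>\<^sub>F P in generic E. reg_fun a b P = 0"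
    using ab(1) assms(2) by eventually_elim simp
  hence "a = 0" "b = 0" by (rule reg_fun_zeroD)+
  thus ?thesis using ab(2) by (simp add: weight_coeff_def)
qed

lemma weight_le_nonzero:
  assumes "weight_le d f c" "c \<noteq> 0"
  shows "\<forall>\<^sub>F P in generic E. f P \<noteq> 0"
proof -
  from assms(1) obtain a b where ab: "\<forall>\<^sub>F P in generic E. f P = reg_fun a b P" "c = weight_coeff d a b"
    unfolding weight_le_def by blast
  have "a \<noteq> 0 \<or> b \<noteq> 0" using ab(2) assms(2) by (auto simp: weight_coeff_def split: if_splits)
  from eventually_reg_fun_nonzero[OF this] ab(1) show ?thesis by eventually_elim simp
qed

lemma weight_le_unique:
  assumes "weight_le d f c" "weight_le d f c'"
  shows "c = c'"
proof -
  have "weight_le (0 + d) (\<lambda>P. (- 1) * f P) (- 1 * c')"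
    by (intro weight_le_mult weight_le_const assms)
  hence "weight_le d (\<lambda>P. (- 1) * f P) (- 1 * c')" by simp
  from weight_le_zeroD[OF weight_le_add[OF assms(1) this]] show ?thesis by simp
qed

end

section \<open>Uniqueness of values\<close>

context smooth_weierstrass begin

text \<open>Numerator and denominator are bounded by the same weight \<open>d\<close>, so the value
  is the quotient of their coefficients in that weight. This is the normal form at infinity, as
  \<open>has_val_affineE\<close> is elsewhere.\<close>

lemma has_val_InfinityE:
  assumes "has_val E Infinity f c"
  obtains d r s k where "weight_le d r (c * k)" "weight_le d s k" "k \<noteq> 0"
    "\<forall>\<^sub>F Q in generic E. f Q = r Q / s Q"
proof -
  from assms have "\<exists>d r s k. weight_le d r (c * k) \<and> weight_le d s k \<and> k \<noteq> 0 \<and>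
    (\<forall>\<^sub>F Q in generic E. f Q = r Q / s Q)"
  proof (induction)
    case (const c)
    show ?case
      using weight_le_const[of c] weight_le_const[of 1]
      by (intro exI[of _ 0] exI[of _ "\<lambda>_. c"] exI[of _ "\<lambda>_. 1"] exI[of _ 1]) simp
  next
    case x_over_y
    show ?case
      using weight_le_mono[OF weight_le_x, of 3] weight_le_y
      by (intro exI[of _ 3] exI[of _ xc] exI[of _ yc] exI[of _ 1]) simp
  next
    case one_over_y
    show ?case
    proof (rule exI[of _ 3], rule exI[of _ "\<lambda>_. 1"], rule exI[of _ yc], rule exI[of _ 1], intro conjI)
      show "weight_le 3 (\<lambda>_. 1) (0 * 1)"
        using weight_le_mono[OF weight_le_const[of 1], of 3] by simp
    qed (simp_all add: weight_le_y)
  next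
    case (add f c g c')
    from add.IH obtain d r s k d' r' s' k' where
      1: "weight_le d r (c * k)" "weight_le d s k" "k \<noteq> 0" "\<forall>\<^sub>F Q in generic E. f Q = r Q / s Q" and
      2: "weight_le d' r' (c' * k')" "weight_le d' s' k'" "k' \<noteq> 0" "\<forall>\<^sub>F Q in generic E. g Q = r' Q / s' Q"
      by (elim exE conjE) (rule that, assumption+)
    have "weight_le (d + d') (\<lambda>Q. r Q * s' Q + s Q * r' Q) (c * k * k' + k * (c' * k'))"
      by (intro weight_le_add weight_le_mult 1 2)
    moreover have "c * k * k' + k * (c' * k') = (c + c') * (k * k')" by (simp add: algebra_simps)
    moreover have "\<forall>\<^sub>F Q in generic E. f Q + g Q = (r Q * s' Q + s Q * r' Q) / (s Q * s' Q)"
      using 1(4) 2(4) weight_le_nonzero[OF 1(2,3)] weight_le_nonzero[OF 2(2,3)]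
      by eventually_elim (simp add: field_simps)
    ultimately show ?case using weight_le_mult[OF 1(2) 2(2)] 1(3) 2(3)
      by (intro exI[of _ "d + d'"] exI[of _ "\<lambda>Q. r Q * s' Q + s Q * r' Q"]
        exI[of _ "\<lambda>Q. s Q * s' Q"] exI[of _ "k * k'"]) auto
  next
    case (mult f c g c')
    from mult.IH obtain d r s k d' r' s' k' where
      1: "weight_le d r (c * k)" "weight_le d s k" "k \<noteq> 0" "\<forall>\<^sub>F Q in generic E. f Q = r Q / s Q" and
      2: "weight_le d' r' (c' * k')" "weight_le d' s' k'" "k' \<noteq> 0" "\<forall>\<^sub>F Q in generic E. g Q = r' Q / s' Q"
      by (elim exE conjE) (rule that, assumption+)
    have "weight_le (d + d') (\<lambda>Q. r Q * r' Q) (c * k * (c' * k'))"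
      by (intro weight_le_mult 1 2)
    moreover have "c * k * (c' * k') = c * c' * (k * k')" by (simp add: algebra_simps)
    moreover have "\<forall>\<^sub>F Q in generic E. f Q * g Q = (r Q * r' Q) / (s Q * s' Q)"
      using 1(4) 2(4) by eventually_elim simp
    ultimately show ?case using weight_le_mult[OF 1(2) 2(2)] 1(3) 2(3)
      by (intro exI[of _ "d + d'"] exI[of _ "\<lambda>Q. r Q * r' Q"]
        exI[of _ "\<lambda>Q. s Q * s' Q"] exI[of _ "k * k'"]) auto
  next
    case (inverse f c)
    from inverse.IH obtain d r s k where
      1: "weight_le d r (c * k)" "weight_le d s k" "k \<noteq> 0" "\<forall>\<^sub>F Q in generic E. f Q = r Q / s Q"
      by (elim exE conjE) (rule that, assumption+)
    have "\<forall>\<^sub>F Q in generic E. inverse (f Q) = s Q / r Q" using 1(4) by eventually_elim simp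
    moreover have "weight_le d s (inverse c * (c * k))"
      using 1(2) inverse.hyps(2) by (simp add: mult.assoc[symmetric])
    ultimately show ?case using 1 inverse.hyps(2)
      by (intro exI[of _ d] exI[of _ s] exI[of _ r] exI[of _ "c * k"]) (simp del: mult.assoc)
  next
    case (cong f c g)
    from cong.IH obtain d r s k where
      1: "weight_le d r (c * k)" "weight_le d s k" "k \<noteq> 0" "\<forall>\<^sub>F Q in generic E. f Q = r Q / s Q"
      by (elim exE conjE) (rule that, assumption+)
    have "\<forall>\<^sub>F Q in generic E. g Q = r Q / s Q" using 1(4) cong.hyps(2) by eventually_elim simp
    thus ?case using 1 by blast
  qed auto
  thus ?thesis using that by blast
qed

lemma has_val_zeroD:
  assumes "has_val E P f c" "P \<in> pts" "\<forall>\<^sub>F Q in generic E. f Q = 0"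
  shows "c = 0"
proof (cases "P = Infinity")
  case True
  from assms(1)[unfolded True] obtain d r s k where *: "weight_le d r (c * k)" "weight_le d s k" "k \<noteq> 0"
    "\<forall>\<^sub>F Q in generic E. f Q = r Q / s Q" by (rule has_val_InfinityE)
  have "\<forall>\<^sub>F Q in generic E. r Q = 0"
    using *(4) assms(3) weight_le_nonzero[OF *(2,3)] by eventually_elim simp
  from weight_le_zeroD[OF *(1) this] show ?thesis using *(3) by simp
next
  case False
  from assms(1,2) False obtain a b a' b' where *: "reg_fun a' b' P \<noteq> 0" "c = reg_fun a b P / reg_fun a' b' P"
    "\<forall>\<^sub>F Q in generic E. f Q = reg_fun a b Q / reg_fun a' b' Q" by (rule has_val_affineE)
  have "\<forall>\<^sub>F Q in generic E. reg_fun a b Q = 0"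
    using *(3) assms(3) eventually_reg_fun_nonzero'[OF *(1)] by eventually_elim simp
  hence "a = 0" "b = 0" by (rule reg_fun_zeroD)+
  thus ?thesis using * by (simp add: reg_fun_def)
qed

lemma has_val_unique:
  assumes "has_val E P f c" "has_val E P f d" "P \<in> pts"
  shows "c = d"
  using has_val_zeroD[OF has_val_diff[OF assms(1,2)]] assms(3) by simp

lemma has_val_nonzero:
  assumes "has_val E P f c" "P \<in> pts" "c \<noteq> 0"
  shows "\<forall>\<^sub>F Q in generic E. f Q \<noteq> 0"
proof (cases "P = Infinity")
  case True
  from assms(1)[unfolded True] obtain d r s k where *: "weight_le d r (c * k)" "weight_le d s k" "k \<noteq> 0"
    "\<forall>\<^sub>F Q in generic E. f Q = r Q / s Q" by (rule has_val_InfinityE)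
  have "c * k \<noteq> 0" using *(3) assms by simp
  from weight_le_nonzero[OF *(1) this] weight_le_nonzero[OF *(2,3)] *(4)
  show ?thesis by eventually_elim simp
next
  case False
  from assms(1,2) False obtain a b a' b' where *: "reg_fun a' b' P \<noteq> 0" "c = reg_fun a b P / reg_fun a' b' P"
    "\<forall>\<^sub>F Q in generic E. f Q = reg_fun a b Q / reg_fun a' b' Q" by (rule has_val_affineE)
  have "reg_fun a b P \<noteq> 0" using * assms by auto
  from eventually_reg_fun_nonzero'[OF this] eventually_reg_fun_nonzero'[OF *(1)] *(3)
  show ?thesis by eventually_elim simp
qed

end

lemma has_val_xc: "has_val E (Affine x y) xc x"
  by (rule has_val.xc) (rule refl)

lemma has_val_yc: "has_val E (Affine x y) yc y"
  by (rule has_val.yc) (rule refl)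

lemmas has_val_intros = has_val.const has_val_xc has_val_yc has_val.add has_val_diff
  has_val.mult has_val_power has_val_uminus

lemma poly_taylor1:
  fixes p :: "'a::field poly"
  obtains q where "p = [:poly p c:] + [:-c, 1:] * q"
proof -
  have "poly (p - [:poly p c:]) c = 0" by simp
  then obtain q where "p - [:poly p c:] = [:-c, 1:] * q" by (metis poly_eq_0_iff_dvd dvdE)
  thus ?thesis using that by (metis add.commute diff_add_cancel)
qed

section \<open>Expansions at infinity\<close>

context smooth_weierstrass begin

lemma eventually_y_nonzero: "\<forall>\<^sub>F P in generic E. yc P \<noteq> 0"
  using eventually_reg_fun_nonzero[of 0 1] by (simp add: reg_fun_def)

lemma eventually_x_nonzero: "\<forall>\<^sub>F P in generic E. xc P \<noteq> 0"
  using eventually_x_neq[of 0] by (rule eventually_mono) auto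

lemma eventually_curve_eq:
  "\<forall>\<^sub>F P in generic E. yc P ^ 2 + a\<^sub>1 * xc P * yc P + a\<^sub>3 * yc P =
     xc P ^ 3 + a\<^sub>2 * xc P ^ 2 + a\<^sub>4 * xc P + a\<^sub>6"
  using eventually_in_pts eventually_neq[of Infinity]
proof eventually_elim
  case (elim P)
  thus ?case by (cases P) (auto simp: curve_points_def)
qed

abbreviation zc :: "'f ec_point \<Rightarrow> 'f" where "zc P \<equiv> xc P / yc P"

lemma has_val_zc: "has_val E Infinity zc 0"
  by (rule has_val.x_over_y) simp

text \<open>Dividing the curve equation by \<open>y^2\<close> expresses \<open>x^3 / y^2\<close>,
  which is \<open>x * zc^2\<close>, through \<open>zc\<close> and \<open>1 / y\<close>. Both vanish
  at infinity, so only the 1 coming from \<open>y^2\<close> remains.\<close>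

lemma has_val_x_zc2: "has_val E Infinity (\<lambda>P. xc P * zc P ^ 2) 1"
proof -
  let ?w = "\<lambda>P. 1 / yc P"
  have "has_val E Infinity (\<lambda>P. 1 + a\<^sub>1 * zc P + a\<^sub>3 * ?w P - a\<^sub>2 * zc P ^ 2 - a\<^sub>4 * (zc P * ?w P) - a\<^sub>6 * ?w P ^ 2)
    (1 + a\<^sub>1 * 0 + a\<^sub>3 * 0 - a\<^sub>2 * 0 ^ 2 - a\<^sub>4 * (0 * 0) - a\<^sub>6 * 0 ^ 2)"
    by (intro has_val_diff has_val.add has_val.mult has_val_power has_val.const has_val_zc
      has_val.one_over_y refl)
  moreover have "\<forall>\<^sub>F P in generic E. 1 + a\<^sub>1 * zc P + a\<^sub>3 * ?w P - a\<^sub>2 * zc P ^ 2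
      - a\<^sub>4 * (zc P * ?w P) - a\<^sub>6 * ?w P ^ 2 = xc P * zc P ^ 2"
    using eventually_curve_eq eventually_y_nonzero
  proof eventually_elim
    case (elim P)
    have "yc P ^ 2 * (1 + a\<^sub>1 * zc P + a\<^sub>3 * ?w P - a\<^sub>2 * zc P ^ 2 - a\<^sub>4 * (zc P * ?w P) - a\<^sub>6 * ?w P ^ 2)
      = yc P ^ 2 + a\<^sub>1 * xc P * yc P + a\<^sub>3 * yc P - a\<^sub>2 * xc P ^ 2 - a\<^sub>4 * xc P - a\<^sub>6"
      using elim(2) by (simp add: field_simps power2_eq_square)
    also have "\<dots> = yc P ^ 2 * (xc P * zc P ^ 2)"
      unfolding elim(1) using elim(2) by (simp add: field_simps power2_eq_square power3_eq_cube)
    finally show ?case using elim(2) by simp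
  qed
  ultimately show ?thesis by (rule has_val_cong') simp
qed

lemma has_val_y_zc3: "has_val E Infinity (\<lambda>P. yc P * zc P ^ 3) 1"
proof (rule has_val.cong[OF has_val_x_zc2])
  show "\<forall>\<^sub>F P in generic E. xc P * zc P ^ 2 = yc P * zc P ^ 3"
    using eventually_y_nonzero by eventually_elim (simp add: field_simps power2_eq_square power3_eq_cube)
qed

text \<open>The monomials \<open>x^i\<close> and \<open>x^i y\<close> become 1 at infinity after
  multiplication by \<open>zc\<close> to the power of their weight, and any surplus power of
  \<open>zc\<close> vanishes. So only weight \<open>d\<close> contributes.\<close>

lemma weight_le_has_val:
  assumes "weight_le d f c"
  shows "has_val E Infinity (\<lambda>P. f P * zc P ^ d) c"
proof -
  from assms obtain a b where ab: "\<forall>\<^sub>F P in generic E. f P = reg_fun a b P"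
     "2 * degree a \<le> d" "b \<noteq> 0 \<longrightarrow> 2 * degree b + 3 \<le> d" "c = weight_coeff d a b"
    unfolding weight_le_def by blast
  have x: "has_val E Infinity (\<lambda>P. xc P ^ i * zc P ^ d) (if d = 2 * i then 1 else 0)"
    if "2 * i \<le> d" for i
  proof (rule has_val_cong')
    show "has_val E Infinity (\<lambda>P. (xc P * zc P ^ 2) ^ i * zc P ^ (d - 2 * i)) (1 ^ i * 0 ^ (d - 2 * i))"
      by (intro has_val.mult has_val_power has_val_x_zc2 has_val_zc)
    have "zc P ^ d = zc P ^ (2 * i) * zc P ^ (d - 2 * i)" for P :: "'f ec_point"
      using that by (metis le_add_diff_inverse power_add)
    thus "\<forall>\<^sub>F P in generic E. (xc P * zc P ^ 2) ^ i * zc P ^ (d - 2 * i) = xc P ^ i * zc P ^ d"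
      by (intro always_eventually allI) (simp add: power_mult_distrib power_mult mult.assoc)
  qed (use that in \<open>auto simp: power_0_left\<close>)
  have y: "has_val E Infinity (\<lambda>P. xc P ^ i * yc P * zc P ^ d) (if d = 2 * i + 3 then 1 else 0)"
    if "2 * i + 3 \<le> d" for i
  proof (rule has_val_cong')
    show "has_val E Infinity (\<lambda>P. (xc P * zc P ^ 2) ^ i * (yc P * zc P ^ 3) * zc P ^ (d - (2 * i + 3)))
      (1 ^ i * 1 * 0 ^ (d - (2 * i + 3)))"
      by (intro has_val.mult has_val_power has_val_x_zc2 has_val_y_zc3 has_val_zc)
    have "zc P ^ d = zc P ^ (2 * i) * zc P ^ 3 * zc P ^ (d - (2 * i + 3))" for P :: "'f ec_point"
      using that by (metis le_add_diff_inverse power_add)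
    thus "\<forall>\<^sub>F P in generic E. (xc P * zc P ^ 2) ^ i * (yc P * zc P ^ 3) * zc P ^ (d - (2 * i + 3))
        = xc P ^ i * yc P * zc P ^ d"
      by (intro always_eventually allI) (simp add: power_mult_distrib flip: power_mult)
  qed (use that in \<open>auto simp: power_0_left\<close>)
  have "has_val E Infinity (\<lambda>P. (\<Sum>i\<le>degree a. coeff a i * (xc P ^ i * zc P ^ d)) +
      (\<Sum>i\<le>degree b. coeff b i * (xc P ^ i * yc P * zc P ^ d)))
    ((\<Sum>i\<le>degree a. coeff a i * (if d = 2 * i then 1 else 0)) +
     (\<Sum>i\<le>degree b. coeff b i * (if d = 2 * i + 3 then 1 else 0)))"
  proof (cases "b = 0")
    case True
    have "has_val E Infinity (\<lambda>P. \<Sum>i\<le>degree a. coeff a i * (xc P ^ i * zc P ^ d))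
        (\<Sum>i\<le>degree a. coeff a i * (if d = 2 * i then 1 else 0))"
      using ab(2) by (intro has_val_sum has_val.mult has_val.const x) auto
    thus ?thesis using True by simp
  next
    case False
    show ?thesis using ab(2,3) False
      by (intro has_val.add has_val_sum has_val.mult has_val.const x y) auto
  qed
  moreover have "\<forall>\<^sub>F P in generic E. (\<Sum>i\<le>degree a. coeff a i * (xc P ^ i * zc P ^ d)) +
      (\<Sum>i\<le>degree b. coeff b i * (xc P ^ i * yc P * zc P ^ d)) = f P * zc P ^ d"
    using ab(1) by eventually_elim
      (simp add: reg_fun_def poly_altdef sum_distrib_left sum_distrib_right ring_distribs mult_ac)
  moreover have "(\<Sum>i\<le>degree a. coeff a i * (if d = 2 * i then 1 else 0)) =
      (if even d then coeff a (d div 2) else 0)"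
  proof (cases "even d")
    case True
    have "(\<Sum>i\<le>degree a. coeff a i * (if d = 2 * i then 1 else 0)) =
      (\<Sum>i\<le>degree a. if d div 2 = i then coeff a i else 0)"
      using True by (intro sum.cong) auto
    thus ?thesis using True by (auto simp: coeff_eq_0)
  qed (auto intro!: sum.neutral)
  moreover have "(\<Sum>i\<le>degree b. coeff b i * (if d = 2 * i + 3 then 1 else 0)) =
      (if odd d \<and> d \<ge> 3 then coeff b ((d - 3) div 2) else 0)"
  proof (cases "odd d \<and> d \<ge> 3")
    case True
    then obtain j where j: "d = 2 * j + 3" using odd_ge_3E by blast
    have "(\<Sum>i\<le>degree b. coeff b i * (if d = 2 * i + 3 then 1 else 0)) =
      (\<Sum>i\<le>degree b. if j = i then coeff b i else 0)"
      using j by (intro sum.cong) auto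
    thus ?thesis using True j by (auto simp: coeff_eq_0)
  qed (auto intro!: sum.neutral)
  ultimately show ?thesis
    unfolding ab(4) by (elim has_val_cong') (auto simp: weight_coeff_def)
qed

lemma weight_le_quotient_has_val:
  assumes "weight_le d r c" "weight_le d s k" "k \<noteq> 0"
  shows "has_val E Infinity (\<lambda>P. r P / s P) (c / k)"
proof (rule has_val.cong)
  show "has_val E Infinity (\<lambda>P. (r P * zc P ^ d) / (s P * zc P ^ d)) (c / k)"
    using assms by (intro has_val_divide weight_le_has_val)
  show "\<forall>\<^sub>F P in generic E. (r P * zc P ^ d) / (s P * zc P ^ d) = r P / s P"
    using eventually_x_nonzero eventually_y_nonzero by eventually_elim simp
qed

lemma weight_le_0_cases:
  assumes "weight_le d f 0"
  obtains "\<forall>\<^sub>F P in generic E. f P = 0" | d' c where "d = Suc d'" "weight_le d' f c"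
proof -
  from assms obtain a b where ab: "\<forall>\<^sub>F P in generic E. f P = reg_fun a b P"
     "2 * degree a \<le> d" "b \<noteq> 0 \<longrightarrow> 2 * degree b + 3 \<le> d" "0 = weight_coeff d a b"
    unfolding weight_le_def by blast
  show ?thesis
  proof (cases d)
    case 0
    hence "b = 0" "degree a = 0" using ab by auto
    moreover have "coeff a 0 = 0" using ab(4) 0 by (simp add: weight_coeff_def)
    ultimately have "a = 0" by (metis leading_coeff_0_iff)
    hence "\<forall>\<^sub>F P in generic E. f P = 0" using ab(1) \<open>b = 0\<close> by (simp add: reg_fun_def)
    thus ?thesis by (rule that)
  next
    case (Suc d')
    have "2 * degree a \<noteq> d"
    proof
      assume *: "2 * degree a = d"
      hence "lead_coeff a = 0" using ab(4) by (auto simp: weight_coeff_def)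
      thus False using * Suc by simp
    qed
    hence a: "2 * degree a \<le> d'" using ab(2) Suc by simp
    have "2 * degree b + 3 \<noteq> d" if "b \<noteq> 0"
    proof
      assume *: "2 * degree b + 3 = d"
      hence "lead_coeff b = 0" using ab(4) by (auto simp: weight_coeff_def)
      thus False using that by simp
    qed
    hence b: "2 * degree b + 3 \<le> d'" if "b \<noteq> 0" using ab(3) Suc that by fastforce
    from weight_leI[OF ab(1) a b refl] show ?thesis using that(2)[OF Suc] by blast
  qed
qed

text \<open>Thus \<open>zc\<close> is a uniformizer at infinity. A vanishing value lowers the weight
  of the numerator by 1, and dividing by \<open>x / y\<close> adds 3 to it and 2 to the weight of
  the denominator, which balances them.\<close>

lemma has_val_div_zc:
  assumes "has_val E Infinity f 0"
  shows "\<exists>c. has_val E Infinity (\<lambda>P. f P / zc P) c"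
proof -
  from assms obtain d r s k where *: "weight_le d r (0 * k)" "weight_le d s k" "k \<noteq> 0"
    "\<forall>\<^sub>F Q in generic E. f Q = r Q / s Q" by (rule has_val_InfinityE)
  from *(1) have "weight_le d r 0" by simp
  thus ?thesis
  proof (cases rule: weight_le_0_cases)
    case 1
    have "has_val E Infinity (\<lambda>P. f P / zc P) 0"
      by (rule has_val.cong[OF has_val.const], use *(4) 1 in eventually_elim) simp
    thus ?thesis ..
  next
    case (2 d' c)
    have a: "weight_le (d' + 3) (\<lambda>P. r P * yc P) (c * 1)"
      by (intro weight_le_mult 2 weight_le_y)
    have b: "weight_le (d' + 3) (\<lambda>P. s P * xc P) (k * 1)"
      using weight_le_mult[OF *(2) weight_le_x] 2(1) by (simp add: numeral_3_eq_3)
    have "has_val E Infinity (\<lambda>P. (r P * yc P) / (s P * xc P)) (c * 1 / (k * 1))"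
      using *(3) by (intro weight_le_quotient_has_val[OF a b]) auto
    moreover have "\<forall>\<^sub>F P in generic E. (r P * yc P) / (s P * xc P) = f P / zc P"
      using *(4) by eventually_elim simp
    ultimately show ?thesis by (blast intro: has_val.cong)
  qed
qed

text \<open>The difference of the curve equations at two points. It relates \<open>x - x0\<close>
  and \<open>y - y0\<close> near a point: a nonvanishing cofactor makes its factor a multiple of the
  other.\<close>

lemma curve_diff_eq:
  assumes "Affine x y \<in> pts" "Affine x0 y0 \<in> pts"
  shows "(y - y0) * (y + y0 + a\<^sub>1 * x + a\<^sub>3) =
    (x - x0) * (x^2 + x * x0 + x0^2 + a\<^sub>2 * (x + x0) + a\<^sub>4 - a\<^sub>1 * y0)"
proof -
  have 1: "y^2 + a\<^sub>1 * x * y + a\<^sub>3 * y = x^3 + a\<^sub>2 * x^2 + a\<^sub>4 * x + a\<^sub>6"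
    using assms(1) by (simp add: curve_points_def)
  have 2: "y0^2 + a\<^sub>1 * x0 * y0 + a\<^sub>3 * y0 = x0^3 + a\<^sub>2 * x0^2 + a\<^sub>4 * x0 + a\<^sub>6"
    using assms(2) by (simp add: curve_points_def)
  have "(y - y0) * (y + y0 + a\<^sub>1 * x + a\<^sub>3) + a\<^sub>1 * y0 * (x - x0) =
      (y^2 + a\<^sub>1 * x * y + a\<^sub>3 * y) - (y0^2 + a\<^sub>1 * x0 * y0 + a\<^sub>3 * y0)"
    by (simp add: algebra_simps power2_eq_square)
  also have "\<dots> = (x - x0) * (x^2 + x * x0 + x0^2 + a\<^sub>2 * (x + x0) + a\<^sub>4)"
    unfolding 1 2 by (simp add: algebra_simps power2_eq_square power3_eq_cube)
  finally show ?thesis by (simp add: algebra_simps)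
qed

lemma eventually_curve_diff_eq:
  assumes "Affine x0 y0 \<in> pts"
  shows "\<forall>\<^sub>F P in generic E. (yc P - y0) * (yc P + y0 + a\<^sub>1 * xc P + a\<^sub>3) =
    (xc P - x0) * (xc P^2 + xc P * x0 + x0^2 + a\<^sub>2 * (xc P + x0) + a\<^sub>4 - a\<^sub>1 * y0)"
  using eventually_in_pts eventually_neq[of Infinity]
proof eventually_elim
  case (elim P)
  thus ?case using curve_diff_eq assms by (cases P) auto
qed

lemma neg_affine_in_pts:
  assumes "Affine x y \<in> pts" shows "Affine x (- y - a\<^sub>1 * x - a\<^sub>3) \<in> pts"
  using assms by (simp add: curve_points_def algebra_simps power2_eq_square)

lemma smooth_at:
  assumes "Affine x y \<in> pts" "2 * y + a\<^sub>1 * x + a\<^sub>3 = 0"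
  shows "3 * x^2 + 2 * a\<^sub>2 * x + a\<^sub>4 - a\<^sub>1 * y \<noteq> 0"
proof
  assume "3 * x^2 + 2 * a\<^sub>2 * x + a\<^sub>4 - a\<^sub>1 * y = 0"
  hence "a\<^sub>1 * y = 3 * x^2 + 2 * a\<^sub>2 * x + a\<^sub>4" by simp
  thus False using smooth assms unfolding smooth_curve_def curve_points_def by blast
qed

section \<open>Regular functions on the affine curve are polynomials in x and y\<close>

definition affine_regular :: "('f ec_point \<Rightarrow> 'f) \<Rightarrow> bool" where
  "affine_regular f \<longleftrightarrow> (\<forall>P\<in>pts. P \<noteq> Infinity \<longrightarrow> (\<exists>c. has_val E P f c))"

lemma affine_regular_reg_fun: "affine_regular (reg_fun a b)"
proof -
  have "\<exists>c. has_val E P (reg_fun a b) c" if "P \<noteq> Infinity" for P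
    using that by (cases P) (blast intro: has_val_reg_fun)+
  thus ?thesis by (simp add: affine_regular_def)
qed

lemma affine_regular_mult:
  "affine_regular f \<Longrightarrow> affine_regular g \<Longrightarrow> affine_regular (\<lambda>P. f P * g P)"
  unfolding affine_regular_def by (fast intro: has_val.mult)

text \<open>The only place where smoothness of the affine part enters: \<open>K[x,y]\<close> is integrally closed.\<close>
lemma dvd_of_affine_regular:
  assumes g: "affine_regular g"
    and eq: "\<forall>\<^sub>F P in generic E. (xc P - x0) * g P = reg_fun a b P"
  shows "poly a x0 = 0" "poly b x0 = 0"
proof -
  have val: "poly a x0 + poly b x0 * y = 0" if y: "Affine x0 y \<in> pts" for y
  proof -
    obtain c where "has_val E (Affine x0 y) g c" using g y unfolding affine_regular_def by blast
    hence "has_val E (Affine x0 y) (\<lambda>P. (xc P - x0) * g P) ((x0 - x0) * c)"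
      by (intro has_val.mult has_val_diff has_val_xc has_val.const)
    from has_val.cong[OF this eq] have "has_val E (Affine x0 y) (reg_fun a b) 0" by simp
    from has_val_unique[OF this has_val_reg_fun y] show ?thesis by (simp add: reg_fun_def)
  qed
  obtain y where y: "Affine x0 y \<in> pts" using point_above by blast
  define y' where "y' = - y - a\<^sub>1 * x0 - a\<^sub>3"
  have y': "Affine x0 y' \<in> pts" using neg_affine_in_pts[OF y] by (simp add: y'_def)
  have "poly b x0 = 0"
  proof (rule ccontr)
    assume B: "poly b x0 \<noteq> 0"
    have "poly b x0 * (y - y') = 0"
    proof -
      have "poly b x0 * (y - y') = (poly a x0 + poly b x0 * y) - (poly a x0 + poly b x0 * y')"
        by (simp add: algebra_simps)
      thus ?thesis using val[OF y] val[OF y'] by simp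
    qed
    hence "y = y'" using B by simp
    \<comment> \<open>\<open>poly a x0 + poly b x0 * y\<close> vanishes at both points above
      \<open>x0\<close>; being linear in y it has one root, so the points coincide and the tangent
      is vertical.\<close>
    hence tors: "2 * y + a\<^sub>1 * x0 + a\<^sub>3 = 0" by (simp add: y'_def algebra_simps eq_neg_iff_add_eq_0)
    obtain a' where a': "a = [:poly a x0:] + [:-x0, 1:] * a'" by (rule poly_taylor1)
    obtain b' where b': "b = [:poly b x0:] + [:-x0, 1:] * b'" by (rule poly_taylor1)
    have A: "poly a x0 = - (poly b x0 * y)" using val[OF y] by (simp add: eq_neg_iff_add_eq_0)
    \<comment> \<open>At almost all points \<open>h\<close> equals
      \<open>(yc - y) / (xc - x0)\<close>. If it has a value here, the curve equation writes the
      x-derivative as \<open>h\<close> times a function vanishing at the point, so both partial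
      derivatives are 0.\<close>
    define h where "h = (\<lambda>P. (g P - reg_fun a' b' P) / poly b x0)"
    obtain c where "has_val E (Affine x0 y) g c" using g y unfolding affine_regular_def by blast
    hence h: "has_val E (Affine x0 y) h ((c - reg_fun a' b' (Affine x0 y)) / poly b x0)" (is "has_val _ _ _ ?c")
      unfolding h_def by (intro has_val_divide has_val_diff has_val_reg_fun has_val.const B)
    have h_eq: "\<forall>\<^sub>F P in generic E. (xc P - x0) * h P = yc P - y"
      using eq
    proof eventually_elim
      case (elim P)
      have pa: "poly a (xc P) = poly a x0 + (xc P - x0) * poly a' (xc P)"
        by (subst a') (simp add: algebra_simps)
      have pb: "poly b (xc P) = poly b x0 + (xc P - x0) * poly b' (xc P)"
        by (subst b') (simp add: algebra_simps)
      have "(xc P - x0) * (g P - reg_fun a' b' P) = poly b x0 * (yc P - y)"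
        using elim unfolding reg_fun_def pa pb A by (simp add: algebra_simps)
      thus ?case using B by (simp add: h_def field_simps)
    qed
    have "has_val E (Affine x0 y) (\<lambda>P. h P * (yc P + y + a\<^sub>1 * xc P + a\<^sub>3)) (?c * (y + y + a\<^sub>1 * x0 + a\<^sub>3))"
      by (intro has_val.mult has_val.add h has_val.const has_val_xc has_val_yc)
    moreover have "\<forall>\<^sub>F P in generic E. h P * (yc P + y + a\<^sub>1 * xc P + a\<^sub>3) =
        xc P^2 + xc P * x0 + x0^2 + a\<^sub>2 * (xc P + x0) + a\<^sub>4 - a\<^sub>1 * y"
      using h_eq eventually_curve_diff_eq[OF y] eventually_x_neq[of x0]
    proof eventually_elim
      case (elim P)
      have "(xc P - x0) * (h P * (yc P + y + a\<^sub>1 * xc P + a\<^sub>3)) = (yc P - y) * (yc P + y + a\<^sub>1 * xc P + a\<^sub>3)"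
        using elim(1) by (simp add: mult.assoc[symmetric])
      thus ?case using elim(2,3) by simp
    qed
    ultimately have "has_val E (Affine x0 y)
        (\<lambda>P. xc P^2 + xc P * x0 + x0^2 + a\<^sub>2 * (xc P + x0) + a\<^sub>4 - a\<^sub>1 * y)
        (?c * (y + y + a\<^sub>1 * x0 + a\<^sub>3))"
      by (rule has_val.cong)
    moreover have "has_val E (Affine x0 y)
        (\<lambda>P. xc P^2 + xc P * x0 + x0^2 + a\<^sub>2 * (xc P + x0) + a\<^sub>4 - a\<^sub>1 * y)
        (x0^2 + x0 * x0 + x0^2 + a\<^sub>2 * (x0 + x0) + a\<^sub>4 - a\<^sub>1 * y)"
      by (intro has_val.mult has_val.add has_val_diff has_val.const has_val_xc has_val_power)
    ultimately have "?c * (y + y + a\<^sub>1 * x0 + a\<^sub>3) = x0^2 + x0 * x0 + x0^2 + a\<^sub>2 * (x0 + x0) + a\<^sub>4 - a\<^sub>1 * y"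
      using has_val_unique y by blast
    moreover have "y + y + a\<^sub>1 * x0 + a\<^sub>3 = 0" using tors by simp
    ultimately have "x0^2 + x0 * x0 + x0^2 + a\<^sub>2 * (x0 + x0) + a\<^sub>4 - a\<^sub>1 * y = 0"
      by (simp only: mult_zero_right)
    hence "3 * x0^2 + 2 * a\<^sub>2 * x0 + a\<^sub>4 - a\<^sub>1 * y = 0"
      by (simp add: algebra_simps power2_eq_square)
    thus False using smooth_at[OF y tors] by simp
  qed
  thus "poly b x0 = 0" "poly a x0 = 0" using val[OF y] by auto
qed

text \<open>The roots of the denominator \<open>d\<close> are removed one at a time: by
  \<open>dvd_of_affine_regular\<close> the numerator is divisible by the same linear factor.\<close>

lemma affine_regular_cancel:
  assumes "affine_regular f" "d \<noteq> 0" "\<forall>\<^sub>F P in generic E. poly d (xc P) * f P = reg_fun a b P"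
  shows "\<exists>a b. \<forall>\<^sub>F P in generic E. f P = reg_fun a b P"
  using assms
proof (induction "degree d" arbitrary: d a b)
  case 0
  then obtain k where k: "d = [:k:]" by (metis degree_eq_zeroE)
  hence "k \<noteq> 0" using 0 by simp
  have "\<forall>\<^sub>F P in generic E. f P = reg_fun (smult (1 / k) a) (smult (1 / k) b) P"
    using 0(4) by eventually_elim (use \<open>k \<noteq> 0\<close> in \<open>simp add: k reg_fun_def field_simps\<close>)
  thus ?case by blast
next
  case (Suc n)
  then obtain x0 where "poly d x0 = 0" using alg_closed_imp_poly_has_root[of d] by auto
  then obtain d1 where d1: "d = [:-x0, 1:] * d1" by (metis poly_eq_0_iff_dvd dvdE)
  have d1n: "d1 \<noteq> 0" using d1 Suc.prems by auto
  have deg: "degree d1 = n" using Suc.hyps(2) d1n unfolding d1 by (subst (asm) degree_mult_eq) auto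
  define g where "g = (\<lambda>P. reg_fun d1 0 P * f P)"
  have g: "affine_regular g"
    unfolding g_def by (intro affine_regular_mult affine_regular_reg_fun Suc.prems)
  have eq: "\<forall>\<^sub>F P in generic E. (xc P - x0) * g P = reg_fun a b P"
    using Suc.prems(3) by eventually_elim (simp add: d1 g_def reg_fun_poly algebra_simps)
  from dvd_of_affine_regular[OF g eq] obtain a' b' where ab: "a = [:-x0, 1:] * a'" "b = [:-x0, 1:] * b'"
    by (metis poly_eq_0_iff_dvd dvdE)
  have "\<forall>\<^sub>F P in generic E. poly d1 (xc P) * f P = reg_fun a' b' P"
    using eq eventually_x_neq[of x0]
  proof eventually_elim
    case (elim P)
    have "(xc P - x0) * g P = (xc P - x0) * reg_fun a' b' P"
      unfolding elim(1) by (simp add: ab reg_fun_def algebra_simps)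
    thus ?case using elim(2) by (simp add: g_def reg_fun_poly)
  qed
  from Suc.hyps(1)[OF deg[symmetric] Suc.prems(1) d1n this] show ?case .
qed

text \<open>Multiplying by the conjugate turns the denominator into its norm, a polynomial in x
  alone, which \<open>affine_regular_cancel\<close> removes.\<close>

lemma affine_regular_imp_reg_fun:
  assumes "affine_regular f"
  obtains a b where "\<forall>\<^sub>F P in generic E. f P = reg_fun a b P"
proof -
  obtain y where P: "Affine 0 y \<in> pts" (is "?P \<in> _") using point_above by blast
  then obtain c where "has_val E ?P f c" using assms unfolding affine_regular_def by blast
  then obtain a b a' b' where *: "reg_fun a' b' ?P \<noteq> 0"
    "\<forall>\<^sub>F Q in generic E. f Q = reg_fun a b Q / reg_fun a' b' Q"
    by (rule has_val_affineE) (use P in auto)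
  have "a' \<noteq> 0 \<or> b' \<noteq> 0" using * by (auto simp: reg_fun_def)
  hence nz: "norm_poly a' b' \<noteq> 0" by (rule norm_poly_nonzero)
  have "\<exists>u v. \<forall>\<^sub>F P in generic E. poly (norm_poly a' b') (xc P) * f P = reg_fun u v P"
  proof (intro exI)
    let ?u = "a * (a' - b' * lin) + b * (- b') * cubic"
    let ?v = "a * (- b') + b * (a' - b' * lin) - b * (- b') * lin"
    show "\<forall>\<^sub>F P in generic E. poly (norm_poly a' b') (xc P) * f P = reg_fun ?u ?v P"
      using *(2) eventually_reg_fun_nonzero'[OF *(1)] eventually_in_pts eventually_neq[of Infinity]
    proof eventually_elim
      case (elim P)
      show ?case
        unfolding elim(1) reg_fun_mult[OF elim(3,4), symmetric] reg_fun_mult_conj[OF elim(3,4), symmetric]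
        using elim(2) by simp
    qed
  qed
  with affine_regular_cancel[OF assms nz] show ?thesis using that by blast
qed

text \<open>This holds because \<open>K[x,y]\<close> has no elements of weight 1.\<close>
lemma simple_pole_imp_const:
  assumes "affine_regular f" "has_val E Infinity (\<lambda>P. zc P * f P) c"
  obtains k where "\<forall>\<^sub>F P in generic E. f P = k"
proof -
  obtain a b where ab: "\<forall>\<^sub>F P in generic E. f P = reg_fun a b P"
    using affine_regular_imp_reg_fun[OF assms(1)] .
  show ?thesis
  proof (cases "b = 0 \<and> degree a = 0")
    case True
    then obtain k where "a = [:k:]" by (metis degree_eq_zeroE)
    thus ?thesis using that[of k] ab True by (simp add: reg_fun_def)
  next
    case False
    \<comment> \<open>The exact weight of \<open>f\<close>: the two candidates differ in parity, so
      the coefficient \<open>\<gamma>\<close> is not cancelled. As \<open>f\<close> is not constant,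
      the pole has order at least 2.\<close>
    define m where "m = (if b = 0 then 2 * degree a else max (2 * degree a) (2 * degree b + 3))"
    define \<gamma> where "\<gamma> = weight_coeff m a b"
    have m: "m \<ge> 2" using False by (auto simp: m_def)
    have w: "weight_le m f \<gamma>"
      by (rule weight_leI[OF ab]) (auto simp: m_def \<gamma>_def)
    have "m = 2 * degree a \<or> b \<noteq> 0 \<and> m = 2 * degree b + 3"
      by (auto simp: m_def max_def)
    hence \<gamma>: "\<gamma> \<noteq> 0"
      using m by (auto simp: \<gamma>_def weight_coeff_def)
    from assms(2) obtain e r s k where *: "weight_le e r (c * k)" "weight_le e s k" "k \<noteq> 0"
      "\<forall>\<^sub>F Q in generic E. zc Q * f Q = r Q / s Q" by (rule has_val_InfinityE)
    \<comment> \<open>Clearing denominators in \<open>zc * f = r / s\<close> gives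
      \<open>y * r = f * x * s\<close>. The right side has weight \<open>m + 2 + e\<close> with a
      nonzero coefficient, the left side weight at most \<open>3 + e\<close>.\<close>
    have "weight_le (m + (2 + e)) (\<lambda>P. f P * (xc P * s P)) (\<gamma> * (1 * k))"
      by (intro weight_le_mult w weight_le_x *)
    moreover have "weight_le (m + (2 + e)) (\<lambda>P. yc P * r P) 0"
      by (rule weight_le_mono[OF weight_le_mult[OF weight_le_y *(1)]]) (use m in auto)
    moreover have "\<forall>\<^sub>F P in generic E. yc P * r P = f P * (xc P * s P)"
      using *(4) eventually_y_nonzero weight_le_nonzero[OF *(2,3)]
      by eventually_elim (simp add: field_simps)
    ultimately have "\<gamma> * (1 * k) = 0"
      using weight_le_unique[OF _ weight_le_cong] by metis
    thus ?thesis using \<gamma> *(3) by simp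
  qed
qed

end

section \<open>Lines and the chord-tangent law\<close>

lemma cubic_factor_chord:
  fixes A B C :: "'a::field"
  assumes "x1 \<noteq> x2" "x1^3 + A * x1^2 + B * x1 + C = 0" "x2^3 + A * x2^2 + B * x2 + C = 0"
    "x3 = - A - x1 - x2"
  shows "x^3 + A * x^2 + B * x + C = (x - x1) * (x - x2) * (x - x3)"
proof -
  have "(x1 - x2) * (x1^2 + x1 * x2 + x2^2 + A * (x1 + x2) + B) =
      (x1^3 + A * x1^2 + B * x1 + C) - (x2^3 + A * x2^2 + B * x2 + C)"
    by (simp add: algebra_simps power2_eq_square power3_eq_cube)
  hence "x1^2 + x1 * x2 + x2^2 + A * (x1 + x2) + B = 0"
    using assms(1-3) by simp
  hence B: "B = - (x1^2 + x1 * x2 + x2^2 + A * (x1 + x2))"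
    by (metis add.commute add_eq_0_iff)
  have C: "C = - (x1^3 + A * x1^2 + B * x1)"
    using assms(2) by (metis add.commute add_eq_0_iff)
  show ?thesis
    unfolding C B assms(4) by (simp add: algebra_simps power2_eq_square power3_eq_cube)
qed

text \<open>The vanishing formal derivative makes \<open>x1\<close> a double root; the sum of the
  roots then gives \<open>x3\<close>.\<close>

lemma cubic_factor_tangent:
  fixes A B C :: "'a::field"
  assumes "x1^3 + A * x1^2 + B * x1 + C = 0" "3 * x1^2 + 2 * A * x1 + B = 0" "x3 = - A - x1 - x1"
  shows "x^3 + A * x^2 + B * x + C = (x - x1) * (x - x1) * (x - x3)"
proof -
  have B: "B = - (3 * x1^2 + 2 * A * x1)"
    using assms(2) by (metis add.commute add_eq_0_iff)
  have C: "C = - (x1^3 + A * x1^2 + B * x1)"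
    using assms(1) by (metis add.commute add_eq_0_iff)
  show ?thesis
    unfolding C B assms(3) by (simp add: algebra_simps power2_eq_square power3_eq_cube)
qed

context smooth_weierstrass begin

text \<open>The right side minus the left side of the curve equation, with \<open>l * x + m\<close>
  in place of y.\<close>

definition line_cubic :: "'f \<Rightarrow> 'f \<Rightarrow> 'f \<Rightarrow> 'f" where
  "line_cubic l m x = x^3 + (a\<^sub>2 - l^2 - a\<^sub>1 * l) * x^2 + (a\<^sub>4 - 2 * l * m - a\<^sub>1 * m - a\<^sub>3 * l) * x
     + (a\<^sub>6 - m^2 - a\<^sub>3 * m)"

lemma on_line_iff: "Affine x (l * x + m) \<in> pts \<longleftrightarrow> line_cubic l m x = 0"
proof -
  have "line_cubic l m x = (x^3 + a\<^sub>2 * x^2 + a\<^sub>4 * x + a\<^sub>6) -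
    ((l * x + m)^2 + a\<^sub>1 * x * (l * x + m) + a\<^sub>3 * (l * x + m))"
    by (simp add: line_cubic_def algebra_simps power2_eq_square)
  thus ?thesis by (auto simp: curve_points_def)
qed

lemma line_mult_conj:
  assumes "Affine x y \<in> pts"
  shows "(y - l * x - m) * (- y - a\<^sub>1 * x - a\<^sub>3 - l * x - m) = - line_cubic l m x"
proof -
  have eq: "y^2 + a\<^sub>1 * x * y + a\<^sub>3 * y = x^3 + a\<^sub>2 * x^2 + a\<^sub>4 * x + a\<^sub>6"
    using assms by (simp add: curve_points_def)
  have "(y - l * x - m) * (- y - a\<^sub>1 * x - a\<^sub>3 - l * x - m) =
      - (y^2 + a\<^sub>1 * x * y + a\<^sub>3 * y) + (l * x + m)^2 + a\<^sub>1 * x * (l * x + m) + a\<^sub>3 * (l * x + m)"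
    by (simp add: algebra_simps power2_eq_square)
  also have "\<dots> = - line_cubic l m x"
    unfolding eq by (simp add: line_cubic_def algebra_simps power2_eq_square)
  finally show ?thesis .
qed

lemma same_x_cases:
  assumes "Affine x y1 \<in> pts" "Affine x y2 \<in> pts"
  shows "y2 = y1 \<or> y2 = - y1 - a\<^sub>1 * x - a\<^sub>3"
proof -
  have "(y2 - y1) * (y2 + y1 + a\<^sub>1 * x + a\<^sub>3) = 0"
    using curve_diff_eq[OF assms(2,1)] by simp
  moreover have "y2 = - y1 - a\<^sub>1 * x - a\<^sub>3" if "y2 + y1 + a\<^sub>1 * x + a\<^sub>3 = 0"
  proof -
    have "y2 = (y2 + y1 + a\<^sub>1 * x + a\<^sub>3) - y1 - a\<^sub>1 * x - a\<^sub>3" by simp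
    thus ?thesis unfolding that by simp
  qed
  ultimately show ?thesis by auto
qed

lemma two_torsion_iff: "2 * y + a\<^sub>1 * x + a\<^sub>3 = 0 \<longleftrightarrow> - y - a\<^sub>1 * x - a\<^sub>3 = y"
proof -
  have "2 * y + a\<^sub>1 * x + a\<^sub>3 = y - (- y - a\<^sub>1 * x - a\<^sub>3)" by simp
  thus ?thesis by (simp only: right_minus_eq) (rule eq_commute)
qed

text \<open>Chord and tangent are treated together: the factorization of \<open>line_cubic\<close>
  lists the intersection points with multiplicity, and the sum is the conjugate of the third
  one.\<close>

lemma ec_add_line:
  assumes P: "Affine x1 y1 \<in> pts" and Q: "Affine x2 y2 \<in> pts"
    and ne: "Affine x2 y2 \<noteq> ec_neg E (Affine x1 y1)"
  obtains l m x3 where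
    "ec_add E (Affine x1 y1) (Affine x2 y2) = Affine x3 (- (l + a\<^sub>1) * x3 - m - a\<^sub>3)"
    "y1 = l * x1 + m" "y2 = l * x2 + m" "x3 = l^2 + a\<^sub>1 * l - a\<^sub>2 - x1 - x2"
    "\<And>x. line_cubic l m x = (x - x1) * (x - x2) * (x - x3)"
    "x1 \<noteq> x2 \<Longrightarrow> l = (y2 - y1) / (x2 - x1)"
proof -
  define l where "l = (if x1 \<noteq> x2 then (y2 - y1) / (x2 - x1)
                   else (3 * x1^2 + 2 * a\<^sub>2 * x1 + a\<^sub>4 - a\<^sub>1 * y1) / (2 * y1 + a\<^sub>1 * x1 + a\<^sub>3))"
  define m where "m = y1 - l * x1"
  define x3 where "x3 = l^2 + a\<^sub>1 * l - a\<^sub>2 - x1 - x2"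
  have y1: "y1 = l * x1 + m" by (simp add: m_def)
  have A: "x3 = - (a\<^sub>2 - l^2 - a\<^sub>1 * l) - x1 - x2" by (simp add: x3_def algebra_simps)
  have c1: "line_cubic l m x1 = 0" using P y1 on_line_iff by metis
  have add: "ec_add E (Affine x1 y1) (Affine x2 y2) = Affine x3 (- (l + a\<^sub>1) * x3 - m - a\<^sub>3)"
    using ne by (simp add: l_def x3_def m_def Let_def)
  show ?thesis
  proof (cases "x1 = x2")
    case False
    have "l * (x2 - x1) = y2 - y1" using False by (simp add: l_def)
    hence y2: "y2 = l * x2 + m" by (simp add: m_def algebra_simps)
    have c2: "line_cubic l m x2 = 0" using Q y2 on_line_iff by metis
    have "line_cubic l m x = (x - x1) * (x - x2) * (x - x3)" for x
      using cubic_factor_chord[OF False c1[unfolded line_cubic_def] c2[unfolded line_cubic_def] A]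
      by (simp only: line_cubic_def)
    from that[OF add y1 y2 x3_def this] show ?thesis using False by (simp add: l_def)
  next
    case True
    hence y: "y2 = y1" using same_x_cases[of x1 y1 y2] P Q ne by auto
    have nz: "2 * y1 + a\<^sub>1 * x1 + a\<^sub>3 \<noteq> 0"
    proof
      assume "2 * y1 + a\<^sub>1 * x1 + a\<^sub>3 = 0"
      hence "(2 * y1 + a\<^sub>1 * x1 + a\<^sub>3) - y1 - a\<^sub>1 * x1 - a\<^sub>3 = - y1 - a\<^sub>1 * x1 - a\<^sub>3" by simp
      hence "y1 = - y1 - a\<^sub>1 * x1 - a\<^sub>3" by simp
      thus False using ne True y by simp
    qed
    have l: "l * (2 * y1 + a\<^sub>1 * x1 + a\<^sub>3) = 3 * x1^2 + 2 * a\<^sub>2 * x1 + a\<^sub>4 - a\<^sub>1 * y1"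
      using True nz by (simp add: l_def)
    have "3 * x1^2 + 2 * (a\<^sub>2 - l^2 - a\<^sub>1 * l) * x1 + (a\<^sub>4 - 2 * l * m - a\<^sub>1 * m - a\<^sub>3 * l) =
        (3 * x1^2 + 2 * a\<^sub>2 * x1 + a\<^sub>4 - a\<^sub>1 * y1) - l * (2 * y1 + a\<^sub>1 * x1 + a\<^sub>3)"
      by (simp add: m_def algebra_simps power2_eq_square)
    hence d: "3 * x1^2 + 2 * (a\<^sub>2 - l^2 - a\<^sub>1 * l) * x1 + (a\<^sub>4 - 2 * l * m - a\<^sub>1 * m - a\<^sub>3 * l) = 0"
      using l by simp
    have "line_cubic l m x = (x - x1) * (x - x2) * (x - x3)" for x
      using cubic_factor_tangent[OF c1[unfolded line_cubic_def] d A[folded True]] True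
      by (simp only: line_cubic_def)
    from that[OF add y1 _ x3_def this] show ?thesis using True y y1 by simp
  qed
qed

lemma ec_neg_in_pts: "P \<in> pts \<Longrightarrow> ec_neg E P \<in> pts"
  using neg_affine_in_pts by (cases P) auto

lemma ec_neg_neg [simp]: "ec_neg E (ec_neg E P) = P"
  by (cases P) auto

lemma ec_add_Infinity [simp]: "ec_add E P Infinity = P"
  by (cases P) auto

lemma ec_add_in_pts:
  assumes "P \<in> pts" "Q \<in> pts"
  shows "ec_add E P Q \<in> pts"
proof (cases "P = Infinity \<or> Q = Infinity \<or> Q = ec_neg E P")
  case True
  thus ?thesis using assms by (cases P; cases Q) auto
next
  case False
  then obtain x1 y1 x2 y2 where PQ: "P = Affine x1 y1" "Q = Affine x2 y2"
    by (cases P; cases Q) auto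
  have "Affine x1 y1 \<in> pts" "Affine x2 y2 \<in> pts" "Affine x2 y2 \<noteq> ec_neg E (Affine x1 y1)"
    using False assms PQ by auto
  from ec_add_line[OF this] obtain l m x3 where *:
    "ec_add E P Q = Affine x3 (- (l + a\<^sub>1) * x3 - m - a\<^sub>3)"
    "\<And>x. line_cubic l m x = (x - x1) * (x - x2) * (x - x3)"
    unfolding PQ by metis
  have "Affine x3 (l * x3 + m) \<in> pts" unfolding on_line_iff *(2) by simp
  moreover have "- (l * x3 + m) - a\<^sub>1 * x3 - a\<^sub>3 = - (l + a\<^sub>1) * x3 - m - a\<^sub>3"
    by (simp add: algebra_simps)
  ultimately show ?thesis
    unfolding *(1) using neg_affine_in_pts by metis
qed

lemma ec_add_eq_Infinity:
  assumes "ec_add E P Q = Infinity"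
  shows "Q = ec_neg E P"
  using assms by (cases P; cases Q) (auto simp: Let_def split: if_splits)

lemma ec_add_neg [simp]: "ec_add E P (ec_neg E P) = Infinity"
  by (cases P) auto

lemma ec_add_neg' [simp]: "ec_add E (ec_neg E P) P = Infinity"
  by (cases P) auto

lemma ec_add_commute:
  assumes "P \<in> pts" "Q \<in> pts"
  shows "ec_add E P Q = ec_add E Q P"
proof (cases "P = Infinity \<or> Q = Infinity \<or> Q = ec_neg E P \<or> P = Q")
  case True
  thus ?thesis by auto
next
  case False
  then obtain x1 y1 x2 y2 where PQ: "P = Affine x1 y1" "Q = Affine x2 y2"
    by (cases P; cases Q) auto
  have x: "x1 \<noteq> x2" using same_x_cases[of x1 y1 y2] False assms PQ by auto
  define l where "l = (y1 - y2) / (x1 - x2)"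
  have l: "(y2 - y1) / (x2 - x1) = l"
    unfolding l_def using x by (metis minus_diff_eq minus_divide_divide)
  have "l * (x1 - x2) = y1 - y2" using x by (simp add: l_def)
  hence m: "y1 - l * x1 = y2 - l * x2" by (simp add: algebra_simps)
  have "ec_add E P Q = Affine (l^2 + a\<^sub>1 * l - a\<^sub>2 - x1 - x2)
      (- (l + a\<^sub>1) * (l^2 + a\<^sub>1 * l - a\<^sub>2 - x1 - x2) - (y1 - l * x1) - a\<^sub>3)"
    using x by (simp add: PQ Let_def l)
  moreover have "ec_add E Q P = Affine (l^2 + a\<^sub>1 * l - a\<^sub>2 - x2 - x1)
      (- (l + a\<^sub>1) * (l^2 + a\<^sub>1 * l - a\<^sub>2 - x2 - x1) - (y2 - l * x2) - a\<^sub>3)"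
    using x by (simp add: PQ Let_def flip: l_def)
  moreover have "l^2 + a\<^sub>1 * l - a\<^sub>2 - x1 - x2 = l^2 + a\<^sub>1 * l - a\<^sub>2 - x2 - x1" by simp
  ultimately show ?thesis by (simp only: m)
qed

subsection \<open>Orders of vanishing\<close>

text \<open>\<open>x - x0\<close> fails only where the tangent is vertical, that is, at points of
  order 2; smoothness makes \<open>y - y0\<close> work there.\<close>

fun uniformizer :: "'f ec_point \<Rightarrow> 'f ec_point \<Rightarrow> 'f" where
  "uniformizer Infinity Q = zc Q"
| "uniformizer (Affine x y) Q = (if 2 * y + a\<^sub>1 * x + a\<^sub>3 \<noteq> 0 then xc Q - x else yc Q - y)"

lemma uniformizer_val: "has_val E P (uniformizer P) 0"
proof (cases P)
  case Infinity
  have "uniformizer Infinity = zc" by (rule ext) simp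
  thus ?thesis using Infinity has_val_zc by simp
next
  case (Affine x y)
  have "has_val E P (\<lambda>Q. xc Q - x) (x - x)" "has_val E P (\<lambda>Q. yc Q - y) (y - y)"
    unfolding Affine by (intro has_val_intros)+
  moreover have "uniformizer P = (if 2 * y + a\<^sub>1 * x + a\<^sub>3 \<noteq> 0 then (\<lambda>Q. xc Q - x) else (\<lambda>Q. yc Q - y))"
    by (rule ext) (simp add: Affine)
  ultimately show ?thesis by simp
qed

lemma uniformizer_nonzero: "\<forall>\<^sub>F Q in generic E. uniformizer P Q \<noteq> 0"
proof (cases P)
  case Infinity
  show ?thesis
    using eventually_x_nonzero eventually_y_nonzero by eventually_elim (simp add: Infinity)
next
  case (Affine x y)
  have "[:-y:] \<noteq> 0 \<or> (1 :: 'f poly) \<noteq> 0" by simp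
  from eventually_x_neq[of x] eventually_reg_fun_nonzero[OF this] show ?thesis
    by eventually_elim (simp add: Affine reg_fun_def)
qed

definition has_ord :: "'f ec_point \<Rightarrow> ('f ec_point \<Rightarrow> 'f) \<Rightarrow> int \<Rightarrow> bool" where
  "has_ord P f j \<longleftrightarrow> (\<exists>c. c \<noteq> 0 \<and> has_val E P (\<lambda>Q. f Q * uniformizer P Q powi (- j)) c)"

lemma has_ord_0I: "has_val E P f c \<Longrightarrow> c \<noteq> 0 \<Longrightarrow> has_ord P f 0"
  by (auto simp: has_ord_def)

lemma has_ord_cong:
  assumes "has_ord P f j" "\<forall>\<^sub>F Q in generic E. f Q = g Q"
  shows "has_ord P g j"
proof -
  from assms(1) obtain c where c: "c \<noteq> 0" "has_val E P (\<lambda>Q. f Q * uniformizer P Q powi (- j)) c"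
    unfolding has_ord_def by blast
  have "has_val E P (\<lambda>Q. g Q * uniformizer P Q powi (- j)) c"
    by (rule has_val.cong[OF c(2)]) (use assms(2) in eventually_elim, simp)
  thus ?thesis using c(1) unfolding has_ord_def by blast
qed

lemma has_ord_mult:
  assumes "has_ord P f j" "has_ord P g k"
  shows "has_ord P (\<lambda>Q. f Q * g Q) (j + k)"
proof -
  from assms obtain c d where c: "c \<noteq> 0" "has_val E P (\<lambda>Q. f Q * uniformizer P Q powi (- j)) c"
    and d: "d \<noteq> 0" "has_val E P (\<lambda>Q. g Q * uniformizer P Q powi (- k)) d"
    unfolding has_ord_def by blast
  have "has_val E P (\<lambda>Q. f Q * g Q * uniformizer P Q powi (- (j + k))) (c * d)"
  proof (rule has_val.cong[OF has_val.mult[OF c(2) d(2)]])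
    show "\<forall>\<^sub>F Q in generic E. f Q * uniformizer P Q powi (- j) * (g Q * uniformizer P Q powi (- k)) =
       f Q * g Q * uniformizer P Q powi (- (j + k))"
      using uniformizer_nonzero[of P]
    proof eventually_elim
      case (elim Q)
      have "uniformizer P Q powi (- (j + k)) = uniformizer P Q powi (- j) * uniformizer P Q powi (- k)"
        using elim by (metis minus_add_distrib power_int_add)
      thus ?case by (simp add: mult_ac)
    qed
  qed
  thus ?thesis unfolding has_ord_def using c(1) d(1) by (intro exI[of _ "c * d"]) simp
qed

lemma has_ord_inverse:
  assumes "has_ord P f j"
  shows "has_ord P (\<lambda>Q. inverse (f Q)) (- j)"
proof -
  from assms(1) obtain c where c: "c \<noteq> 0" "has_val E P (\<lambda>Q. f Q * uniformizer P Q powi (- j)) c"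
    unfolding has_ord_def by blast
  have "has_val E P (\<lambda>Q. inverse (f Q * uniformizer P Q powi (- j))) (inverse c)"
    by (rule has_val.inverse[OF c(2,1)])
  hence "has_val E P (\<lambda>Q. inverse (f Q) * uniformizer P Q powi (- (- j))) (inverse c)"
    by (rule has_val.cong) (intro always_eventually allI, simp add: power_int_minus)
  thus ?thesis using c(1) unfolding has_ord_def by (intro exI[of _ "inverse c"]) simp
qed

lemma has_ord_divide:
  "has_ord P f j \<Longrightarrow> has_ord P g k \<Longrightarrow> has_ord P (\<lambda>Q. f Q / g Q) (j - k)"
  using has_ord_mult[OF _ has_ord_inverse, of P f j g k] by (simp add: divide_inverse)

lemma has_ord_le:
  assumes "has_ord P f j" "k \<le> j"
  shows "\<exists>c. has_val E P (\<lambda>Q. f Q * uniformizer P Q powi (- k)) c"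
proof -
  from assms(1) obtain c where c: "c \<noteq> 0" "has_val E P (\<lambda>Q. f Q * uniformizer P Q powi (- j)) c"
    unfolding has_ord_def by blast
  have "has_val E P (\<lambda>Q. f Q * uniformizer P Q powi (- j) * uniformizer P Q ^ nat (j - k)) (c * 0 ^ nat (j - k))"
    by (intro has_val.mult c has_val_power uniformizer_val)
  moreover have "\<forall>\<^sub>F Q in generic E. f Q * uniformizer P Q powi (- j) * uniformizer P Q ^ nat (j - k) =
      f Q * uniformizer P Q powi (- k)"
    using uniformizer_nonzero[of P]
  proof eventually_elim
    case (elim Q)
    have "uniformizer P Q ^ nat (j - k) = uniformizer P Q powi (j - k)"
      using assms(2) by (simp add: power_int_def)
    moreover have "uniformizer P Q powi (- j + (j - k)) = uniformizer P Q powi (- j) * uniformizer P Q powi (j - k)"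
      using elim by (intro power_int_add) simp
    ultimately show ?case by simp
  qed
  ultimately show ?thesis by (blast intro: has_val.cong)
qed

lemma has_ord_unique:
  assumes "has_ord P f j" "has_ord P f k" "P \<in> pts"
  shows "j = k"
proof -
  have False if jk: "has_ord P f j" "has_ord P f k" "k < j" for j k
  proof -
    from jk(2) obtain c where c: "c \<noteq> 0" "has_val E P (\<lambda>Q. f Q * uniformizer P Q powi (- k)) c"
      unfolding has_ord_def by blast
    from jk(1,3) obtain d where d: "has_val E P (\<lambda>Q. f Q * uniformizer P Q powi (- (k + 1))) d"
      using has_ord_le[of P f j "k + 1"] by auto
    have "has_val E P (\<lambda>Q. f Q * uniformizer P Q powi (- (k + 1)) * uniformizer P Q) (d * 0)"
      by (intro has_val.mult d uniformizer_val)
    moreover have "\<forall>\<^sub>F Q in generic E. f Q * uniformizer P Q powi (- (k + 1)) * uniformizer P Q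
        = f Q * uniformizer P Q powi (- k)"
      using uniformizer_nonzero[of P]
    proof eventually_elim
      case (elim Q)
      have "uniformizer P Q powi (- (k + 1) + 1) = uniformizer P Q powi (- (k + 1)) * uniformizer P Q powi 1"
        using elim by (intro power_int_add) simp
      thus ?case by simp
    qed
    ultimately have "has_val E P (\<lambda>Q. f Q * uniformizer P Q powi (- k)) (d * 0)" by (rule has_val.cong)
    thus False using has_val_unique[OF c(2) _ assms(3)] c(1) by simp
  qed
  thus ?thesis using assms by (metis linorder_neqE)
qed

lemma has_ord_x:
  assumes P: "Affine x0 y0 \<in> pts"
  shows "has_ord (Affine x0 y0) (\<lambda>Q. xc Q - x0) (if 2 * y0 + a\<^sub>1 * x0 + a\<^sub>3 = 0 then 2 else 1)"
proof (cases "2 * y0 + a\<^sub>1 * x0 + a\<^sub>3 = 0")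
  case False
  have "has_val E (Affine x0 y0) (\<lambda>Q. (xc Q - x0) * uniformizer (Affine x0 y0) Q powi (- 1)) 1"
    by (rule has_val.cong[OF has_val.const], use eventually_x_neq[of x0] in eventually_elim)
       (use False in simp)
  thus ?thesis using False unfolding has_ord_def by (auto intro!: exI[of _ 1])
next
  case True
  \<comment> \<open>The factor with \<open>(y - y0)^2 = (x - x0) * K\<close> at a point with
    vertical tangent. Its value is, up to sign, the x-derivative, nonzero by smoothness, so
    \<open>x - x0\<close> has order 2.\<close>
  define K where "K = (\<lambda>Q :: 'f ec_point. xc Q^2 + xc Q * x0 + x0^2 + a\<^sub>2 * (xc Q + x0) + a\<^sub>4 - a\<^sub>1 * y0 - a\<^sub>1 * (yc Q - y0))"
  have K: "has_val E (Affine x0 y0) K (x0^2 + x0 * x0 + x0^2 + a\<^sub>2 * (x0 + x0) + a\<^sub>4 - a\<^sub>1 * y0 - a\<^sub>1 * (y0 - y0))"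
    unfolding K_def by (intro has_val_intros)
  have nz: "x0^2 + x0 * x0 + x0^2 + a\<^sub>2 * (x0 + x0) + a\<^sub>4 - a\<^sub>1 * y0 - a\<^sub>1 * (y0 - y0) \<noteq> 0" (is "?k \<noteq> 0")
    using smooth_at[OF P True] by (simp add: algebra_simps power2_eq_square)
  have "has_val E (Affine x0 y0) (\<lambda>Q. (xc Q - x0) * uniformizer (Affine x0 y0) Q powi (- 2)) (inverse ?k)"
  proof (rule has_val.cong[OF has_val.inverse[OF K nz]])
    show "\<forall>\<^sub>F Q in generic E. inverse (K Q) = (xc Q - x0) * uniformizer (Affine x0 y0) Q powi (- 2)"
      using eventually_curve_diff_eq[OF P] eventually_x_neq[of x0] has_val_nonzero[OF K P nz]
        uniformizer_nonzero[of "Affine x0 y0"]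
    proof eventually_elim
      case (elim Q)
      have y: "yc Q - y0 \<noteq> 0" using elim(4) True by simp
      have "yc Q + y0 + a\<^sub>1 * xc Q + a\<^sub>3 = (yc Q - y0) + a\<^sub>1 * (xc Q - x0) + (2 * y0 + a\<^sub>1 * x0 + a\<^sub>3)"
        by (simp add: algebra_simps)
      hence *: "yc Q + y0 + a\<^sub>1 * xc Q + a\<^sub>3 = (yc Q - y0) + a\<^sub>1 * (xc Q - x0)"
        unfolding True by (simp only: add_0_right)
      have "(yc Q - y0) * ((yc Q - y0) + a\<^sub>1 * (xc Q - x0)) =
          (xc Q - x0) * (K Q + a\<^sub>1 * (yc Q - y0))"
        using elim(1) unfolding * by (simp only: K_def diff_add_cancel)
      moreover have "d^2 = e * k" if "d * (d + a * e) = e * (k + a * d)" for a d e k :: 'f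
        using that by (simp add: algebra_simps power2_eq_square)
      ultimately have "(yc Q - y0)^2 = (xc Q - x0) * K Q" by blast
      hence "inverse (K Q) = (xc Q - x0) / (yc Q - y0)^2"
        using elim(2,3) y by (simp add: field_simps)
      thus ?case using True by (simp add: power_int_minus divide_inverse)
    qed
  qed
  thus ?thesis using True nz unfolding has_ord_def by (intro exI[of _ "inverse ?k"]) simp
qed

text \<open>A line that is not vertical crosses a vertical tangent transversally:
  \<open>x - x0\<close> has order 2, so \<open>y - y0\<close> alone determines the leading
  term.\<close>

lemma has_ord_line_2torsion:
  assumes P: "Affine x0 y0 \<in> pts" "2 * y0 + a\<^sub>1 * x0 + a\<^sub>3 = 0" and on: "y0 = l * x0 + m"
  shows "has_ord (Affine x0 y0) (\<lambda>Q. yc Q - l * xc Q - m) 1"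
proof -
  let ?u = "uniformizer (Affine x0 y0)"
  obtain c where c: "has_val E (Affine x0 y0) (\<lambda>Q. (xc Q - x0) * ?u Q powi (- 2)) c"
    using has_ord_x[OF P(1)] P(2) unfolding has_ord_def by auto
  have "has_val E (Affine x0 y0) (\<lambda>Q. 1 - l * ((xc Q - x0) * ?u Q powi (- 2) * ?u Q)) (1 - l * (c * 0))"
    by (intro has_val_intros c uniformizer_val)
  moreover have "\<forall>\<^sub>F Q in generic E. 1 - l * ((xc Q - x0) * ?u Q powi (- 2) * ?u Q) =
      (yc Q - l * xc Q - m) * ?u Q powi (- 1)"
    using uniformizer_nonzero[of "Affine x0 y0"]
  proof eventually_elim
    case (elim Q)
    have y: "yc Q - y0 \<noteq> 0" using elim P(2) by simp
    have "?u Q powi (- 2) * ?u Q = inverse (yc Q - y0)"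
      using P(2) y by (simp add: power_int_minus power2_eq_square)
    hence "1 - l * ((xc Q - x0) * ?u Q powi (- 2) * ?u Q) = 1 - l * ((xc Q - x0) * inverse (yc Q - y0))"
      by (simp only: mult.assoc)
    also have "\<dots> = ((yc Q - y0) - l * (xc Q - x0)) * inverse (yc Q - y0)"
    proof -
      have "1 - l * (a * inverse d) = (d - l * a) * inverse d" if "d \<noteq> 0" for a d :: 'f
        using that by (simp add: left_diff_distrib mult.assoc)
      thus ?thesis using y by blast
    qed
    also have "(yc Q - y0) - l * (xc Q - x0) = yc Q - l * xc Q - m"
      by (simp add: on algebra_simps)
    finally show ?case using P(2) by (simp add: power_int_minus)
  qed
  ultimately have "has_val E (Affine x0 y0) (\<lambda>Q. (yc Q - l * xc Q - m) * ?u Q powi (- 1)) (1 - l * (c * 0))"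
    by (rule has_val.cong)
  thus ?thesis unfolding has_ord_def by (intro exI[of _ 1]) simp
qed

lemma has_ord_x':
  assumes P: "Affine x0 y0 \<in> pts"
  shows "has_ord (Affine x0 y0) (\<lambda>Q. xc Q - x) (if x = x0 then if 2 * y0 + a\<^sub>1 * x0 + a\<^sub>3 = 0 then 2 else 1 else 0)"
proof (cases "x = x0")
  case True
  thus ?thesis using has_ord_x[OF P] by simp
next
  case False
  have "has_ord (Affine x0 y0) (\<lambda>Q. xc Q - x) 0"
    by (rule has_ord_0I[of _ _ "x0 - x"]) (use False in \<open>auto intro!: has_val_intros\<close>)
  thus ?thesis using False by simp
qed

lemma eventually_line_mult_conj:
  "\<forall>\<^sub>F Q in generic E. (yc Q - l * xc Q - m) * (- yc Q - a\<^sub>1 * xc Q - a\<^sub>3 - l * xc Q - m) = - line_cubic l m (xc Q)"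
  using eventually_in_pts eventually_neq[of Infinity]
proof eventually_elim
  case (elim Q)
  thus ?case using line_mult_conj by (cases Q) auto
qed

text \<open>By \<open>line_mult_conj\<close> the line times its conjugate is, up to sign, the
  product of \<open>x - x1\<close>, \<open>x - x2\<close>, \<open>x - x3\<close>, whose orders are
  known. Unless the point has order 2, the conjugate is nonzero there; if it has, line and conjugate
  both have order 1, which forces exactly one root to equal \<open>x0\<close>.\<close>

lemma has_ord_line:
  assumes P: "Affine x0 y0 \<in> pts" and on: "y0 = l * x0 + m"
    and roots: "\<And>x. line_cubic l m x = (x - x1) * (x - x2) * (x - x3)"
  shows "has_ord (Affine x0 y0) (\<lambda>Q. yc Q - l * xc Q - m)
    (of_bool (x1 = x0) + of_bool (x2 = x0) + of_bool (x3 = x0))"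
proof -
  let ?P = "Affine x0 y0"
  let ?e = "(if 2 * y0 + a\<^sub>1 * x0 + a\<^sub>3 = 0 then 2 else 1) :: int"
  let ?n = "of_bool (x1 = x0) + of_bool (x2 = x0) + of_bool (x3 = x0) :: int"
  let ?conj = "\<lambda>Q. - yc Q - a\<^sub>1 * xc Q - a\<^sub>3 - l * xc Q - m"
  have "has_ord ?P (\<lambda>Q. (xc Q - x1) * (xc Q - x2) * (xc Q - x3))
      ((if x1 = x0 then ?e else 0) + (if x2 = x0 then ?e else 0) + (if x3 = x0 then ?e else 0))"
    by (intro has_ord_mult has_ord_x' P)
  also have "(if x1 = x0 then ?e else 0) + (if x2 = x0 then ?e else 0) + (if x3 = x0 then ?e else 0) = ?n * ?e"
    by auto
  finally have prod: "has_ord ?P (\<lambda>Q. (xc Q - x1) * (xc Q - x2) * (xc Q - x3)) (?n * ?e)" .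
  have eq: "\<forall>\<^sub>F Q in generic E. (yc Q - l * xc Q - m) * (- 1 * ?conj Q) = (xc Q - x1) * (xc Q - x2) * (xc Q - x3)"
    using eventually_line_mult_conj[of l m] by eventually_elim (simp only: mult_minus1 mult_minus_right roots minus_minus)
  show ?thesis
  proof (cases "2 * y0 + a\<^sub>1 * x0 + a\<^sub>3 = 0")
    case False
    have "has_val E ?P (\<lambda>Q. - 1 * ?conj Q) (- 1 * (- y0 - a\<^sub>1 * x0 - a\<^sub>3 - l * x0 - m))"
      by (intro has_val_intros)
    moreover have "- 1 * (- y0 - a\<^sub>1 * x0 - a\<^sub>3 - l * x0 - m) = 2 * y0 + a\<^sub>1 * x0 + a\<^sub>3"
      using on by simp
    ultimately have c: "has_val E ?P (\<lambda>Q. - 1 * ?conj Q) (2 * y0 + a\<^sub>1 * x0 + a\<^sub>3)"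
      by (simp only:)
    have "has_ord ?P (\<lambda>Q. ((xc Q - x1) * (xc Q - x2) * (xc Q - x3)) / (- 1 * ?conj Q)) (?n * ?e - 0)"
      by (intro has_ord_divide prod has_ord_0I[OF c False])
    moreover have "\<forall>\<^sub>F Q in generic E. ((xc Q - x1) * (xc Q - x2) * (xc Q - x3)) / (- 1 * ?conj Q) = yc Q - l * xc Q - m"
      using eq has_val_nonzero[OF c P False]
    proof eventually_elim
      case (elim Q)
      show ?case unfolding elim(1)[symmetric] using elim(2) by simp
    qed
    ultimately have "has_ord ?P (\<lambda>Q. yc Q - l * xc Q - m) (?n * ?e - 0)" by (rule has_ord_cong)
    thus ?thesis using False by simp
  next
    case True
    have o1: "has_ord ?P (\<lambda>Q. yc Q - l * xc Q - m) 1"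
      by (rule has_ord_line_2torsion[OF P True on])
    have "has_ord ?P (\<lambda>Q. yc Q - (- l - a\<^sub>1) * xc Q - (- m - a\<^sub>3)) 1"
    proof (rule has_ord_line_2torsion[OF P True])
      have "y0 = (2 * y0 + a\<^sub>1 * x0 + a\<^sub>3) - y0 - a\<^sub>1 * x0 - a\<^sub>3" by simp
      also have "\<dots> = - (l * x0 + m) - a\<^sub>1 * x0 - a\<^sub>3" unfolding True using on by simp
      finally show "y0 = (- l - a\<^sub>1) * x0 + (- m - a\<^sub>3)" by (simp add: algebra_simps)
    qed
    hence "has_ord ?P (\<lambda>Q. - 1 * ?conj Q) 1"
      by (rule has_ord_cong) (simp add: algebra_simps)
    from has_ord_cong[OF has_ord_mult[OF o1 this] eq]
    have "has_ord ?P (\<lambda>Q. (xc Q - x1) * (xc Q - x2) * (xc Q - x3)) 2" by simp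
    from has_ord_unique[OF this prod P] have "?n = 1" using True by simp
    thus ?thesis using o1 by simp
  qed
qed

section \<open>Principal divisors and associativity of the addition\<close>

definition principal_divisor :: "('f ec_point \<Rightarrow> int) \<Rightarrow> bool" where
  "principal_divisor D \<longleftrightarrow> (\<exists>f. \<forall>P\<in>pts. has_ord P f (D P))"

lemma principal_divisor_add:
  "principal_divisor D \<Longrightarrow> principal_divisor D' \<Longrightarrow> principal_divisor (\<lambda>P. D P + D' P)"
  unfolding principal_divisor_def by (fast intro: has_ord_mult)

lemma principal_divisor_diff:
  "principal_divisor D \<Longrightarrow> principal_divisor D' \<Longrightarrow> principal_divisor (\<lambda>P. D P - D' P)"
  unfolding principal_divisor_def by (fast intro: has_ord_divide)

abbreviation dlt :: "'f ec_point \<Rightarrow> 'f ec_point \<Rightarrow> int" where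
  "dlt P Q \<equiv> of_bool (Q = P)"

lemma principal_divisor_x:
  assumes "Affine x0 y0 \<in> pts"
  shows "principal_divisor (\<lambda>Q. dlt (Affine x0 y0) Q + dlt (ec_neg E (Affine x0 y0)) Q - 2 * dlt Infinity Q)"
  unfolding principal_divisor_def
proof (intro exI[of _ "\<lambda>Q. xc Q - x0"] ballI)
  fix P assume P: "P \<in> pts"
  show "has_ord P (\<lambda>Q. xc Q - x0) (dlt (Affine x0 y0) P + dlt (ec_neg E (Affine x0 y0)) P - 2 * dlt Infinity P)"
  proof (cases P)
    case Infinity
    have "weight_le 2 (\<lambda>Q. xc Q + (- x0)) (1 + 0)"
      by (intro weight_le_add weight_le_x weight_le_mono[OF weight_le_const]) simp
    from weight_le_has_val[OF this] show ?thesis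
      unfolding has_ord_def Infinity by (intro exI[of _ 1]) simp
  next
    case (Affine x y)
    show ?thesis
    proof (cases "x = x0")
      case False
      thus ?thesis using has_ord_x'[of x y x0] P Affine by auto
    next
      case True
      have "y = y0 \<or> y = - y0 - a\<^sub>1 * x0 - a\<^sub>3"
        using same_x_cases[OF assms, of y] P Affine True by simp
      hence "(if 2 * y + a\<^sub>1 * x + a\<^sub>3 = 0 then 2 else 1) =
          dlt (Affine x0 y0) P + dlt (ec_neg E (Affine x0 y0)) P - 2 * dlt Infinity P"
      proof -
        define w where "w = - y0 - a\<^sub>1 * x0 - a\<^sub>3"
        have "- w - a\<^sub>1 * x0 - a\<^sub>3 = y0" by (simp add: w_def)
        moreover assume "y = y0 \<or> y = - y0 - a\<^sub>1 * x0 - a\<^sub>3"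
        ultimately show ?thesis
          unfolding True Affine two_torsion_iff ec_neg.simps w_def[symmetric]
          by (elim disjE) (auto simp flip: w_def)
      qed
      thus ?thesis using has_ord_x[of x y] P Affine True by simp
    qed
  qed
qed

lemma principal_divisor_line:
  assumes roots: "\<And>x. line_cubic l m x = (x - x1) * (x - x2) * (x - x3)"
  shows "principal_divisor (\<lambda>Q. dlt (Affine x1 (l * x1 + m)) Q + dlt (Affine x2 (l * x2 + m)) Q
    + dlt (Affine x3 (l * x3 + m)) Q - 3 * dlt Infinity Q)"
  unfolding principal_divisor_def
proof (intro exI[of _ "\<lambda>Q. yc Q - l * xc Q - m"] ballI)
  fix P assume P: "P \<in> pts"
  show "has_ord P (\<lambda>Q. yc Q - l * xc Q - m) (dlt (Affine x1 (l * x1 + m)) P + dlt (Affine x2 (l * x2 + m)) P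
    + dlt (Affine x3 (l * x3 + m)) P - 3 * dlt Infinity P)"
  proof (cases P)
    case Infinity
    have "weight_le 3 (\<lambda>Q. yc Q + ((- l) * xc Q + (- m))) (1 + (0 + 0))"
      by (intro weight_le_add weight_le_y weight_le_mono[OF weight_le_const]
            weight_le_mono[OF weight_le_mult[OF weight_le_const weight_le_x]]) simp_all
    hence "weight_le 3 (\<lambda>Q. yc Q + ((- l) * xc Q + (- m))) 1" by simp
    hence "weight_le 3 (\<lambda>Q. yc Q - l * xc Q - m) 1"
      by (rule weight_le_cong) (intro always_eventually allI, simp)
    from weight_le_has_val[OF this] show ?thesis
      unfolding has_ord_def Infinity by (intro exI[of _ 1]) simp
  next
    case (Affine x y)
    show ?thesis
    proof (cases "y = l * x + m")
      case True
      have "dlt (Affine x' (l * x' + m)) P = of_bool (x' = x)" for x'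
        unfolding Affine using True by auto
      moreover have "dlt Infinity P = 0" unfolding Affine by simp
      ultimately show ?thesis using has_ord_line[OF P[unfolded Affine] True roots]
        unfolding Affine by (simp only:) simp
    next
      case False
      have "has_ord P (\<lambda>Q. yc Q - l * xc Q - m) 0"
        unfolding Affine
        by (rule has_ord_0I[of _ _ "y - l * x - m"]) (use False in \<open>auto intro!: has_val_intros simp: diff_diff_eq\<close>)
      thus ?thesis using False Affine by auto
    qed
  qed
qed

text \<open>In the main case the function is the line through \<open>P\<close> and \<open>Q\<close>
  divided by the vertical line through their third intersection point, whose conjugate is the
  sum.\<close>

lemma principal_divisor_ec_add:
  assumes "P \<in> pts" "Q \<in> pts"
  shows "principal_divisor (\<lambda>R. dlt P R + dlt Q R - dlt (ec_add E P Q) R - dlt Infinity R)"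
proof -
  have zero: "principal_divisor (\<lambda>_. 0)"
    unfolding principal_divisor_def by (intro exI[of _ "\<lambda>_. 1"] ballI has_ord_0I[OF has_val.const]) simp
  consider "P = Infinity \<or> Q = Infinity" | "P \<noteq> Infinity" "Q = ec_neg E P" |
    "P \<noteq> Infinity" "Q \<noteq> Infinity" "Q \<noteq> ec_neg E P" by blast
  thus ?thesis
  proof cases
    case 1
    hence "(\<lambda>R. dlt P R + dlt Q R - dlt (ec_add E P Q) R - dlt Infinity R) = (\<lambda>_. 0)"
      by auto
    thus ?thesis using zero by simp
  next
    case 2
    then obtain x y where "P = Affine x y" by (cases P) auto
    thus ?thesis using 2 principal_divisor_x[of x y] assms by simp
  next
    case 3
    then obtain x1 y1 x2 y2 where PQ: "P = Affine x1 y1" "Q = Affine x2 y2"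
      by (cases P; cases Q) auto
    have "Affine x1 y1 \<in> pts" "Affine x2 y2 \<in> pts" "Affine x2 y2 \<noteq> ec_neg E (Affine x1 y1)"
      using 3 assms PQ by auto
    from ec_add_line[OF this] obtain l m x3 where *:
      "ec_add E P Q = Affine x3 (- (l + a\<^sub>1) * x3 - m - a\<^sub>3)"
      "y1 = l * x1 + m" "y2 = l * x2 + m"
      "\<And>x. line_cubic l m x = (x - x1) * (x - x2) * (x - x3)"
      unfolding PQ by metis
    have R: "Affine x3 (l * x3 + m) \<in> pts" unfolding on_line_iff *(4) by simp
    have neg: "ec_neg E (Affine x3 (l * x3 + m)) = ec_add E P Q"
      unfolding *(1) by (simp add: algebra_simps)
    from principal_divisor_diff[OF principal_divisor_line[OF *(4)] principal_divisor_x[OF R]]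
    show ?thesis unfolding neg *(2,3)[symmetric] PQ[symmetric]
      by (rule arg_cong[of _ _ principal_divisor, THEN iffD1, rotated]) (auto simp: fun_eq_iff)
  qed
qed

text \<open>Otherwise a function with this divisor would have a single simple pole, at infinity,
  hence be constant and have no pole.\<close>

lemma principal_divisor_point:
  assumes "principal_divisor (\<lambda>R. dlt T R - dlt Infinity R)" "T \<in> pts"
  shows "T = Infinity"
proof (rule ccontr)
  assume T: "T \<noteq> Infinity"
  from assms(1) obtain f where f: "\<And>P. P \<in> pts \<Longrightarrow> has_ord P f (dlt T P - dlt Infinity P)"
    unfolding principal_divisor_def by blast
  have "affine_regular f"
    unfolding affine_regular_def
  proof (intro ballI impI)
    fix P assume "P \<in> pts" "P \<noteq> Infinity"
    thus "\<exists>c. has_val E P f c" using has_ord_le[OF f, of P 0] by simp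
  qed
  moreover have "has_ord Infinity f (- 1)" using f[of Infinity] T by simp
  then obtain c where c: "c \<noteq> 0" "has_val E Infinity (\<lambda>Q. f Q * zc Q) c"
    unfolding has_ord_def by auto
  hence "has_val E Infinity (\<lambda>Q. zc Q * f Q) c" by (simp add: mult.commute)
  ultimately obtain k where k: "\<forall>\<^sub>F P in generic E. f P = k" by (rule simple_pole_imp_const)
  have "has_val E Infinity (\<lambda>Q. k * zc Q) (k * 0)"
    by (intro has_val_intros has_val_zc)
  moreover have "\<forall>\<^sub>F Q in generic E. k * zc Q = f Q * zc Q" using k by eventually_elim simp
  ultimately have "has_val E Infinity (\<lambda>Q. f Q * zc Q) (k * 0)" by (rule has_val.cong)
  from has_val_unique[OF c(2) this] show False using c(1) by simp
qed

text \<open>Modulo principal divisors both sums are \<open>P + Q + R\<close> minus twice infinity.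
  So the difference \<open>T\<close> of the two sums is equivalent to infinity, and
  \<open>principal_divisor_point\<close> makes it equal to infinity.\<close>

lemma ec_add_assoc:
  assumes "P \<in> pts" "Q \<in> pts" "R \<in> pts"
  shows "ec_add E (ec_add E P Q) R = ec_add E P (ec_add E Q R)"
proof -
  define S1 where "S1 = ec_add E (ec_add E P Q) R"
  define S2 where "S2 = ec_add E P (ec_add E Q R)"
  define T where "T = ec_add E S2 (ec_neg E S1)"
  note [simp] = ec_add_in_pts ec_neg_in_pts
  have S: "S1 \<in> pts" "S2 \<in> pts" "T \<in> pts" using assms by (simp_all add: S1_def S2_def T_def)
  note pr = principal_divisor_ec_add
  have 1: "principal_divisor (\<lambda>W. (dlt P W + dlt Q W - dlt (ec_add E P Q) W - dlt Infinity W) +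
     (dlt (ec_add E P Q) W + dlt R W - dlt S1 W - dlt Infinity W))"
    unfolding S1_def using assms by (intro principal_divisor_add pr) auto
  have 2: "principal_divisor (\<lambda>W. (dlt Q W + dlt R W - dlt (ec_add E Q R) W - dlt Infinity W) +
     (dlt P W + dlt (ec_add E Q R) W - dlt S2 W - dlt Infinity W))"
    unfolding S2_def using assms by (intro principal_divisor_add pr) auto
  have 3: "principal_divisor (\<lambda>W. dlt S2 W + dlt (ec_neg E S1) W - dlt T W - dlt Infinity W)"
    unfolding T_def using S by (intro pr) auto
  have 4: "principal_divisor (\<lambda>W. dlt S1 W + dlt (ec_neg E S1) W - dlt Infinity W - dlt Infinity W)"
    using pr[of S1 "ec_neg E S1"] S by simp
  from principal_divisor_diff[OF principal_divisor_diff[OF 1 2] principal_divisor_diff[OF 3 4]]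
  have "principal_divisor (\<lambda>R. dlt T R - dlt Infinity R)"
    by (rule arg_cong[of _ _ principal_divisor, THEN iffD1, rotated]) (auto simp: fun_eq_iff)
  from principal_divisor_point[OF this S(3)] have "ec_neg E S1 = ec_neg E S2"
    unfolding T_def by (rule ec_add_eq_Infinity)
  thus ?thesis unfolding S1_def[symmetric] S2_def[symmetric] by (metis ec_neg_neg)
qed

end

text \<open>The coordinates that generate the local ring at \<open>P'\<close> suffice: the remaining
  rules are closure properties, and the assumption on \<open>\<phi>\<close> carries exceptional sets
  through the rule \<open>cong\<close>.\<close>

lemma has_val_pullback:
  assumes "has_val F P' f c"
    and "\<And>\<phi>. \<forall>\<^sub>F Q in generic F. \<phi> Q \<Longrightarrow> \<forall>\<^sub>F Q in generic E. \<phi> (\<theta> Q)"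
    and "\<And>x y. P' = Affine x y \<Longrightarrow>
      has_val E P (\<lambda>Q. xc (\<theta> Q)) x \<and> has_val E P (\<lambda>Q. yc (\<theta> Q)) y"
    and "P' = Infinity \<Longrightarrow>
      has_val E P (\<lambda>Q. xc (\<theta> Q) / yc (\<theta> Q)) 0 \<and> has_val E P (\<lambda>Q. 1 / yc (\<theta> Q)) 0"
  shows "has_val E P (\<lambda>Q. f (\<theta> Q)) c"
  using assms(1)
proof induction
  case (cong f c g)
  show ?case by (rule has_val.cong[OF cong.IH assms(2)[OF cong.hyps(2)]])
qed (use assms(3,4) in \<open>auto intro: has_val.const has_val.add has_val.mult has_val.inverse\<close>)

lemma eventually_generic_inj:
  assumes "inj_on \<theta> (curve_points E)" "\<theta> \<in> curve_points E \<rightarrow> curve_points F"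
    and "\<forall>\<^sub>F Q in generic F. \<phi> Q"
  shows "\<forall>\<^sub>F Q in generic E. \<phi> (\<theta> Q)"
proof -
  have "finite (\<theta> -` {Q \<in> curve_points F. \<not> \<phi> Q} \<inter> curve_points E)"
    using assms(3) unfolding eventually_generic by (rule finite_vimage_IntI[OF _ assms(1)])
  moreover have "{Q \<in> curve_points E. \<not> \<phi> (\<theta> Q)} \<subseteq> \<theta> -` {Q \<in> curve_points F. \<not> \<phi> Q} \<inter> curve_points E"
    using assms(2) by auto
  ultimately show ?thesis unfolding eventually_generic by (rule rev_finite_subset)
qed

lemma ec_add_chord:
  assumes "x1 \<noteq> x2"
  shows "ec_add E (Affine x1 y1) (Affine x2 y2) =
    (let l = (y2 - y1) / (x2 - x1); x3 = l^2 + wa1 E * l - wa2 E - x1 - x2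
     in Affine x3 (- (l + wa1 E) * x3 - (y1 - l * x1) - wa3 E))"
  using assms by (simp add: Let_def)

text \<open>When the x-values at \<open>P\<close> differ, the chord formula is a quotient with
  nonzero denominator, so the sum of two point-valued functions has the expected coordinates. Later
  arguments insert auxiliary points to stay in this case.\<close>

lemma has_val_ec_add_chord:
  assumes E: "smooth_weierstrass E" and P: "P \<in> curve_points E"
    and 1: "has_val E P (\<lambda>R. xc (\<phi> R)) x1" "has_val E P (\<lambda>R. yc (\<phi> R)) y1"
    and 2: "has_val E P (\<lambda>R. xc (\<psi> R)) x2" "has_val E P (\<lambda>R. yc (\<psi> R)) y2"
    and ne: "x1 \<noteq> x2"
    and inf: "\<forall>\<^sub>F R in generic E. \<phi> R \<noteq> Infinity" "\<forall>\<^sub>F R in generic E. \<psi> R \<noteq> Infinity"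
    and add: "ec_add F (Affine x1 y1) (Affine x2 y2) = Affine x3 y3"
  shows "has_val E P (\<lambda>R. xc (ec_add F (\<phi> R) (\<psi> R))) x3"
    and "has_val E P (\<lambda>R. yc (ec_add F (\<phi> R) (\<psi> R))) y3"
    and "\<forall>\<^sub>F R in generic E. ec_add F (\<phi> R) (\<psi> R) \<noteq> Infinity"
proof -
  interpret smooth_weierstrass E by fact
  define s where "s = (\<lambda>R. (yc (\<psi> R) - yc (\<phi> R)) / (xc (\<psi> R) - xc (\<phi> R)))"
  define s0 where "s0 = (y2 - y1) / (x2 - x1)"
  have s: "has_val E P s s0"
    unfolding s_def s0_def using ne by (intro has_val_divide has_val_diff 1 2) simp
  define X3 where "X3 = (\<lambda>R. s R^2 + wa1 F * s R - wa2 F - xc (\<phi> R) - xc (\<psi> R))"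
  define Y3 where "Y3 = (\<lambda>R. - (s R + wa1 F) * X3 R - (yc (\<phi> R) - s R * xc (\<phi> R)) - wa3 F)"
  have x3: "x3 = s0^2 + wa1 F * s0 - wa2 F - x1 - x2"
    and y3: "y3 = - (s0 + wa1 F) * x3 - (y1 - s0 * x1) - wa3 F"
    using add ec_add_chord[OF ne, of F y1 y2] by (auto simp: s0_def Let_def)
  have X3: "has_val E P X3 x3"
    unfolding X3_def x3 by (intro has_val_intros s 1 2)
  have Y3: "has_val E P Y3 y3"
    unfolding Y3_def y3 by (intro has_val_intros s X3 1 2)
  have "has_val E P (\<lambda>R. xc (\<psi> R) - xc (\<phi> R)) (x2 - x1)"
    by (intro has_val_diff 1 2)
  from has_val_nonzero[OF this P] ne
  have "\<forall>\<^sub>F R in generic E. xc (\<psi> R) - xc (\<phi> R) \<noteq> 0" by simp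
  hence eq: "\<forall>\<^sub>F R in generic E. ec_add F (\<phi> R) (\<psi> R) = Affine (X3 R) (Y3 R)"
    using inf
  proof eventually_elim
    case (elim R)
    then obtain u v u' v' where uv: "\<phi> R = Affine u v" "\<psi> R = Affine u' v'"
      by (cases "\<phi> R"; cases "\<psi> R") auto
    hence "u \<noteq> u'" using elim(1) by auto
    from ec_add_chord[OF this, of F v v'] show ?case
      by (simp add: uv X3_def Y3_def s_def Let_def del: ec_add.simps)
  qed
  show "has_val E P (\<lambda>R. xc (ec_add F (\<phi> R) (\<psi> R))) x3"
    by (rule has_val.cong[OF X3], use eq in eventually_elim) simp
  show "has_val E P (\<lambda>R. yc (ec_add F (\<phi> R) (\<psi> R))) y3"
    by (rule has_val.cong[OF Y3], use eq in eventually_elim) simp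
  show "\<forall>\<^sub>F R in generic E. ec_add F (\<phi> R) (\<psi> R) \<noteq> Infinity"
    using eq by eventually_elim simp
qed

section \<open>The group of points; negation and translations act on values\<close>

context smooth_weierstrass begin

lemma ec_group_simps:
  "carrier (ec_group E) = pts" "(\<otimes>\<^bsub>ec_group E\<^esub>) = ec_add E" "\<one>\<^bsub>ec_group E\<^esub> = Infinity"
  by (simp_all add: ec_group_def)

lemma comm_group_ec_group: "comm_group (ec_group E)"
proof (rule comm_groupI)
  fix P assume "P \<in> carrier (ec_group E)"
  thus "\<exists>Q\<in>carrier (ec_group E). Q \<otimes>\<^bsub>ec_group E\<^esub> P = \<one>\<^bsub>ec_group E\<^esub>"
    by (intro bexI[of _ "ec_neg E P"]) (auto simp: ec_group_simps ec_neg_in_pts)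
next
  fix P Q R assume "P \<in> carrier (ec_group E)" "Q \<in> carrier (ec_group E)" "R \<in> carrier (ec_group E)"
  thus "P \<otimes>\<^bsub>ec_group E\<^esub> Q \<otimes>\<^bsub>ec_group E\<^esub> R = P \<otimes>\<^bsub>ec_group E\<^esub> (Q \<otimes>\<^bsub>ec_group E\<^esub> R)"
    by (simp only: ec_group_simps ec_add_assoc)
next
  fix P Q assume "P \<in> carrier (ec_group E)" "Q \<in> carrier (ec_group E)"
  thus "P \<otimes>\<^bsub>ec_group E\<^esub> Q = Q \<otimes>\<^bsub>ec_group E\<^esub> P"
    by (simp only: ec_group_simps ec_add_commute)
qed (auto simp: ec_group_simps ec_add_in_pts)

sublocale pt: comm_group "ec_group E"
  rewrites "carrier (ec_group E) = pts" and "(\<otimes>\<^bsub>ec_group E\<^esub>) = ec_add E"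
    and "\<one>\<^bsub>ec_group E\<^esub> = Infinity"
  by (rule comm_group_ec_group) (simp_all add: ec_group_simps)

lemma inv_eq_ec_neg: "P \<in> pts \<Longrightarrow> inv\<^bsub>ec_group E\<^esub> P = ec_neg E P"
  by (rule pt.inv_equality) (auto simp: ec_neg_in_pts)

abbreviation plus_pt :: "'f ec_point \<Rightarrow> 'f ec_point \<Rightarrow> 'f ec_point" (infixl "\<boxplus>" 65) where
  "P \<boxplus> Q \<equiv> ec_add E P Q"

abbreviation neg_pt :: "'f ec_point \<Rightarrow> 'f ec_point" ("\<boxminus>_" [81] 80) where
  "\<boxminus>P \<equiv> ec_neg E P"

lemmas [simp] = ec_add_in_pts ec_neg_in_pts

lemma add_neg_cancel [simp]:
  "P \<in> pts \<Longrightarrow> Q \<in> pts \<Longrightarrow> P \<boxplus> Q \<boxplus> \<boxminus>Q = P"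
  "P \<in> pts \<Longrightarrow> Q \<in> pts \<Longrightarrow> P \<boxplus> \<boxminus>Q \<boxplus> Q = P"
  by (simp_all add: ec_add_assoc)

lemma add_left_neg_cancel [simp]:
  "P \<in> pts \<Longrightarrow> Q \<in> pts \<Longrightarrow> P \<boxplus> (\<boxminus>P \<boxplus> Q) = Q"
  "P \<in> pts \<Longrightarrow> Q \<in> pts \<Longrightarrow> \<boxminus>P \<boxplus> (P \<boxplus> Q) = Q"
  by (simp_all add: ec_add_assoc[symmetric])

lemma ec_add_left_commute:
  "P \<in> pts \<Longrightarrow> Q \<in> pts \<Longrightarrow> R \<in> pts \<Longrightarrow> P \<boxplus> (Q \<boxplus> R) = Q \<boxplus> (P \<boxplus> R)"
  by (rule pt.m_lcomm)

lemmas pt_ac = ec_add_assoc ec_add_commute ec_add_left_commute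

lemma neg_add: "P \<in> pts \<Longrightarrow> Q \<in> pts \<Longrightarrow> \<boxminus>(P \<boxplus> Q) = \<boxminus>P \<boxplus> \<boxminus>Q"
  using pt.inv_mult[of P Q] by (simp add: inv_eq_ec_neg)

lemma neg_eq_Infinity_iff [simp]: "\<boxminus>P = Infinity \<longleftrightarrow> P = Infinity"
  by (cases P) auto

lemma neg_eq_iff: "\<boxminus>P = \<boxminus>Q \<longleftrightarrow> P = Q"
  by (metis ec_neg_neg)

lemma add_right_cancel [simp]:
  "P \<in> pts \<Longrightarrow> Q \<in> pts \<Longrightarrow> R \<in> pts \<Longrightarrow> P \<boxplus> R = Q \<boxplus> R \<longleftrightarrow> P = Q"
  by (metis add_neg_cancel(1))

lemma add_left_cancel [simp]:
  "P \<in> pts \<Longrightarrow> Q \<in> pts \<Longrightarrow> R \<in> pts \<Longrightarrow> R \<boxplus> P = R \<boxplus> Q \<longleftrightarrow> P = Q"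
  by (metis add_left_neg_cancel(2))

lemma add_eq_Infinity_iff: "P \<boxplus> Q = Infinity \<longleftrightarrow> Q = \<boxminus>P"
  using ec_add_eq_Infinity by auto

lemma eventually_translate:
  assumes "Q \<in> pts" "\<forall>\<^sub>F R in generic E. \<phi> R"
  shows "\<forall>\<^sub>F R in generic E. \<phi> (R \<boxplus> Q)"
  using assms by (intro eventually_generic_inj[of "\<lambda>R. R \<boxplus> Q" E E]) (auto simp: inj_on_def)

lemma eventually_negate:
  assumes "\<forall>\<^sub>F R in generic E. \<phi> R"
  shows "\<forall>\<^sub>F R in generic E. \<phi> (\<boxminus>R)"
  using assms by (intro eventually_generic_inj[of "\<lambda>R. \<boxminus>R" E E]) (auto simp: inj_on_def neg_eq_iff)

lemma has_val_negate:
  assumes "has_val E (\<boxminus>P) f c" "P \<in> pts"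
  shows "has_val E P (\<lambda>R. f (\<boxminus>R)) c"
proof (rule has_val_pullback[OF assms(1) eventually_negate])
  have aff: "\<forall>\<^sub>F R in generic E. \<exists>x y. R = Affine x y"
    using eventually_neq[of Infinity] by eventually_elim (metis ec_point.exhaust)
  {
    fix x y assume "\<boxminus>P = Affine x y"
    then obtain y' where P: "P = Affine x y'" "y = - y' - a\<^sub>1 * x - a\<^sub>3" by (cases P) auto
    have "has_val E P (\<lambda>R. - yc R - a\<^sub>1 * xc R - a\<^sub>3) y"
      unfolding P by (intro has_val_intros)
    hence y: "has_val E P (\<lambda>R. yc (\<boxminus>R)) y"
      by (rule has_val.cong) (use aff in eventually_elim, auto)
    have "has_val E P xc x" unfolding P by (rule has_val_xc)
    hence "has_val E P (\<lambda>R. xc (\<boxminus>R)) x"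
      by (rule has_val.cong) (use aff in eventually_elim, auto)
    with y show "has_val E P (\<lambda>R. xc (\<boxminus>R)) x \<and> has_val E P (\<lambda>R. yc (\<boxminus>R)) y" by simp
  }
  {
    assume "\<boxminus>P = Infinity"
    hence P: "P = Infinity" by simp
    have w: "has_val E P (\<lambda>R. 1 / yc R) 0" by (rule has_val.one_over_y[OF P])
    \<comment> \<open>The quotient of the y-coordinates of \<open>-R\<close> and \<open>R\<close>;
      it is -1 at infinity.\<close>
    have den: "has_val E P (\<lambda>R. - 1 - a\<^sub>1 * zc R - a\<^sub>3 * (1 / yc R)) (- 1 - a\<^sub>1 * 0 - a\<^sub>3 * 0)"
      by (intro has_val_intros w) (use P has_val_zc in simp)
    have "has_val E P (\<lambda>R. zc R / (- 1 - a\<^sub>1 * zc R - a\<^sub>3 * (1 / yc R))) (0 / (- 1 - a\<^sub>1 * 0 - a\<^sub>3 * 0))"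
      by (intro has_val_divide den) (use P has_val_zc in auto)
    hence "has_val E P (\<lambda>R. xc (\<boxminus>R) / yc (\<boxminus>R)) (0 / (- 1 - a\<^sub>1 * 0 - a\<^sub>3 * 0))"
    proof (rule has_val.cong)
      show "\<forall>\<^sub>F R in generic E. zc R / (- 1 - a\<^sub>1 * zc R - a\<^sub>3 * (1 / yc R)) = xc (\<boxminus>R) / yc (\<boxminus>R)"
        using aff eventually_y_nonzero
        by eventually_elim (auto simp: divide_divide_eq_left right_diff_distrib)
    qed
    moreover have "has_val E P (\<lambda>R. (1 / yc R) / (- 1 - a\<^sub>1 * zc R - a\<^sub>3 * (1 / yc R))) (0 / (- 1 - a\<^sub>1 * 0 - a\<^sub>3 * 0))"
      by (intro has_val_divide den w) auto
    hence "has_val E P (\<lambda>R. 1 / yc (\<boxminus>R)) (0 / (- 1 - a\<^sub>1 * 0 - a\<^sub>3 * 0))"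
    proof (rule has_val.cong)
      show "\<forall>\<^sub>F R in generic E. (1 / yc R) / (- 1 - a\<^sub>1 * zc R - a\<^sub>3 * (1 / yc R)) = 1 / yc (\<boxminus>R)"
        using aff eventually_y_nonzero
        by eventually_elim (auto simp: divide_divide_eq_left right_diff_distrib)
    qed
    ultimately show "has_val E P (\<lambda>R. xc (\<boxminus>R) / yc (\<boxminus>R)) 0 \<and> has_val E P (\<lambda>R. 1 / yc (\<boxminus>R)) 0"
      by simp
  }
qed

text \<open>If \<open>2 y + a\<^sub>1 x + a\<^sub>3\<close> vanished identically, then 2 = 0 and
  \<open>a\<^sub>1 = a\<^sub>3 = 0\<close>; a point with \<open>x^2 = a\<^sub>4\<close> would then
  be singular.\<close>

lemma eventually_not_2torsion: "\<forall>\<^sub>F R in generic E. \<boxminus>R \<noteq> R"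
proof -
  have "lin \<noteq> 0 \<or> [:2:] \<noteq> (0 :: 'f poly)"
  proof (rule ccontr)
    assume "\<not> ?thesis"
    hence l: "a\<^sub>1 = 0" "a\<^sub>3 = 0" and two: "(2 :: 'f) = 0" by (auto simp: lin_def)
    obtain x where x: "x ^ 2 = a\<^sub>4" using nth_root_exists[of 2 a\<^sub>4] by auto
    obtain y where y: "Affine x y \<in> pts" using point_above by blast
    have "3 * x^2 + 2 * a\<^sub>2 * x + a\<^sub>4 - a\<^sub>1 * y = 2 * (2 * x^2 + a\<^sub>2 * x)"
      by (simp add: l flip: x)
    thus False using smooth_at[OF y] two l by simp
  qed
  from eventually_reg_fun_nonzero[OF this] eventually_neq[of Infinity]
  show ?thesis
  proof eventually_elim
    case (elim R)
    then obtain x y where R: "R = Affine x y" by (cases R) auto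
    have "2 * y + a\<^sub>1 * x + a\<^sub>3 \<noteq> 0"
      using elim by (simp add: R reg_fun_def poly_lin algebra_simps)
    thus ?case using two_torsion_iff[of y x] by (simp add: R)
  qed
qed

text \<open>Translation by \<open>Q\<close> is regular at \<open>P\<close>. The relation is stated
  per point because different addition formulas apply, and because \<open>translates_trans\<close>
  composes the easy cases.\<close>

definition translates :: "'f ec_point \<Rightarrow> 'f ec_point \<Rightarrow> bool" where
  "translates P Q \<longleftrightarrow> (\<forall>f c. has_val E (P \<boxplus> Q) f c \<longrightarrow> has_val E P (\<lambda>R. f (R \<boxplus> Q)) c)"

lemma translatesI:
  assumes "Q \<in> pts"
    and "\<And>x y. P \<boxplus> Q = Affine x y \<Longrightarrow>
      has_val E P (\<lambda>R. xc (R \<boxplus> Q)) x \<and> has_val E P (\<lambda>R. yc (R \<boxplus> Q)) y"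
    and "P \<boxplus> Q = Infinity \<Longrightarrow>
      has_val E P (\<lambda>R. xc (R \<boxplus> Q) / yc (R \<boxplus> Q)) 0 \<and> has_val E P (\<lambda>R. 1 / yc (R \<boxplus> Q)) 0"
  shows "translates P Q"
  unfolding translates_def using assms(2,3)
  by (intro allI impI has_val_pullback[OF _ eventually_translate[OF assms(1)]])

lemma translates_Infinity_right: "translates P Infinity"
  by (simp add: translates_def)

lemma translates_chord:
  assumes P: "Affine x1 y1 \<in> pts" and Q: "Affine x2 y2 \<in> pts" and ne: "x1 \<noteq> x2"
  shows "translates (Affine x1 y1) (Affine x2 y2)"
proof (rule translatesI[OF Q])
  have E: "smooth_weierstrass E" by unfold_locales
  obtain x3 y3 where add: "Affine x1 y1 \<boxplus> Affine x2 y2 = Affine x3 y3"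
    using ec_add_chord[OF ne, of E y1 y2] by (auto simp: Let_def)
  have inf: "\<forall>\<^sub>F R in generic E. Affine x2 y2 \<noteq> Infinity" by simp
  have c: "has_val E (Affine x1 y1) (\<lambda>R. xc (Affine x2 y2)) x2"
    "has_val E (Affine x1 y1) (\<lambda>R. yc (Affine x2 y2)) y2"
    by (simp_all add: has_val.const)
  note * = has_val_ec_add_chord[OF E P, of "\<lambda>R. R" x1 y1 "\<lambda>_. Affine x2 y2" x2 y2 E x3 y3,
      OF has_val_xc has_val_yc c ne eventually_neq inf add]
  show "has_val E (Affine x1 y1) (\<lambda>R. xc (R \<boxplus> Affine x2 y2)) x \<and>
      has_val E (Affine x1 y1) (\<lambda>R. yc (R \<boxplus> Affine x2 y2)) y"
    if "Affine x1 y1 \<boxplus> Affine x2 y2 = Affine x y" for x y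
    using *(1,2) that add by simp
  show "has_val E (Affine x1 y1) (\<lambda>R. xc (R \<boxplus> Affine x2 y2) / yc (R \<boxplus> Affine x2 y2)) 0 \<and>
    has_val E (Affine x1 y1) (\<lambda>R. 1 / yc (R \<boxplus> Affine x2 y2)) 0"
    if "Affine x1 y1 \<boxplus> Affine x2 y2 = Infinity"
    using that add by simp
qed

text \<open>The slope of the line through the point and \<open>(x0, y0)\<close>. It enters the
  addition formula, and it is also the source of functions with two simple poles, at infinity and at
  the negative of \<open>(x0, y0)\<close>.\<close>

definition slope :: "'f \<Rightarrow> 'f \<Rightarrow> 'f ec_point \<Rightarrow> 'f" where
  "slope x0 y0 R = (yc R - y0) / (xc R - x0)"

lemma eventually_add_slope:
  assumes "Affine x0 y0 \<in> pts"
  shows "\<forall>\<^sub>F R in generic E. R \<boxplus> Affine x0 y0 =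
    (let l = slope x0 y0 R; x3 = l^2 + a\<^sub>1 * l - a\<^sub>2 - x0 - xc R
     in Affine x3 (- (l + a\<^sub>1) * x3 - (y0 - l * x0) - a\<^sub>3))"
  using eventually_x_neq[of x0] eventually_in_pts
proof eventually_elim
  case (elim R)
  then obtain x y where R: "R = Affine x y" by (cases R) auto
  have "x0 \<noteq> x" using elim R by auto
  have "R \<boxplus> Affine x0 y0 = Affine x0 y0 \<boxplus> Affine x y"
    using ec_add_commute[OF elim(2) assms] R by simp
  also have "\<dots> = (let l = slope x0 y0 R; x3 = l^2 + a\<^sub>1 * l - a\<^sub>2 - x0 - xc R
     in Affine x3 (- (l + a\<^sub>1) * x3 - (y0 - l * x0) - a\<^sub>3))"
    unfolding ec_add_chord[OF \<open>x0 \<noteq> x\<close>] by (simp add: R slope_def)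
  finally show ?case .
qed

lemma translates_Infinity_left:
  assumes Q: "Affine x0 y0 \<in> pts"
  shows "translates Infinity (Affine x0 y0)"
proof (rule translatesI[OF Q])
  \<comment> \<open>Coefficients of the numerator \<open>M\<close> of \<open>?X - x0\<close> over
    the squared denominator of the slope. The curve equation cancels all terms of weight above 3,
    while the denominator has weight 4, so the difference vanishes at infinity.\<close>
  define \<alpha> where "\<alpha> = a\<^sub>4 - a\<^sub>1 * y0 + 2 * a\<^sub>2 * x0 + 3 * x0^2"
  define \<beta> where "\<beta> = - a\<^sub>3 - 2 * y0 - a\<^sub>1 * x0"
  define \<gamma> where "\<gamma> = a\<^sub>6 + y0^2 + a\<^sub>1 * x0 * y0 - (a\<^sub>2 + x0) * x0^2 - x0^3"
  define M where "M = (\<lambda>R :: 'f ec_point. \<alpha> * xc R + \<beta> * yc R + \<gamma>)"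
  let ?d = "\<lambda>R :: 'f ec_point. xc R + (- x0)"
  let ?X = "\<lambda>R. slope x0 y0 R^2 + a\<^sub>1 * slope x0 y0 R - a\<^sub>2 - x0 - xc R"
  have M_eq: "\<forall>\<^sub>F R in generic E. ?X R - x0 = M R / (?d R * ?d R)"
    using eventually_curve_eq eventually_x_neq[of x0]
  proof eventually_elim
    case (elim R)
    let ?x = "xc R" and ?y = "yc R"
    have d: "?d R \<noteq> 0" using elim(2) by simp
    have sl: "slope x0 y0 R * ?d R = ?y - y0" using d by (simp add: slope_def)
    have "(?X R - x0) * (?d R * ?d R) = (slope x0 y0 R * ?d R)^2 + a\<^sub>1 * (slope x0 y0 R * ?d R) * ?d R
        - (a\<^sub>2 + x0 + ?x + x0) * (?d R * ?d R)"
      by (simp add: algebra_simps power2_eq_square)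
    also have "\<dots> = (?y - y0)^2 + a\<^sub>1 * (?y - y0) * ?d R - (a\<^sub>2 + x0 + ?x + x0) * (?d R * ?d R)"
      by (simp only: sl)
    also have "\<dots> = (?y^2 + a\<^sub>1 * ?x * ?y + a\<^sub>3 * ?y) - (a\<^sub>3 * ?y) - 2 * y0 * ?y + y0^2
        + a\<^sub>1 * (x0 * y0 - x0 * ?y - y0 * ?x) - (a\<^sub>2 + x0 + ?x + x0) * (?d R * ?d R)"
      by (simp add: algebra_simps power2_eq_square)
    also have "\<dots> = M R"
      unfolding elim(1) M_def \<alpha>_def \<beta>_def \<gamma>_def
      by (simp add: algebra_simps power2_eq_square power3_eq_cube)
    finally have "(?X R - x0) * (?d R * ?d R) = M R" .
    moreover have "?d R * ?d R \<noteq> 0" using d by simp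
    ultimately show ?case by (metis nonzero_mult_div_cancel_right)
  qed
  have wd: "weight_le 2 ?d (1 + 0)"
    by (intro weight_le_add weight_le_x weight_le_mono[OF weight_le_const]) simp
  have wM: "weight_le 3 M (0 + \<beta> * 1 + 0)"
  proof -
    have "weight_le 3 (\<lambda>R. \<alpha> * xc R) 0"
      by (rule weight_le_mono[OF weight_le_mult[OF weight_le_const weight_le_x]]) simp
    moreover have "weight_le 3 (\<lambda>R. \<beta> * yc R) (\<beta> * 1)"
      using weight_le_mult[OF weight_le_const[of \<beta>] weight_le_y] by simp
    ultimately show ?thesis
      unfolding M_def by (intro weight_le_add weight_le_mono[OF weight_le_const]) simp_all
  qed
  have "has_val E Infinity (\<lambda>R. M R / (?d R * ?d R)) (0 / ((1 + 0) * (1 + 0)))"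
    by (rule weight_le_quotient_has_val[of "2 + 2"])
       (use weight_le_mult[OF wd wd] weight_le_mono[OF wM, of 4] in auto)
  hence X0: "has_val E Infinity (\<lambda>R. ?X R - x0) 0"
    by (rule has_val_cong') (use M_eq in eventually_elim, auto)
  have "has_val E Infinity (\<lambda>R. x0 + (?X R - x0)) (x0 + 0)"
    by (intro has_val.add has_val.const X0)
  hence vX: "has_val E Infinity ?X x0"
    by (rule has_val_cong') (intro always_eventually allI, simp_all)
  have wy: "weight_le 3 (\<lambda>R. yc R + (- y0)) (1 + 0)"
    by (intro weight_le_add weight_le_y weight_le_mono[OF weight_le_const]) simp
  \<comment> \<open>The slope has a pole at infinity and \<open>?X - x0\<close> a zero. Their
    product has numerator and denominator of weight 6 and so the value \<open>\<beta>\<close>, which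
    is exactly what turns the formula for y into \<open>y0\<close>.\<close>
  have "has_val E Infinity (\<lambda>R. ((yc R + (- y0)) * M R) / (?d R * (?d R * ?d R)))
      ((1 + 0) * (0 + \<beta> * 1 + 0) / ((1 + 0) * ((1 + 0) * (1 + 0))))"
    by (rule weight_le_quotient_has_val[of "3 + 3"])
       (use weight_le_mult[OF wd weight_le_mult[OF wd wd]] weight_le_mult[OF wy wM] in auto)
  hence sX: "has_val E Infinity (\<lambda>R. slope x0 y0 R * (?X R - x0)) \<beta>"
  proof (rule has_val_cong')
    show "\<forall>\<^sub>F R in generic E. ((yc R + (- y0)) * M R) / (?d R * (?d R * ?d R)) = slope x0 y0 R * (?X R - x0)"
      using M_eq
    proof eventually_elim
      case (elim R)
      show ?case unfolding elim by (simp add: slope_def)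
    qed
  qed simp
  have "has_val E Infinity (\<lambda>R. - (slope x0 y0 R * (?X R - x0)) - a\<^sub>1 * ?X R - y0 - a\<^sub>3)
      (- \<beta> - a\<^sub>1 * x0 - y0 - a\<^sub>3)"
    by (intro has_val_diff has_val_uminus has_val.mult has_val.const sX vX)
  moreover have "- \<beta> - a\<^sub>1 * x0 - y0 - a\<^sub>3 = y0" by (simp add: \<beta>_def)
  ultimately have "has_val E Infinity (\<lambda>R. - (slope x0 y0 R * (?X R - x0)) - a\<^sub>1 * ?X R - y0 - a\<^sub>3) y0"
    by (simp only:)
  hence "has_val E Infinity (\<lambda>R. yc (R \<boxplus> Affine x0 y0)) y0"
  proof (rule has_val.cong)
    show "\<forall>\<^sub>F R in generic E. - (slope x0 y0 R * (?X R - x0)) - a\<^sub>1 * ?X R - y0 - a\<^sub>3 = yc (R \<boxplus> Affine x0 y0)"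
      using eventually_add_slope[OF Q]
    proof eventually_elim
      case (elim R)
      have "- (l * (w - x0)) - a\<^sub>1 * w - y0 - a\<^sub>3 = - (l + a\<^sub>1) * w - (y0 - l * x0) - a\<^sub>3" for l w
        by (simp add: algebra_simps)
      thus ?case unfolding elim Let_def yc.simps by blast
    qed
  qed
  moreover have "has_val E Infinity (\<lambda>R. xc (R \<boxplus> Affine x0 y0)) x0"
    by (rule has_val.cong[OF vX], use eventually_add_slope[OF Q] in eventually_elim) (simp add: Let_def)
  ultimately show "has_val E Infinity (\<lambda>R. xc (R \<boxplus> Affine x0 y0)) x \<and>
      has_val E Infinity (\<lambda>R. yc (R \<boxplus> Affine x0 y0)) y"
    if "Infinity \<boxplus> Affine x0 y0 = Affine x y" for x y
    using that by simp
qed auto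

lemma translates_inverse:
  assumes Q: "Affine x0 y0 \<in> pts" and ne: "2 * y0 + a\<^sub>1 * x0 + a\<^sub>3 \<noteq> 0"
  shows "translates (\<boxminus>Affine x0 y0) (Affine x0 y0)"
proof (rule translatesI[OF Q])
  let ?P = "\<boxminus>Affine x0 y0"
  define y' where "y' = - y0 - a\<^sub>1 * x0 - a\<^sub>3"
  have P: "?P = Affine x0 y'" by (simp add: y'_def)
  have y': "y' - y0 \<noteq> 0" using ne two_torsion_iff[of y0 x0] by (simp add: y'_def)
  let ?d = "\<lambda>R :: 'f ec_point. xc R - x0" and ?e = "\<lambda>R :: 'f ec_point. yc R - y0"
  \<comment> \<open>\<open>N\<close> and \<open>N'\<close> are the numerators of the coordinates of
    \<open>R\<close> plus \<open>(x0, y0)\<close> over the second and third power of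
    \<open>?d\<close>. At the negative of \<open>(x0, y0)\<close> they are nonzero while
    \<open>?d\<close> vanishes, so x/y and 1/y of the sum vanish.\<close>
  define N where "N = (\<lambda>R. ?e R^2 + a\<^sub>1 * ?e R * ?d R - (a\<^sub>2 + x0 + xc R) * ?d R^2)"
  define N' where "N' = (\<lambda>R. - (?e R + a\<^sub>1 * ?d R) * N R - (y0 * ?d R - ?e R * x0) * ?d R^2 - a\<^sub>3 * ?d R^3)"
  have vd: "has_val E ?P ?d 0"
    using has_val_diff[OF has_val_xc has_val.const, of E x0 y' x0] P by simp
  have ve: "has_val E ?P ?e (y' - y0)" unfolding P by (intro has_val_intros)
  have vx: "has_val E ?P xc x0" unfolding P by (rule has_val_xc)
  have "has_val E ?P N ((y' - y0)^2 + a\<^sub>1 * (y' - y0) * 0 - (a\<^sub>2 + x0 + x0) * 0^2)"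
    unfolding N_def by (intro has_val_intros vd ve vx)
  hence vN: "has_val E ?P N ((y' - y0)^2)" by simp
  have "has_val E ?P N' (- ((y' - y0) + a\<^sub>1 * 0) * (y' - y0)^2 - (y0 * 0 - (y' - y0) * x0) * 0^2 - a\<^sub>3 * 0^3)"
    unfolding N'_def by (intro has_val_intros vd ve vN)
  hence vN': "has_val E ?P N' (- (y' - y0) * (y' - y0)^2)" by simp
  have nz: "- (y' - y0) * (y' - y0)^2 \<noteq> 0" using y' by simp
  have eq: "\<forall>\<^sub>F R in generic E. xc (R \<boxplus> Affine x0 y0) = N R / ?d R^2 \<and> yc (R \<boxplus> Affine x0 y0) = N' R / ?d R^3 \<and> ?d R \<noteq> 0"
    using eventually_add_slope[OF Q] eventually_x_neq[of x0]
  proof eventually_elim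
    case (elim R)
    have d: "?d R \<noteq> 0" using elim(2) by simp
    define l where "l = slope x0 y0 R"
    have e: "?e R = l * ?d R" using d by (simp add: slope_def l_def)
    have N: "N R = (l^2 + a\<^sub>1 * l - a\<^sub>2 - x0 - xc R) * ?d R^2"
      unfolding N_def e by (simp add: algebra_simps power2_eq_square)
    have alg: "- (l * d + a\<^sub>1 * d) * (x * d^2) - (y0 * d - l * d * x0) * d^2 - a\<^sub>3 * d^3 =
        (- (l + a\<^sub>1) * x - (y0 - l * x0) - a\<^sub>3) * d^3" for x d
      by (simp add: algebra_simps power2_eq_square power3_eq_cube)
    have N': "N' R = (- (l + a\<^sub>1) * (l^2 + a\<^sub>1 * l - a\<^sub>2 - x0 - xc R) - (y0 - l * x0) - a\<^sub>3) * ?d R^3"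
      unfolding N'_def N e by (rule alg)
    show ?case unfolding elim(1) N N' Let_def l_def[symmetric] using d by simp
  qed
  have "has_val E ?P (\<lambda>R. (N R * ?d R) / N' R) ((y' - y0)^2 * 0 / (- (y' - y0) * (y' - y0)^2))"
    by (intro has_val_divide has_val.mult vN vd vN' nz)
  hence "has_val E ?P (\<lambda>R. xc (R \<boxplus> Affine x0 y0) / yc (R \<boxplus> Affine x0 y0)) 0"
    by (rule has_val_cong') (use eq in eventually_elim, auto simp: power2_eq_square power3_eq_cube)
  moreover have "has_val E ?P (\<lambda>R. (?d R^3) / N' R) (0^3 / (- (y' - y0) * (y' - y0)^2))"
    by (intro has_val_divide has_val_power vd vN' nz)
  hence "has_val E ?P (\<lambda>R. 1 / yc (R \<boxplus> Affine x0 y0)) 0"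
    by (rule has_val_cong') (use eq in eventually_elim, auto)
  ultimately show "has_val E ?P (\<lambda>R. xc (R \<boxplus> Affine x0 y0) / yc (R \<boxplus> Affine x0 y0)) 0 \<and>
    has_val E ?P (\<lambda>R. 1 / yc (R \<boxplus> Affine x0 y0)) 0" by blast
qed (simp add: ec_add_neg' del: ec_neg.simps ec_add.simps)

lemma translates_trans:
  assumes "translates P Q" "translates (P \<boxplus> Q) R" "P \<in> pts" "Q \<in> pts" "R \<in> pts"
  shows "translates P (Q \<boxplus> R)"
  unfolding translates_def
proof (intro allI impI)
  fix f c assume "has_val E (P \<boxplus> (Q \<boxplus> R)) f c"
  hence "has_val E (P \<boxplus> Q \<boxplus> R) f c" using assms by (simp add: ec_add_assoc)
  hence "has_val E P (\<lambda>S. f (S \<boxplus> Q \<boxplus> R)) c"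
    using assms(1,2) unfolding translates_def by blast
  thus "has_val E P (\<lambda>S. f (S \<boxplus> (Q \<boxplus> R))) c"
    by (rule has_val.cong, use eventually_in_pts in eventually_elim) (use assms in \<open>simp add: ec_add_assoc\<close>)
qed

lemma translates_distinct:
  assumes "P \<in> pts" "Q \<in> pts" "P \<noteq> Q" "P = \<boxminus>Q \<Longrightarrow> Q \<noteq> \<boxminus>Q"
  shows "translates P Q"
proof (cases "P = Infinity \<or> Q = Infinity \<or> P = \<boxminus>Q")
  case True
  thus ?thesis
  proof (elim disjE)
    assume "P = \<boxminus>Q"
    show ?thesis
    proof (cases Q)
      case (Affine x y)
      have "\<boxminus>Q \<noteq> Q" using assms(4) \<open>P = \<boxminus>Q\<close> by auto
      hence "2 * y + a\<^sub>1 * x + a\<^sub>3 \<noteq> 0" using Affine two_torsion_iff[of y x] by auto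
      from translates_inverse[OF _ this] show ?thesis using assms(2) Affine \<open>P = \<boxminus>Q\<close> by simp
    qed (simp add: translates_Infinity_right)
  next
    assume "P = Infinity"
    thus ?thesis using translates_Infinity_left assms(2) translates_Infinity_right
      by (cases Q) auto
  qed (auto simp: translates_Infinity_right)
next
  case False
  then obtain x1 y1 x2 y2 where PQ: "P = Affine x1 y1" "Q = Affine x2 y2" by (cases P; cases Q) auto
  hence "x1 \<noteq> x2" using same_x_cases[of x2 y2 y1] assms False by auto
  thus ?thesis using translates_chord assms PQ by simp
qed

text \<open>Doubling is avoided: for \<open>P = Q\<close> a generic \<open>R\<close> splits the
  translation into \<open>R\<close> followed by \<open>Q - R\<close>, both within
  \<open>translates_distinct\<close>. The second one needs that \<open>R\<close> does not have order
  2.\<close>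

lemma translates: 
  assumes "P \<in> pts" "Q \<in> pts"
  shows "translates P Q"
proof (cases "P = Q")
  case False
  show ?thesis
  proof (cases "P = \<boxminus>Q \<and> Q = \<boxminus>Q")
    case True thus ?thesis using False by auto
  qed (use translates_distinct assms False in auto)
next
  case True
  have "\<forall>\<^sub>F R in generic E. R \<noteq> Infinity \<and> R \<noteq> P \<and> R \<noteq> \<boxminus>P \<and> \<boxminus>R \<noteq> R"
    using eventually_neq[of Infinity] eventually_neq[of P] eventually_neq[of "\<boxminus>P"] eventually_not_2torsion
    by eventually_elim blast
  from eventually_generic_ex[OF this] obtain R where R: "R \<in> pts" "R \<noteq> Infinity" "R \<noteq> P" "R \<noteq> \<boxminus>P" "\<boxminus>R \<noteq> R"
    by blast
  have "translates P R"
    using R assms by (intro translates_distinct) auto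
  moreover have "translates (P \<boxplus> R) (Q \<boxplus> \<boxminus>R)"
  proof (rule translates_distinct)
    show "P \<boxplus> R \<noteq> Q \<boxplus> \<boxminus>R" using True R assms by simp
    show "Q \<boxplus> \<boxminus>R \<noteq> \<boxminus>(Q \<boxplus> \<boxminus>R)" if "P \<boxplus> R = \<boxminus>(Q \<boxplus> \<boxminus>R)"
      using that True R assms by auto
  qed (use R assms in auto)
  ultimately have "translates P (R \<boxplus> (Q \<boxplus> \<boxminus>R))"
    by (rule translates_trans) (use R assms in auto)
  also have "R \<boxplus> (Q \<boxplus> \<boxminus>R) = Q" using R assms by (simp add: ec_add_left_commute)
  finally show ?thesis .
qed

lemma has_val_translate:
  assumes "has_val E (P \<boxplus> Q) f c" "P \<in> pts" "Q \<in> pts"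
  shows "has_val E P (\<lambda>R. f (R \<boxplus> Q)) c"
  using translates[OF assms(2,3)] assms(1) by (simp add: translates_def)

end

section \<open>Expansions of functions and lower bounds for divisors\<close>

context smooth_weierstrass begin

lemma add_conj_cancel [simp]:
  "P \<in> pts \<Longrightarrow> Q \<in> pts \<Longrightarrow> P \<boxplus> (Q \<boxplus> \<boxminus>P) = Q"
  "P \<in> pts \<Longrightarrow> Q \<in> pts \<Longrightarrow> \<boxminus>P \<boxplus> (Q \<boxplus> P) = Q"
  by (simp_all add: ec_add_left_commute[of P Q] ec_add_left_commute[of "\<boxminus>P" Q])

lemma eventually_zc_nonzero: "\<forall>\<^sub>F R in generic E. zc R \<noteq> 0"
  using eventually_x_nonzero eventually_y_nonzero by eventually_elim simp

text \<open>The translates of the uniformizer \<open>x/y\<close> at infinity, so that expansions are compatible with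
  translations.\<close>
definition local_param :: "'f ec_point \<Rightarrow> 'f ec_point \<Rightarrow> 'f" where
  "local_param P R = zc (R \<boxplus> \<boxminus>P)"

lemma local_param_nonzero: "P \<in> pts \<Longrightarrow> \<forall>\<^sub>F R in generic E. local_param P R \<noteq> 0"
  unfolding local_param_def by (intro eventually_translate eventually_zc_nonzero) simp

lemma has_val_local_param: "P \<in> pts \<Longrightarrow> has_val E P (local_param P) 0"
  unfolding local_param_def[abs_def] using has_val_translate[of P "\<boxminus>P" zc 0] has_val_zc by simp

text \<open>\<open>c\<close> is the coefficient of \<open>j\<close>-th order in the expansion of \<open>f\<close> at \<open>P\<close>, which has no terms of
  lower order.\<close>
definition has_coeff :: "('f ec_point \<Rightarrow> 'f) \<Rightarrow> int \<Rightarrow> 'f ec_point \<Rightarrow> 'f \<Rightarrow> bool" where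
  "has_coeff f j P c \<longleftrightarrow> has_val E P (\<lambda>R. f R * local_param P R powi (- j)) c"

text \<open>The Riemann-Roch space of \<open>- D\<close>. Lower bounds instead of exact orders keep
  the condition linear and admit the zero function.\<close>

definition div_ge :: "('f ec_point \<Rightarrow> 'f) \<Rightarrow> ('f ec_point \<Rightarrow> int) \<Rightarrow> bool" where
  "div_ge f D \<longleftrightarrow> (\<forall>P\<in>pts. \<exists>c. has_coeff f (D P) P c)"

lemma has_coeff_unique: "has_coeff f j P c \<Longrightarrow> has_coeff f j P d \<Longrightarrow> P \<in> pts \<Longrightarrow> c = d"
  unfolding has_coeff_def by (rule has_val_unique)

lemma has_coeff_0_iff: "has_coeff f 0 P c \<longleftrightarrow> has_val E P f c"
  by (simp add: has_coeff_def)

lemma has_coeff_cong: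
  assumes "has_coeff f j P c" "\<forall>\<^sub>F R in generic E. f R = g R"
  shows "has_coeff g j P c"
  using assms(1) unfolding has_coeff_def
  by (rule has_val.cong) (use assms(2) in eventually_elim, simp)

lemma has_coeff_mult:
  assumes "has_coeff f j P c" "has_coeff g k P d" "P \<in> pts"
  shows "has_coeff (\<lambda>R. f R * g R) (j + k) P (c * d)"
  unfolding has_coeff_def
proof (rule has_val.cong[OF has_val.mult[OF assms(1,2)[unfolded has_coeff_def]]])
  show "\<forall>\<^sub>F R in generic E. f R * local_param P R powi (- j) * (g R * local_param P R powi (- k)) =
      f R * g R * local_param P R powi (- (j + k))"
    using local_param_nonzero[OF assms(3)]
  proof eventually_elim
    case (elim R)
    have "local_param P R powi (- (j + k)) = local_param P R powi (- j) * local_param P R powi (- k)"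
      using elim by (metis minus_add_distrib power_int_add)
    thus ?case by (simp add: mult_ac)
  qed
qed

lemma has_coeff_add:
  "has_coeff f j P c \<Longrightarrow> has_coeff g j P d \<Longrightarrow> has_coeff (\<lambda>R. f R + g R) j P (c + d)"
  unfolding has_coeff_def using has_val.add by (fastforce simp: ring_distribs)

lemma has_coeff_cmult:
  "has_coeff f j P c \<Longrightarrow> has_coeff (\<lambda>R. k * f R) j P (k * c)"
  unfolding has_coeff_def using has_val.mult[OF has_val.const] by (fastforce simp: mult.assoc)

lemma has_coeff_zero: "has_coeff (\<lambda>R. 0) j P 0"
  unfolding has_coeff_def by (simp add: has_val.const)

lemma has_coeff_sum:
  "(\<And>i. i \<in> I \<Longrightarrow> has_coeff (f i) j P (c i)) \<Longrightarrow> has_coeff (\<lambda>R. \<Sum>i\<in>I. f i R) j P (\<Sum>i\<in>I. c i)"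
  by (induction I rule: infinite_finite_induct) (auto intro: has_coeff_zero has_coeff_add)

lemma has_coeff_lower:
  assumes "has_coeff f j P c" "k < j" "P \<in> pts"
  shows "has_coeff f k P 0"
proof -
  have "has_val E P (\<lambda>R. f R * local_param P R powi (- j) * local_param P R ^ nat (j - k)) (c * 0 ^ nat (j - k))"
    by (intro has_val.mult has_val_power has_val_local_param assms(1)[unfolded has_coeff_def] assms(3))
  moreover have "\<forall>\<^sub>F R in generic E. f R * local_param P R powi (- j) * local_param P R ^ nat (j - k) =
      f R * local_param P R powi (- k)"
    using local_param_nonzero[OF assms(3)]
  proof eventually_elim
    case (elim R)
    have "local_param P R ^ nat (j - k) = local_param P R powi (j - k)"
      using assms(2) by (simp add: power_int_def)
    moreover have "local_param P R powi (- j + (j - k)) = local_param P R powi (- j) * local_param P R powi (j - k)"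
      using elim by (intro power_int_add) simp
    ultimately show ?case by simp
  qed
  ultimately have "has_val E P (\<lambda>R. f R * local_param P R powi (- k)) (c * 0 ^ nat (j - k))"
    by (rule has_val.cong)
  moreover have "c * 0 ^ nat (j - k) = 0" using assms(2) by simp
  ultimately show ?thesis by (simp only: has_coeff_def)
qed

text \<open>A translation moves \<open>P\<close> to infinity, where \<open>has_val_div_zc\<close>
  divides by the uniformizer; since \<open>local_param\<close> is a translate of \<open>zc\<close>,
  translating back is exact.\<close>

lemma has_coeff_raise:
  assumes "has_coeff f j P 0" "P \<in> pts"
  shows "\<exists>c. has_coeff f (j + 1) P c"
proof -
  let ?g = "\<lambda>R. f R * local_param P R powi (- j)"
  have "has_val E Infinity (\<lambda>R. ?g (R \<boxplus> P)) 0"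
    using assms unfolding has_coeff_def by (intro has_val_translate) auto
  then obtain c where c: "has_val E Infinity (\<lambda>R. ?g (R \<boxplus> P) / zc R) c"
    using has_val_div_zc by blast
  have "has_val E P (\<lambda>R. ?g (R \<boxplus> \<boxminus>P \<boxplus> P) / zc (R \<boxplus> \<boxminus>P)) c"
    by (rule has_val_translate[of P "\<boxminus>P" "\<lambda>R. ?g (R \<boxplus> P) / zc R" c]) (use assms c in auto)
  moreover have "\<forall>\<^sub>F R in generic E. ?g (R \<boxplus> \<boxminus>P \<boxplus> P) / zc (R \<boxplus> \<boxminus>P) = f R * local_param P R powi (- (j + 1))"
    using local_param_nonzero[OF assms(2)] eventually_in_pts
  proof eventually_elim
    case (elim R)
    have "local_param P R powi (- j + (- 1)) = local_param P R powi (- j) * local_param P R powi (- 1)"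
      using elim by (intro power_int_add) simp
    hence "local_param P R powi (- (j + 1)) = local_param P R powi (- j) / local_param P R"
      by (simp add: divide_inverse power_int_minus)
    moreover have "R \<boxplus> \<boxminus>P \<boxplus> P = R" using elim assms(2) by simp
    moreover have "zc (R \<boxplus> \<boxminus>P) = local_param P R" by (simp add: local_param_def)
    ultimately show ?case by (simp only: times_divide_eq_right)
  qed
  ultimately show ?thesis unfolding has_coeff_def by (blast intro: has_val.cong)
qed

lemma has_coeff_translate:
  assumes "has_coeff f j (P \<boxplus> Q) c" "P \<in> pts" "Q \<in> pts"
  shows "has_coeff (\<lambda>R. f (R \<boxplus> Q)) j P c"
proof -
  have "has_val E P (\<lambda>R. f (R \<boxplus> Q) * local_param (P \<boxplus> Q) (R \<boxplus> Q) powi (- j)) c"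
    by (rule has_val_translate[OF assms(1)[unfolded has_coeff_def] assms(2,3)])
  moreover have "\<forall>\<^sub>F R in generic E. f (R \<boxplus> Q) * local_param (P \<boxplus> Q) (R \<boxplus> Q) powi (- j) =
      f (R \<boxplus> Q) * local_param P R powi (- j)"
    using eventually_in_pts
  proof eventually_elim
    case (elim R)
    have "R \<boxplus> Q \<boxplus> \<boxminus>(P \<boxplus> Q) = R \<boxplus> \<boxminus>P \<boxplus> (Q \<boxplus> \<boxminus>Q)"
      using assms(2,3) elim by (simp add: neg_add pt_ac del: ec_add_neg)
    hence "R \<boxplus> Q \<boxplus> \<boxminus>(P \<boxplus> Q) = R \<boxplus> \<boxminus>P" by simp
    thus ?case unfolding local_param_def by (simp only:)
  qed
  ultimately show ?thesis unfolding has_coeff_def by (rule has_val.cong)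
qed

lemma div_ge_translate:
  assumes "div_ge f D" "Q \<in> pts"
  shows "div_ge (\<lambda>R. f (R \<boxplus> Q)) (\<lambda>P. D (P \<boxplus> Q))"
  unfolding div_ge_def
proof (intro ballI)
  fix P assume P: "P \<in> pts"
  then obtain c where "has_coeff f (D (P \<boxplus> Q)) (P \<boxplus> Q) c"
    using assms unfolding div_ge_def by (metis ec_add_in_pts)
  from has_coeff_translate[OF this P assms(2)]
  show "\<exists>c. has_coeff (\<lambda>R. f (R \<boxplus> Q)) (D (P \<boxplus> Q)) P c" by blast
qed

lemma div_ge_mono:
  assumes "div_ge f D" "\<And>P. P \<in> pts \<Longrightarrow> D' P \<le> D P"
  shows "div_ge f D'"
  unfolding div_ge_def
proof (intro ballI)
  fix P assume P: "P \<in> pts"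
  then obtain c where c: "has_coeff f (D P) P c" using assms(1) unfolding div_ge_def by blast
  show "\<exists>c. has_coeff f (D' P) P c"
    using has_coeff_lower[OF c _ P, of "D' P"] c assms(2)[OF P] by (cases "D' P = D P") force+
qed

lemma div_ge_mult:
  assumes "div_ge f D" "div_ge g D'"
  shows "div_ge (\<lambda>R. f R * g R) (\<lambda>P. D P + D' P)"
  using assms unfolding div_ge_def by (fast intro: has_coeff_mult)

lemma div_ge_add: "div_ge f D \<Longrightarrow> div_ge g D \<Longrightarrow> div_ge (\<lambda>R. f R + g R) D"
  unfolding div_ge_def by (fast intro: has_coeff_add)

lemma div_ge_cmult: "div_ge f D \<Longrightarrow> div_ge (\<lambda>R. k * f R) D"
  unfolding div_ge_def by (fast intro: has_coeff_cmult)

lemma div_ge_zero: "div_ge (\<lambda>R. 0) D"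
  unfolding div_ge_def by (fast intro: has_coeff_zero)

lemma div_ge_sum: "(\<And>i. i \<in> I \<Longrightarrow> div_ge (f i) D) \<Longrightarrow> div_ge (\<lambda>R. \<Sum>i\<in>I. f i R) D"
  by (induction I rule: infinite_finite_induct) (auto intro: div_ge_zero div_ge_add)

lemma div_ge_one: "div_ge (\<lambda>_. 1) (\<lambda>_. 0)"
  unfolding div_ge_def has_coeff_0_iff by (blast intro: has_val.const)

subsection \<open>Functions with two simple poles\<close>

text \<open>\<open>R\<close> and the negative of its sum with \<open>S = (xs, ys)\<close> lie on one
  line through \<open>S\<close>. This symmetry carries the pole at infinity to \<open>-S\<close> and
  pairs the zeros.\<close>

lemma slope_symmetric:
  assumes S: "Affine xs ys \<in> pts"
  shows "\<forall>\<^sub>F R in generic E. slope xs ys (\<boxminus>(R \<boxplus> Affine xs ys)) = slope xs ys R"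
proof -
  have "\<forall>\<^sub>F R in generic E. R \<boxplus> Affine xs ys \<noteq> Infinity \<and> xc (R \<boxplus> Affine xs ys) \<noteq> xs"
    by (rule eventually_translate[OF S eventually_x_neq])
  thus ?thesis using eventually_x_neq[of xs] eventually_in_pts
  proof eventually_elim
    case (elim R)
    then obtain x y where R: "R = Affine x y" by (cases R) auto
    have "Affine xs ys \<noteq> \<boxminus>Affine x y" using elim R by auto
    from ec_add_line[OF _ S this] obtain l m x3 where *:
      "Affine x y \<boxplus> Affine xs ys = Affine x3 (- (l + a\<^sub>1) * x3 - m - a\<^sub>3)"
      "y = l * x + m" "ys = l * xs + m" using elim R by metis
    have ne: "x3 \<noteq> xs" "x \<noteq> xs" using elim(1,2) by (auto simp: R *(1) simp del: ec_add.simps)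
    have "\<boxminus>(R \<boxplus> Affine xs ys) = Affine x3 (l * x3 + m)"
      unfolding R *(1) by (simp add: algebra_simps)
    moreover have "slope xs ys (Affine x3 (l * x3 + m)) = l"
    proof -
      have "l * x3 + m - (l * xs + m) = l * (x3 - xs)" by (simp add: algebra_simps)
      thus ?thesis using ne unfolding slope_def by (simp add: *(3))
    qed
    moreover have "slope xs ys R = l"
    proof -
      have "l * x + m - (l * xs + m) = l * (x - xs)" by (simp add: algebra_simps)
      thus ?thesis using ne unfolding slope_def by (simp add: *(2,3) R)
    qed
    ultimately show ?case by simp
  qed
qed

lemma has_val_slope:
  assumes S: "Affine xs ys \<in> pts" and P: "P \<in> pts" "P \<noteq> Infinity" "P \<noteq> \<boxminus>Affine xs ys"
  shows "\<exists>c. has_val E P (slope xs ys) c"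
proof -
  obtain x y where Pxy: "P = Affine x y" using P by (cases P) auto
  show ?thesis
  proof (cases "x = xs")
    case False
    have "has_val E P (\<lambda>R. (yc R - ys) / (xc R - xs)) ((y - ys) / (x - xs))"
      unfolding Pxy by (intro has_val_divide has_val_intros) (use False in simp)
    thus ?thesis by (auto simp: slope_def[abs_def])
  next
    case True
    hence y: "y = ys" using same_x_cases[of xs ys y] P S Pxy by auto
    have nz: "y + ys + a\<^sub>1 * x + a\<^sub>3 \<noteq> 0"
      using two_torsion_iff[of ys xs] P(3) True y Pxy by (auto simp flip: mult_2)
    \<comment> \<open>At \<open>S\<close> itself numerator and denominator of the slope both vanish;
      \<open>curve_diff_eq\<close> rewrites the quotient with a denominator that is nonzero since
      \<open>S\<close> is not of order 2 here.\<close>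
    let ?K = "\<lambda>R. xc R^2 + xc R * xs + xs^2 + a\<^sub>2 * (xc R + xs) + a\<^sub>4 - a\<^sub>1 * ys"
    have den: "has_val E P (\<lambda>R. yc R + ys + a\<^sub>1 * xc R + a\<^sub>3) (y + ys + a\<^sub>1 * x + a\<^sub>3)"
      unfolding Pxy by (intro has_val_intros)
    have "has_val E P (\<lambda>R. ?K R / (yc R + ys + a\<^sub>1 * xc R + a\<^sub>3))
        ((x^2 + x * xs + xs^2 + a\<^sub>2 * (x + xs) + a\<^sub>4 - a\<^sub>1 * ys) / (y + ys + a\<^sub>1 * x + a\<^sub>3))"
      by (rule has_val_divide[OF _ den nz]) (unfold Pxy, intro has_val_intros)
    moreover have "\<forall>\<^sub>F R in generic E. ?K R / (yc R + ys + a\<^sub>1 * xc R + a\<^sub>3) = slope xs ys R"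
      using eventually_curve_diff_eq[OF S] eventually_x_neq[of xs] has_val_nonzero[OF den P(1) nz]
    proof eventually_elim
      case (elim R)
      have "xc R - xs \<noteq> 0" using elim(2) by simp
      thus ?case unfolding slope_def using elim(1,3) by (simp add: frac_eq_eq mult_ac)
    qed
    ultimately show ?thesis by (blast intro: has_val.cong)
  qed
qed

text \<open>Multiplied by \<open>x / y\<close>, the slope has numerator and denominator of weight 5
  with leading coefficients 1.\<close>

lemma has_coeff_slope_Infinity:
  "has_coeff (slope xs ys) (- 1) Infinity 1"
proof -
  have "weight_le 3 (\<lambda>R. yc R + (- ys)) (1 + 0)" "weight_le 2 (\<lambda>R. xc R + (- xs)) (1 + 0)"
    by (intro weight_le_add weight_le_y weight_le_x weight_le_mono[OF weight_le_const]; simp)+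
  from weight_le_mult[OF this(1) weight_le_x] weight_le_mult[OF this(2) weight_le_y]
  have "weight_le 5 (\<lambda>R. (yc R + (- ys)) * xc R) 1" "weight_le 5 (\<lambda>R. (xc R + (- xs)) * yc R) 1"
    by simp_all
  from weight_le_quotient_has_val[OF this] show ?thesis
    unfolding has_coeff_def local_param_def
    by (rule_tac has_val_cong') (auto simp: slope_def intro!: always_eventually)
qed

text \<open>Negation preserves orders at infinity: the quotient of \<open>zc (-R)\<close> by
  \<open>zc R\<close> has a value \<open>d\<close>, and negating once more gives
  \<open>d * d = 1\<close>, so \<open>d\<close> is nonzero.\<close>

lemma has_coeff_negate:
  assumes "has_coeff f j Infinity c"
  shows "\<exists>d. has_coeff (\<lambda>R. f (\<boxminus>R)) j Infinity d"
proof -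
  have n0: "has_val E Infinity (\<lambda>R. zc (\<boxminus>R)) 0"
    by (rule has_val_negate) (use has_val_zc in simp_all)
  obtain d where d: "has_val E Infinity (\<lambda>R. zc (\<boxminus>R) / zc R) d"
    using has_val_div_zc[OF n0] by blast
  have dn: "has_val E Infinity (\<lambda>R. zc (\<boxminus>(\<boxminus>R)) / zc (\<boxminus>R)) d"
    by (rule has_val_negate[of Infinity "\<lambda>R. zc (\<boxminus>R) / zc R"]) (use d in simp_all)
  have nz: "\<forall>\<^sub>F R in generic E. zc (\<boxminus>R) \<noteq> 0 \<and> zc R \<noteq> 0"
    using eventually_negate[OF eventually_zc_nonzero] eventually_zc_nonzero by eventually_elim simp
  have "has_val E Infinity (\<lambda>R. (zc (\<boxminus>R) / zc R) * (zc (\<boxminus>(\<boxminus>R)) / zc (\<boxminus>R))) (d * d)"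
    by (intro has_val.mult d dn)
  moreover have "\<forall>\<^sub>F R in generic E. (zc (\<boxminus>R) / zc R) * (zc (\<boxminus>(\<boxminus>R)) / zc (\<boxminus>R)) = 1"
    using nz by eventually_elim simp
  ultimately have "has_val E Infinity (\<lambda>_. 1) (d * d)" by (rule has_val.cong)
  from has_val_unique[OF this has_val.const] have d0: "d \<noteq> 0" by auto
  have "has_val E Infinity (\<lambda>R. f (\<boxminus>R) * zc (\<boxminus>R) powi (- j)) c"
    by (rule has_val_negate[of Infinity "\<lambda>R. f R * zc R powi (- j)"])
       (use assms in \<open>simp_all add: has_coeff_def local_param_def\<close>)
  hence "has_val E Infinity (\<lambda>R. (f (\<boxminus>R) * zc (\<boxminus>R) powi (- j)) * (zc (\<boxminus>R) / zc R) powi j) (c * d powi j)"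
    by (intro has_val.mult has_val_power_int d d0)
  moreover have "\<forall>\<^sub>F R in generic E. (f (\<boxminus>R) * zc (\<boxminus>R) powi (- j)) * (zc (\<boxminus>R) / zc R) powi j =
      f (\<boxminus>R) * zc R powi (- j)"
    using nz
  proof eventually_elim
    case (elim R)
    have "a powi (- j) * (a / b) powi j = b powi (- j)" if "a \<noteq> 0" "b \<noteq> 0" for a b :: 'f
      using that by (simp add: power_int_divide_distrib power_int_minus field_simps)
    from this[OF conjunct1[OF elim] conjunct2[OF elim]] show ?case by (simp only: mult.assoc)
  qed
  ultimately have "has_val E Infinity (\<lambda>R. f (\<boxminus>R) * zc R powi (- j)) (c * d powi j)"
    by (rule has_val.cong)
  thus ?thesis unfolding has_coeff_def local_param_def by auto
qed

lemma has_coeff_slope_pole: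
  assumes S: "Affine xs ys \<in> pts"
  shows "\<exists>c. has_coeff (slope xs ys) (- 1) (\<boxminus>Affine xs ys) c"
proof -
  obtain d where d: "has_coeff (\<lambda>R. slope xs ys (\<boxminus>R)) (- 1) Infinity d"
    using has_coeff_negate[OF has_coeff_slope_Infinity] by blast
  have "has_coeff (\<lambda>R. slope xs ys (\<boxminus>(R \<boxplus> Affine xs ys))) (- 1) (\<boxminus>Affine xs ys) d"
    by (rule has_coeff_translate[of "\<lambda>R. slope xs ys (\<boxminus>R)"])
       (use d S in \<open>simp_all add: ec_add_neg' del: ec_neg.simps ec_add.simps\<close>)
  from has_coeff_cong[OF this slope_symmetric[OF S]] show ?thesis by blast
qed

lemma has_coeff_diff_const:
  assumes "has_coeff f (- 1) P c" "P \<in> pts"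
  shows "has_coeff (\<lambda>R. f R - k) (- 1) P c"
proof -
  have "has_coeff (\<lambda>R. - k) (- 1) P 0"
    by (rule has_coeff_lower[of _ 0 _ "- k"]) (use assms in \<open>auto simp: has_coeff_0_iff has_val.const\<close>)
  from has_coeff_add[OF assms(1) this] show ?thesis by simp
qed

lemma eventually_slope_neq: "\<forall>\<^sub>F R in generic E. slope xs ys R - c \<noteq> 0"
proof -
  from has_coeff_diff_const[OF has_coeff_slope_Infinity]
  have "has_coeff (\<lambda>R. slope xs ys R - c) (- 1) Infinity 1" by simp
  hence "\<forall>\<^sub>F R in generic E. (slope xs ys R - c) * local_param Infinity R powi (- (- 1)) \<noteq> 0"
    unfolding has_coeff_def by (rule has_val_nonzero) simp_all
  thus ?thesis by (rule eventually_mono) simp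
qed

text \<open>\<open>c\<close> is the slope at \<open>C\<close>. Since \<open>C\<close>,
  \<open>D\<close> and \<open>(xs, ys)\<close> sum to infinity they lie on one line, so
  \<open>slope_symmetric\<close> gives the same value at \<open>D\<close>.\<close>

lemma div_ge_slope:
  assumes S: "Affine xs ys \<in> pts" and C: "C \<in> pts" "D \<in> pts" "C \<noteq> D" "C \<noteq> Infinity" "D \<noteq> Infinity"
    and sum: "C \<boxplus> D = \<boxminus>Affine xs ys"
  shows "\<exists>c. div_ge (\<lambda>R. slope xs ys R - c)
      (\<lambda>P. dlt C P + dlt D P - dlt Infinity P - dlt (\<boxminus>Affine xs ys) P)"
proof -
  let ?S = "Affine xs ys"
  have inS: "\<boxminus>?S \<in> pts" using S by (rule ec_neg_in_pts)
  have Cn: "C \<noteq> \<boxminus>?S" using sum C(1,2,5) by (metis ec_add_Infinity add_left_cancel Infinity_in_pts)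
  have Dn: "D \<noteq> \<boxminus>?S" using sum C(1,2,4) by (metis ec_add.simps(1) add_right_cancel Infinity_in_pts)
  obtain c where c: "has_val E C (slope xs ys) c"
    using has_val_slope[OF S C(1) _ Cn] C by blast
  have eqC: "\<boxminus>(D \<boxplus> ?S) = C"
  proof -
    have "\<boxminus>(D \<boxplus> ?S) = \<boxminus>D \<boxplus> (C \<boxplus> D)" using S C by (simp add: neg_add sum del: ec_neg.simps)
    also have "\<dots> = C" using C by (simp add: ec_add_left_commute ec_add_neg')
    finally show ?thesis .
  qed
  have "has_val E (D \<boxplus> ?S) (\<lambda>R. slope xs ys (\<boxminus>R)) c"
    by (rule has_val_negate) (use c eqC S C in simp_all)
  from has_val_translate[OF this C(2) S] have "has_val E D (\<lambda>R. slope xs ys (\<boxminus>(R \<boxplus> ?S))) c" .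
  from has_val.cong[OF this slope_symmetric[OF S]] have d: "has_val E D (slope xs ys) c" .
  have "div_ge (\<lambda>R. slope xs ys R - c) (\<lambda>P. dlt C P + dlt D P - dlt Infinity P - dlt (\<boxminus>?S) P)"
    unfolding div_ge_def
  proof (intro ballI)
    fix P assume P: "P \<in> pts"
    consider "P = Infinity" | "P = \<boxminus>?S" | "P = C" | "P = D" |
      "P \<noteq> Infinity" "P \<noteq> \<boxminus>?S" "P \<noteq> C" "P \<noteq> D" by blast
    thus "\<exists>c'. has_coeff (\<lambda>R. slope xs ys R - c) (dlt C P + dlt D P - dlt Infinity P - dlt (\<boxminus>?S) P) P c'"
    proof cases
      case 1
      thus ?thesis using has_coeff_diff_const[OF has_coeff_slope_Infinity] C Cn Dn by auto
    next
      case 2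
      obtain c' where "has_coeff (slope xs ys) (- 1) P c'" using has_coeff_slope_pole[OF S] 2 by blast
      from has_coeff_diff_const[OF this P] show ?thesis using 2 Cn Dn by auto
    next
      case 3
      have "has_val E C (\<lambda>R. slope xs ys R - c) (c - c)" by (intro has_val_diff c has_val.const)
      hence "has_coeff (\<lambda>R. slope xs ys R - c) 0 C 0" by (simp add: has_coeff_0_iff)
      from has_coeff_raise[OF this C(1)] show ?thesis using 3 C Cn by auto
    next
      case 4
      have "has_val E D (\<lambda>R. slope xs ys R - c) (c - c)" by (intro has_val_diff d has_val.const)
      hence "has_coeff (\<lambda>R. slope xs ys R - c) 0 D 0" by (simp add: has_coeff_0_iff)
      from has_coeff_raise[OF this C(2)] show ?thesis using 4 C Dn by auto
    next
      case 5
      obtain c' where "has_val E P (slope xs ys) c'" using has_val_slope[OF S P 5(1,2)] by blast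
      hence "has_val E P (\<lambda>R. slope xs ys R - c) (c' - c)" by (intro has_val_diff has_val.const)
      thus ?thesis using 5 by (auto simp: has_coeff_0_iff)
    qed
  qed
  thus "\<exists>c. div_ge (\<lambda>R. slope xs ys R - c)
      (\<lambda>P. dlt C P + dlt D P - dlt Infinity P - dlt (\<boxminus>?S) P)" ..
qed

definition nonzero_fun :: "('f ec_point \<Rightarrow> 'f) \<Rightarrow> bool" where
  "nonzero_fun f \<longleftrightarrow> (\<forall>\<^sub>F R in generic E. f R \<noteq> 0)"

lemma nonzero_fun_mult: "nonzero_fun f \<Longrightarrow> nonzero_fun g \<Longrightarrow> nonzero_fun (\<lambda>R. f R * g R)"
  by (simp add: nonzero_fun_def eventually_conj_iff)

text \<open>Translation by \<open>A1\<close> moves the poles to infinity and \<open>A2 - A1\<close>,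
  the poles of the slope through \<open>-(A2 - A1)\<close>; the translated zeros satisfy the
  condition on sums in \<open>div_ge_slope\<close>.\<close>

lemma quad_fun_distinct:
  assumes in_pts: "A1 \<in> pts" "A2 \<in> pts" "B1 \<in> pts" "B2 \<in> pts"
    and ne: "A1 \<noteq> A2" "B1 \<noteq> B2" "A1 \<noteq> B1" "A1 \<noteq> B2" and sum: "A1 \<boxplus> A2 = B1 \<boxplus> B2"
  shows "\<exists>f. div_ge f (\<lambda>P. dlt B1 P + dlt B2 P - dlt A1 P - dlt A2 P) \<and> nonzero_fun f"
proof -
  have "\<boxminus>(A2 \<boxplus> \<boxminus>A1) \<noteq> Infinity" using in_pts ne by (simp add: add_eq_Infinity_iff neg_eq_iff)
  then obtain xs ys where S: "Affine xs ys = \<boxminus>(A2 \<boxplus> \<boxminus>A1)" by (metis ec_point.exhaust)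
  have S': "\<boxminus>Affine xs ys = A2 \<boxplus> \<boxminus>A1" unfolding S by (rule ec_neg_neg)
  let ?C = "B1 \<boxplus> \<boxminus>A1" and ?D = "B2 \<boxplus> \<boxminus>A1"
  have CD: "?C \<boxplus> ?D = \<boxminus>Affine xs ys"
  proof -
    have "?C \<boxplus> ?D = (B1 \<boxplus> B2) \<boxplus> (\<boxminus>A1 \<boxplus> \<boxminus>A1)" using in_pts by (simp add: pt_ac)
    also have "\<dots> = A2 \<boxplus> (A1 \<boxplus> (\<boxminus>A1 \<boxplus> \<boxminus>A1))"
      unfolding sum[symmetric] using in_pts
      by (simp add: pt_ac del: add_left_neg_cancel add_neg_cancel)
    finally show ?thesis unfolding S' using in_pts by simp
  qed
  have pts': "Affine xs ys \<in> pts" "?C \<in> pts" "?D \<in> pts" using in_pts by (simp_all add: S)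
  have ne': "?C \<noteq> ?D" "?C \<noteq> Infinity" "?D \<noteq> Infinity"
    using in_pts ne by (auto simp: add_eq_Infinity_iff neg_eq_iff)
  from div_ge_slope[OF pts' ne' CD] obtain c where c: "div_ge (\<lambda>R. slope xs ys R - c)
      (\<lambda>P. dlt ?C P + dlt ?D P - dlt Infinity P - dlt (\<boxminus>Affine xs ys) P)" by blast
  have "div_ge (\<lambda>R. slope xs ys (R \<boxplus> \<boxminus>A1) - c)
      (\<lambda>P. dlt ?C (P \<boxplus> \<boxminus>A1) + dlt ?D (P \<boxplus> \<boxminus>A1) - dlt Infinity (P \<boxplus> \<boxminus>A1) - dlt (\<boxminus>Affine xs ys) (P \<boxplus> \<boxminus>A1))"
    by (rule div_ge_translate[OF c]) (use in_pts in simp)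
  hence "div_ge (\<lambda>R. slope xs ys (R \<boxplus> \<boxminus>A1) - c) (\<lambda>P. dlt B1 P + dlt B2 P - dlt A1 P - dlt A2 P)"
    by (rule div_ge_mono) (use in_pts in \<open>simp add: S' add_eq_Infinity_iff neg_eq_iff eq_commute[of A1] del: ec_neg.simps\<close>)
  moreover have "nonzero_fun (\<lambda>R. slope xs ys (R \<boxplus> \<boxminus>A1) - c)"
    unfolding nonzero_fun_def
    by (rule eventually_translate[OF _ eventually_slope_neq]) (use in_pts in simp)
  ultimately show ?thesis by blast
qed

text \<open>Repeated points are avoided by a detour: with a generic \<open>T\<close> and
  \<open>U = A1 + T - B1\<close>, one factor has zeros \<open>B1\<close>, \<open>U\<close> and poles
  \<open>A1\<close>, \<open>T\<close>, the other has zeros \<open>T\<close>, \<open>B2\<close> and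
  poles \<open>U\<close>, \<open>A2\<close>. The points excluded for \<open>T\<close> provide the
  distinctness that both factors require.\<close>

lemma quad_fun:
  assumes in_pts: "A1 \<in> pts" "A2 \<in> pts" "B1 \<in> pts" "B2 \<in> pts"
    and sum: "A1 \<boxplus> A2 = B1 \<boxplus> B2"
  shows "\<exists>f. div_ge f (\<lambda>P. dlt B1 P + dlt B2 P - dlt A1 P - dlt A2 P) \<and> nonzero_fun f"
proof (cases "A1 = B1 \<or> A1 = B2")
  case True
  hence "A1 = B1 \<and> A2 = B2 \<or> A1 = B2 \<and> A2 = B1"
  proof (elim disjE)
    assume "A1 = B1"
    thus ?thesis using sum in_pts by simp
  next
    assume "A1 = B2"
    hence "B2 \<boxplus> A2 = B2 \<boxplus> B1" using sum ec_add_commute[OF in_pts(3,4)] by simp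
    thus ?thesis using \<open>A1 = B2\<close> in_pts by simp
  qed
  hence "dlt B1 P + dlt B2 P - dlt A1 P - dlt A2 P = 0" for P by auto
  thus ?thesis using div_ge_one by (intro exI[of _ "\<lambda>_. 1"]) (simp add: nonzero_fun_def)
next
  case False
  have "\<forall>\<^sub>F R in generic E. R \<noteq> A1 \<and> R \<noteq> B1 \<and> R \<noteq> B2 \<and> R \<noteq> A2 \<and> R \<noteq> B1 \<boxplus> B1 \<boxplus> \<boxminus>A1 \<and>
      R \<noteq> A2 \<boxplus> B1 \<boxplus> \<boxminus>A1 \<and> R \<noteq> B2 \<boxplus> B1 \<boxplus> \<boxminus>A1"
    by (intro eventually_conj eventually_neq)
  from eventually_generic_ex[OF this] obtain T where T: "T \<in> pts" "T \<noteq> A1" "T \<noteq> B1" "T \<noteq> B2" "T \<noteq> A2"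
    "T \<noteq> B1 \<boxplus> B1 \<boxplus> \<boxminus>A1" "T \<noteq> A2 \<boxplus> B1 \<boxplus> \<boxminus>A1" "T \<noteq> B2 \<boxplus> B1 \<boxplus> \<boxminus>A1" by blast
  define U where "U = A1 \<boxplus> T \<boxplus> \<boxminus>B1"
  have U: "U \<in> pts" using in_pts T by (simp add: U_def)
  have UB: "U \<boxplus> B1 = A1 \<boxplus> T" using in_pts T by (simp add: U_def)
  have move: "T = Q \<boxplus> B1 \<boxplus> \<boxminus>A1" if "Q = U" "Q \<in> pts" for Q
  proof -
    have "Q \<boxplus> B1 \<boxplus> \<boxminus>A1 = \<boxminus>A1 \<boxplus> (A1 \<boxplus> T)"
      unfolding that(1) UB using in_pts T by (simp add: ec_add_commute)
    thus ?thesis using in_pts T by simp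
  qed
  have Une: "B1 \<noteq> U" "A2 \<noteq> U" "B2 \<noteq> U" using move T in_pts by blast+
  have UA: "A1 \<noteq> U"
  proof
    assume "A1 = U"
    hence "A1 \<boxplus> B1 = A1 \<boxplus> T" using UB by simp
    thus False using in_pts T by simp
  qed
  have UT: "T \<noteq> U"
  proof
    assume "T = U"
    hence "T \<boxplus> B1 = A1 \<boxplus> T" using UB by simp
    hence "T \<boxplus> B1 = T \<boxplus> A1" using ec_add_commute[OF in_pts(1) T(1)] by simp
    thus False using in_pts T False by simp
  qed
  obtain f where f: "div_ge f (\<lambda>P. dlt B1 P + dlt U P - dlt A1 P - dlt T P)" "nonzero_fun f"
    using quad_fun_distinct[of A1 T B1 U] in_pts T U Une UA False UB ec_add_commute[OF U in_pts(3)] by auto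
  have "U \<boxplus> A2 = T \<boxplus> B2"
  proof -
    have "U \<boxplus> A2 \<boxplus> B1 = T \<boxplus> (A1 \<boxplus> A2)"
      using in_pts T by (simp add: U_def pt_ac)
    also have "\<dots> = T \<boxplus> B2 \<boxplus> B1" unfolding sum using in_pts T by (simp add: pt_ac)
    finally show ?thesis using in_pts T U by simp
  qed
  then obtain g where g: "div_ge g (\<lambda>P. dlt T P + dlt B2 P - dlt U P - dlt A2 P)" "nonzero_fun g"
    using quad_fun_distinct[of U A2 T B2] in_pts T U Une UT by auto
  have "div_ge (\<lambda>R. f R * g R) (\<lambda>P. dlt B1 P + dlt B2 P - dlt A1 P - dlt A2 P)"
    by (rule div_ge_mono[OF div_ge_mult[OF f(1) g(1)]]) simp
  thus ?thesis using nonzero_fun_mult[OF f(2) g(2)] by blast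
qed

subsection \<open>Interpolation\<close>

fun psum :: "'f ec_point list \<Rightarrow> 'f ec_point" where
  "psum [] = Infinity"
| "psum (P # Ps) = P \<boxplus> psum Ps"

abbreviation cnt :: "'f ec_point list \<Rightarrow> 'f ec_point \<Rightarrow> int" where
  "cnt A P \<equiv> int (count_list A P)"

lemma psum_in_pts [simp]: "set A \<subseteq> pts \<Longrightarrow> psum A \<in> pts"
  by (induction A) auto

lemma psum_append: "set A \<subseteq> pts \<Longrightarrow> set B \<subseteq> pts \<Longrightarrow> psum (A @ B) = psum A \<boxplus> psum B"
  by (induction A) (auto simp: ec_add_assoc)

text \<open>The existence half of Abel's theorem, by induction on the number of points. A factor
  with poles \<open>a\<close>, \<open>a'\<close> and zeros \<open>b\<close>,
  \<open>c = a + a' - b\<close> leaves \<open>c # As'\<close> and \<open>Bs\<close>, one point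
  shorter and again with equal sums.\<close>

theorem exists_fun_div_ge:
  assumes "length A = length B" "set A \<subseteq> pts" "set B \<subseteq> pts" "psum A = psum B"
  shows "\<exists>f. div_ge f (\<lambda>P. cnt B P - cnt A P) \<and> nonzero_fun f"
  using assms
proof (induction "length A" arbitrary: A B)
  case 0
  thus ?case using div_ge_one by (intro exI[of _ "\<lambda>_. 1"]) (auto simp: nonzero_fun_def)
next
  case (Suc n)
  then obtain a As b Bs where AB: "A = a # As" "B = b # Bs"
    by (metis length_Suc_conv)
  show ?case
  proof (cases As)
    case Nil
    hence "B = A" using Suc.prems Suc.hyps AB by auto
    thus ?thesis using div_ge_one by (intro exI[of _ "\<lambda>_. 1"]) (auto simp: nonzero_fun_def)
  next
    case (Cons a' As')
    define c where "c = a \<boxplus> a' \<boxplus> \<boxminus>b"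
    have in_pts: "a \<in> pts" "a' \<in> pts" "b \<in> pts" "set As' \<subseteq> pts" "set Bs \<subseteq> pts" "c \<in> pts"
      using Suc.prems AB Cons by (auto simp: c_def)
    have "b \<boxplus> psum (c # As') = b \<boxplus> psum Bs"
    proof -
      have "b \<boxplus> psum (c # As') = (a \<boxplus> a') \<boxplus> (b \<boxplus> \<boxminus>b) \<boxplus> psum As'"
        using in_pts by (simp add: c_def pt_ac del: ec_add_neg)
      also have "\<dots> = psum A" using in_pts by (simp add: AB Cons ec_add_assoc)
      finally show ?thesis using Suc.prems AB by simp
    qed
    hence sum: "psum (c # As') = psum Bs" using in_pts by simp
    have "n = length (c # As')" "length (c # As') = length Bs" using Suc.hyps(2) Suc.prems AB Cons by auto
    from Suc.hyps(1)[OF this _ _ sum] in_pts obtain f where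
      f: "div_ge f (\<lambda>P. cnt Bs P - cnt (c # As') P)" "nonzero_fun f" by auto
    have "a \<boxplus> a' = b \<boxplus> c"
      using in_pts ec_add_commute[of b c] by (simp add: c_def)
    then obtain g where g: "div_ge g (\<lambda>P. dlt b P + dlt c P - dlt a P - dlt a' P)" "nonzero_fun g"
      using quad_fun[of a a' b c] in_pts by blast
    have "div_ge (\<lambda>R. f R * g R) (\<lambda>P. cnt B P - cnt A P)"
      by (rule div_ge_mono[OF div_ge_mult[OF f(1) g(1)]]) (simp add: AB Cons)
    thus ?thesis using nonzero_fun_mult[OF f(2) g(2)] by blast
  qed
qed

text \<open>If the sums differ by \<open>S\<close>, there is a function with zeros
  \<open>Infinity # A\<close> and poles \<open>S # B\<close>. Its product with \<open>f\<close> has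
  at most a simple pole, at \<open>S\<close>, and vanishes at infinity; translated by
  \<open>S\<close> it is constant by \<open>simple_pole_imp_const\<close>, and the zero makes it
  0.\<close>

theorem div_ge_imp_zero:
  assumes f: "div_ge f (\<lambda>P. cnt B P - cnt A P)"
    and "length A = length B" "set A \<subseteq> pts" "set B \<subseteq> pts" "psum A \<noteq> psum B"
  shows "\<forall>\<^sub>F R in generic E. f R = 0"
proof -
  define S where "S = psum A \<boxplus> \<boxminus>psum B"
  have S: "S \<in> pts" using assms by (simp add: S_def)
  have SO: "S \<noteq> Infinity" using assms by (auto simp: S_def add_eq_Infinity_iff neg_eq_iff)
  have "psum (S # B) = psum (Infinity # A)"
    using assms by (simp add: S_def)
  with exists_fun_div_ge[of "S # B" "Infinity # A"] assms S obtain g where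
    g: "div_ge g (\<lambda>P. cnt (Infinity # A) P - cnt (S # B) P)" "nonzero_fun g" by auto
  define h where "h = (\<lambda>R. f R * g R)"
  have h: "div_ge h (\<lambda>P. dlt Infinity P - dlt S P)"
    unfolding h_def by (rule div_ge_mono[OF div_ge_mult[OF f g(1)]]) auto
  define k where "k = (\<lambda>R. h (R \<boxplus> S))"
  have k: "div_ge k (\<lambda>P. dlt Infinity (P \<boxplus> S) - dlt S (P \<boxplus> S))"
    unfolding k_def by (rule div_ge_translate[OF h S])
  have kd: "dlt Infinity (P \<boxplus> S) - dlt S (P \<boxplus> S) = dlt (\<boxminus>S) P - dlt Infinity P" if "P \<in> pts" for P
  proof -
    have "P \<boxplus> S = Infinity \<longleftrightarrow> P = \<boxminus>S" by (metis add_eq_Infinity_iff ec_neg_neg)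
    moreover have "P \<boxplus> S = S \<longleftrightarrow> P = Infinity" using that S by (metis add_right_cancel ec_add.simps(1) Infinity_in_pts)
    ultimately show ?thesis by simp
  qed
  have "affine_regular k"
    unfolding affine_regular_def
  proof (intro ballI impI)
    fix P assume P: "P \<in> pts" "P \<noteq> Infinity"
    obtain c where c: "has_coeff k (dlt (\<boxminus>S) P) P c" using k kd[OF P(1)] P unfolding div_ge_def by auto
    show "\<exists>c. has_val E P k c"
      using c has_coeff_lower[OF c _ P(1), of 0] by (cases "P = \<boxminus>S") (auto simp: has_coeff_0_iff)
  qed
  moreover obtain c where "has_coeff k (- 1) Infinity c"
  proof -
    have "dlt Infinity (Infinity \<boxplus> S) - dlt S (Infinity \<boxplus> S) = - 1" using SO by simp
    thus ?thesis using that k[unfolded div_ge_def, rule_format, OF Infinity_in_pts] by auto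
  qed
  hence "has_val E Infinity (\<lambda>R. zc R * k R) c"
    by (simp add: has_coeff_def local_param_def mult.commute)
  ultimately obtain w where w: "\<forall>\<^sub>F R in generic E. k R = w" by (rule simple_pole_imp_const)
  have "\<exists>c. has_coeff k 1 (\<boxminus>S) c"
  proof -
    have "dlt Infinity (\<boxminus>S \<boxplus> S) - dlt S (\<boxminus>S \<boxplus> S) = 1" using SO by (simp add: eq_commute[of Infinity])
    thus ?thesis using k[unfolded div_ge_def, rule_format, of "\<boxminus>S"] S by auto
  qed
  then obtain c where "has_coeff k 1 (\<boxminus>S) c" ..
  from has_coeff_lower[OF this, of 0] S have "has_val E (\<boxminus>S) k 0" by (simp add: has_coeff_0_iff)
  from has_val_unique[OF has_val.cong[OF this w] has_val.const] S have "w = 0" by simp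
  with w have "\<forall>\<^sub>F R in generic E. h (R \<boxplus> S) = 0" by (simp add: k_def)
  from eventually_translate[OF _ this, of "\<boxminus>S"] S
  have "\<forall>\<^sub>F R in generic E. h (R \<boxplus> \<boxminus>S \<boxplus> S) = 0" by simp
  thus ?thesis using g(2)[unfolded nonzero_fun_def] eventually_in_pts
    by eventually_elim (use S in \<open>simp add: h_def\<close>)
qed

text \<open>Vanishing coefficients raise the order by one along \<open>B\<close>, whose points count
  once since \<open>B\<close> is distinct; \<open>div_ge_imp_zero\<close> then applies to a divisor
  of degree 0.\<close>

theorem interpolation_unique:
  assumes f: "div_ge f (\<lambda>P. - cnt A P)" and z: "\<And>b. b \<in> set B \<Longrightarrow> has_coeff f (- cnt A b) b 0"
    and "length A = length B" "distinct B" "set A \<subseteq> pts" "set B \<subseteq> pts" "psum A \<noteq> psum B"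
  shows "\<forall>\<^sub>F R in generic E. f R = 0"
proof (rule div_ge_imp_zero[OF _ assms(3,5,6,7)])
  show "div_ge f (\<lambda>P. cnt B P - cnt A P)"
    unfolding div_ge_def
  proof (intro ballI)
    fix P assume P: "P \<in> pts"
    show "\<exists>c. has_coeff f (cnt B P - cnt A P) P c"
    proof (cases "P \<in> set B")
      case True
      hence "cnt B P = 1" using assms(4) by (induction B) (auto simp: count_list_0_iff)
      thus ?thesis using has_coeff_raise[OF z[OF True] P] by (simp add: algebra_simps)
    next
      case False
      thus ?thesis using f P unfolding div_ge_def by (simp add: count_list_0_iff)
    qed
  qed
qed

text \<open>Lagrange interpolation. The basis function for \<open>b\<close> vanishes on the rest of
  \<open>B\<close> and at one more point \<open>T\<close>, forced by equality of sums; its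
  coefficient at \<open>b\<close> is nonzero, since otherwise \<open>interpolation_unique\<close>
  would make it 0.\<close>

theorem interpolation_exists:
  assumes "length A = length B" "distinct B" "set A \<subseteq> pts" "set B \<subseteq> pts" "psum A \<noteq> psum B"
  shows "\<exists>f. div_ge f (\<lambda>P. - cnt A P) \<and> (\<forall>b\<in>set B. has_coeff f (- cnt A b) b (y b))"
proof -
  have "\<exists>f c. c \<noteq> 0 \<and> div_ge f (\<lambda>P. - cnt A P) \<and>
      (\<forall>b'\<in>set B. has_coeff f (- cnt A b') b' (if b' = b then c else 0))" if b: "b \<in> set B" for b
  proof -
    define B' where "B' = remove1 b B"
    have B': "set B' = set B - {b}" using assms(2) by (simp add: B'_def)
    have B'p: "set B' \<subseteq> pts" using assms(4) B' by auto
    define T where "T = psum A \<boxplus> \<boxminus>psum B'"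
    have T: "T \<in> pts" using assms B'p by (simp add: T_def)
    have len: "length A = length (T # B')" using assms(1) b
      by (simp add: B'_def length_remove1) (metis length_pos_if_in_set Suc_pred)
    have "psum A = psum (T # B')" using assms B'p by (simp add: T_def)
    from exists_fun_div_ge[OF len assms(3) _ this] T B'p obtain f where
      f: "div_ge f (\<lambda>P. cnt (T # B') P - cnt A P)" "nonzero_fun f" by auto
    have f1: "div_ge f (\<lambda>P. - cnt A P)" by (rule div_ge_mono[OF f(1)]) simp
    have z: "has_coeff f (- cnt A b') b' 0" if "b' \<in> set B" "b' \<noteq> b" for b'
    proof -
      have P: "b' \<in> pts" using that assms by auto
      then obtain c where "has_coeff f (cnt (T # B') b' - cnt A b') b' c" using f(1) unfolding div_ge_def by blast
      moreover have "cnt (T # B') b' > 0" using that B' count_list_0_iff[of B' b'] by auto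
      ultimately show ?thesis using P by (intro has_coeff_lower) auto
    qed
    obtain c where c: "has_coeff f (- cnt A b) b c" using f1 b assms(4) unfolding div_ge_def by blast
    have "c \<noteq> 0"
    proof
      assume "c = 0"
      hence "has_coeff f (- cnt A b') b' 0" if "b' \<in> set B" for b'
        using z[OF that] c by (cases "b' = b") auto
      from interpolation_unique[OF f1 this assms] f(2)
      have "\<forall>\<^sub>F R in generic E. False" unfolding nonzero_fun_def by (auto elim: eventually_elim2)
      thus False using infinite_pts by (simp add: eventually_generic)
    qed
    thus ?thesis using f1 z c by (intro exI[of _ f] exI[of _ c]) auto
  qed
  then obtain F c where F: "\<And>b. b \<in> set B \<Longrightarrow> c b \<noteq> 0" "\<And>b. b \<in> set B \<Longrightarrow> div_ge (F b) (\<lambda>P. - cnt A P)"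
    "\<And>b b'. b \<in> set B \<Longrightarrow> b' \<in> set B \<Longrightarrow> has_coeff (F b) (- cnt A b') b' (if b' = b then c b else 0)"
    by metis
  define f where "f = (\<lambda>R. \<Sum>b\<in>set B. y b / c b * F b R)"
  have "div_ge f (\<lambda>P. - cnt A P)"
    unfolding f_def by (intro div_ge_sum div_ge_cmult F)
  moreover have "has_coeff f (- cnt A b') b' (y b')" if "b' \<in> set B" for b'
  proof -
    have "has_coeff f (- cnt A b') b' (\<Sum>b\<in>set B. y b / c b * (if b' = b then c b else 0))"
      unfolding f_def by (intro has_coeff_sum has_coeff_cmult F that)
    also have "(\<Sum>b\<in>set B. y b / c b * (if b' = b then c b else 0)) = (\<Sum>b\<in>set B. if b' = b then y b else 0)"
      by (intro sum.cong) (use F in auto)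
    also have "\<dots> = y b'" using that by simp
    finally show ?thesis .
  qed
  ultimately show ?thesis by blast
qed

end

section \<open>Rigidity and the homomorphism property of the quotient map\<close>

context smooth_weierstrass begin

text \<open>If \<open>R\<close> and \<open>R + T\<close> both double to \<open>k\<close>, then
  \<open>T + T\<close> is infinity. So two admissible points that differ by a \<open>T\<close> not
  equal to its negative cannot both fail.\<close>

lemma exists_double_neq:
  assumes ev: "\<forall>\<^sub>F R in generic E. \<phi> R"
  shows "\<exists>R\<in>pts. \<phi> R \<and> R \<boxplus> R \<noteq> k"
proof (rule ccontr)
  assume neg: "\<not> ?thesis"
  obtain T where T: "T \<in> pts" "\<boxminus>T \<noteq> T"
    using eventually_generic_ex[OF eventually_not_2torsion] by blast
  have "\<forall>\<^sub>F R in generic E. \<phi> R \<and> \<phi> (R \<boxplus> T)"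
    using ev eventually_translate[OF T(1) ev] by (simp add: eventually_conj_iff)
  from eventually_generic_ex[OF this] obtain R where R: "R \<in> pts" "\<phi> R" "\<phi> (R \<boxplus> T)" by blast
  have "R \<boxplus> R = k" "R \<boxplus> T \<boxplus> (R \<boxplus> T) = k" using neg R T by auto
  moreover have "R \<boxplus> T \<boxplus> (R \<boxplus> T) = R \<boxplus> R \<boxplus> (T \<boxplus> T)"
    using R T by (simp add: pt_ac)
  ultimately have "k \<boxplus> (T \<boxplus> T) = k \<boxplus> Infinity" by simp
  moreover have "k \<in> pts" using R \<open>R \<boxplus> R = k\<close> by auto
  ultimately have "T \<boxplus> T = Infinity" using T by simp
  thus False using T by (simp add: add_eq_Infinity_iff)
qed

lemma add_add_shift:
  assumes "a \<in> pts" "b \<in> pts" "d \<in> pts" "e \<in> pts"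
  shows "a \<boxplus> (d \<boxplus> \<boxminus>e) \<boxplus> (b \<boxplus> e) = a \<boxplus> b \<boxplus> d"
proof -
  have "a \<boxplus> w \<boxplus> (b \<boxplus> e) = a \<boxplus> b \<boxplus> (w \<boxplus> e)" if "w \<in> pts" for w
    using assms that by (simp add: pt_ac)
  from this[of "d \<boxplus> \<boxminus>e"] assms show ?thesis by simp
qed

lemma same_xc:
  assumes "P \<in> pts" "Q \<in> pts" "P \<noteq> Infinity" "Q \<noteq> Infinity" "xc P = xc Q"
  shows "P = Q \<or> P = \<boxminus>Q"
  using assms same_x_cases by (cases P; cases Q) auto

lemma regular_imp_const:
  assumes "\<And>P. P \<in> pts \<Longrightarrow> has_val E P f (g P)" "P \<in> pts" "Q \<in> pts"
  shows "g P = g Q"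
proof -
  have "affine_regular f" using assms(1) unfolding affine_regular_def by blast
  moreover have "has_val E Infinity (\<lambda>R. zc R * f R) (0 * g Infinity)"
    by (intro has_val.mult has_val_zc assms) simp
  ultimately obtain k where "\<forall>\<^sub>F R in generic E. f R = k" by (rule simple_pole_imp_const)
  hence "g P = k" if "P \<in> pts" for P
    using has_val_unique[OF has_val.cong[OF assms(1)[OF that]] has_val.const that] by blast
  thus ?thesis using assms by simp
qed

end

text \<open>
  Rigidity: for \<open>Q\<close> outside the kernel, \<open>P \<mapsto> \<rho>(P + Q) - \<rho>(P)\<close> never takes the value \<open>\<infinity>\<close>, so its
  coordinates are regular functions on a projective curve and hence constant.
\<close>
lemma quotient_map_hom:
  fixes E F :: "'f::alg_closed_field weierstrass"
  assumes E: "smooth_weierstrass E" and F: "smooth_weierstrass F"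
    and \<rho>: "\<rho> \<in> curve_points E \<rightarrow> curve_points F" "\<rho> Infinity = Infinity"
    and pull: "\<And>P f c. P \<in> curve_points E \<Longrightarrow> has_val F (\<rho> P) f c \<Longrightarrow> has_val E P (\<lambda>R. f (\<rho> R)) c"
    and evp: "\<And>\<phi>. \<forall>\<^sub>F R in generic F. \<phi> R \<Longrightarrow> \<forall>\<^sub>F R in generic E. \<phi> (\<rho> R)"
    and C: "C \<subseteq> curve_points E"
    and fib: "\<And>P Q. P \<in> curve_points E \<Longrightarrow> Q \<in> curve_points E \<Longrightarrow>
      \<rho> P = \<rho> Q \<longleftrightarrow> (\<exists>c\<in>C. Q = ec_add E P c)"
    and P: "P \<in> curve_points E" and Q: "Q \<in> curve_points E"
  shows "\<rho> (ec_add E P Q) = ec_add F (\<rho> P) (\<rho> Q)"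
proof -
  interpret Y: smooth_weierstrass E by fact
  interpret W: smooth_weierstrass F by fact
  have \<rho>p: "\<rho> R \<in> W.pts" if "R \<in> Y.pts" for R using \<rho>(1) that by blast
  show ?thesis
  proof (cases "Q \<in> C")
    case True
    hence "\<rho> P = \<rho> (ec_add E P Q)" using fib[OF P] P Q by auto
    moreover have "\<rho> Infinity = \<rho> Q" using fib[of Infinity Q] True Q by auto
    ultimately show ?thesis using \<rho>(2) by simp
  next
    case QC: False
    define \<theta> where "\<theta> = (\<lambda>R. ec_add F (\<rho> (ec_add E R Q)) (ec_neg F (\<rho> R)))"
    have \<theta>p: "\<theta> R \<in> W.pts" if "R \<in> Y.pts" for R using that Q by (simp add: \<theta>_def \<rho>p)
    have \<theta>_ne: "\<theta> R \<noteq> Infinity" if R: "R \<in> Y.pts" for R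
    proof
      assume "\<theta> R = Infinity"
      hence "\<rho> R = \<rho> (ec_add E R Q)"
        unfolding \<theta>_def W.add_eq_Infinity_iff W.neg_eq_iff .
      then obtain c where "c \<in> C" "ec_add E R Q = ec_add E R c" using fib[OF R] R Q by auto
      thus False using QC R Q C by auto
    qed
    have vals: "has_val E R (\<lambda>S. xc (\<theta> S)) (xc (\<theta> R)) \<and> has_val E R (\<lambda>S. yc (\<theta> S)) (yc (\<theta> R))"
      if R: "R \<in> Y.pts" for R
    proof -
      have RQ: "ec_add E R Q \<in> Y.pts" using R Q by simp
      have pR: "\<rho> R \<in> W.pts" "\<rho> (ec_add E R Q) \<in> W.pts" using \<rho>p R RQ by blast+
      note [simp] = pR \<theta>p[OF R]
      \<comment> \<open>The chord formula needs different x-coordinates, so \<open>\<theta>\<close>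
        at \<open>S\<close> is computed as \<open>(\<rho>(S + Q) + D1) + (D2 - \<rho>(S))\<close>
        minus \<open>D\<close>, where \<open>D1 + D2 = D\<close>. The auxiliary points are chosen so
        that both additions are chords at \<open>R\<close>.\<close>
      obtain D2 where D2: "D2 \<in> W.pts" "D2 \<noteq> \<rho> R"
        using W.eventually_generic_ex[OF W.eventually_neq] by blast
      define B' where "B' = ec_add F (ec_neg F (\<rho> R)) D2"
      have B': "B' \<in> W.pts" "B' \<noteq> Infinity"
        using D2 by (auto simp: B'_def W.add_eq_Infinity_iff)
      have "\<forall>\<^sub>F D in generic F. D \<noteq> Infinity \<and> D \<noteq> ec_neg F (\<theta> R) \<and>
          D \<noteq> ec_add F D2 (ec_neg F (\<rho> (ec_add E R Q))) \<and>
          D \<noteq> ec_add F (ec_add F B' D2) (ec_neg F (\<rho> (ec_add E R Q)))"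
        by (intro eventually_conj W.eventually_neq)
      \<comment> \<open>The exclusions keep \<open>A'\<close> apart from infinity and
        \<open>B'\<close>, and the sum of \<open>A'\<close> and \<open>B'\<close> apart from
        infinity; the condition on \<open>D + D\<close> keeps \<open>\<theta> R + D\<close> apart
        from \<open>-D\<close>, as the second chord requires.\<close>
      from W.exists_double_neq[OF this, of "ec_neg F (\<theta> R)"] obtain D where D: "D \<in> W.pts" "D \<noteq> Infinity"
        "D \<noteq> ec_neg F (\<theta> R)" "D \<noteq> ec_add F D2 (ec_neg F (\<rho> (ec_add E R Q)))"
        "D \<noteq> ec_add F (ec_add F B' D2) (ec_neg F (\<rho> (ec_add E R Q)))"
        "ec_add F D D \<noteq> ec_neg F (\<theta> R)" by blast
      define D1 where "D1 = ec_add F D (ec_neg F D2)"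
      define A' where "A' = ec_add F (\<rho> (ec_add E R Q)) D1"
      have D1: "D1 \<in> W.pts" and A'p: "A' \<in> W.pts" using D D2 by (simp_all add: D1_def A'_def)
      have Deq: "D = ec_add F (ec_add F T D2) (ec_neg F (\<rho> (ec_add E R Q)))" if "A' = T" "T \<in> W.pts" for T
      proof -
        have "ec_add F T D2 = ec_add F (\<rho> (ec_add E R Q)) D"
          unfolding that(1)[symmetric] A'_def D1_def using D D2 by (simp add: W.ec_add_assoc)
        also have "\<dots> = ec_add F D (\<rho> (ec_add E R Q))"
          by (rule W.ec_add_commute[OF pR(2) D(1)])
        finally have "ec_add F T D2 = ec_add F D (\<rho> (ec_add E R Q))" .
        thus ?thesis using D D2 that by simp
      qed
      have A': "A' \<noteq> Infinity" "A' \<noteq> B'"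
        using Deq[of Infinity] Deq[of B'] D B' by auto
      have AB: "ec_add F A' B' = ec_add F (\<theta> R) D"
        unfolding A'_def B'_def D1_def \<theta>_def using D D2 by (intro W.add_add_shift) simp_all
      have ne0: "ec_add F (\<theta> R) D \<noteq> Infinity" using D(3) W.add_eq_Infinity_iff by auto
      have AnB: "A' \<noteq> ec_neg F B'"
      proof
        assume "A' = ec_neg F B'"
        hence "ec_add F A' B' = Infinity" by simp
        thus False using AB ne0 by simp
      qed
      obtain x1 y1 x2 y2 where xy: "A' = Affine x1 y1" "B' = Affine x2 y2"
        using A'(1) B'(2) by (metis ec_point.exhaust)
      have x12: "x1 \<noteq> x2" using W.same_xc[OF A'p B'(1) A'(1) B'(2)] A'(2) AnB xy by auto
      obtain x3 y3 where x3: "ec_add F (\<theta> R) D = Affine x3 y3" using ne0 by (metis ec_point.exhaust)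
      obtain x4 y4 where x4: "ec_neg F D = Affine x4 y4" using D(2) by (metis ec_point.exhaust W.neg_eq_Infinity_iff)
      have x34: "x3 \<noteq> x4"
      proof
        assume "x3 = x4"
        hence "xc (ec_add F (\<theta> R) D) = xc (ec_neg F D)" unfolding x3 x4 by simp
        moreover have "ec_add F (\<theta> R) D \<in> W.pts" "ec_neg F D \<in> W.pts" "ec_neg F D \<noteq> Infinity"
          using D by simp_all
        ultimately have "ec_add F (\<theta> R) D = ec_neg F D \<or> ec_add F (\<theta> R) D = ec_neg F (ec_neg F D)"
          using W.same_xc ne0 by blast
        thus False
        proof
          assume "ec_add F (\<theta> R) D = ec_neg F D"
          hence "ec_add F (ec_add F (\<theta> R) D) D = Infinity" by simp
          hence "ec_add F (\<theta> R) (ec_add F D D) = Infinity" using D by (simp add: W.ec_add_assoc)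
          thus False using D(6) W.add_eq_Infinity_iff by blast
        next
          assume "ec_add F (\<theta> R) D = ec_neg F (ec_neg F D)"
          hence "ec_add F (\<theta> R) D = ec_add F Infinity D" by simp
          thus False using D(1) \<theta>_ne[OF R] by (simp del: ec_add.simps)
        qed
      qed
      obtain x5 y5 where x5: "\<theta> R = Affine x5 y5" using \<theta>_ne[OF R] by (metis ec_point.exhaust)
      let ?A = "\<lambda>S. ec_add F (\<rho> (ec_add E S Q)) D1" and ?B = "\<lambda>S. ec_add F (ec_neg F (\<rho> S)) D2"
      have vA: "has_val E R (\<lambda>S. f (?A S)) c" if "has_val F A' f c" for f c
      proof -
        have "has_val F (\<rho> (ec_add E R Q)) (\<lambda>S. f (ec_add F S D1)) c"
          by (rule W.has_val_translate) (use that D1 in \<open>simp_all add: A'_def\<close>)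
        from pull[OF RQ this] show ?thesis by (rule Y.has_val_translate[OF _ R Q])
      qed
      have vB: "has_val E R (\<lambda>S. f (?B S)) c" if "has_val F B' f c" for f c
      proof -
        have "has_val F (ec_neg F (\<rho> R)) (\<lambda>S. f (ec_add F S D2)) c"
          by (rule W.has_val_translate) (use that D2 in \<open>simp_all add: B'_def\<close>)
        from W.has_val_negate[OF this] have "has_val F (\<rho> R) (\<lambda>S. f (ec_add F (ec_neg F S) D2)) c" by simp
        from pull[OF R this] show ?thesis .
      qed
      have eA: "\<forall>\<^sub>F S in generic E. ?A S \<noteq> Infinity"
        by (rule Y.eventually_translate[OF Q evp[OF W.eventually_translate[OF D1 W.eventually_neq]]])
      have eB: "\<forall>\<^sub>F S in generic E. ?B S \<noteq> Infinity"
        by (rule evp[OF W.eventually_negate[OF W.eventually_translate[OF D2(1) W.eventually_neq]]])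
      have add1: "ec_add F (Affine x1 y1) (Affine x2 y2) = Affine x3 y3"
        using AB xy x3 by simp
      note s1 = has_val_ec_add_chord[OF E R vA[unfolded xy, OF has_val_xc] vA[unfolded xy, OF has_val_yc]
         vB[unfolded xy, OF has_val_xc] vB[unfolded xy, OF has_val_yc] x12 eA eB add1]
      have c4: "has_val E R (\<lambda>S. xc (Affine x4 y4)) x4" "has_val E R (\<lambda>S. yc (Affine x4 y4)) y4"
        by (simp_all add: has_val.const)
      have e4: "\<forall>\<^sub>F S in generic E. Affine x4 y4 \<noteq> Infinity" by simp
      have add2: "ec_add F (Affine x3 y3) (Affine x4 y4) = Affine x5 y5"
        unfolding x3[symmetric] x4[symmetric] x5[symmetric] using D by simp
      note s2 = has_val_ec_add_chord[OF E R s1(1,2) c4 x34 s1(3) e4 add2]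
      have eq: "\<forall>\<^sub>F S in generic E. ec_add F (ec_add F (?A S) (?B S)) (Affine x4 y4) = \<theta> S"
        using Y.eventually_in_pts
      proof eventually_elim
        case (elim S)
        have [simp]: "\<rho> S \<in> W.pts" "\<rho> (ec_add E S Q) \<in> W.pts" using elim Q \<rho>p by simp_all
        have "ec_add F (?A S) (?B S) = ec_add F (\<theta> S) D"
          unfolding D1_def \<theta>_def using D D2 by (intro W.add_add_shift) simp_all
        thus ?case unfolding x4[symmetric] using D \<theta>p[OF elim] by simp
      qed
      have "has_val E R (\<lambda>S. xc (\<theta> S)) x5"
        by (rule has_val.cong[OF s2(1)], use eq in eventually_elim) (simp only:)
      moreover have "has_val E R (\<lambda>S. yc (\<theta> S)) y5"
        by (rule has_val.cong[OF s2(2)], use eq in eventually_elim) (simp only:)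
      ultimately show ?thesis by (simp add: x5)
    qed
    have "xc (\<theta> P) = xc (\<theta> Infinity)" "yc (\<theta> P) = yc (\<theta> Infinity)"
      using Y.regular_imp_const[of "\<lambda>S. xc (\<theta> S)" "\<lambda>R. xc (\<theta> R)" P Infinity]
        Y.regular_imp_const[of "\<lambda>S. yc (\<theta> S)" "\<lambda>R. yc (\<theta> R)" P Infinity] vals P by auto
    hence "\<theta> P = \<theta> Infinity" using \<theta>_ne[OF P] \<theta>_ne[of Infinity]
      by (cases "\<theta> P"; cases "\<theta> Infinity") auto
    also have "\<theta> Infinity = \<rho> Q" using \<rho>(2) by (simp add: \<theta>_def)
    finally have "ec_add F (\<rho> (ec_add E P Q)) (ec_neg F (\<rho> P)) = \<rho> Q" by (simp add: \<theta>_def)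
    hence "\<rho> (ec_add E P Q) = ec_add F (\<rho> Q) (\<rho> P)"
      using \<rho>p P Q by (metis W.add_neg_cancel(2) Y.ec_add_in_pts)
    thus ?thesis using W.ec_add_commute \<rho>p P Q by simp
  qed
qed

subsection \<open>Isogenies as functions\<close>

text \<open>Only quotients of forms are functions. One dehomogenizing factor \<open>h\<close>,
  namely 1 at affine points and \<open>y^d\<close> at infinity, serves all forms of degree
  \<open>d\<close> and so cancels in quotients.\<close>

lemma has_val_form_at:
  fixes E :: "'k::field alg_closure weierstrass"
  assumes "smooth_weierstrass E" "P \<in> curve_points E"
  obtains h where "\<forall>\<^sub>F R in generic E. h R \<noteq> 0"
    "\<And>c. has_val E P (\<lambda>R. form_at d c R / h R) (form_at d c P)"
proof -
  interpret smooth_weierstrass E by fact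
  have form: "\<forall>\<^sub>F R in generic E. form_at d c R = (\<Sum>i\<le>d. \<Sum>j\<le>d - i. to_ac (c i j) * xc R ^ i * yc R ^ j)" for c
    using eventually_neq[of Infinity]
  proof eventually_elim
    case (elim R)
    then obtain x y where "R = Affine x y" by (cases R) auto
    thus ?case by simp
  qed
  show ?thesis
  proof (cases P)
    case (Affine x y)
    have "has_val E P (\<lambda>R. form_at d c R / 1) (form_at d c P)" for c
    proof (rule has_val_cong')
      show "has_val E P (\<lambda>R. \<Sum>i\<le>d. \<Sum>j\<le>d - i. to_ac (c i j) * xc R ^ i * yc R ^ j)
          (\<Sum>i\<le>d. \<Sum>j\<le>d - i. to_ac (c i j) * x ^ i * y ^ j)"
        unfolding Affine by (intro has_val_sum has_val_intros)
      show "\<forall>\<^sub>F R in generic E. (\<Sum>i\<le>d. \<Sum>j\<le>d - i. to_ac (c i j) * xc R ^ i * yc R ^ j) = form_at d c R / 1"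
        using form[of c] by eventually_elim simp
    qed (simp add: Affine)
    thus ?thesis using that[of "\<lambda>_. 1"] by simp
  next
    case Infinity
    have w: "has_val E P (\<lambda>R. 1 / yc R) 0" using Infinity by (rule has_val.one_over_y)
    have z: "has_val E P (\<lambda>R. zc R) 0" using Infinity by (rule has_val.x_over_y)
    have "has_val E P (\<lambda>R. form_at d c R / yc R ^ d) (form_at d c P)" for c
    proof (rule has_val_cong')
      show "has_val E P (\<lambda>R. \<Sum>i\<le>d. \<Sum>j\<le>d - i. to_ac (c i j) * zc R ^ i * (1 / yc R) ^ (d - i - j))
          (\<Sum>i\<le>d. \<Sum>j\<le>d - i. to_ac (c i j) * 0 ^ i * 0 ^ (d - i - j))"
        by (intro has_val_sum has_val.mult has_val_power has_val.const w z)
      show "\<forall>\<^sub>F R in generic E. (\<Sum>i\<le>d. \<Sum>j\<le>d - i. to_ac (c i j) * zc R ^ i * (1 / yc R) ^ (d - i - j)) = form_at d c R / yc R ^ d"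
        using form[of c] eventually_y_nonzero
      proof eventually_elim
        case (elim R)
        have "to_ac (c i j) * zc R ^ i * (1 / yc R) ^ (d - i - j) = to_ac (c i j) * xc R ^ i * yc R ^ j / yc R ^ d"
          if "i \<le> d" "j \<le> d - i" for i j
        proof -
          have "d = i + j + (d - i - j)" using that by simp
          hence "yc R ^ d = yc R ^ i * yc R ^ j * yc R ^ (d - i - j)" by (metis power_add)
          thus ?thesis using elim(2) by (simp add: power_divide)
        qed
        thus ?case unfolding elim(1) sum_divide_distrib by (intro sum.cong) auto
      qed
    qed (simp add: Infinity)
    moreover have "\<forall>\<^sub>F R in generic E. yc R ^ d \<noteq> 0"
      using eventually_y_nonzero by eventually_elim simp
    ultimately show ?thesis using that[of "\<lambda>R. yc R ^ d"] by simp
  qed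
qed

text \<open>Near \<open>P\<close> the map is given by forms F, G, H. The coordinates of the image
  are F/H and G/H if \<open>\<rho> P\<close> is affine; if it is infinity, x/y and 1/y are F/G and
  H/G. \<open>has_val_pullback\<close> does the rest.\<close>

lemma curve_morphism_pullback:
  fixes Y W :: "'k::field weierstrass"
  assumes Y: "smooth_weierstrass (geom Y)" and mor: "curve_morphism Y W \<rho>"
    and evp: "\<And>\<phi>. \<forall>\<^sub>F R in generic (geom W). \<phi> R \<Longrightarrow> \<forall>\<^sub>F R in generic (geom Y). \<phi> (\<rho> R)"
    and P: "P \<in> geom_points Y" and f: "has_val (geom W) (\<rho> P) f c"
  shows "has_val (geom Y) P (\<lambda>R. f (\<rho> R)) c"
proof (rule has_val_pullback[OF f evp])
  interpret smooth_weierstrass "geom Y" by fact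
  have "\<forall>P\<in>geom_points Y. \<exists>d F G H.
        (form_at d F P, form_at d G P, form_at d H P) \<noteq> (0, 0, 0) \<and>
        (\<forall>Q\<in>geom_points Y. (form_at d F Q, form_at d G Q, form_at d H Q) \<noteq> (0, 0, 0) \<longrightarrow>
           (case hcoords (\<rho> Q) of (x, y, z) \<Rightarrow>
              \<exists>s. form_at d F Q = s * x \<and> form_at d G Q = s * y \<and> form_at d H Q = s * z))"
    using mor unfolding curve_morphism_def by (rule conjunct2)
  from bspec[OF this P] obtain d F G H where nz: "(form_at d F P, form_at d G P, form_at d H P) \<noteq> (0, 0, 0)"
    and all': "\<forall>Q\<in>geom_points Y. (form_at d F Q, form_at d G Q, form_at d H Q) \<noteq> (0, 0, 0) \<longrightarrow>
           (case hcoords (\<rho> Q) of (x, y, z) \<Rightarrow>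
              \<exists>s. form_at d F Q = s * x \<and> form_at d G Q = s * y \<and> form_at d H Q = s * z)"
    by (elim exE conjE)
  note all = bspec[OF all', THEN mp]
  obtain h where h: "\<forall>\<^sub>F R in generic (geom Y). h R \<noteq> 0"
    "\<And>c. has_val (geom Y) P (\<lambda>R. form_at d c R / h R) (form_at d c P)"
    by (rule has_val_form_at[OF Y P, where d = d]) (rule that)
  have quot: "has_val (geom Y) P (\<lambda>R. form_at d c R / form_at d e R) (form_at d c P / form_at d e P)"
    if "form_at d e P \<noteq> 0" for c e
  proof (rule has_val.cong[OF has_val_divide[OF h(2)[of c] h(2)[of e] that]])
    show "\<forall>\<^sub>F R in generic (geom Y). form_at d c R / h R / (form_at d e R / h R) = form_at d c R / form_at d e R"
      using h(1) by eventually_elim simp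
  qed
  have gnz: "\<forall>\<^sub>F R in generic (geom Y). form_at d e R \<noteq> 0" if "form_at d e P \<noteq> 0" for e
    using has_val_nonzero[OF h(2) P that] by (rule eventually_mono) auto
  {
    fix x y assume xy: "\<rho> P = Affine x y"
    from all[OF P nz] obtain s where s: "form_at d F P = s * x" "form_at d G P = s * y" "form_at d H P = s"
      using xy by auto
    hence s0: "form_at d H P \<noteq> 0" using nz by auto
    have eq: "\<forall>\<^sub>F R in generic (geom Y). form_at d F R / form_at d H R = xc (\<rho> R) \<and> form_at d G R / form_at d H R = yc (\<rho> R)"
      using gnz[OF s0] eventually_in_pts
    proof eventually_elim
      case (elim R)
      show ?case using all[OF elim(2)] elim(1) by (cases "\<rho> R") auto
    qed
    have "form_at d F P / form_at d H P = x" "form_at d G P / form_at d H P = y" using s s0 by auto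
    with quot[OF s0, of F] quot[OF s0, of G] have
      "has_val (geom Y) P (\<lambda>R. form_at d F R / form_at d H R) x"
      "has_val (geom Y) P (\<lambda>R. form_at d G R / form_at d H R) y" by (simp_all only:)
    thus "has_val (geom Y) P (\<lambda>Q. xc (\<rho> Q)) x \<and> has_val (geom Y) P (\<lambda>Q. yc (\<rho> Q)) y"
      by (intro conjI; elim has_val.cong) (use eq in \<open>eventually_elim, blast\<close>)+
  }
  {
    assume O: "\<rho> P = Infinity"
    from all[OF P nz] obtain s where s: "form_at d F P = 0" "form_at d G P = s" "form_at d H P = 0"
      using O by auto
    hence s0: "form_at d G P \<noteq> 0" using nz by auto
    have "\<forall>\<^sub>F R in generic (geom W). R \<noteq> Infinity"
      by (simp add: eventually_generic)
    from evp[OF this] have inf: "\<forall>\<^sub>F R in generic (geom Y). \<rho> R \<noteq> Infinity" .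
    have eq: "\<forall>\<^sub>F R in generic (geom Y). form_at d F R / form_at d G R = xc (\<rho> R) / yc (\<rho> R) \<and> form_at d H R / form_at d G R = 1 / yc (\<rho> R)"
      using gnz[OF s0] eventually_in_pts inf
    proof eventually_elim
      case (elim R)
      show ?case using all[OF elim(2)] elim(1,3) by (cases "\<rho> R") auto
    qed
    have "form_at d F P / form_at d G P = 0" "form_at d H P / form_at d G P = 0" using s s0 by auto
    with quot[OF s0, of F] quot[OF s0, of H] have
      "has_val (geom Y) P (\<lambda>R. form_at d F R / form_at d G R) 0"
      "has_val (geom Y) P (\<lambda>R. form_at d H R / form_at d G R) 0" by (simp_all only:)
    thus "has_val (geom Y) P (\<lambda>Q. xc (\<rho> Q) / yc (\<rho> Q)) 0 \<and> has_val (geom Y) P (\<lambda>Q. 1 / yc (\<rho> Q)) 0"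
      by (intro conjI; elim has_val.cong) (use eq in \<open>eventually_elim, blast\<close>)+
  }
qed

lemma quotient_isogeny_hom:
  fixes Y W :: "'k::field weierstrass"
  assumes Y: "smooth_weierstrass (geom Y)" and W: "smooth_weierstrass (geom W)"
    and q: "quotient_isogeny Y C W \<rho>" and C: "C \<subseteq> geom_points Y" "finite C"
    and P: "P \<in> geom_points Y" and Q: "Q \<in> geom_points Y"
  shows "\<rho> (ec_add (geom Y) P Q) = ec_add (geom W) (\<rho> P) (\<rho> Q)"
proof -
  have mor: "curve_morphism Y W \<rho>" and O: "\<rho> Infinity = Infinity"
    and fib: "\<And>P Q. P \<in> geom_points Y \<Longrightarrow> Q \<in> geom_points Y \<Longrightarrow>
        \<rho> P = \<rho> Q \<longleftrightarrow> (\<exists>c\<in>C. Q = ec_add (geom Y) P c)"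
    using q by (auto simp: quotient_isogeny_def isogeny_def ec_group_def)
  have maps: "\<rho> \<in> geom_points Y \<rightarrow> geom_points W" using mor by (simp add: curve_morphism_def)
  \<comment> \<open>The fibres are translates of the finite group \<open>C\<close>, so exceptional
    sets pull back to finite sets.\<close>
  have evp: "\<forall>\<^sub>F R in generic (geom Y). \<phi> (\<rho> R)" if "\<forall>\<^sub>F R in generic (geom W). \<phi> R" for \<phi>
    unfolding eventually_generic
  proof -
    have fin: "finite {R \<in> geom_points W. \<not> \<phi> R}" using that unfolding eventually_generic .
    have "finite {R \<in> geom_points Y. \<rho> R = S}" for S
    proof (cases "\<exists>R\<in>geom_points Y. \<rho> R = S")
      case True
      then obtain R where R: "R \<in> geom_points Y" "\<rho> R = S" by blast
      have "{R' \<in> geom_points Y. \<rho> R' = S} \<subseteq> ec_add (geom Y) R ` C" using fib[OF R(1)] R(2) by blast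
      thus ?thesis using C(2) finite_surj by blast
    next
      case False
      hence "{R \<in> geom_points Y. \<rho> R = S} = {}" by blast
      thus ?thesis by (simp only: finite.emptyI)
    qed
    hence "finite (\<Union>S\<in>{R \<in> geom_points W. \<not> \<phi> R}. {R \<in> geom_points Y. \<rho> R = S})"
      using fin by blast
    moreover have "{R \<in> geom_points Y. \<not> \<phi> (\<rho> R)} \<subseteq> \<dots>" using maps by blast
    ultimately show "finite {R \<in> geom_points Y. \<not> \<phi> (\<rho> R)}" by (rule rev_finite_subset)
  qed
  show ?thesis
    by (rule quotient_map_hom[OF Y W maps O _ evp C(1) fib P Q])
       (rule curve_morphism_pullback[OF Y mor evp])
qed

section \<open>The Frobenius action\<close>

definition frob :: "'k::finite_field alg_closure \<Rightarrow> 'k alg_closure" where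
  "frob x = x ^ CARD('k)"

lemma frob_add [simp]: "frob (x + y) = frob x + frob y"
  using q_power_add[of x y 1] by (simp add: frob_def)

lemma frob_mult [simp]: "frob (x * y) = frob x * frob y"
  by (simp add: frob_def power_mult_distrib)

lemma frob_0 [simp]: "frob 0 = 0"
  by (simp add: frob_def)

lemma frob_minus [simp]: "frob (- x) = - frob x"
  using q_power_minus[of x 1] by (simp add: frob_def)

lemma frob_diff [simp]: "frob (x - y) = frob x - frob y"
  using frob_add[of x "- y"] by simp

lemma frob_inverse [simp]: "frob (inverse x) = inverse (frob x)"
  by (simp add: frob_def power_inverse)

lemma frob_divide [simp]: "frob (x / y) = frob x / frob y"
  by (simp add: frob_def power_divide)

lemma frob_power [simp]: "frob (x ^ n) = frob x ^ n"
  by (simp add: frob_def flip: power_mult) (simp add: mult.commute)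

lemma frob_powi: "frob (x powi n) = frob x powi n"
  by (simp add: power_int_def)

lemma frob_to_ac [simp]: "frob (to_ac a) = to_ac a"
  by (simp add: frob_def finite_field_power_card_eq_same flip: to_ac_power)

lemma frob_1 [simp]: "frob 1 = 1"
  by (simp add: frob_def)

lemma frob_numeral [simp]: "frob (numeral w) = numeral w"
  using frob_to_ac[of "numeral w"] by simp

lemma frob_sum: "frob (\<Sum>i\<in>I. f i) = (\<Sum>i\<in>I. frob (f i))"
  by (induction I rule: infinite_finite_induct) auto

lemma frob_eq_0_iff [simp]: "frob x = 0 \<longleftrightarrow> x = 0"
  by (simp add: frob_def)

lemma inj_frob: "inj (frob :: 'k::finite_field alg_closure \<Rightarrow> _)"
proof (rule injI)
  fix x y :: "'k alg_closure" assume "frob x = frob y"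
  hence "frob (x - y) = 0" by simp
  thus "x = y" unfolding frob_eq_0_iff by simp
qed

lemma frob_eq_iff [simp]: "frob x = frob y \<longleftrightarrow> x = y"
  using inj_frob by (auto simp: inj_def)

lemma surj_frob: "surj (frob :: 'k::finite_field alg_closure \<Rightarrow> _)"
proof -
  have "\<exists>y. frob y = x" for x :: "'k alg_closure"
    using nth_root_exists[of "CARD('k)" x] by (simp add: frob_def)
  thus ?thesis by (metis surjI)
qed

lemma card_ge_2: "CARD('k::finite_field) \<ge> 2"
  using card_mono[of "UNIV :: 'k set" "{0, 1}"] by simp

lemma frob_fixed_iff:
  fixes x :: "'k::finite_field alg_closure"
  shows "frob x = x \<longleftrightarrow> x \<in> range to_ac"
proof -
  have "finite (ext_field 1 :: 'k::finite_field alg_closure set)"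
    using card_ge_2[where ?'k = 'k] by (intro card_ge_0_finite) (simp add: card_ext_field)
  hence "range to_ac = (ext_field 1 :: 'k alg_closure set)"
    by (intro card_subset_eq) (auto simp: to_ac_in_ext_field card_ext_field card_image[OF inj_to_ac])
  thus ?thesis
    by (auto simp: ext_field_def frob_def)
qed

abbreviation "frob_pt \<equiv> map_ec_point frob"

lemma bij_frob_pt: "bij (frob_pt :: 'k::finite_field alg_closure ec_point \<Rightarrow> _)"
proof (rule bijI)
  show "inj (frob_pt :: 'k alg_closure ec_point \<Rightarrow> _)" by (rule ec_point.inj_map[OF inj_frob])
  have "frob_pt (map_ec_point (inv_into UNIV frob) P) = P" for P :: "'k alg_closure ec_point"
    by (cases P) (simp_all add: surj_f_inv_f[OF surj_frob])
  thus "surj (frob_pt :: 'k alg_closure ec_point \<Rightarrow> _)" by (metis surjI)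
qed

abbreviation "frob_pt_inv \<equiv> inv_into UNIV frob_pt"

lemma frob_pt_inv [simp]: "frob_pt (frob_pt_inv P) = P" "frob_pt_inv (frob_pt P) = P"
  by (rule surj_f_inv_f[OF bij_is_surj[OF bij_frob_pt]], rule inv_f_f[OF bij_is_inj[OF bij_frob_pt]])

lemma xc_frob_pt [simp]: "xc (frob_pt P) = frob (xc P)"
  by (cases P) auto

lemma yc_frob_pt [simp]: "yc (frob_pt P) = frob (yc P)"
  by (cases P) auto

lemma frob_xc_inv: "frob (xc (frob_pt_inv P)) = xc P"
  by (metis frob_pt_inv(1) xc_frob_pt)

lemma frob_yc_inv: "frob (yc (frob_pt_inv P)) = yc P"
  by (metis frob_pt_inv(1) yc_frob_pt)

lemma frob_pt_in_pts_iff: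
  fixes Y :: "'k::finite_field weierstrass"
  shows "frob_pt P \<in> geom_points Y \<longleftrightarrow> P \<in> geom_points Y"
proof (cases P)
  case (Affine x y)
  have "frob_pt P \<in> geom_points Y \<longleftrightarrow>
    frob (y^2 + wa1 (geom Y) * x * y + wa3 (geom Y) * y) = frob (x^3 + wa2 (geom Y) * x^2 + wa4 (geom Y) * x + wa6 (geom Y))"
    unfolding Affine by (simp add: curve_points_def weierstrass.map_sel)
  thus ?thesis unfolding frob_eq_iff by (simp add: Affine curve_points_def)
qed (simp add: curve_points_def)

lemma frob_pt_neg:
  fixes Y :: "'k::finite_field weierstrass"
  shows "frob_pt (ec_neg (geom Y) P) = ec_neg (geom Y) (frob_pt P)"
  by (cases P) (auto simp: weierstrass.map_sel)

lemma frob_pt_add: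
  fixes Y :: "'k::finite_field weierstrass"
  shows "frob_pt (ec_add (geom Y) P Q) = ec_add (geom Y) (frob_pt P) (frob_pt Q)"
proof (cases "P = Infinity \<or> Q = Infinity")
  case True thus ?thesis by (cases P; cases Q) auto
next
  case False
  then obtain x1 y1 x2 y2 where PQ: "P = Affine x1 y1" "Q = Affine x2 y2"
    by (cases P; cases Q) auto
  have eq: "frob_pt Q = ec_neg (geom Y) (frob_pt P) \<longleftrightarrow> Q = ec_neg (geom Y) P"
    by (metis frob_pt_neg frob_pt_inv(2))
  show ?thesis
  proof (cases "Q = ec_neg (geom Y) P")
    case True
    thus ?thesis using eq PQ by simp
  next
    case False
    hence "ec_add (geom Y) P Q =
     (let l = (if x1 \<noteq> x2 then (y2 - y1) / (x2 - x1)
                   else (3 * x1^2 + 2 * wa2 (geom Y) * x1 + wa4 (geom Y) - wa1 (geom Y) * y1) /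
                        (2 * y1 + wa1 (geom Y) * x1 + wa3 (geom Y)));
              x3 = l^2 + wa1 (geom Y) * l - wa2 (geom Y) - x1 - x2
          in Affine x3 (- (l + wa1 (geom Y)) * x3 - (y1 - l * x1) - wa3 (geom Y)))"
      unfolding PQ ec_add.simps by (simp only: if_False)
    moreover have "frob_pt Q \<noteq> ec_neg (geom Y) (frob_pt P)" using False eq by simp
    hence "ec_add (geom Y) (frob_pt P) (frob_pt Q) =
     (let l = (if frob x1 \<noteq> frob x2 then (frob y2 - frob y1) / (frob x2 - frob x1)
                   else (3 * frob x1^2 + 2 * wa2 (geom Y) * frob x1 + wa4 (geom Y) - wa1 (geom Y) * frob y1) /
                        (2 * frob y1 + wa1 (geom Y) * frob x1 + wa3 (geom Y)));
              x3 = l^2 + wa1 (geom Y) * l - wa2 (geom Y) - frob x1 - frob x2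
          in Affine x3 (- (l + wa1 (geom Y)) * x3 - (frob y1 - l * frob x1) - wa3 (geom Y)))"
      unfolding PQ ec_point.map ec_add.simps by (simp only: if_False)
    ultimately show ?thesis by (simp add: Let_def weierstrass.map_sel)
  qed
qed

lemma rat_points_iff:
  fixes Y :: "'k::finite_field weierstrass"
  shows "P \<in> rat_points Y \<longleftrightarrow> P \<in> geom_points Y \<and> frob_pt P = P"
proof (cases P)
  case (Affine x y)
  have "Affine (to_ac a) (to_ac b) \<in> geom_points Y \<longleftrightarrow> Affine a b \<in> curve_points Y" for a b
  proof -
    have "Affine (to_ac a) (to_ac b) \<in> geom_points Y \<longleftrightarrow>
      to_ac (b^2 + wa1 Y * a * b + wa3 Y * b) = to_ac (a^3 + wa2 Y * a^2 + wa4 Y * a + wa6 Y)"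
      by (simp add: curve_points_def weierstrass.map_sel)
    thus ?thesis unfolding to_ac_eq_iff by (simp add: curve_points_def)
  qed
  note * = this
  show ?thesis
  proof
    assume "P \<in> rat_points Y"
    then obtain Q where Q: "Q \<in> curve_points Y" "P = map_ec_point to_ac Q" by (auto simp: rat_points_def)
    with Affine obtain a b where "Q = Affine a b" by (cases Q) auto
    thus "P \<in> geom_points Y \<and> frob_pt P = P" using Q * by simp
  next
    assume A: "P \<in> geom_points Y \<and> frob_pt P = P"
    then obtain a b where "x = to_ac a" "y = to_ac b" using Affine frob_fixed_iff by (metis ec_point.inject ec_point.map(2) imageE)
    thus "P \<in> rat_points Y" using A * Affine unfolding rat_points_def
      by (intro image_eqI[of _ _ "Affine a b"]) auto
  qed
next
  case Infinity
  have "Infinity \<in> rat_points Y"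
    unfolding rat_points_def by (rule image_eqI[of _ _ Infinity]) (auto simp: curve_points_def)
  thus ?thesis by (simp add: Infinity curve_points_def)
qed

text \<open>\<open>hcoords\<close> chooses one representative of each projective point, so
  proportional representatives are equal.\<close>

lemma hcoords_scalar:
  assumes "s \<noteq> 0" "case hcoords P of (x, y, z) \<Rightarrow> a = s * x \<and> b = s * y \<and> c = s * z"
    "case hcoords Q of (x, y, z) \<Rightarrow> a = s' * x \<and> b = s' * y \<and> c = s' * z"
  shows "P = Q"
  using assms by (cases P; cases Q) auto

lemma frob_form_at: "frob (form_at d c P) = form_at d c (frob_pt P)"
  by (cases P) (simp_all add: frob_sum)

text \<open>The forms have coefficients in the base field, so Frobenius commutes with their
  evaluation; both sides of the equation are then represented by the same homogeneous
  coordinates.\<close>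

lemma curve_morphism_frob:
  fixes Y W :: "'k::finite_field weierstrass"
  assumes mor: "curve_morphism Y W \<rho>" and P: "P \<in> geom_points Y"
  shows "\<rho> (frob_pt P) = frob_pt (\<rho> P)"
proof -
  have "\<forall>P\<in>geom_points Y. \<exists>d F G H.
        (form_at d F P, form_at d G P, form_at d H P) \<noteq> (0, 0, 0) \<and>
        (\<forall>Q\<in>geom_points Y. (form_at d F Q, form_at d G Q, form_at d H Q) \<noteq> (0, 0, 0) \<longrightarrow>
           (case hcoords (\<rho> Q) of (x, y, z) \<Rightarrow>
              \<exists>s. form_at d F Q = s * x \<and> form_at d G Q = s * y \<and> form_at d H Q = s * z))"
    using mor unfolding curve_morphism_def by (rule conjunct2)
  from bspec[OF this P] obtain d F G H where nz: "(form_at d F P, form_at d G P, form_at d H P) \<noteq> (0, 0, 0)"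
    and all': "\<forall>Q\<in>geom_points Y. (form_at d F Q, form_at d G Q, form_at d H Q) \<noteq> (0, 0, 0) \<longrightarrow>
           (case hcoords (\<rho> Q) of (x, y, z) \<Rightarrow>
              \<exists>s. form_at d F Q = s * x \<and> form_at d G Q = s * y \<and> form_at d H Q = s * z)"
    by (elim exE conjE)
  note all = bspec[OF all', THEN mp]
  have nz': "(form_at d F (frob_pt P), form_at d G (frob_pt P), form_at d H (frob_pt P)) \<noteq> (0, 0, 0)"
    using nz unfolding frob_form_at[symmetric] by simp
  from all[OF P nz] obtain s where s: "case hcoords (\<rho> P) of (x, y, z) \<Rightarrow>
      form_at d F P = s * x \<and> form_at d G P = s * y \<and> form_at d H P = s * z" by (cases "\<rho> P") auto
  have s0: "frob s \<noteq> 0" using s nz by (cases "\<rho> P") auto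
  have 1: "case hcoords (frob_pt (\<rho> P)) of (x, y, z) \<Rightarrow> form_at d F (frob_pt P) = frob s * x \<and>
      form_at d G (frob_pt P) = frob s * y \<and> form_at d H (frob_pt P) = frob s * z"
    unfolding frob_form_at[symmetric] using s by (cases "\<rho> P") auto
  from all[OF _ nz'] P obtain s' where 2: "case hcoords (\<rho> (frob_pt P)) of (x, y, z) \<Rightarrow>
      form_at d F (frob_pt P) = s' * x \<and> form_at d G (frob_pt P) = s' * y \<and> form_at d H (frob_pt P) = s' * z"
    by (cases "\<rho> (frob_pt P)") (auto simp: frob_pt_in_pts_iff)
  from hcoords_scalar[OF s0 1 2] show ?thesis by simp
qed

text \<open>Frobenius applied to the coefficients of the rational function \<open>f\<close>.\<close>

definition frob_conj :: "('k::finite_field alg_closure ec_point \<Rightarrow> 'k alg_closure) \<Rightarrow> 'k alg_closure ec_point \<Rightarrow> 'k alg_closure" where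
  "frob_conj f R = frob (f (frob_pt_inv R))"

lemma eventually_frob:
  fixes Y :: "'k::finite_field weierstrass"
  assumes "\<forall>\<^sub>F R in generic (geom Y). \<phi> R"
  shows "\<forall>\<^sub>F R in generic (geom Y). \<phi> (frob_pt_inv R)"
proof (rule eventually_generic_inj[OF _ _ assms])
  show "inj_on frob_pt_inv (geom_points Y)"
    using bij_imp_bij_inv[OF bij_frob_pt] by (auto simp: bij_def inj_def inj_on_def)
  show "frob_pt_inv \<in> geom_points Y \<rightarrow> geom_points Y"
    by (intro Pi_I) (metis frob_pt_in_pts_iff frob_pt_inv(1))
qed

lemma has_val_frob:
  fixes Y :: "'k::finite_field weierstrass"
  assumes "has_val (geom Y) P f c"
  shows "has_val (geom Y) (frob_pt P) (frob_conj f) (frob c)"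
  using assms
proof induction
  case (const c)
  show ?case unfolding frob_conj_def[abs_def] by (rule has_val.const)
next
  case (xc x y)
  show ?case unfolding frob_conj_def[abs_def] frob_xc_inv xc by (simp add: has_val_xc)
next
  case (yc x y)
  show ?case unfolding frob_conj_def[abs_def] frob_yc_inv yc by (simp add: has_val_yc)
next
  case x_over_y
  show ?case unfolding frob_conj_def[abs_def] frob_divide frob_yc_inv frob_xc_inv x_over_y
    by (simp add: has_val.x_over_y)
next
  case one_over_y
  show ?case unfolding frob_conj_def[abs_def] frob_divide frob_yc_inv frob_1 one_over_y
    by (simp add: has_val.one_over_y)
next
  case (add f c g d)
  from has_val.add[OF add.IH] show ?case by (simp add: frob_conj_def[abs_def])
next
  case (mult f c g d)
  from has_val.mult[OF mult.IH] show ?case by (simp add: frob_conj_def[abs_def])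
next
  case (inverse f c)
  have "frob c \<noteq> 0" using inverse.hyps by simp
  from has_val.inverse[OF inverse.IH this] show ?case by (simp add: frob_conj_def[abs_def])
next
  case (cong f c g)
  show ?case
    by (rule has_val.cong[OF cong.IH], use eventually_frob[OF cong.hyps(2)] in eventually_elim)
       (simp add: frob_conj_def)
qed

locale frob_curve =
  fixes Y :: "'k::finite_field weierstrass"
  assumes smooth_geom: "smooth_curve (geom Y)"
begin

sublocale smooth_weierstrass "geom Y"
  by unfold_locales (rule smooth_geom)

notation plus_pt (infixl "\<boxplus>" 65)
notation neg_pt ("\<boxminus>_" [81] 80)

text \<open>Conjugating \<open>local_param P\<close> gives exactly
  \<open>local_param (frob_pt P)\<close>, because x/y and the addition are defined over the base
  field. So coefficients are conjugated without an extra factor.\<close>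

lemma has_coeff_frob:
  assumes "has_coeff f j P c" "P \<in> pts"
  shows "has_coeff (frob_conj f) j (frob_pt P) (frob c)"
proof -
  have "has_val (geom Y) (frob_pt P) (frob_conj (\<lambda>R. f R * local_param P R powi (- j))) (frob c)"
    by (rule has_val_frob[OF assms(1)[unfolded has_coeff_def]])
  moreover have "frob (local_param P (frob_pt_inv R)) = local_param (frob_pt P) R" for R
  proof -
    have "frob (local_param P (frob_pt_inv R)) = zc (frob_pt (frob_pt_inv R \<boxplus> \<boxminus>P))"
      by (simp add: local_param_def)
    also have "\<dots> = local_param (frob_pt P) R"
      unfolding frob_pt_add frob_pt_neg frob_pt_inv local_param_def ..
    finally show ?thesis .
  qed
  ultimately show ?thesis
    unfolding has_coeff_def by (simp add: frob_conj_def[abs_def] frob_powi)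
qed

lemma div_ge_frob:
  assumes "div_ge f D" "\<And>P. P \<in> pts \<Longrightarrow> D (frob_pt P) = D P"
  shows "div_ge (frob_conj f) D"
  unfolding div_ge_def
proof (intro ballI)
  fix P assume P: "P \<in> pts"
  have Q: "frob_pt_inv P \<in> pts" using P by (metis frob_pt_in_pts_iff frob_pt_inv(1))
  then obtain c where "has_coeff f (D (frob_pt_inv P)) (frob_pt_inv P) c"
    using assms(1) unfolding div_ge_def by blast
  from has_coeff_frob[OF this Q] assms(2)[OF Q] show "\<exists>c. has_coeff (frob_conj f) (D P) P c" by auto
qed

end

section \<open>Multiples of points and sequences indexed by the cyclic group\<close>

context smooth_weierstrass begin

primrec mul :: "'f ec_point \<Rightarrow> nat \<Rightarrow> 'f ec_point" where
  "mul P 0 = Infinity"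
| "mul P (Suc k) = mul P k \<boxplus> P"

lemma mul_eq_nat_pow: "mul P k = P [^]\<^bsub>ec_group E\<^esub> k"
  by (induction k) (simp_all add: ec_group_simps)

declare mul.simps(2) [simp del]

lemma mul_in_pts [simp]: "P \<in> pts \<Longrightarrow> mul P k \<in> pts"
  by (induction k) (simp_all add: mul.simps)

lemma mul_Infinity [simp]: "mul Infinity k = Infinity"
  by (induction k) (simp_all add: mul.simps)

lemma mul_add: "P \<in> pts \<Longrightarrow> mul P (i + j) = mul P i \<boxplus> mul P j"
  by (induction j) (simp_all add: mul.simps ec_add_assoc)

lemma mul_mul: "P \<in> pts \<Longrightarrow> mul (mul P i) j = mul P (i * j)"
  by (induction j) (simp_all add: mul.simps mul_add ec_add_commute)

lemma mul_distrib: "P \<in> pts \<Longrightarrow> Q \<in> pts \<Longrightarrow> mul (P \<boxplus> Q) k = mul P k \<boxplus> mul Q k"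
  by (induction k) (simp_all add: mul.simps pt_ac)

end

definition periodic_seqs :: "nat \<Rightarrow> (nat \<Rightarrow> 'k) set" where
  "periodic_seqs n = {y. \<forall>k. y (k + n) = y k}"

text \<open>A model of \<open>L\<^bsup>n2\<^esup>\<close> in which the generator of the cyclic group is the shift.\<close>
definition twisted_seqs :: "nat \<Rightarrow> nat \<Rightarrow> (nat \<Rightarrow> 'k::finite_field alg_closure) set" where
  "twisted_seqs n1 n2 = {x. (\<forall>k. x (k + n2) = frob (x k)) \<and> (\<forall>k. x (k + n1 * n2) = x k)}"

lemma periodic_mod:
  assumes "y \<in> periodic_seqs n"
  shows "y (k mod n) = y k"
proof -
  have "y (i + j * n) = y i" for i j
  proof (induction j)
    case (Suc j)
    have "y (i + Suc j * n) = y (i + j * n + n)" by (simp add: add_ac)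
    thus ?case using Suc assms by (simp add: periodic_seqs_def)
  qed auto
  from this[of "k mod n" "k div n"] show ?thesis by simp
qed

text \<open>The points \<open>a0\<close>, \<open>v0\<close>, \<open>u0\<close> lie above \<open>a\<close>, \<open>v\<close>, \<open>u\<close>; for a suitable choice of the generator \<open>t\<close>, the
  Frobenius acts on the fibre of \<open>a\<close> as translation by \<open>n2\<close> times \<open>t\<close>.\<close>
locale cyclic_cover = frob_curve Y for Y :: "'k::finite_field weierstrass" +
  fixes n n1 n2 m :: nat and t a0 v0 u0 :: "'k alg_closure ec_point"
  assumes n: "n = n1 * n2" "n > 0"
    and t: "t \<in> pts" "frob_pt t = t"
    and ord_t: "\<And>k. mul t (k::nat) = Infinity \<longleftrightarrow> n dvd k"
    and pts0: "a0 \<in> pts" "v0 \<in> pts" "u0 \<in> pts"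
    and frob_a: "frob_pt a0 = a0 \<boxplus> mul t n2"
    and frob_v: "frob_pt v0 = v0 \<boxplus> mul t m"
    and frob_u: "frob_pt u0 = u0"
    and u_notin: "\<And>k::nat. u0 \<noteq> mul t k"
    and na: "mul a0 n \<noteq> mul v0 n"
    and nu: "mul u0 n \<noteq> mul v0 (2 * n)"
begin

abbreviation p :: "nat \<Rightarrow> 'k alg_closure ec_point" where
  "p k \<equiv> mul t k"

lemma p_in_pts [simp]: "p k \<in> pts"
  using t by simp

lemma p_add: "p (i + j) = p i \<boxplus> p j"
  using t by (simp add: mul_add)

lemma p_Suc: "p (Suc k) = p k \<boxplus> t"
  by (rule mul.simps)

lemma p_n [simp]: "p n = Infinity"
  using ord_t by simp

lemma p_periodic: "p (k + n) = p k"
  by (simp add: p_add)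

lemma p_mod: "p (k mod n) = p k"
  using periodic_mod[of p n k] by (simp add: periodic_seqs_def p_periodic)

lemma p_inj: "p i = p j \<longleftrightarrow> i mod n = j mod n"
proof -
  have *: "p i = p j \<Longrightarrow> i mod n = j mod n" if "i \<le> j" for i j
  proof -
    assume "p i = p j"
    moreover have "p j = p (j - i) \<boxplus> p i" using that by (simp flip: p_add)
    ultimately have "Infinity \<boxplus> p i = p (j - i) \<boxplus> p i" by simp
    hence "p (j - i) = Infinity" using add_right_cancel[of Infinity "p (j - i)" "p i"] by simp
    hence "n dvd j - i" by (simp add: ord_t)
    thus "i mod n = j mod n" using that by (metis mod_eq_dvd_iff_nat)
  qed
  thus ?thesis by (metis linorder_le_cases p_mod)
qed

lemma frob_p [simp]: "frob_pt (p k) = p k"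
proof (induction k)
  case (Suc k)
  thus ?case using t by (simp only: p_Suc frob_pt_add)
qed simp

definition orbit :: "'k alg_closure ec_point \<Rightarrow> 'k alg_closure ec_point list" where
  "orbit b = map (\<lambda>k. b \<boxplus> p k) [0..<n]"

lemma set_orbit: "b \<in> pts \<Longrightarrow> set (orbit b) = {b \<boxplus> p k |k. True}"
proof -
  assume b: "b \<in> pts"
  have "b \<boxplus> p k \<in> set (orbit b)" for k
  proof -
    have "k mod n < n" using n(2) by simp
    hence "b \<boxplus> p (k mod n) \<in> set (orbit b)" by (auto simp: orbit_def simp del: mod_less_divisor)
    thus ?thesis by (simp only: p_mod)
  qed
  thus ?thesis by (auto simp: orbit_def)
qed

lemma orbit_pts: "b \<in> pts \<Longrightarrow> set (orbit b) \<subseteq> pts"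
  by (auto simp: orbit_def)

lemma distinct_orbit: "b \<in> pts \<Longrightarrow> distinct (orbit b)"
  by (auto simp: orbit_def distinct_map inj_on_def p_inj)

lemma length_orbit [simp]: "length (orbit b) = n"
  by (simp add: orbit_def)

lemma psum_map_add:
  assumes "b \<in> pts"
  shows "psum (map (\<lambda>k. b \<boxplus> p k) ks) = mul b (length ks) \<boxplus> psum (map p ks)"
proof (induction ks)
  case (Cons k ks)
  have in_pts: "psum (map p ks) \<in> pts" by (rule psum_in_pts) auto
  have "psum (map (\<lambda>k. b \<boxplus> p k) (k # ks)) = b \<boxplus> p k \<boxplus> (mul b (length ks) \<boxplus> psum (map p ks))"
    using Cons by simp
  also have "\<dots> = mul b (length ks) \<boxplus> b \<boxplus> (p k \<boxplus> psum (map p ks))"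
    using assms in_pts by (simp add: pt_ac)
  finally show ?case by (simp add: mul.simps)
qed simp

lemma psum_orbit: "b \<in> pts \<Longrightarrow> psum (orbit b) = mul b n \<boxplus> psum (map p [0..<n])"
  unfolding orbit_def using psum_map_add[of b "[0..<n]"] by simp

lemma psum_p_in_pts [simp]: "psum (map p ks) \<in> pts"
  by (rule psum_in_pts) auto

definition D1 :: "'k alg_closure ec_point \<Rightarrow> int" where "D1 P = - cnt (orbit v0) P"

lemma D1_altdef: "P \<in> pts \<Longrightarrow> D1 P = - of_bool (\<exists>k. P = v0 \<boxplus> p k)"
proof -
  have "cnt (orbit v0) P = of_bool (P \<in> set (orbit v0))" for P
  proof -
    have "count_list xs P = of_bool (P \<in> set xs)" if "distinct xs" for xs
      using that by (induction xs) (auto simp: count_list_0_iff)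
    thus ?thesis using distinct_orbit[OF pts0(2)] by simp
  qed
  thus ?thesis using set_orbit[OF pts0(2)] by (simp add: D1_def)
qed

lemma D1_translate: "P \<in> pts \<Longrightarrow> D1 (P \<boxplus> t) = D1 P"
proof -
  assume P: "P \<in> pts"
  have "(\<exists>k. P \<boxplus> t = v0 \<boxplus> p k) \<longleftrightarrow> (\<exists>k. P = v0 \<boxplus> p k)"
  proof safe
    fix k assume "P \<boxplus> t = v0 \<boxplus> p k"
    hence "P \<boxplus> t \<boxplus> p (n - 1) = v0 \<boxplus> p k \<boxplus> p (n - 1)" by simp
    moreover have "t \<boxplus> p (n - 1) = Infinity"
    proof -
      have "p (Suc (n - 1)) = p (n - 1) \<boxplus> t" by (rule p_Suc)
      moreover have "Suc (n - 1) = n" using n(2) by simp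
      ultimately have "p (n - 1) \<boxplus> t = Infinity" by (simp only: p_n)
      thus ?thesis using ec_add_commute[OF p_in_pts t(1)] by simp
    qed
    ultimately have "P = v0 \<boxplus> p (k + (n - 1))"
      using P t pts0 by (simp add: ec_add_assoc p_add)
    thus "\<exists>k. P = v0 \<boxplus> p k" by blast
  next
    fix k
    have "v0 \<boxplus> p k \<boxplus> t = v0 \<boxplus> p (Suc k)" using pts0 t by (simp add: ec_add_assoc p_Suc)
    thus "\<exists>k'. v0 \<boxplus> p k \<boxplus> t = v0 \<boxplus> p k'" by blast
  qed
  thus ?thesis using P t by (simp add: D1_altdef)
qed

lemma D1_frob: "P \<in> pts \<Longrightarrow> D1 (frob_pt P) = D1 P"
proof -
  assume P: "P \<in> pts"
  have fv: "frob_pt (v0 \<boxplus> p k) = v0 \<boxplus> p (m + k)" for k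
    using pts0 by (simp add: frob_pt_add frob_v p_add ec_add_assoc)
  have "(\<exists>k. frob_pt P = v0 \<boxplus> p k) \<longleftrightarrow> (\<exists>k. P = v0 \<boxplus> p k)"
  proof safe
    fix k assume k: "frob_pt P = v0 \<boxplus> p k"
    \<comment> \<open>The index is moved back by \<open>m\<close> modulo \<open>n\<close>; adding
      \<open>m * n\<close> first keeps the subtraction of naturals exact.\<close>
    have "m \<le> m * n" using n(2) by simp
    hence "m \<le> k + m * n" by (rule trans_le_add2)
    hence "m + (k + m * n - m) = k + m * n" by (rule le_add_diff_inverse)
    hence "frob_pt (v0 \<boxplus> p (k + m * n - m)) = v0 \<boxplus> p (k + m * n)" using fv by simp
    also have "p (k + m * n) = p k" by (simp add: p_inj)
    finally have "frob_pt (v0 \<boxplus> p (k + m * n - m)) = frob_pt P" using k by simp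
    hence "P = v0 \<boxplus> p (k + m * n - m)" by (metis frob_pt_inv(2))
    thus "\<exists>k. P = v0 \<boxplus> p k" by blast
  next
    fix k
    show "\<exists>k'. frob_pt (v0 \<boxplus> p k) = v0 \<boxplus> p k'" using fv by blast
  qed
  thus ?thesis using P by (simp add: D1_altdef frob_pt_in_pts_iff)
qed

text \<open>\<open>n\<close> times a point depends only on its coset modulo the multiples of
  \<open>t\<close>, so \<open>na\<close> keeps the fibres of \<open>a\<close> and \<open>v\<close>
  disjoint.\<close>

lemma D1_fibre: "D1 (a0 \<boxplus> p k) = 0"
proof -
  have "a0 \<boxplus> p k \<noteq> v0 \<boxplus> p k'" for k'
  proof
    assume "a0 \<boxplus> p k = v0 \<boxplus> p k'"
    hence "mul (a0 \<boxplus> p k) n = mul (v0 \<boxplus> p k') n" by simp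
    hence "mul a0 n \<boxplus> mul (p k) n = mul v0 n \<boxplus> mul (p k') n"
      using pts0 by (simp add: mul_distrib)
    moreover have "mul (p k) n = Infinity" for k
      using t by (simp add: mul_mul ord_t)
    ultimately show False using na by simp
  qed
  thus ?thesis using pts0 by (simp add: D1_altdef)
qed

lemma frob_fibre: "frob_pt (a0 \<boxplus> p k) = a0 \<boxplus> p (k + n2)"
  using pts0 by (simp add: frob_pt_add frob_a p_add ec_add_assoc ec_add_commute[of "p n2"])

subsection \<open>Functions with poles in the fibre of \<open>v\<close>\<close>

text \<open>The index \<open>k\<close> numbers the fibre of \<open>a\<close> by multiples of the
  generator. Since this fibre carries no poles, plain values can be prescribed there.\<close>

definition rep :: "(nat \<Rightarrow> 'k alg_closure) \<Rightarrow> ('k alg_closure ec_point \<Rightarrow> 'k alg_closure) \<Rightarrow> bool" where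
  "rep x f \<longleftrightarrow> div_ge f D1 \<and> (\<forall>k. has_val (geom Y) (a0 \<boxplus> p k) f (x k))"

lemma psum_ne1: "psum (orbit v0) \<noteq> psum (orbit a0)"
  using na pts0 by (auto simp: psum_orbit)

lemma rep_zero_unique:
  assumes "rep (\<lambda>_. 0) f"
  shows "\<forall>\<^sub>F R in generic (geom Y). f R = 0"
proof (rule interpolation_unique[of f "orbit v0" "orbit a0"])
  show "div_ge f (\<lambda>P. - cnt (orbit v0) P)" using assms by (simp add: rep_def D1_def[abs_def])
  fix b assume "b \<in> set (orbit a0)"
  then obtain k where "b = a0 \<boxplus> p k" by (auto simp: orbit_def)
  thus "has_coeff f (- cnt (orbit v0) b) b 0"
    using assms D1_fibre[of k] by (simp add: rep_def D1_def has_coeff_0_iff)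
qed (use pts0 psum_ne1 in \<open>simp_all add: orbit_pts distinct_orbit\<close>)

lemma rep_add: "rep x f \<Longrightarrow> rep y g \<Longrightarrow> rep (\<lambda>k. x k + y k) (\<lambda>R. f R + g R)"
  unfolding rep_def by (auto intro: div_ge_add has_val.add)

lemma rep_cmult: "rep x f \<Longrightarrow> rep (\<lambda>k. c * x k) (\<lambda>R. c * f R)"
  unfolding rep_def by (auto intro: div_ge_cmult has_val.mult has_val.const)

lemma rep_unique:
  assumes "rep x f" "rep x g"
  shows "\<forall>\<^sub>F R in generic (geom Y). f R = g R"
proof -
  have "rep (\<lambda>k. x k + - 1 * x k) (\<lambda>R. f R + - 1 * g R)"
    by (intro rep_add rep_cmult assms)
  hence "rep (\<lambda>_. 0) (\<lambda>R. f R + - 1 * g R)" by simp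
  from rep_zero_unique[OF this] show ?thesis by (rule eventually_mono) simp
qed

lemma div_ge_D1_shift: 
  assumes "div_ge f (\<lambda>P. j * D1 P)"
  shows "div_ge (\<lambda>R. f (R \<boxplus> t)) (\<lambda>P. j * D1 P)"
  by (rule div_ge_mono[OF div_ge_translate[OF assms t(1)]]) (simp add: D1_translate)

lemma rep_shift:
  assumes "rep x f"
  shows "rep (\<lambda>k. x (Suc k)) (\<lambda>R. f (R \<boxplus> t))"
  unfolding rep_def
proof (intro conjI allI)
  show "div_ge (\<lambda>R. f (R \<boxplus> t)) D1"
    using div_ge_D1_shift[of f 1] assms by (simp add: rep_def)
  fix k
  have "a0 \<boxplus> p k \<boxplus> t = a0 \<boxplus> p (Suc k)" using pts0 t by (simp add: ec_add_assoc p_Suc)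
  thus "has_val (geom Y) (a0 \<boxplus> p k) (\<lambda>R. f (R \<boxplus> t)) (x (Suc k))"
    using assms pts0 t by (intro has_val_translate) (simp_all add: rep_def)
qed

text \<open>The index stands for \<open>k - n2\<close> modulo \<open>n\<close>, written without
  leaving the naturals.\<close>

lemma twisted_seq_shift_back:
  assumes "x \<in> twisted_seqs n1 n2"
  shows "x k = frob (x (k + n - n2))"
proof -
  have "n2 \<le> n" using n by (cases n1) auto
  hence "x (k + n - n2 + n2) = x (k + n)" by simp
  thus ?thesis using assms n by (simp add: twisted_seqs_def)
qed

lemma p_shift_back: "p (k + n - n2 + n2) = p k"
proof -
  have "n2 \<le> n" using n by (cases n1) auto
  thus ?thesis by (simp add: p_periodic)
qed

text \<open>Frobenius moves the fibre of \<open>a\<close> by \<open>n2\<close> steps and raises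
  values to the power q; the defining relation of \<open>twisted_seqs\<close> says that both effects
  cancel. With \<open>rep_unique\<close>, this means that \<open>f\<close> is defined over the base
  field.\<close>

lemma rep_frob:
  assumes "rep x f" "x \<in> twisted_seqs n1 n2"
  shows "rep x (frob_conj f)"
  unfolding rep_def
proof (intro conjI allI)
  show "div_ge (frob_conj f) D1"
    using assms by (intro div_ge_frob D1_frob) (auto simp: rep_def)
  fix k
  have "has_val (geom Y) (frob_pt (a0 \<boxplus> p (k + n - n2))) (frob_conj f) (frob (x (k + n - n2)))"
    using assms by (intro has_val_frob) (simp add: rep_def)
  thus "has_val (geom Y) (a0 \<boxplus> p k) (frob_conj f) (x k)"
    unfolding frob_fibre p_shift_back twisted_seq_shift_back[OF assms(2), symmetric] .
qed

text \<open>Periodicity makes data indexed by \<open>k\<close> a well-defined function of the point,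
  the form in which \<open>interpolation_exists\<close> takes its data.\<close>

lemma index_fun:
  assumes "b \<in> pts" "y \<in> periodic_seqs n"
  obtains Y' where "\<And>k. Y' (b \<boxplus> p k) = y k"
proof
  fix k
  let ?i = "SOME i. b \<boxplus> p k = b \<boxplus> p i"
  have "b \<boxplus> p k = b \<boxplus> p ?i" by (rule someI[of _ k]) simp
  hence "p k = p ?i" using assms by simp
  hence "k mod n = ?i mod n" by (simp only: p_inj)
  thus "y (SOME i. b \<boxplus> p k = b \<boxplus> p i) = y k"
    using periodic_mod[OF assms(2), of k] periodic_mod[OF assms(2), of ?i] by simp
qed

lemma twisted_imp_periodic: "x \<in> twisted_seqs n1 n2 \<Longrightarrow> x \<in> periodic_seqs n"
  using n by (simp add: twisted_seqs_def periodic_seqs_def)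

lemma rep_exists:
  assumes "x \<in> periodic_seqs n"
  shows "\<exists>f. rep x f"
proof -
  obtain Y' where Y': "\<And>k. Y' (a0 \<boxplus> p k) = x k" using index_fun[OF pts0(1) assms] by blast
  have "\<exists>f. div_ge f (\<lambda>P. - cnt (orbit v0) P) \<and> (\<forall>b\<in>set (orbit a0). has_coeff f (- cnt (orbit v0) b) b (Y' b))"
    using pts0 psum_ne1 by (intro interpolation_exists) (simp_all add: orbit_pts distinct_orbit)
  then obtain f where f: "div_ge f (\<lambda>P. - cnt (orbit v0) P)"
    "\<forall>b\<in>set (orbit a0). has_coeff f (- cnt (orbit v0) b) b (Y' b)" by (elim exE conjE)
  have "has_val (geom Y) (a0 \<boxplus> p k) f (x k)" for k
  proof -
    have "a0 \<boxplus> p k \<in> set (orbit a0)" using set_orbit[OF pts0(1)] by auto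
    with f(2) have "has_coeff f (D1 (a0 \<boxplus> p k)) (a0 \<boxplus> p k) (Y' (a0 \<boxplus> p k))" by (simp add: D1_def)
    thus ?thesis by (simp add: D1_fibre has_coeff_0_iff Y')
  qed
  thus ?thesis using f(1) unfolding rep_def by (auto simp: D1_def[abs_def])
qed

text \<open>Leading coefficients instead of values, as \<open>f\<close> has poles at \<open>b + C\<close> if \<open>b\<close> lies above \<open>v\<close>.\<close>
definition top_map :: "'k alg_closure ec_point \<Rightarrow> (nat \<Rightarrow> 'k alg_closure) \<Rightarrow> nat \<Rightarrow> 'k" where
  "top_map b x k = of_ac (THE c. has_coeff (SOME f. rep x f) (D1 (b \<boxplus> p k)) (b \<boxplus> p k) c)"

text \<open>At a rational point the coefficients of the function and of its Frobenius conjugate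
  agree by \<open>rep_frob\<close> and \<open>rep_unique\<close>, so they lie in the base field and
  \<open>of_ac\<close> loses nothing. The same uniqueness frees the result from the choice made by
  \<open>SOME\<close>.\<close>

lemma has_coeff_top_map:
  assumes f: "rep x f" and x: "x \<in> twisted_seqs n1 n2" and b: "b \<in> pts" "frob_pt b = b"
  shows "has_coeff f (D1 (b \<boxplus> p k)) (b \<boxplus> p k) (to_ac (top_map b x k))"
proof -
  let ?P = "b \<boxplus> p k"
  define g where "g = (SOME f. rep x f)"
  have g: "rep x g" unfolding g_def by (rule someI[of _ f]) (rule f)
  have P: "?P \<in> pts" "frob_pt ?P = ?P" using b by (simp_all add: frob_pt_add)
  obtain c where c: "has_coeff g (D1 ?P) ?P c" using g P unfolding rep_def div_ge_def by blast
  have "has_coeff (frob_conj g) (D1 ?P) (frob_pt ?P) (frob c)"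
    by (rule has_coeff_frob[OF c P(1)])
  from has_coeff_cong[OF this rep_unique[OF rep_frob[OF g x] g]]
  have "has_coeff g (D1 ?P) ?P (frob c)" by (simp add: P)
  from has_coeff_unique[OF this c P(1)] have "c \<in> range to_ac" by (simp add: frob_fixed_iff)
  moreover have "(THE c. has_coeff g (D1 ?P) ?P c) = c"
    by (rule the_equality) (use c has_coeff_unique P in blast)+
  ultimately have "to_ac (top_map b x k) = c"
    unfolding top_map_def g_def[symmetric] by (metis to_ac_of_ac)
  thus ?thesis using has_coeff_cong[OF c rep_unique[OF g f]] by simp
qed

text \<open>Additivity, scaling and shift below all follow from this by exhibiting one function with
  the required values above \<open>a\<close>.\<close>

lemma top_map_eqI:
  assumes "rep x f" "x \<in> twisted_seqs n1 n2" "b \<in> pts" "frob_pt b = b"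
    and "has_coeff f (D1 (b \<boxplus> p k)) (b \<boxplus> p k) (to_ac c)"
  shows "top_map b x k = c"
  using has_coeff_unique[OF has_coeff_top_map[OF assms(1-4)] assms(5)] assms(3) by simp

lemma twisted_seqs_add: "x \<in> twisted_seqs n1 n2 \<Longrightarrow> y \<in> twisted_seqs n1 n2 \<Longrightarrow> (\<lambda>k. x k + y k) \<in> twisted_seqs n1 n2"
  by (simp add: twisted_seqs_def)

lemma twisted_seqs_scale: "x \<in> twisted_seqs n1 n2 \<Longrightarrow> (\<lambda>k. to_ac r * x k) \<in> twisted_seqs n1 n2"
  by (simp add: twisted_seqs_def)

lemma twisted_seqs_shift: "x \<in> twisted_seqs n1 n2 \<Longrightarrow> (\<lambda>k. x (Suc k)) \<in> twisted_seqs n1 n2"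
proof -
  assume x: "x \<in> twisted_seqs n1 n2"
  have "x (Suc k + n2) = frob (x (Suc k))" "x (Suc k + n1 * n2) = x (Suc k)" for k
    using x unfolding twisted_seqs_def by blast+
  thus ?thesis by (simp add: twisted_seqs_def)
qed

context
  fixes b assumes b: "b \<in> pts" "frob_pt b = b"
begin

lemma top_map_periodic: "top_map b x \<in> periodic_seqs n"
  by (simp add: periodic_seqs_def top_map_def p_periodic)

lemma top_map_add:
  assumes "x \<in> twisted_seqs n1 n2" "y \<in> twisted_seqs n1 n2"
  shows "top_map b (\<lambda>k. x k + y k) k = top_map b x k + top_map b y k"
proof -
  obtain f g where fg: "rep x f" "rep y g" using rep_exists[OF twisted_imp_periodic] assms by blast
  show ?thesis
    by (rule top_map_eqI[OF rep_add[OF fg] _ b])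
       (use assms fg b in \<open>auto intro!: twisted_seqs_add has_coeff_add has_coeff_top_map\<close>)
qed

lemma top_map_scale:
  assumes "x \<in> twisted_seqs n1 n2"
  shows "top_map b (\<lambda>k. to_ac r * x k) k = r * top_map b x k"
proof -
  obtain f where f: "rep x f" using rep_exists[OF twisted_imp_periodic] assms by blast
  show ?thesis
    by (rule top_map_eqI[OF rep_cmult[OF f] _ b])
       (use assms f b in \<open>auto intro!: twisted_seqs_scale has_coeff_cmult has_coeff_top_map\<close>)
qed

lemma top_map_shift:
  assumes "x \<in> twisted_seqs n1 n2"
  shows "top_map b (\<lambda>k. x (Suc k)) k = top_map b x (Suc k)"
proof -
  obtain f where f: "rep x f" using rep_exists[OF twisted_imp_periodic] assms by blast
  have eq: "b \<boxplus> p k \<boxplus> t = b \<boxplus> p (Suc k)" using b t by (simp add: ec_add_assoc p_Suc)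
  have "has_coeff f (D1 (b \<boxplus> p (Suc k))) (b \<boxplus> p (Suc k)) (to_ac (top_map b x (Suc k)))"
    by (rule has_coeff_top_map[OF f assms b])
  hence "has_coeff f (D1 (b \<boxplus> p k)) (b \<boxplus> p k \<boxplus> t) (to_ac (top_map b x (Suc k)))"
    unfolding eq[symmetric] using b by (simp add: D1_translate)
  hence "has_coeff (\<lambda>R. f (R \<boxplus> t)) (D1 (b \<boxplus> p k)) (b \<boxplus> p k) (to_ac (top_map b x (Suc k)))"
    by (rule has_coeff_translate) (use b t in simp_all)
  from top_map_eqI[OF rep_shift[OF f] twisted_seqs_shift[OF assms] b this] show ?thesis .
qed

end

subsection \<open>Products\<close>

text \<open>The data lie in the base field since the fibres of 0 and \<open>u\<close> consist of
  rational points; coefficients at order \<open>2 * D1\<close> replace values in case one of these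
  fibres meets the poles.\<close>

definition rep2 :: "(nat \<Rightarrow> 'k) \<Rightarrow> (nat \<Rightarrow> 'k) \<Rightarrow> ('k alg_closure ec_point \<Rightarrow> 'k alg_closure) \<Rightarrow> bool" where
  "rep2 y z f \<longleftrightarrow> div_ge f (\<lambda>P. 2 * D1 P) \<and>
     (\<forall>k. has_coeff f (2 * D1 (p k)) (p k) (to_ac (y k))) \<and>
     (\<forall>k. has_coeff f (2 * D1 (u0 \<boxplus> p k)) (u0 \<boxplus> p k) (to_ac (z k)))"

lemma D2_eq': "- cnt (orbit v0 @ orbit v0) P = 2 * D1 P"
  by (simp add: D1_def)

lemma D2_eq: "(\<lambda>P. - cnt (orbit v0 @ orbit v0) P) = (\<lambda>P. 2 * D1 P)"
  by (simp add: D1_def fun_eq_iff)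

lemma psum_ne2: "psum (orbit v0 @ orbit v0) \<noteq> psum (orbit Infinity @ orbit u0)"
proof
  let ?s = "psum (map p [0..<n])"
  assume "psum (orbit v0 @ orbit v0) = psum (orbit Infinity @ orbit u0)"
  hence eq: "(mul v0 n \<boxplus> ?s) \<boxplus> (mul v0 n \<boxplus> ?s) = ?s \<boxplus> (mul u0 n \<boxplus> ?s)"
    using pts0 by (simp add: psum_append psum_orbit orbit_pts)
  have "(mul v0 n \<boxplus> mul v0 n) \<boxplus> (?s \<boxplus> ?s) = (mul v0 n \<boxplus> ?s) \<boxplus> (mul v0 n \<boxplus> ?s)"
    using pts0 by (simp add: pt_ac)
  also have "\<dots> = mul u0 n \<boxplus> (?s \<boxplus> ?s)"
    unfolding eq using pts0 by (simp add: pt_ac)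
  finally have "mul v0 n \<boxplus> mul v0 n = mul u0 n" using pts0 by simp
  moreover have "mul v0 n \<boxplus> mul v0 n = mul v0 (2 * n)"
    using pts0 by (simp add: mul_add mult_2)
  ultimately show False using nu by simp
qed

lemma u0_notin_orbit: "p k \<noteq> u0 \<boxplus> p k'"
proof
  assume "p k = u0 \<boxplus> p k'"
  \<comment> \<open>\<open>k' * (n - 1)\<close> represents \<open>- k'\<close> modulo
    \<open>n\<close>.\<close>
  hence "p k \<boxplus> p (k' * (n - 1)) = u0 \<boxplus> (p k' \<boxplus> p (k' * (n - 1)))"
    using pts0 by (simp add: ec_add_assoc)
  moreover have "p k' \<boxplus> p (k' * (n - 1)) = Infinity"
  proof -
    have "k' + k' * (n - 1) = k' * n" using n(2) by (cases n) auto
    thus ?thesis by (simp add: ord_t flip: p_add)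
  qed
  ultimately have "u0 = p (k + k' * (n - 1))" by (simp add: p_add)
  thus False using u_notin by blast
qed

lemma orbits_disjoint: "distinct (orbit Infinity @ orbit u0)"
  using distinct_orbit[of Infinity] distinct_orbit[of u0] pts0 u0_notin_orbit
  by (auto simp: set_orbit) 

lemma rep2_exists:
  assumes "y \<in> periodic_seqs n" "z \<in> periodic_seqs n"
  shows "\<exists>f. rep2 y z f"
proof -
  have per: "(\<lambda>k. to_ac (w k)) \<in> periodic_seqs n" if "w \<in> periodic_seqs n" for w
    using that by (simp add: periodic_seqs_def)
  obtain Y' where Y': "\<And>k. Y' (Infinity \<boxplus> p k) = to_ac (y k)"
    using index_fun[OF Infinity_in_pts per[OF assms(1)]] by blast
  obtain Z' where Z': "\<And>k. Z' (u0 \<boxplus> p k) = to_ac (z k)"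
    using index_fun[OF pts0(3) per[OF assms(2)]] by blast
  define w where "w P = (if P \<in> set (orbit u0) then Z' P else Y' P)" for P
  have "\<exists>f. div_ge f (\<lambda>P. - cnt (orbit v0 @ orbit v0) P) \<and>
      (\<forall>b\<in>set (orbit Infinity @ orbit u0). has_coeff f (- cnt (orbit v0 @ orbit v0) b) b (w b))"
    using pts0 psum_ne2 orbits_disjoint by (intro interpolation_exists) (simp_all add: orbit_pts)
  then obtain f where f: "div_ge f (\<lambda>P. - cnt (orbit v0 @ orbit v0) P)"
    "\<forall>b\<in>set (orbit Infinity @ orbit u0). has_coeff f (- cnt (orbit v0 @ orbit v0) b) b (w b)"
    by (elim exE conjE)
  have f2: "has_coeff f (2 * D1 b) b (w b)" if "b \<in> set (orbit Infinity) \<union> set (orbit u0)" for b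
    using f(2)[unfolded D2_eq'] that by simp
  have "has_coeff f (2 * D1 (p k)) (p k) (to_ac (y k))" for k
  proof -
    have "p k \<in> set (orbit Infinity)" by (auto simp: set_orbit)
    moreover have "p k \<notin> set (orbit u0)" using u0_notin_orbit pts0 by (auto simp: set_orbit)
    hence "w (p k) = to_ac (y k)" using Y'[of k] by (simp add: w_def)
    ultimately show ?thesis using f2[of "p k"] by simp
  qed
  moreover have "has_coeff f (2 * D1 (u0 \<boxplus> p k)) (u0 \<boxplus> p k) (to_ac (z k))" for k
  proof -
    have "u0 \<boxplus> p k \<in> set (orbit u0)" using pts0 by (auto simp: set_orbit)
    moreover from this have "w (u0 \<boxplus> p k) = to_ac (z k)" using Z'[of k] by (simp add: w_def)
    ultimately show ?thesis using f2[of "u0 \<boxplus> p k"] by simp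
  qed
  ultimately show ?thesis using f(1) unfolding rep2_def D2_eq by blast
qed

lemma rep2_zero_unique:
  assumes "rep2 (\<lambda>_. 0) (\<lambda>_. 0) f"
  shows "\<forall>\<^sub>F R in generic (geom Y). f R = 0"
proof (rule interpolation_unique[of f "orbit v0 @ orbit v0" "orbit Infinity @ orbit u0"])
  show "div_ge f (\<lambda>P. - cnt (orbit v0 @ orbit v0) P)" unfolding D2_eq using assms by (simp add: rep2_def)
  fix b assume "b \<in> set (orbit Infinity @ orbit u0)"
  hence "(\<exists>k. b = p k) \<or> (\<exists>k. b = u0 \<boxplus> p k)" using pts0 by (auto simp: set_orbit)
  hence "has_coeff f (2 * D1 b) b 0" using assms by (auto simp: rep2_def)
  thus "has_coeff f (- cnt (orbit v0 @ orbit v0) b) b 0" by (simp only: D2_eq')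
qed (use pts0 psum_ne2 orbits_disjoint in \<open>simp_all add: orbit_pts\<close>)

lemma rep2_add: "rep2 y z f \<Longrightarrow> rep2 y' z' g \<Longrightarrow> rep2 (\<lambda>k. y k + y' k) (\<lambda>k. z k + z' k) (\<lambda>R. f R + g R)"
  unfolding rep2_def by (auto intro: div_ge_add has_coeff_add)

lemma rep2_scale: "rep2 y z f \<Longrightarrow> rep2 (\<lambda>k. r * y k) (\<lambda>k. r * z k) (\<lambda>R. to_ac r * f R)"
  unfolding rep2_def by (auto intro: div_ge_cmult has_coeff_cmult)

lemma rep2_unique:
  assumes "rep2 y z f" "rep2 y z g"
  shows "\<forall>\<^sub>F R in generic (geom Y). f R = g R"
proof -
  have "rep2 (\<lambda>k. y k + - 1 * y k) (\<lambda>k. z k + - 1 * z k) (\<lambda>R. f R + to_ac (- 1) * g R)"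
    by (intro rep2_add rep2_scale assms)
  hence "rep2 (\<lambda>_. 0) (\<lambda>_. 0) (\<lambda>R. f R + to_ac (- 1) * g R)" by simp
  from rep2_zero_unique[OF this] show ?thesis by (rule eventually_mono) simp
qed

lemma rep2_shift:
  assumes "rep2 y z f"
  shows "rep2 (\<lambda>k. y (Suc k)) (\<lambda>k. z (Suc k)) (\<lambda>R. f (R \<boxplus> t))"
  unfolding rep2_def
proof (intro conjI allI)
  show "div_ge (\<lambda>R. f (R \<boxplus> t)) (\<lambda>P. 2 * D1 P)"
    using div_ge_D1_shift assms by (simp add: rep2_def)
  have *: "has_coeff (\<lambda>R. f (R \<boxplus> t)) (2 * D1 (b \<boxplus> p k)) (b \<boxplus> p k) c"
    if "has_coeff f (2 * D1 (b \<boxplus> p (Suc k))) (b \<boxplus> p (Suc k)) c" "b \<in> pts" for b c k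
  proof (rule has_coeff_translate)
    have "b \<boxplus> p k \<boxplus> t = b \<boxplus> p (Suc k)" using that t by (simp add: ec_add_assoc p_Suc)
    thus "has_coeff f (2 * D1 (b \<boxplus> p k)) (b \<boxplus> p k \<boxplus> t) c"
      using that D1_translate[of "b \<boxplus> p k"] by (simp)
  qed (use that t in simp_all)
  fix k
  show "has_coeff (\<lambda>R. f (R \<boxplus> t)) (2 * D1 (p k)) (p k) (to_ac (y (Suc k)))"
    using *[of Infinity k "to_ac (y (Suc k))"] assms by (simp add: rep2_def)
  show "has_coeff (\<lambda>R. f (R \<boxplus> t)) (2 * D1 (u0 \<boxplus> p k)) (u0 \<boxplus> p k) (to_ac (z (Suc k)))"
    using *[of u0 k "to_ac (z (Suc k))"] assms pts0 by (simp add: rep2_def)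
qed

lemma rep2_frob:
  assumes "rep2 y z f"
  shows "rep2 y z (frob_conj f)"
  unfolding rep2_def
proof (intro conjI allI)
  show "div_ge (frob_conj f) (\<lambda>P. 2 * D1 P)"
    using assms by (intro div_ge_frob) (auto simp: rep2_def D1_frob)
  fix k
  show "has_coeff (frob_conj f) (2 * D1 (p k)) (p k) (to_ac (y k))"
    using has_coeff_frob[of f "2 * D1 (p k)" "p k" "to_ac (y k)"] assms by (simp add: rep2_def)
  have "frob_pt (u0 \<boxplus> p k) = u0 \<boxplus> p k" by (simp add: frob_pt_add frob_u)
  thus "has_coeff (frob_conj f) (2 * D1 (u0 \<boxplus> p k)) (u0 \<boxplus> p k) (to_ac (z k))"
    using has_coeff_frob[of f "2 * D1 (u0 \<boxplus> p k)" "u0 \<boxplus> p k" "to_ac (z k)"] assms pts0 by (simp add: rep2_def)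
qed

definition bot_map :: "(nat \<Rightarrow> 'k) \<Rightarrow> (nat \<Rightarrow> 'k) \<Rightarrow> nat \<Rightarrow> 'k alg_closure" where
  "bot_map y z k = (THE c. has_val (geom Y) (a0 \<boxplus> p k) (SOME f. rep2 y z f) c)"

lemma has_val_bot_map:
  assumes f: "rep2 y z f"
  shows "has_val (geom Y) (a0 \<boxplus> p k) f (bot_map y z k)"
proof -
  let ?P = "a0 \<boxplus> p k"
  define g where "g = (SOME f. rep2 y z f)"
  have g: "rep2 y z g" unfolding g_def by (rule someI[of _ f]) (rule f)
  have P: "?P \<in> pts" using pts0 by simp
  obtain c where "has_coeff g (2 * D1 ?P) ?P c" using g P unfolding rep2_def div_ge_def by blast
  hence c: "has_val (geom Y) ?P g c" by (simp add: D1_fibre has_coeff_0_iff)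
  have "bot_map y z k = c"
    unfolding bot_map_def g_def[symmetric]
    by (rule the_equality) (use c has_val_unique P in blast)+
  thus ?thesis using has_val.cong[OF c rep2_unique[OF g f]] by simp
qed

lemma bot_map_eqI:
  assumes "rep2 y z f" "has_val (geom Y) (a0 \<boxplus> p k) f c"
  shows "bot_map y z k = c"
  using has_val_unique[OF has_val_bot_map[OF assms(1)] assms(2)] pts0 by simp

text \<open>Data in the base field are invariant under conjugation, so the interpolating function
  equals its conjugate, and Frobenius on the fibre of \<open>a\<close> relates its values
  \<open>n2\<close> steps apart.\<close>

lemma bot_map_twisted:
  assumes "y \<in> periodic_seqs n" "z \<in> periodic_seqs n"
  shows "bot_map y z \<in> twisted_seqs n1 n2"
proof -
  obtain f where f: "rep2 y z f" using rep2_exists[OF assms] by blast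
  have "bot_map y z (k + n2) = frob (bot_map y z k)" for k
  proof (rule bot_map_eqI[OF rep2_frob[OF f]])
    show "has_val (geom Y) (a0 \<boxplus> p (k + n2)) (frob_conj f) (frob (bot_map y z k))"
      using has_val_frob[OF has_val_bot_map[OF f, of k]] by (simp only: frob_fibre)
  qed
  moreover have "bot_map y z (k + n) = bot_map y z k" for k
    by (simp add: bot_map_def p_periodic)
  ultimately show ?thesis using n(1) by (simp add: twisted_seqs_def)
qed

lemma bot_map_add:
  assumes "y \<in> periodic_seqs n" "z \<in> periodic_seqs n" "y' \<in> periodic_seqs n" "z' \<in> periodic_seqs n"
  shows "bot_map (\<lambda>k. y k + y' k) (\<lambda>k. z k + z' k) k = bot_map y z k + bot_map y' z' k"
proof -
  obtain f g where fg: "rep2 y z f" "rep2 y' z' g" using rep2_exists[OF assms(1,2)] rep2_exists[OF assms(3,4)] by blast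
  show ?thesis
    by (rule bot_map_eqI[OF rep2_add[OF fg]]) (intro has_val.add has_val_bot_map fg)
qed

lemma bot_map_scale:
  assumes "y \<in> periodic_seqs n" "z \<in> periodic_seqs n"
  shows "bot_map (\<lambda>k. r * y k) (\<lambda>k. r * z k) k = to_ac r * bot_map y z k"
proof -
  obtain f where f: "rep2 y z f" using rep2_exists[OF assms] by blast
  show ?thesis
    by (rule bot_map_eqI[OF rep2_scale[OF f]]) (intro has_val.mult has_val.const has_val_bot_map f)
qed

lemma bot_map_shift:
  assumes "y \<in> periodic_seqs n" "z \<in> periodic_seqs n"
  shows "bot_map (\<lambda>k. y (Suc k)) (\<lambda>k. z (Suc k)) k = bot_map y z (Suc k)"
proof -
  obtain f where f: "rep2 y z f" using rep2_exists[OF assms] by blast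
  have eq: "a0 \<boxplus> p k \<boxplus> t = a0 \<boxplus> p (Suc k)" using pts0 t by (simp add: ec_add_assoc p_Suc)
  have "has_val (geom Y) (a0 \<boxplus> p k) (\<lambda>R. f (R \<boxplus> t)) (bot_map y z (Suc k))"
    by (rule has_val_translate) (use has_val_bot_map[OF f, of "Suc k"] pts0 t eq in \<open>simp_all\<close>)
  from bot_map_eqI[OF rep2_shift[OF f] this] show ?thesis .
qed

lemma bot_map_top_map:
  assumes x: "x \<in> twisted_seqs n1 n2" and y: "y \<in> twisted_seqs n1 n2"
  shows "bot_map (\<lambda>k. top_map Infinity x k * top_map Infinity y k) (\<lambda>k. top_map u0 x k * top_map u0 y k) k
    = x k * y k"
proof -
  obtain f g where fg: "rep x f" "rep y g" using rep_exists[OF twisted_imp_periodic] x y by blast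
  show ?thesis
  proof (rule bot_map_eqI)
    show "has_val (geom Y) (a0 \<boxplus> p k) (\<lambda>R. f R * g R) (x k * y k)"
      using fg by (intro has_val.mult) (auto simp: rep_def)
    have "div_ge (\<lambda>R. f R * g R) (\<lambda>P. 2 * D1 P)"
      unfolding mult_2 using fg by (intro div_ge_mult) (auto simp: rep_def)
    moreover have c: "has_coeff (\<lambda>R. f R * g R) (2 * D1 (b \<boxplus> p k)) (b \<boxplus> p k)
        (to_ac (top_map b x k * top_map b y k))" if b: "b \<in> pts" "frob_pt b = b" for b k
      unfolding mult_2 to_ac_mult
      by (rule has_coeff_mult[OF has_coeff_top_map[OF fg(1) x b] has_coeff_top_map[OF fg(2) y b]])
         (use b in simp)
    moreover have "has_coeff (\<lambda>R. f R * g R) (2 * D1 (p k)) (p k)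
        (to_ac (top_map Infinity x k * top_map Infinity y k))" for k
      using c[of Infinity k] by simp
    moreover note c[OF pts0(3) frob_u]
    ultimately show "rep2 (\<lambda>k. top_map Infinity x k * top_map Infinity y k)
        (\<lambda>k. top_map u0 x k * top_map u0 y k) (\<lambda>R. f R * g R)"
      unfolding rep2_def by (intro conjI allI) assumption+
  qed
qed

end

section \<open>Finite extensions and the cyclic group algebra\<close>

abbreviation "frob_pow k \<equiv> frob ^^ k"

lemma frob_pow_eq: "frob_pow k (x :: 'k::finite_field alg_closure) = x ^ (CARD('k) ^ k)"
proof (induction k)
  case (Suc k)
  thus ?case by (simp add: frob_def flip: power_mult) (simp add: mult.commute)
qed simp

lemma frob_pow_add: "frob_pow k (x + y) = frob_pow k x + frob_pow k y"
  by (induction k) auto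

lemma frob_pow_mult: "frob_pow k (x * y) = frob_pow k x * frob_pow k y"
  by (induction k) auto

lemma frob_pow_0: "frob_pow k 0 = 0"
  by (induction k) auto

lemma frob_pow_1: "frob_pow k 1 = 1"
  by (induction k) auto

lemma frob_pow_to_ac: "frob_pow k (to_ac a) = to_ac a"
  by (induction k) auto

lemma frob_pow_sum: "frob_pow k (\<Sum>i\<in>I. f i) = (\<Sum>i\<in>I. frob_pow k (f i))"
  by (induction I rule: infinite_finite_induct) (auto simp: frob_pow_add frob_pow_0)

lemma ext_field_iff: "x \<in> ext_field n \<longleftrightarrow> frob_pow n x = x"
  by (simp add: ext_field_def frob_pow_eq)

lemma frob_pow_ext_field: "x \<in> ext_field n \<Longrightarrow> frob_pow k x \<in> ext_field n"
  unfolding ext_field_iff by (metis add.commute comp_apply funpow_add)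

lemma finite_ext_field: "n > 0 \<Longrightarrow> finite (ext_field n :: 'k::finite_field alg_closure set)"
  using card_ge_2[where ?'k = 'k] by (intro card_ge_0_finite) (simp add: card_ext_field)

lemma ext_field_closed:
  "0 \<in> ext_field n" "1 \<in> ext_field n"
  "x \<in> ext_field n \<Longrightarrow> y \<in> ext_field n \<Longrightarrow> x + y \<in> ext_field n"
  "x \<in> ext_field n \<Longrightarrow> y \<in> ext_field n \<Longrightarrow> x * y \<in> ext_field n"
  by (simp_all add: ext_field_iff frob_pow_0 frob_pow_1 frob_pow_add frob_pow_mult)

lemma ext_field_sum: "(\<And>i. i \<in> I \<Longrightarrow> f i \<in> ext_field n) \<Longrightarrow> (\<Sum>i\<in>I. f i) \<in> ext_field n"
  by (induction I rule: infinite_finite_induct) (auto intro: ext_field_closed)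

lemma ext_field_power: "x \<in> ext_field n \<Longrightarrow> x ^ k \<in> ext_field n"
  by (induction k) (auto intro: ext_field_closed)

lemma ext_field_generator:
  assumes "n > 0"
  obtains w :: "'k::finite_field alg_closure" where "w \<in> ext_field n"
    "\<And>x. x \<in> ext_field n \<Longrightarrow> x \<noteq> 0 \<Longrightarrow> \<exists>k. x = w ^ k"
proof -
  let ?R = "ring_of_type_algebra :: 'k alg_closure ring"
  let ?L = "?R\<lparr>carrier := ext_field n\<rparr>"
  interpret R: field ?R by (rule field_from_type_algebra)
  interpret L: field ?L by (rule R.subfield_iff(2)[OF subfield_ext_field])
  have "finite (carrier ?L)" using finite_ext_field[OF assms] by simp
  from L.finite_field_mult_group_has_gen[OF this] obtain w where
    w: "w \<in> carrier (mult_of ?L)" "carrier (mult_of ?L) = {w [^]\<^bsub>?L\<^esub> i |i::nat. i \<in> UNIV}"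
    by (auto simp: nat_pow_mult_of)
  have pow: "w [^]\<^bsub>?L\<^esub> i = w ^ i" for i :: nat
    by (induction i) (simp_all add: ring_of_type_algebra_def mult.commute)
  have car: "carrier (mult_of ?L) = ext_field n - {0}"
    by (simp add: ring_of_type_algebra_def)
  show ?thesis
  proof
    show "w \<in> ext_field n" using w(1) car by simp
    fix x assume "x \<in> ext_field n" "x \<noteq> (0 :: 'k alg_closure)"
    hence "x \<in> carrier (mult_of ?L)" using car by simp
    thus "\<exists>k. x = w ^ k" unfolding w(2) pow by auto
  qed
qed

text \<open>A root of a polynomial with coefficients in the prime field is mapped to a root; this applies
  to the characteristic polynomial of a generator of the multiplicative group.\<close>
lemma ext_field_hom_eq_frob_pow:
  fixes \<sigma> :: "'k::finite_field alg_closure \<Rightarrow> 'k alg_closure"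
  assumes n: "n > 0"
    and add: "\<And>x y. x \<in> ext_field n \<Longrightarrow> y \<in> ext_field n \<Longrightarrow> \<sigma> (x + y) = \<sigma> x + \<sigma> y"
    and mult: "\<And>x y. x \<in> ext_field n \<Longrightarrow> y \<in> ext_field n \<Longrightarrow> \<sigma> (x * y) = \<sigma> x * \<sigma> y"
    and fixed: "\<And>a. \<sigma> (to_ac a) = to_ac a"
  obtains i where "i < n" "\<And>x. x \<in> ext_field n \<Longrightarrow> \<sigma> x = frob_pow i x"
proof -
  obtain w :: "'k alg_closure" where w: "w \<in> ext_field n"
    "\<And>x. x \<in> ext_field n \<Longrightarrow> x \<noteq> 0 \<Longrightarrow> \<exists>k. x = w ^ k"
    by (rule ext_field_generator[OF n]) (rule that)
  \<comment> \<open>Frobenius permutes the factors cyclically because \<open>w\<close> is fixed by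
    its \<open>n\<close>-th power. So the coefficients lie in the base field, and
    \<open>\<sigma> w\<close> is again a root, hence one of the conjugates of
    \<open>w\<close>.\<close>
  define P where "P = (\<Prod>i<n. [:- frob_pow i w, 1:])"
  have "map_poly frob P = (\<Prod>i<n. map_poly frob [:- frob_pow i w, 1:])"
  proof -
    have m: "map_poly frob (p * q) = map_poly frob p * map_poly frob q" for p q :: "'k alg_closure poly"
      by (rule poly_eqI) (simp add: coeff_map_poly coeff_mult frob_sum)
    show ?thesis unfolding P_def by (induction n) (simp_all add: m del: mult_pCons_left mult_pCons_right)
  qed
  also have "\<dots> = (\<Prod>i<n. [:- frob_pow (Suc i) w, 1:])"
    by (simp add: map_poly_pCons)
  also have "\<dots> = (\<Prod>i\<in>{..<n}. [:- frob_pow (Suc i mod n) w, 1:])"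
  proof (rule prod.cong)
    fix i assume "i \<in> {..<n}"
    show "[:- frob_pow (Suc i) w, 1:] = [:- frob_pow (Suc i mod n) w, 1:]"
    proof (cases "Suc i = n")
      case True
      hence "frob_pow (Suc i) w = w" using w(1) by (simp only: ext_field_iff)
      moreover have "Suc i mod n = 0" using True by simp
      ultimately show ?thesis by (simp only: funpow_0)
    next
      case False
      hence "Suc i mod n = Suc i" using \<open>i \<in> {..<n}\<close> by simp
      thus ?thesis by (simp only:)
    qed
  qed simp
  also have "\<dots> = P"
    unfolding P_def
  proof (rule prod.reindex_bij_betw)
    show "bij_betw (\<lambda>i. Suc i mod n) {..<n} {..<n}"
    proof (rule bij_betw_imageI)
      have inj: "inj_on (\<lambda>i. Suc i mod n) {..<n}"
        by (auto simp: inj_on_def mod_Suc split: if_splits)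
      thus "inj_on (\<lambda>i. Suc i mod n) {..<n}" .
      have "(\<lambda>i. Suc i mod n) ` {..<n} \<subseteq> {..<n}" using n by auto
      thus "(\<lambda>i. Suc i mod n) ` {..<n} = {..<n}"
        by (rule card_subset_eq[rotated]) (simp_all add: card_image[OF inj])
    qed
  qed
  finally have "frob (coeff P j) = coeff P j" for j
    by (metis coeff_map_poly frob_0)
  hence "\<exists>a. coeff P j = to_ac a" for j
    using frob_fixed_iff by (metis imageE)
  then obtain c where c: "\<And>j. coeff P j = to_ac (c j)" by metis
  have pow: "\<sigma> (w ^ k) = \<sigma> w ^ k" for k
  proof (induction k)
    case 0
    show ?case using fixed[of 1] by simp
  next
    case (Suc k)
    thus ?case using mult[OF w(1) ext_field_power[OF w(1)]] by simp
  qed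
  have \<sigma>0: "\<sigma> 0 = 0" using fixed[of 0] by simp
  have mem: "to_ac a * w ^ j \<in> ext_field n" for a j
    by (intro ext_field_closed to_ac_in_ext_field ext_field_power w)
  have sum: "\<sigma> (\<Sum>j\<in>A. to_ac (c j) * w ^ j) = (\<Sum>j\<in>A. to_ac (c j) * \<sigma> w ^ j)" if "finite A" for A
    using that
  proof induction
    case (insert j A)
    thus ?case
      by (simp add: add[OF mem ext_field_sum[OF mem]] mult[OF to_ac_in_ext_field ext_field_power[OF w(1)]] fixed pow)
  qed (simp add: \<sigma>0)
  have "poly P w = 0"
    unfolding P_def poly_prod using n by (intro prod_zero bexI[of _ 0]) auto
  hence "(\<Sum>j\<le>degree P. to_ac (c j) * w ^ j) = 0" by (simp add: poly_altdef c)
  hence "poly P (\<sigma> w) = 0"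
    using sum[of "{..degree P}"] by (simp add: poly_altdef c \<sigma>0)
  then obtain i where i: "i < n" "\<sigma> w = frob_pow i w"
    unfolding P_def poly_prod by (auto simp: prod_zero_iff)
  have frob_pow_power: "frob_pow i (w ^ k) = frob_pow i w ^ k" for k
    by (induction k) (simp_all add: frob_pow_mult frob_pow_1)
  have "\<sigma> x = frob_pow i x" if x: "x \<in> ext_field n" for x
  proof (cases "x = 0")
    case False
    then obtain k where "x = w ^ k" using w(2) x by blast
    thus ?thesis using pow i frob_pow_power by simp
  qed (simp add: \<sigma>0 frob_pow_0)
  thus ?thesis using that i(1) by blast
qed

section \<open>The cyclic group acting on twisted sequences\<close>

lemma twisted_seqs_faithful:
  assumes "n1 > 0" "n2 > 0" "0 < d" "d < n1 * n2"
    and per: "\<And>x :: nat \<Rightarrow> 'k::finite_field alg_closure. x \<in> twisted_seqs n1 n2 \<Longrightarrow> x d = x 0"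
  shows False
proof -
  \<comment> \<open>The sequence supported on the multiples of \<open>n2\<close> that starts with
    \<open>z\<close>. A shift by \<open>d\<close> not divisible by \<open>n2\<close> moves it; a
    shift by \<open>e * n2\<close> acts on it as the \<open>e\<close>-th power of Frobenius.\<close>
  define seq where "seq z k = (if n2 dvd k then frob_pow (k div n2) z else 0)" for z :: "'k alg_closure" and k
  have seq: "seq z \<in> twisted_seqs n1 n2" if z: "z \<in> ext_field n1" for z
  proof -
    have "seq z (k + n2) = frob (seq z k)" for k
      using assms(2) by (simp add: seq_def)
    moreover have "seq z (k + n1 * n2) = seq z k" for k
    proof -
      have "frob_pow (k div n2 + n1) z = frob_pow (k div n2) z"
        using z unfolding ext_field_iff by (simp add: funpow_add)
      thus ?thesis using assms(2) by (simp add: seq_def)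
    qed
    ultimately show ?thesis by (simp add: twisted_seqs_def)
  qed
  show False
  proof (cases "n2 dvd d")
    case False
    from per[OF seq[OF ext_field_closed(2)]] False show False by (simp add: seq_def)
  next
    case True
    then obtain e where e: "d = e * n2" by (metis dvdE mult.commute)
    have e1: "0 < e" "e < n1" using e assms by auto
    \<comment> \<open>The \<open>e\<close>-th power of Frobenius would fix the whole extension of
      degree \<open>n1\<close>, although this has more than q^e elements.\<close>
    have "ext_field n1 \<subseteq> (ext_field e :: 'k alg_closure set)"
    proof
      fix z :: "'k alg_closure" assume "z \<in> ext_field n1"
      from per[OF seq[OF this]] show "z \<in> ext_field e" using assms(2) by (simp add: seq_def e ext_field_iff)
    qed
    hence "card (ext_field n1 :: 'k alg_closure set) \<le> card (ext_field e :: 'k alg_closure set)"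
      using e1 by (intro card_mono finite_ext_field) auto
    hence "CARD('k) ^ n1 \<le> CARD('k) ^ e" using e1 by (simp add: card_ext_field)
    moreover have "CARD('k) ^ e < CARD('k) ^ n1"
      using e1 card_ge_2[where ?'k = 'k] by (intro power_strict_increasing) auto
    ultimately show False by simp
  qed
qed

text \<open>A common frame for \<open>twisted_carrier\<close> and, with \<open>n2 = 1\<close>, for
  \<open>ext_field\<close>: the map \<open>\<iota>\<close> identifies the set with
  \<open>twisted_seqs\<close> and turns the generator into the shift.\<close>

locale cyclic_rep =
  fixes n n1 n2 :: nat and S :: "'a set" and g :: "'a \<Rightarrow> 'a"
    and \<iota> :: "'a \<Rightarrow> nat \<Rightarrow> 'k::finite_field alg_closure"
  assumes n: "n = n1 * n2" "n > 0"
    and g: "g \<in> Bij S"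
    and \<iota>: "bij_betw \<iota> S (twisted_seqs n1 n2)"
    and \<iota>_g: "\<And>x k. x \<in> S \<Longrightarrow> \<iota> (g x) k = \<iota> x (Suc k)"
    and finS: "finite S"
begin

definition G :: "('a \<Rightarrow> 'a) monoid" where
  "G = (BijGroup S)\<lparr>carrier := generate (BijGroup S) {g}\<rparr>"

definition gp :: "nat \<Rightarrow> 'a \<Rightarrow> 'a" where "gp k = g [^]\<^bsub>BijGroup S\<^esub> k"

lemma group_Bij: "group (BijGroup S)"
  by (rule group_BijGroup)

sublocale B: group "BijGroup S" by (rule group_Bij)

lemma g_carrier: "g \<in> carrier (BijGroup S)"
  using g by (simp add: BijGroup_def)

lemma group_G: "group G"
  unfolding G_def
  by (rule subgroup.subgroup_is_group[OF B.generate_is_subgroup group_Bij]) (use g_carrier in simp)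

sublocale GG: group G by (rule group_G)

lemma finite_Bij: "finite (carrier (BijGroup S))"
proof -
  have "carrier (BijGroup S) \<subseteq> S \<rightarrow>\<^sub>E S"
    by (auto simp: BijGroup_def Bij_def PiE_def bij_betw_def)
  thus ?thesis using finite_PiE[OF finS, of "\<lambda>_. S"] finS finite_subset by blast
qed

lemma gp_carrier: "gp k \<in> carrier (BijGroup S)"
  unfolding gp_def using g_carrier by simp

lemma gp_S: "x \<in> S \<Longrightarrow> gp k x \<in> S"
  using gp_carrier[of k] by (auto simp: BijGroup_def Bij_def bij_betw_def)

lemma mult_apply: "f \<in> carrier (BijGroup S) \<Longrightarrow> h \<in> carrier (BijGroup S) \<Longrightarrow> x \<in> S \<Longrightarrow>
    (f \<otimes>\<^bsub>BijGroup S\<^esub> h) x = f (h x)"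
  by (simp add: BijGroup_def compose_def)

lemma \<iota>_gp: "x \<in> S \<Longrightarrow> \<iota> (gp j x) k = \<iota> x (k + j)"
proof (induction j arbitrary: x)
  case 0
  thus ?case by (simp add: gp_def) (simp add: BijGroup_def)
next
  case (Suc j)
  have "gp (Suc j) x = gp j (g x)"
    using mult_apply[OF gp_carrier g_carrier Suc.prems] by (simp add: gp_def)
  moreover have "g x \<in> S" using g Suc.prems by (auto simp: Bij_def bij_betw_def)
  ultimately show ?case using Suc \<iota>_g by simp
qed

lemma \<iota>_inj: "x \<in> S \<Longrightarrow> y \<in> S \<Longrightarrow> (\<And>k. \<iota> x k = \<iota> y k) \<Longrightarrow> x = y"
  using \<iota> by (meson bij_betw_imp_inj_on ext inj_onD)

lemma \<iota>_mem: "x \<in> S \<Longrightarrow> \<iota> x \<in> twisted_seqs n1 n2"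
  using \<iota> by (rule bij_betw_apply)

lemma \<iota>_surj: "s \<in> twisted_seqs n1 n2 \<Longrightarrow> \<exists>x\<in>S. \<iota> x = s"
  using \<iota> by (metis bij_betw_def imageE)

lemma gp_add: "gp (i + j) = gp i \<otimes>\<^bsub>BijGroup S\<^esub> gp j"
  unfolding gp_def using B.nat_pow_mult[OF g_carrier] by simp

lemma gp_n: "gp n = \<one>\<^bsub>BijGroup S\<^esub>"
proof -
  have "gp n x = x" if "x \<in> S" for x
    using that \<iota>_mem[OF that] n
    by (intro \<iota>_inj) (auto simp: gp_S \<iota>_gp twisted_seqs_def)
  moreover have "gp n \<in> extensional S" using gp_carrier by (simp add: BijGroup_def Bij_def)
  ultimately show ?thesis by (auto simp: BijGroup_def extensional_def fun_eq_iff restrict_def)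
qed

lemma gp_mod: "gp (k mod n) = gp k"
proof -
  have "gp (k + n) = gp k" for k using gp_n gp_carrier by (simp add: gp_add)
  thus ?thesis using periodic_mod[of gp n k] by (simp add: periodic_seqs_def)
qed

text \<open>Equal powers would make the entries at 0 and \<open>j - i\<close> of every twisted
  sequence agree, against \<open>twisted_seqs_faithful\<close>.\<close>

lemma inj_gp: "inj_on gp {..<n}"
proof (rule linorder_inj_onI')
  fix i j assume ij: "i \<in> {..<n}" "j \<in> {..<n}" "i < j"
  show "gp i \<noteq> gp j"
  proof
    assume eq: "gp i = gp j"
    have "x (j - i) = x 0" if x: "x \<in> twisted_seqs n1 n2" for x :: "nat \<Rightarrow> 'k alg_closure"
    proof -
      obtain z where z: "z \<in> S" "\<iota> z = x" using \<iota>_surj[OF x] by blast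
      have "x (n - i + i) = x (n - i + j)"
        using \<iota>_gp[OF z(1), of i "n - i"] \<iota>_gp[OF z(1), of j "n - i"] eq z(2) by simp
      moreover have "n - i + i = 0 + n" "n - i + j = (j - i) + n" using ij by auto
      ultimately have "x (0 + n) = x ((j - i) + n)" by (simp only:)
      moreover have "x (k + n) = x k" for k using x unfolding twisted_seqs_def n(1) by blast
      ultimately show ?thesis by (simp only:)
    qed
    moreover have "n1 > 0" "n2 > 0" "0 < j - i" "j - i < n1 * n2" using n ij by auto
    ultimately show False by (intro twisted_seqs_faithful[of n1 n2 "j - i"])
  qed
qed

lemma carrier_G: "carrier G = gp ` {..<n}"
proof -
  have "carrier G = {gp k |k. k \<in> UNIV}"
    unfolding G_def gp_def using B.generate_pow_on_finite_carrier[OF finite_Bij g_carrier] by simp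
  also have "\<dots> = gp ` {..<n}"
  proof safe
    fix k
    have "gp (k mod n) \<in> gp ` {..<n}" using n(2) by (intro imageI) simp
    thus "gp k \<in> gp ` {..<n}" by (simp only: gp_mod)
  qed auto
  finally show ?thesis .
qed

lemma card_G: "card (carrier G) = n"
  unfolding carrier_G by (simp add: card_image inj_gp)

lemma sum_carrier_G: "(\<Sum>c\<in>carrier G. f c) = (\<Sum>j<n. f (gp j))"
  unfolding carrier_G by (simp add: sum.reindex inj_gp)

lemma gp_in_G: "gp k \<in> carrier G"
proof -
  have "gp (k mod n) \<in> gp ` {..<n}" using n(2) by (intro imageI) simp
  thus ?thesis by (simp only: gp_mod carrier_G)
qed

lemma mult_G: "(\<otimes>\<^bsub>G\<^esub>) = (\<otimes>\<^bsub>BijGroup S\<^esub>)" and one_G: "\<one>\<^bsub>G\<^esub> = \<one>\<^bsub>BijGroup S\<^esub>"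
  by (simp_all add: G_def)

lemma gp_add_G: "gp (i + j) = gp i \<otimes>\<^bsub>G\<^esub> gp j"
  by (simp add: mult_G gp_add)

text \<open>Multiplication by \<open>gp j\<close> in the group algebra sends \<open>f\<close> to the
  map whose value at \<open>c\<close> is that of \<open>f\<close> at the inverse of
  \<open>gp j\<close> times \<open>c\<close>. Read along the inverses \<open>ginv k\<close>, this is
  the shift of \<open>k\<close> by \<open>j\<close>, in agreement with the action on
  \<open>twisted_seqs\<close>.\<close>

abbreviation "ginv k \<equiv> inv\<^bsub>G\<^esub> (gp k)"

lemma ginv_in_G: "ginv k \<in> carrier G"
  using gp_in_G by simp

lemma ginv_mult: "inv\<^bsub>G\<^esub> (gp j) \<otimes>\<^bsub>G\<^esub> ginv k = ginv (k + j)"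
  by (simp add: gp_add_G GG.inv_mult_group gp_in_G)

lemma ginv_periodic: "ginv (k + n) = ginv k"
  by (metis gp_mod mod_add_self2)

lemma carrier_G_inv: "c \<in> carrier G \<Longrightarrow> \<exists>k. c = ginv k"
proof -
  assume c: "c \<in> carrier G"
  then obtain k where "inv\<^bsub>G\<^esub> c = gp k" using carrier_G by (metis GG.inv_closed imageE)
  hence "c = ginv k" using c by (metis GG.inv_inv)
  thus ?thesis by blast
qed

end

text \<open>The interface between curve and algebra: \<open>T0\<close> and \<open>T1\<close> become
  the two components of the top map and \<open>B\<close> the bottom map. Linearity over the group
  algebra is reduced to additivity, scaling and a single shift.\<close>

locale seq_decomp =
  fixes n n1 n2 :: nat
    and T0 T1 :: "(nat \<Rightarrow> 'k::finite_field alg_closure) \<Rightarrow> nat \<Rightarrow> 'k"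
    and B :: "(nat \<Rightarrow> 'k) \<Rightarrow> (nat \<Rightarrow> 'k) \<Rightarrow> nat \<Rightarrow> 'k alg_closure"
  assumes T: "T \<in> {T0, T1} \<Longrightarrow> x \<in> twisted_seqs n1 n2 \<Longrightarrow> T x \<in> periodic_seqs n"
      "T \<in> {T0, T1} \<Longrightarrow> x \<in> twisted_seqs n1 n2 \<Longrightarrow> y \<in> twisted_seqs n1 n2 \<Longrightarrow> T (\<lambda>k. x k + y k) k = T x k + T y k"
      "T \<in> {T0, T1} \<Longrightarrow> x \<in> twisted_seqs n1 n2 \<Longrightarrow> T (\<lambda>k. to_ac r * x k) k = r * T x k"
      "T \<in> {T0, T1} \<Longrightarrow> x \<in> twisted_seqs n1 n2 \<Longrightarrow> T (\<lambda>k. x (Suc k)) k = T x (Suc k)"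
    and B: "p \<in> periodic_seqs n \<Longrightarrow> s \<in> periodic_seqs n \<Longrightarrow> B p s \<in> twisted_seqs n1 n2"
      "p \<in> periodic_seqs n \<Longrightarrow> s \<in> periodic_seqs n \<Longrightarrow> p' \<in> periodic_seqs n \<Longrightarrow> s' \<in> periodic_seqs n \<Longrightarrow>
        B (\<lambda>k. p k + p' k) (\<lambda>k. s k + s' k) k = B p s k + B p' s' k"
      "p \<in> periodic_seqs n \<Longrightarrow> s \<in> periodic_seqs n \<Longrightarrow> B (\<lambda>k. r * p k) (\<lambda>k. r * s k) k = to_ac r * B p s k"
      "p \<in> periodic_seqs n \<Longrightarrow> s \<in> periodic_seqs n \<Longrightarrow> B (\<lambda>k. p (Suc k)) (\<lambda>k. s (Suc k)) k = B p s (Suc k)"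
    and BT: "x \<in> twisted_seqs n1 n2 \<Longrightarrow> y \<in> twisted_seqs n1 n2 \<Longrightarrow>
        B (\<lambda>k. T0 x k * T0 y k) (\<lambda>k. T1 x k * T1 y k) k = x k * y k"
begin

lemma twisted_closed:
  "x \<in> twisted_seqs n1 n2 \<Longrightarrow> y \<in> twisted_seqs n1 n2 \<Longrightarrow> (\<lambda>k. x k + y k) \<in> twisted_seqs n1 n2"
  "x \<in> twisted_seqs n1 n2 \<Longrightarrow> (\<lambda>k. to_ac r * x k) \<in> twisted_seqs n1 n2"
  "(\<lambda>k. 0) \<in> twisted_seqs n1 n2"
  by (simp_all add: twisted_seqs_def)

lemma twisted_shift: "x \<in> twisted_seqs n1 n2 \<Longrightarrow> (\<lambda>k. x (k + j)) \<in> twisted_seqs n1 n2"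
proof -
  assume x: "x \<in> twisted_seqs n1 n2"
  have "x (k + j + n2) = frob (x (k + j))" "x (k + j + n1 * n2) = x (k + j)" for k
    using x unfolding twisted_seqs_def by blast+
  thus ?thesis by (simp add: twisted_seqs_def add_ac)
qed

lemma periodic_closed:
  "y \<in> periodic_seqs n \<Longrightarrow> z \<in> periodic_seqs n \<Longrightarrow> (\<lambda>k. y k + z k) \<in> periodic_seqs n"
  "y \<in> periodic_seqs n \<Longrightarrow> (\<lambda>k. r * y k) \<in> periodic_seqs n"
  "(\<lambda>k. 0) \<in> periodic_seqs n" for y z :: "nat \<Rightarrow> 'k"
  by (simp_all add: periodic_seqs_def)

lemma periodic_shift: "y \<in> periodic_seqs n \<Longrightarrow> (\<lambda>k. y (k + j)) \<in> periodic_seqs n" for y :: "nat \<Rightarrow> 'k"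
proof -
  assume "y \<in> periodic_seqs n"
  hence "y (k + j + n) = y (k + j)" for k unfolding periodic_seqs_def by blast
  thus ?thesis by (simp add: periodic_seqs_def add_ac)
qed

lemma T_shift:
  assumes "T \<in> {T0, T1}" "x \<in> twisted_seqs n1 n2"
  shows "T (\<lambda>k. x (k + j)) k = T x (k + j)"
proof (induction j arbitrary: k)
  case (Suc j)
  have "T (\<lambda>k. x (Suc k + j)) k = T (\<lambda>k. x (k + j)) (Suc k)"
    by (rule T(4)[OF assms(1) twisted_shift[OF assms(2)]])
  thus ?case using Suc by simp
qed simp

lemma T_sum:
  assumes "T \<in> {T0, T1}" "x \<in> twisted_seqs n1 n2"
  shows "(\<lambda>k. \<Sum>j<m. to_ac (r j) * x (k + j)) \<in> twisted_seqs n1 n2 \<and>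
    T (\<lambda>k. \<Sum>j<m. to_ac (r j) * x (k + j)) k = (\<Sum>j<m. r j * T x (k + j))"
proof (induction m arbitrary: k)
  case 0
  have "T (\<lambda>k. to_ac 0 * x k) k = 0 * T x k" by (rule T(3)[OF assms])
  thus ?case using twisted_closed(3) by simp
next
  case (Suc m)
  have mem: "(\<lambda>k. \<Sum>j<m. to_ac (r j) * x (k + j)) \<in> twisted_seqs n1 n2" using Suc by blast
  have mem': "(\<lambda>k. to_ac (r m) * x (k + m)) \<in> twisted_seqs n1 n2"
    by (rule twisted_closed(2)[OF twisted_shift[OF assms(2)]])
  have "T (\<lambda>k. to_ac (r m) * x (k + m)) k = r m * T x (k + m)"
    using T(3)[OF assms(1) twisted_shift[OF assms(2)]] T_shift[OF assms] by simp
  thus ?case using twisted_closed(1)[OF mem mem'] T(2)[OF assms(1) mem mem'] Suc by simp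
qed

lemma B_shift:
  assumes "y \<in> periodic_seqs n" "z \<in> periodic_seqs n"
  shows "B (\<lambda>k. y (k + j)) (\<lambda>k. z (k + j)) k = B y z (k + j)"
proof (induction j arbitrary: k)
  case (Suc j)
  have "B (\<lambda>k. y (Suc k + j)) (\<lambda>k. z (Suc k + j)) k = B (\<lambda>k. y (k + j)) (\<lambda>k. z (k + j)) (Suc k)"
    by (rule B(4)[OF periodic_shift[OF assms(1)] periodic_shift[OF assms(2)]])
  thus ?case using Suc by simp
qed simp

lemma periodic_sum:
  "y \<in> periodic_seqs n \<Longrightarrow> (\<lambda>k. \<Sum>j<m. r j * y (k + j)) \<in> periodic_seqs n" for y :: "nat \<Rightarrow> 'k"
  by (induction m) (simp_all add: periodic_closed periodic_shift)

lemma B_sum: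
  assumes y: "y \<in> periodic_seqs n" and z: "z \<in> periodic_seqs n"
  shows "B (\<lambda>k. \<Sum>j<m. r j * y (k + j)) (\<lambda>k. \<Sum>j<m. r j * z (k + j)) k = (\<Sum>j<m. to_ac (r j) * B y z (k + j))"
proof (induction m arbitrary: k)
  case 0
  have "B (\<lambda>k. 0 * y k) (\<lambda>k. 0 * z k) k = to_ac 0 * B y z k" by (rule B(3)[OF y z])
  thus ?case by simp
next
  case (Suc m)
  have "B (\<lambda>k. r m * y (k + m)) (\<lambda>k. r m * z (k + m)) k = to_ac (r m) * B y z (k + m)"
    using B(3)[OF periodic_shift[OF y] periodic_shift[OF z]] B_shift[OF y z] by simp
  thus ?case
    using B(2)[OF periodic_sum[OF y] periodic_sum[OF z]
        periodic_closed(2)[OF periodic_shift[OF y]] periodic_closed(2)[OF periodic_shift[OF z]]] Suc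
    by simp
qed

end

locale rep_decomp = cyclic_rep n n1 n2 S g \<iota> + seq_decomp n n1 n2 T0 T1 B
  for n n1 n2 :: nat and S :: "'a set" and g :: "'a \<Rightarrow> 'a"
    and \<iota> :: "'a \<Rightarrow> nat \<Rightarrow> 'k::finite_field alg_closure"
    and T0 T1 :: "(nat \<Rightarrow> 'k alg_closure) \<Rightarrow> nat \<Rightarrow> 'k"
    and B :: "(nat \<Rightarrow> 'k) \<Rightarrow> (nat \<Rightarrow> 'k) \<Rightarrow> nat \<Rightarrow> 'k alg_closure"
begin

text \<open>The assumptions on \<open>L\<close> and \<open>t\<close> say that \<open>\<iota>\<close>
  carries addition and product to the pointwise operations and the scalar action to sums of shifts,
  where \<open>seq_decomp\<close> provides the decomposition.\<close>

lemma sym_complexity_le_2: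
  fixes L :: "(('a \<Rightarrow> 'a) \<Rightarrow> 'k, 'a) module" and t :: "'a \<Rightarrow> 'a \<Rightarrow> 'a"
  assumes car: "carrier L = S"
    and addc: "\<And>x y. x \<in> S \<Longrightarrow> y \<in> S \<Longrightarrow> x \<oplus>\<^bsub>L\<^esub> y \<in> S"
    and add: "\<And>x y k. x \<in> S \<Longrightarrow> y \<in> S \<Longrightarrow> \<iota> (x \<oplus>\<^bsub>L\<^esub> y) k = \<iota> x k + \<iota> y k"
    and smc: "\<And>r x. x \<in> S \<Longrightarrow> r \<odot>\<^bsub>L\<^esub> x \<in> S"
    and sm: "\<And>r x k. x \<in> S \<Longrightarrow> \<iota> (r \<odot>\<^bsub>L\<^esub> x) k = (\<Sum>c\<in>carrier G. to_ac (r c) * \<iota> (c x) k)"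
    and tc: "\<And>x y. x \<in> S \<Longrightarrow> y \<in> S \<Longrightarrow> t x y \<in> S"
    and t: "\<And>x y k. x \<in> S \<Longrightarrow> y \<in> S \<Longrightarrow> \<iota> (t x y) k = \<iota> x k * \<iota> y k"
  shows "sym_complexity G L L t \<le> 2"
proof -
  define TT where "TT i = (if i = (0::nat) then T0 else T1)" for i
  have TT: "TT i \<in> {T0, T1}" for i by (simp add: TT_def)
  \<comment> \<open>Any exponent will do: \<open>top_ginv\<close> shows by periodicity that the
    value does not depend on the choice.\<close>
  define ix where "ix c = (SOME k. c = ginv k)" for c
  have ix: "ginv (ix c) = c" if "c \<in> carrier G" for c
    unfolding ix_def using someI_ex[OF carrier_G_inv[OF that]] by simp
  define top where "top x = (\<lambda>i\<in>{..<2}. \<lambda>c\<in>carrier G. TT i (\<iota> x) (ix c))" for x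
  have top_ginv: "top x i (ginv k) = TT i (\<iota> x) k" if "x \<in> S" "i < 2" for x i k
  proof -
    have per: "TT i (\<iota> x) \<in> periodic_seqs n" by (rule T(1)[OF TT \<iota>_mem[OF that(1)]])
    have "ginv (ix (ginv k)) = ginv k" by (rule ix[OF ginv_in_G])
    hence "gp (ix (ginv k)) = gp k" using GG.inv_inv gp_in_G by metis
    hence "gp (ix (ginv k) mod n) = gp (k mod n)" by (simp only: gp_mod)
    hence "ix (ginv k) mod n = k mod n" using inj_gp n(2) by (auto simp: inj_on_def)
    hence "TT i (\<iota> x) (ix (ginv k)) = TT i (\<iota> x) k"
      using periodic_mod[OF per] by metis
    thus ?thesis using that(2) ginv_in_G by (simp add: top_def)
  qed
  let ?y = "\<lambda>f i k. f i (ginv k) :: 'k"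
  have y_per: "?y f i \<in> periodic_seqs n" for f :: "nat \<Rightarrow> ('a \<Rightarrow> 'a) \<Rightarrow> 'k" and i
    by (simp add: periodic_seqs_def ginv_periodic)
  define bot where "bot f = inv_into S \<iota> (B (?y f 0) (?y f 1))"
    for f :: "nat \<Rightarrow> ('a \<Rightarrow> 'a) \<Rightarrow> 'k"
  have bot_S: "bot f \<in> S" for f
    unfolding bot_def using B(1)[OF y_per y_per, of f 0 f 1] \<iota>
    by (intro inv_into_into) (simp add: bij_betw_def)
  have \<iota>_bot: "\<iota> (bot f) = B (?y f 0) (?y f 1)" for f
    unfolding bot_def using \<iota> B(1)[OF y_per y_per] by (rule bij_betw_inv_into_right)
  have carK: "carrier (group_algebra G :: (('a \<Rightarrow> 'a) \<Rightarrow> 'k) ring) = carrier G \<rightarrow>\<^sub>E UNIV" by (simp add: group_algebra_def)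
  have carP: "carrier (group_algebra_pow G 2 :: (_, nat \<Rightarrow> ('a \<Rightarrow> 'a) \<Rightarrow> 'k) module) = {..<2} \<rightarrow>\<^sub>E (carrier G \<rightarrow>\<^sub>E UNIV)"
    by (simp add: group_algebra_pow_def carK)
  have smP: "(r \<odot>\<^bsub>group_algebra_pow G 2\<^esub> f) i (ginv k) = (\<Sum>j<n. r (gp j) * f i (ginv (k + j)))"
    if "i < 2" for r and f :: "nat \<Rightarrow> ('a \<Rightarrow> 'a) \<Rightarrow> 'k" and i k
    using that by (simp add: group_algebra_pow_def group_algebra_def ginv_in_G sum_carrier_G ginv_mult)
  have addP: "(f \<oplus>\<^bsub>group_algebra_pow G 2\<^esub> f') i (ginv k) = f i (ginv k) + f' i (ginv k)"
    if "i < 2" for f f' :: "nat \<Rightarrow> ('a \<Rightarrow> 'a) \<Rightarrow> 'k" and i k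
    using that by (simp add: group_algebra_pow_def group_algebra_def ginv_in_G)
  have extP: "f = f'" if "f \<in> {..<2} \<rightarrow>\<^sub>E (carrier G \<rightarrow>\<^sub>E UNIV)" "f' \<in> {..<2} \<rightarrow>\<^sub>E (carrier G \<rightarrow>\<^sub>E UNIV)"
    "\<And>i k. i < 2 \<Longrightarrow> f i (ginv k) = f' i (ginv k)" for f f' :: "nat \<Rightarrow> ('a \<Rightarrow> 'a) \<Rightarrow> 'k"
  proof (rule PiE_ext[OF that(1,2)])
    fix i :: nat assume i: "i \<in> {..<2}"
    show "f i = f' i"
    proof (rule PiE_ext)
      show "f i \<in> carrier G \<rightarrow>\<^sub>E UNIV" "f' i \<in> carrier G \<rightarrow>\<^sub>E UNIV" using that(1,2) i by (auto elim!: PiE_mem)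
      fix c assume "c \<in> carrier G"
      then obtain k where "c = ginv k" using carrier_G_inv by blast
      thus "f i c = f' i c" using that(3) i by simp
    qed
  qed
  have top_mem: "top x \<in> {..<2} \<rightarrow>\<^sub>E (carrier G \<rightarrow>\<^sub>E UNIV)" for x
    unfolding top_def by (auto simp: PiE_def extensional_def)
  have smult_mem: "r \<odot>\<^bsub>group_algebra_pow G 2\<^esub> f \<in> {..<2} \<rightarrow>\<^sub>E (carrier G \<rightarrow>\<^sub>E UNIV)"
    for r and f :: "nat \<Rightarrow> ('a \<Rightarrow> 'a) \<Rightarrow> 'k"
    by (auto simp: group_algebra_pow_def group_algebra_def PiE_def extensional_def)
  have add_mem: "f \<oplus>\<^bsub>group_algebra_pow G 2\<^esub> f' \<in> {..<2} \<rightarrow>\<^sub>E (carrier G \<rightarrow>\<^sub>E UNIV)"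
    for f f' :: "nat \<Rightarrow> ('a \<Rightarrow> 'a) \<Rightarrow> 'k"
    by (auto simp: group_algebra_pow_def group_algebra_def PiE_def extensional_def)
  have sm': "\<iota> (r \<odot>\<^bsub>L\<^esub> x) = (\<lambda>k. \<Sum>j<n. to_ac (r (gp j)) * \<iota> x (k + j))" if "x \<in> S" for r x
    using that by (simp add: fun_eq_iff sm sum_carrier_G \<iota>_gp)
  have add': "\<iota> (x \<oplus>\<^bsub>L\<^esub> y) = (\<lambda>k. \<iota> x k + \<iota> y k)" if "x \<in> S" "y \<in> S" for x y
    using that by (simp add: fun_eq_iff add)
  have top: "top \<in> module_homs (group_algebra G) L (group_algebra_pow G 2)"
    unfolding module_homs_def car carP
  proof (safe intro!: top_mem)
    fix x y assume xy: "x \<in> S" "y \<in> S"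
    show "top (x \<oplus>\<^bsub>L\<^esub> y) = top x \<oplus>\<^bsub>group_algebra_pow G 2\<^esub> top y"
      by (rule extP[OF top_mem add_mem])
         (simp add: addP top_ginv xy addc add' T(2)[OF TT] \<iota>_mem)
  next
    fix r :: "('a \<Rightarrow> 'a) \<Rightarrow> 'k" and x assume x: "x \<in> S"
    show "top (r \<odot>\<^bsub>L\<^esub> x) = r \<odot>\<^bsub>group_algebra_pow G 2\<^esub> top x"
      by (rule extP[OF top_mem smult_mem])
         (simp add: smP top_ginv x smc sm' T_sum[OF TT \<iota>_mem[OF x]])
  qed
  have bot: "bot \<in> module_homs (group_algebra G) (group_algebra_pow G 2) L"
    unfolding module_homs_def car carP
  proof (safe intro!: bot_S)
    fix f f' :: "nat \<Rightarrow> ('a \<Rightarrow> 'a) \<Rightarrow> 'k"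
    show "bot (f \<oplus>\<^bsub>group_algebra_pow G 2\<^esub> f') = bot f \<oplus>\<^bsub>L\<^esub> bot f'"
      by (rule \<iota>_inj) (simp_all add: bot_S addc add' \<iota>_bot addP B(2)[OF y_per y_per y_per y_per])
  next
    fix r :: "('a \<Rightarrow> 'a) \<Rightarrow> 'k" and f :: "nat \<Rightarrow> ('a \<Rightarrow> 'a) \<Rightarrow> 'k"
    show "bot (r \<odot>\<^bsub>group_algebra_pow G 2\<^esub> f) = r \<odot>\<^bsub>L\<^esub> bot f"
      by (rule \<iota>_inj) (simp_all add: bot_S smc sm' \<iota>_bot smP
          B_sum[OF y_per[of f 0] y_per[of f "Suc 0"]])
  qed
  have "t x y = bot (diamond_pow G 2 (top x) (top y))" if xy: "x \<in> S" "y \<in> S" for x y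
  proof (rule \<iota>_inj)
    fix k
    have "?y (diamond_pow G 2 (top x) (top y)) i = (\<lambda>k. TT i (\<iota> x) k * TT i (\<iota> y) k)" if "i < 2" for i
      using that by (simp add: diamond_pow_def diamond_def ginv_in_G top_ginv xy fun_eq_iff)
    from this[of 0] this[of 1] show "\<iota> (t x y) k = \<iota> (bot (diamond_pow G 2 (top x) (top y))) k"
      using BT[OF \<iota>_mem[OF xy(1)] \<iota>_mem[OF xy(2)], of k] by (simp add: \<iota>_bot t xy TT_def)
  qed (use xy tc bot_S in auto)
  hence "(2::nat) \<in> {k. \<exists>top \<in> module_homs (group_algebra G) L (group_algebra_pow G k).
     \<exists>bot \<in> module_homs (group_algebra G) (group_algebra_pow G k) L.
       \<forall>x\<in>carrier L. \<forall>y\<in>carrier L. t x y = bot (diamond_pow G k (top x) (top y))}"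
    using top bot car by auto
  hence "sym_complexity G L L t \<le> enat 2"
    unfolding sym_complexity_def by (rule INF_lower)
  thus ?thesis by (simp add: numeral_eq_enat)
qed

end

section \<open>The twisted module and the extension field as cyclic representations\<close>

lemma bij_betw_of_shift:
  fixes \<iota> :: "'a \<Rightarrow> nat \<Rightarrow> 'k::finite_field alg_closure"
  assumes fin: "finite S" and n: "n1 > 0" "n2 > 0" and \<iota>: "bij_betw \<iota> S (twisted_seqs n1 n2)"
    and g: "g \<in> S \<rightarrow> S" "\<And>x k. x \<in> S \<Longrightarrow> \<iota> (g x) k = \<iota> x (Suc k)"
  shows "bij_betw g S S"
proof -
  have "inj_on g S"
  proof (rule inj_onI)
    fix x y assume xy: "x \<in> S" "y \<in> S" "g x = g y"
    have "\<iota> x k = \<iota> y k" for k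
    proof -
      have N: "n1 * n2 > 0" using n by simp
      \<comment> \<open>\<open>n1 * n2 - 1\<close> further shifts complete a full period, so a shift
        can be undone.\<close>
      have "z (Suc (k + (n1 * n2 - 1))) = z k" if "z \<in> twisted_seqs n1 n2" for z :: "nat \<Rightarrow> 'k alg_closure"
      proof -
        have "Suc (k + (n1 * n2 - 1)) = k + n1 * n2" using N by linarith
        moreover have "z (k + n1 * n2) = z k" using that unfolding twisted_seqs_def by blast
        ultimately show ?thesis by (simp only:)
      qed
      thus ?thesis
        using g(2)[OF xy(1), of "k + (n1 * n2 - 1)"] g(2)[OF xy(2), of "k + (n1 * n2 - 1)"] xy \<iota>
        by (metis bij_betw_apply)
    qed
    hence "\<iota> x = \<iota> y" by (rule ext)
    thus "x = y" using \<iota> xy by (metis bij_betw_imp_inj_on inj_onD)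
  qed
  moreover have "g ` S \<subseteq> S" using g(1) by blast
  ultimately show ?thesis using fin by (metis bij_betw_def endo_inj_surj)
qed

lemma twisted_seqs_frob_pow:
  assumes "s \<in> twisted_seqs n1 n2"
  shows "s (i + j * n2) = frob_pow j (s i)"
proof (induction j)
  case (Suc j)
  have "s (i + Suc j * n2) = s (i + j * n2 + n2)" by (simp add: add_ac)
  also have "\<dots> = frob (s (i + j * n2))" using assms unfolding twisted_seqs_def by blast
  finally show ?case using Suc by simp
qed simp

lemma finite_twisted_carrier:
  assumes "n1 > 0"
  shows "finite (twisted_carrier n1 n2 :: (nat \<Rightarrow> 'k::finite_field alg_closure) set)"
  unfolding twisted_carrier_def using finite_ext_field[OF assms] by (intro finite_PiE) auto

text \<open>The vector is continued to all indices by the rule that \<open>n2\<close> steps apply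
  Frobenius; \<open>twisted_shift\<close> then becomes the index shift, as its last entry is
  \<open>x 0\<close> to the power q.\<close>

definition twisted_seq_of :: "nat \<Rightarrow> (nat \<Rightarrow> 'k::finite_field alg_closure) \<Rightarrow> nat \<Rightarrow> 'k alg_closure" where
  "twisted_seq_of n2 x k = frob_pow (k div n2) (x (k mod n2))"

lemma cyclic_rep_twisted:
  assumes n: "n1 > 0" "n2 > 0"
  shows "cyclic_rep (n1 * n2) n1 n2 (twisted_carrier n1 n2) (twisted_shift n1 n2)
    (twisted_seq_of n2 :: (nat \<Rightarrow> 'k::finite_field alg_closure) \<Rightarrow> _)"
proof
  let ?S = "twisted_carrier n1 n2 :: (nat \<Rightarrow> 'k alg_closure) set"
  show fin: "finite ?S" by (rule finite_twisted_carrier[OF n(1)])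
  have x_mem: "x i \<in> ext_field n1" if "x \<in> ?S" "i < n2" for x i
    using that by (auto simp: twisted_carrier_def)
  show bij: "bij_betw (twisted_seq_of n2) ?S (twisted_seqs n1 n2)"
  proof (rule bij_betw_imageI)
    show "inj_on (twisted_seq_of n2) ?S"
    proof (rule inj_onI)
      fix x y assume xy: "x \<in> ?S" "y \<in> ?S" "twisted_seq_of n2 x = twisted_seq_of n2 y"
      have "x i = y i" if "i < n2" for i
        using fun_cong[OF xy(3), of i] that by (simp add: twisted_seq_of_def)
      thus "x = y" using xy(1,2) unfolding twisted_carrier_def by (auto intro: PiE_ext)
    qed
    show "twisted_seq_of n2 ` ?S = twisted_seqs n1 n2"
    proof (intro equalityI subsetI)
      fix s assume "s \<in> twisted_seq_of n2 ` ?S"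
      then obtain x where x: "x \<in> ?S" "s = twisted_seq_of n2 x" by blast
      have "s (k + n2) = frob (s k)" for k using n by (simp add: x twisted_seq_of_def)
      moreover have "s (k + n1 * n2) = s k" for k
      proof -
        have "x (k mod n2) \<in> ext_field n1" using n x by (intro x_mem) auto
        hence "frob_pow (n1 + k div n2) (x (k mod n2)) = frob_pow (k div n2) (x (k mod n2))"
          unfolding ext_field_iff by (subst add.commute) (simp add: funpow_add)
        thus ?thesis using n by (simp add: x twisted_seq_of_def)
      qed
      ultimately show "s \<in> twisted_seqs n1 n2" by (simp add: twisted_seqs_def)
    next
      fix s :: "nat \<Rightarrow> 'k alg_closure" assume s: "s \<in> twisted_seqs n1 n2"
      have "s i \<in> ext_field n1" for i
        using twisted_seqs_frob_pow[OF s, of i n1] s by (simp add: ext_field_iff twisted_seqs_def)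
      hence "restrict s {..<n2} \<in> ?S" by (auto simp: twisted_carrier_def)
      moreover have "twisted_seq_of n2 (restrict s {..<n2}) k = s k" for k
        using twisted_seqs_frob_pow[OF s, of "k mod n2" "k div n2"] n by (simp add: twisted_seq_of_def)
      hence "s = twisted_seq_of n2 (restrict s {..<n2})" by (simp add: fun_eq_iff)
      ultimately show "s \<in> twisted_seq_of n2 ` ?S" by blast
    qed
  qed
  have maps: "twisted_shift n1 n2 \<in> ?S \<rightarrow> ?S"
  proof
    fix x assume x: "x \<in> ?S"
    have "x 0 ^ CARD('k) \<in> ext_field n1" using x_mem[OF x n(2)] by (rule ext_field_power)
    thus "twisted_shift n1 n2 x \<in> ?S"
      using x x_mem[OF x] by (simp add: twisted_shift_def twisted_carrier_def)
  qed
  show sh: "twisted_seq_of n2 (twisted_shift n1 n2 x) k = twisted_seq_of n2 x (Suc k)" if x: "x \<in> ?S" for x k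
  proof (cases "Suc (k mod n2) < n2")
    case True
    have d: "Suc k = (k div n2) * n2 + Suc (k mod n2)" by simp
    have "Suc k div n2 = k div n2" "Suc k mod n2 = Suc (k mod n2)"
      using True n by (simp_all add: div_Suc mod_Suc)
    thus ?thesis using x True by (simp add: twisted_seq_of_def twisted_shift_def)
  next
    case False
    hence m: "Suc (k mod n2) = n2" using n by (metis Suc_lessI mod_less_divisor)
    hence "Suc k div n2 = Suc (k div n2)" "Suc k mod n2 = 0"
      using n by (simp_all add: div_Suc mod_Suc)
    moreover have "k mod n2 < n2" using n by simp
    ultimately show ?thesis using x False
      by (simp add: twisted_seq_of_def twisted_shift_def funpow_swap1 flip: frob_def)
  qed
  have "bij_betw (twisted_shift n1 n2) ?S ?S"
    by (rule bij_betw_of_shift[where \<iota> = "twisted_seq_of n2", OF fin n bij]) (use maps sh in auto)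
  moreover have "twisted_shift n1 n2 \<in> extensional ?S" by (simp only: twisted_shift_def restrict_extensional)
  ultimately show "twisted_shift n1 n2 \<in> Bij ?S" by (simp only: Bij_def Int_iff mem_Collect_eq)
qed (use n in auto)

lemma cyclic_rep_ext:
  assumes n: "n > 0"
  shows "cyclic_rep n n 1 (ext_field n) (restrict frob (ext_field n))
    (\<lambda>x :: 'k::finite_field alg_closure. \<lambda>k. frob_pow k x)"
proof
  let ?S = "ext_field n :: 'k alg_closure set" and ?\<iota> = "\<lambda>x :: 'k alg_closure. \<lambda>k. frob_pow k x"
  show fin: "finite ?S" by (rule finite_ext_field[OF n])
  show bij: "bij_betw ?\<iota> ?S (twisted_seqs n 1)"
  proof (rule bij_betw_imageI)
    show "inj_on ?\<iota> ?S" by (rule inj_onI) (metis funpow_0)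
    show "?\<iota> ` ?S = twisted_seqs n 1"
    proof (intro equalityI subsetI)
      fix s assume "s \<in> ?\<iota> ` ?S"
      then obtain x where x: "x \<in> ?S" "s = ?\<iota> x" by blast
      have "frob_pow (k + n) x = frob_pow k x" for k
        using x(1) unfolding ext_field_iff by (simp add: funpow_add)
      thus "s \<in> twisted_seqs n 1" by (simp add: twisted_seqs_def x)
    next
      fix s :: "nat \<Rightarrow> 'k alg_closure" assume s: "s \<in> twisted_seqs n 1"
      have sk: "s k = frob_pow k (s 0)" for k using twisted_seqs_frob_pow[OF s, of 0 k] by simp
      have "s (0 + n * 1) = s 0" using s unfolding twisted_seqs_def by blast
      hence "s 0 \<in> ?S" using sk[of n] by (simp add: ext_field_iff)
      moreover have "s = ?\<iota> (s 0)" by (rule ext) (rule sk)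
      ultimately show "s \<in> ?\<iota> ` ?S" by (rule rev_image_eqI)
    qed
  qed
  have maps: "restrict frob ?S \<in> ?S \<rightarrow> ?S"
    using frob_pow_ext_field[of _ n 1] by auto
  show sh: "?\<iota> (restrict frob ?S x) k = ?\<iota> x (Suc k)" if "x \<in> ?S" for x k
    using that by (simp add: funpow_swap1)
  have "bij_betw (restrict frob ?S) ?S ?S"
    by (rule bij_betw_of_shift[where \<iota> = ?\<iota>, OF fin n zero_less_one bij]) (use maps sh in auto)
  thus "restrict frob ?S \<in> Bij ?S" by (simp add: Bij_def)
qed (use n in auto)

text \<open>By \<open>ext_field_hom_eq_frob_pow\<close> every automorphism over the base field is a
  power of Frobenius, so the Galois group is cyclic and generated by the restricted
  Frobenius.\<close>

lemma ext_galois_group_eq: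
  assumes pos: "n > 0"
  shows "ext_galois_group n = cyclic_rep.G (ext_field n :: 'k::finite_field alg_closure set) (restrict frob (ext_field n))"
proof -
  let ?S = "ext_field n :: 'k alg_closure set"
  interpret cyclic_rep n n 1 "ext_field n :: 'k alg_closure set" "restrict frob (ext_field n)" "\<lambda>x k. frob_pow k x"
    by (rule cyclic_rep_ext[OF pos])
  have gp: "gp j x = frob_pow j x" if "x \<in> ?S" for j x
    using \<iota>_gp[OF that, where j = j and k = 0] by simp
  have "{\<sigma> \<in> Bij ?S.
        (\<forall>x\<in>?S. \<forall>y\<in>?S. \<sigma> (x + y) = \<sigma> x + \<sigma> y \<and> \<sigma> (x * y) = \<sigma> x * \<sigma> y) \<and>
        (\<forall>a. \<sigma> (to_ac a) = to_ac a)} = gp ` {..<n}" (is "?H = _")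
  proof (intro equalityI subsetI)
    fix \<sigma> assume \<sigma>: "\<sigma> \<in> ?H"
    obtain i where i: "i < n" "\<And>x. x \<in> ?S \<Longrightarrow> \<sigma> x = frob_pow i x"
      by (rule ext_field_hom_eq_frob_pow[OF pos, of \<sigma>]) (use \<sigma> in auto)
    have "\<sigma> = gp i"
    proof (rule extensionalityI[of _ ?S])
      show "\<sigma> \<in> extensional ?S" using \<sigma> by (simp add: Bij_def)
      show "gp i \<in> extensional ?S" using gp_carrier by (simp add: BijGroup_def Bij_def)
    qed (simp add: i gp)
    thus "\<sigma> \<in> gp ` {..<n}" using i by blast
  next
    fix \<sigma> assume "\<sigma> \<in> gp ` {..<n}"
    then obtain i where "\<sigma> = gp i" by blast
    moreover have "gp i \<in> Bij ?S" using gp_carrier by (simp add: BijGroup_def)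
    ultimately show "\<sigma> \<in> ?H"
      by (simp add: gp ext_field_closed to_ac_in_ext_field frob_pow_add frob_pow_mult frob_pow_to_ac)
  qed
  moreover have "generate (BijGroup ?S) {restrict frob ?S} = gp ` {..<n}"
    using carrier_G by (simp add: G_def)
  ultimately show ?thesis by (simp add: ext_galois_group_def G_def)
qed

lemma nu_sym_twisted_le_2:
  fixes T0 T1 :: "(nat \<Rightarrow> 'k::finite_field alg_closure) \<Rightarrow> nat \<Rightarrow> 'k"
    and B :: "(nat \<Rightarrow> 'k) \<Rightarrow> (nat \<Rightarrow> 'k) \<Rightarrow> nat \<Rightarrow> 'k alg_closure"
  assumes pos: "n1 > 0" "n2 > 0" and dec: "seq_decomp (n1 * n2) n1 n2 T0 T1 B"
  shows "nu_sym_twisted TYPE('k::finite_field) n1 n2 \<le> 2"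
proof -
  let ?S = "twisted_carrier n1 n2 :: (nat \<Rightarrow> 'k alg_closure) set"
  let ?L = "twisted_module n1 n2 :: (((nat \<Rightarrow> 'k alg_closure) \<Rightarrow> (nat \<Rightarrow> 'k alg_closure)) \<Rightarrow> 'k, nat \<Rightarrow> 'k alg_closure) module"
  interpret rep_decomp "n1 * n2" n1 n2 ?S "twisted_shift n1 n2" "twisted_seq_of n2" T0 T1 B
    by (intro rep_decomp.intro cyclic_rep_twisted pos dec)
  have lt: "k mod n2 < n2" for k using pos by simp
  have G: "twisted_group n1 n2 = G" by (simp add: twisted_group_def G_def)
  have mem: "c x i \<in> ext_field n1" if "c \<in> carrier G" "x \<in> ?S" "i < n2" for c x i
  proof -
    have "c x \<in> ?S" using that gp_S unfolding carrier_G by blast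
    thus ?thesis using that(3) by (auto simp: twisted_carrier_def)
  qed
  have "sym_complexity G ?L ?L (\<otimes>\<^bsub>?L\<^esub>) \<le> 2"
  proof (rule sym_complexity_le_2)
    fix r :: "((nat \<Rightarrow> 'k alg_closure) \<Rightarrow> (nat \<Rightarrow> 'k alg_closure)) \<Rightarrow> 'k" and x k assume x: "x \<in> ?S"
    have "(\<Sum>c\<in>carrier G. to_ac (r c) * c x i) \<in> ext_field n1" if "i < n2" for i
      using mem[OF _ x that] by (intro ext_field_sum ext_field_closed to_ac_in_ext_field) auto
    thus "r \<odot>\<^bsub>?L\<^esub> x \<in> ?S" by (simp add: twisted_module_def twisted_carrier_def G)
    show "twisted_seq_of n2 (r \<odot>\<^bsub>?L\<^esub> x) k = (\<Sum>c\<in>carrier G. to_ac (r c) * twisted_seq_of n2 (c x) k)"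
      using lt by (simp only: twisted_module_def twisted_seq_of_def G module.simps lessThan_iff restrict_apply'
          frob_pow_sum frob_pow_mult frob_pow_to_ac)
  next
    fix x y k assume "x \<in> ?S" "y \<in> ?S"
    hence "x i \<in> ext_field n1" "y i \<in> ext_field n1" if "i < n2" for i
      using that unfolding twisted_carrier_def by auto
    hence "x i + y i \<in> ext_field n1" "x i * y i \<in> ext_field n1" if "i < n2" for i
      using that ext_field_closed by blast+
    thus "x \<oplus>\<^bsub>?L\<^esub> y \<in> ?S" "x \<otimes>\<^bsub>?L\<^esub> y \<in> ?S"
      unfolding twisted_module_def twisted_carrier_def by auto
    show "twisted_seq_of n2 (x \<oplus>\<^bsub>?L\<^esub> y) k = twisted_seq_of n2 x k + twisted_seq_of n2 y k"
      "twisted_seq_of n2 (x \<otimes>\<^bsub>?L\<^esub> y) k = twisted_seq_of n2 x k * twisted_seq_of n2 y k"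
      using lt by (simp_all add: twisted_module_def twisted_seq_of_def frob_pow_add frob_pow_mult)
  qed (simp add: twisted_module_def)
  thus ?thesis by (simp only: nu_sym_twisted_def G Let_def)
qed

lemma nu_sym_le_2:
  fixes T0 T1 :: "(nat \<Rightarrow> 'k::finite_field alg_closure) \<Rightarrow> nat \<Rightarrow> 'k"
    and B :: "(nat \<Rightarrow> 'k) \<Rightarrow> (nat \<Rightarrow> 'k) \<Rightarrow> nat \<Rightarrow> 'k alg_closure"
  assumes pos: "n > 0" and dec: "seq_decomp n n 1 T0 T1 B"
  shows "nu_sym TYPE('k::finite_field) n \<le> 2"
proof -
  let ?S = "ext_field n :: 'k alg_closure set"
  let ?L = "ext_module n :: (('k alg_closure \<Rightarrow> 'k alg_closure) \<Rightarrow> 'k, 'k alg_closure) module"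
  interpret rep_decomp n n 1 ?S "restrict frob ?S" "\<lambda>x k. frob_pow k x" T0 T1 B
    by (intro rep_decomp.intro cyclic_rep_ext pos dec)
  have G: "ext_galois_group n = G" by (rule ext_galois_group_eq[OF pos])
  have "sym_complexity G ?L ?L (\<otimes>\<^bsub>?L\<^esub>) \<le> 2"
  proof (rule sym_complexity_le_2)
    fix r :: "('k alg_closure \<Rightarrow> 'k alg_closure) \<Rightarrow> 'k" and x k assume x: "x \<in> ?S"
    have "c x \<in> ?S" if "c \<in> carrier G" for c
      using that x gp_S unfolding carrier_G by blast
    thus "r \<odot>\<^bsub>?L\<^esub> x \<in> ?S"
      by (auto simp: ext_module_def G intro!: ext_field_sum ext_field_closed to_ac_in_ext_field)
    show "frob_pow k (r \<odot>\<^bsub>?L\<^esub> x) = (\<Sum>c\<in>carrier G. to_ac (r c) * frob_pow k (c x))"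
      by (simp only: ext_module_def module.simps G frob_pow_sum frob_pow_mult frob_pow_to_ac)
  qed (auto simp: ext_module_def frob_pow_add frob_pow_mult ext_field_closed)
  thus ?thesis by (simp only: nu_sym_def G Let_def)
qed

text \<open>A decomposition of length 1 would make \<open>top\<close> a bijection onto \<open>K[C]\<close>, which has zero divisors
  for the componentwise product.\<close>
lemma nu_sym_ge_2:
  assumes n2: "n \<ge> 2"
  shows "nu_sym TYPE('k::finite_field) n \<ge> 2"
proof -
  let ?S = "ext_field n :: 'k alg_closure set"
  let ?L = "ext_module n :: (('k alg_closure \<Rightarrow> 'k alg_closure) \<Rightarrow> 'k, 'k alg_closure) module"
  have n0: "n > 0" using n2 by simp
  interpret cyclic_rep n n 1 ?S "restrict frob ?S" "\<lambda>x k. frob_pow k x"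
    by (rule cyclic_rep_ext[OF n0])
  have G: "ext_galois_group n = G" by (rule ext_galois_group_eq[OF n0])
  have car: "carrier ?L = ?S" by (simp add: ext_module_def)
  have finG: "finite (carrier G)" by (simp add: carrier_G)
  have q: "CARD('k) > 1" using card_ge_2[where ?'k = 'k] by simp
  have no_short: False if k: "k < 2"
    and top: "top \<in> module_homs (group_algebra G) ?L (group_algebra_pow G k)"
    and bot: "bot \<in> module_homs (group_algebra G) (group_algebra_pow G k) ?L"
    and dec: "\<And>x y. x \<in> ?S \<Longrightarrow> y \<in> ?S \<Longrightarrow> x * y = bot (diamond_pow G k (top x) (top y))" for k top bot
  proof -
    let ?A = "carrier (group_algebra_pow G k :: (('k alg_closure \<Rightarrow> 'k alg_closure) \<Rightarrow> 'k, nat \<Rightarrow> ('k alg_closure \<Rightarrow> 'k alg_closure) \<Rightarrow> 'k) module)"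
    have A: "?A = {..<k} \<rightarrow>\<^sub>E (carrier G \<rightarrow>\<^sub>E UNIV)" by (simp add: group_algebra_pow_def group_algebra_def)
    have top_A: "top x \<in> ?A" if "x \<in> ?S" for x using top that by (auto simp: module_homs_def car)
    \<comment> \<open>\<open>top x\<close> determines \<open>x\<close>, as \<open>x * 1\<close> is
      recovered from \<open>top x\<close> and \<open>top 1\<close>.\<close>
    have inj: "inj_on top ?S"
    proof (rule inj_onI)
      fix x y assume xy: "x \<in> ?S" "y \<in> ?S" "top x = top y"
      have "x * 1 = y * 1" using dec[OF xy(1) ext_field_closed(2)] dec[OF xy(2) ext_field_closed(2)] xy(3) by simp
      thus "x = y" by simp
    qed
    have cardA: "card ?A = (CARD('k) ^ n) ^ k"
      unfolding A using finG by (simp add: card_PiE card_G)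
    have finA: "finite ?A" unfolding A using finG by (intro finite_PiE) auto
    have cardS: "card (top ` ?S) = CARD('k) ^ n" using n0 by (simp add: card_image[OF inj] card_ext_field)
    have sub: "top ` ?S \<subseteq> ?A" using top_A by blast
    \<comment> \<open>Length 0 leaves a single element in the target, too few for an injection; in
      length 1 the target has the size of the field.\<close>
    have "CARD('k) ^ n \<le> (CARD('k) ^ n) ^ k" using card_mono[OF finA sub] cardA cardS by simp
    moreover have "CARD('k) ^ n > 1" using q n0 by (metis one_less_power)
    ultimately have k1: "k = 1" using k by (cases k) auto
    have img: "top ` ?S = ?A" using finA sub cardA cardS k1 by (intro card_subset_eq) auto
    \<comment> \<open>Indicator functions: for two different group elements their componentwise
      product is 0 although neither is 0.\<close>
    define e where "e c = (\<lambda>i\<in>{..<k}. \<lambda>d\<in>carrier G. if d = c then (1::'k) else 0)" for c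
    define z where "z = (\<lambda>i\<in>{..<k}. \<lambda>d\<in>carrier G. (0::'k))"
    have "e (gp 0) \<in> ?A" "e (gp 1) \<in> ?A" unfolding A e_def by (auto simp: PiE_def extensional_def)
    then obtain x y where xy: "x \<in> ?S" "top x = e (gp 0)" "y \<in> ?S" "top y = e (gp 1)"
      using img by (metis imageE)
    have ne: "gp 0 \<noteq> gp 1" using inj_on_eq_iff[OF inj_gp, of 0 1] n2 by simp
    have "top 0 = top (0 + 0)" by simp
    also have "\<dots> = top 0 \<oplus>\<^bsub>group_algebra_pow G k\<^esub> top 0"
    proof -
      have "top (x \<oplus>\<^bsub>?L\<^esub> y) = top x \<oplus>\<^bsub>group_algebra_pow G k\<^esub> top y"
        if "x \<in> carrier ?L" "y \<in> carrier ?L" for x y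
        using top that unfolding module_homs_def by blast
      from this[of 0 0] show ?thesis using ext_field_closed(1)[of n] by (simp add: ext_module_def)
    qed
    finally have t00: "top 0 = top 0 \<oplus>\<^bsub>group_algebra_pow G k\<^esub> top 0" .
    have t0: "top 0 i c = 0" if "i < k" "c \<in> carrier G" for i c
    proof -
      have "top 0 i c = (top 0 \<oplus>\<^bsub>group_algebra_pow G k\<^esub> top 0) i c"
        by (rule fun_cong[OF fun_cong[OF t00]])
      also have "\<dots> = top 0 i c + top 0 i c" using that by (simp add: group_algebra_pow_def group_algebra_def)
      finally show ?thesis by (simp only: add_cancel_right_right)
    qed
    have "diamond_pow G k (top x) (top y) = z"
      unfolding xy z_def diamond_pow_def diamond_def e_def by (intro restrict_ext) (use ne in \<open>auto simp del: One_nat_def\<close>)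
    \<comment> \<open>Comparison with the pair \<open>0\<close>, \<open>y\<close> shows
      \<open>x * y = 0\<close> without evaluating \<open>bot\<close>.\<close>
    moreover have "diamond_pow G k (top 0) (top y) = z"
      unfolding z_def diamond_pow_def diamond_def by (intro restrict_ext) (simp add: t0)
    ultimately have "x * y = 0 * y"
      using dec[OF xy(1,3)] dec[OF ext_field_closed(1) xy(3)] by simp
    hence "x = 0 \<or> y = 0" by simp
    thus False
      using t0[of 0 "gp 0"] t0[of 0 "gp 1"] xy gp_in_G k1 by (auto simp: e_def)
  qed
  have no: "\<not> k < 2" if "\<exists>top\<in>module_homs (group_algebra G) ?L (group_algebra_pow G k).
      \<exists>bot\<in>module_homs (group_algebra G) (group_algebra_pow G k) ?L.
       \<forall>x\<in>carrier ?L. \<forall>y\<in>carrier ?L. x \<otimes>\<^bsub>?L\<^esub> y = bot (diamond_pow G k (top x) (top y))" for k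
  proof
    assume k: "k < 2"
    from that obtain top bot where top: "top \<in> module_homs (group_algebra G) ?L (group_algebra_pow G k)"
      and bot: "bot \<in> module_homs (group_algebra G) (group_algebra_pow G k) ?L"
      and dec: "\<forall>x\<in>carrier ?L. \<forall>y\<in>carrier ?L. x \<otimes>\<^bsub>?L\<^esub> y = bot (diamond_pow G k (top x) (top y))"
      by (elim bexE)
    have "x * y = bot (diamond_pow G k (top x) (top y))" if "x \<in> ?S" "y \<in> ?S" for x y
      using bspec[OF bspec[OF dec], of x y] that by (simp add: ext_module_def)
    thus False by (rule no_short[OF k top bot])
  qed
  have "2 \<le> sym_complexity G ?L ?L (\<otimes>\<^bsub>?L\<^esub>)"
    unfolding sym_complexity_def
  proof (rule INF_greatest)
    fix k assume "k \<in> {k. \<exists>top\<in>module_homs (group_algebra G) ?L (group_algebra_pow G k).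
      \<exists>bot\<in>module_homs (group_algebra G) (group_algebra_pow G k) ?L.
       \<forall>x\<in>carrier ?L. \<forall>y\<in>carrier ?L. x \<otimes>\<^bsub>?L\<^esub> y = bot (diamond_pow G k (top x) (top y))}"
    from no[OF CollectD[OF this]] show "2 \<le> enat k" by (simp add: numeral_eq_enat)
  qed
  thus ?thesis by (simp only: nu_sym_def G Let_def)
qed

section \<open>Closed points of a fibre and the choice of the generator\<close>

lemma ex_coprime_mult_gcd_mod_eq:
  fixes j n :: nat
  assumes "n > 0"
  obtains e where "coprime e n" "(e * gcd j n) mod n = j mod n"
proof -
  define d where "d = gcd j n"
  obtain j' n' where jn: "j = j' * d" "n = n' * d" "coprime j' n'"
    using gcd_coprime_exists[of j n] assms unfolding d_def by auto
  \<comment> \<open>\<open>k\<close> is built so that each prime factor of \<open>n\<close> divides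
    exactly one of \<open>j'\<close> and \<open>n' * k\<close>; hence it does not divide their sum,
    which serves as \<open>e\<close>.\<close>
  define k where "k = (\<Prod>p\<in>{p \<in> prime_factors n. \<not> p dvd j'}. p)"
  have no: "\<not> q dvd j' + n' * k" if q: "prime q" "q dvd n" for q
  proof (cases "q dvd j'")
    case True
    have "\<not> q dvd n'" using True q(1) jn(3) by (metis coprime_common_divisor not_prime_unit)
    moreover have "\<not> q dvd k"
    proof
      assume "q dvd k"
      then obtain p where "p \<in> prime_factors n" "\<not> p dvd j'" "q dvd p"
        unfolding k_def using q(1) by (auto simp: prime_dvd_prod_iff)
      thus False using q(1) True by (metis in_prime_factors_imp_prime primes_dvd_imp_eq)
    qed
    ultimately have "\<not> q dvd n' * k" using q(1) by (simp add: prime_dvd_mult_iff)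
    thus ?thesis using True by (simp add: dvd_add_right_iff)
  next
    case False
    have "q \<in> prime_factors n" using q assms by (simp add: in_prime_factors_iff)
    hence "q dvd k" unfolding k_def using False by (intro dvd_prodI) auto
    thus ?thesis using False by (simp add: dvd_add_left_iff)
  qed
  have "coprime (j' + n' * k) n"
  proof (rule coprimeI, rule ccontr)
    fix c assume c: "c dvd j' + n' * k" "c dvd n" "\<not> is_unit c"
    then obtain q where "prime q" "q dvd c" using prime_factor_nat[of c] by auto
    with no[of q] c show False using dvd_trans by blast
  qed
  moreover have "((j' + n' * k) * d) mod n = j mod n"
  proof -
    have "(j' + n' * k) * d = j + n * k" by (simp add: jn algebra_simps)
    thus ?thesis by simp
  qed
  ultimately show ?thesis by (rule that[unfolded d_def[symmetric]])
qed

lemma ex_mult_mod_eq_gcd: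
  fixes j n :: nat
  obtains f where "(f * j) mod n = gcd j n mod n"
proof (cases "j = 0")
  case False
  from bezout_nat[OF this, of n] obtain x y where "j * x = n * y + gcd j n" by blast
  hence "(x * j) mod n = gcd j n mod n" by (simp add: mult.commute)
  thus ?thesis by (rule that)
qed (rule that[of 0], simp)

lemma frob_pow_in_absolute_galois: "frob_pow i \<in> (absolute_galois :: ('k::finite_field alg_closure \<Rightarrow> _) set)"
  unfolding absolute_galois_def
  by (simp add: bij_fn bij_def inj_frob surj_frob frob_pow_add frob_pow_mult frob_pow_to_ac)

context smooth_weierstrass begin

lemma mul_mod:
  assumes "P \<in> pts" "mul P n = Infinity"
  shows "mul P (k mod n) = mul P k"
proof -
  have "mul P k = mul P (n * (k div n) + k mod n)" by simp
  also have "\<dots> = mul P (k mod n)" using assms by (simp only: mul_add flip: mul_mul) simp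
  finally show ?thesis by simp
qed

lemma mul_neg: "P \<in> pts \<Longrightarrow> mul (\<boxminus>P) k = \<boxminus>(mul P k)"
  by (subst add_eq_Infinity_iff[symmetric], subst mul_distrib[symmetric]) simp_all

lemma mul_2: "P \<in> pts \<Longrightarrow> mul P 2 = P \<boxplus> P"
  by (simp add: numeral_2_eq_2 mul.simps(2))

end

context frob_curve begin

lemma funpow_frob_pt: "(frob_pt ^^ i) P = map_ec_point (frob_pow i) P"
  by (induction i) (cases P; simp)+

lemma frob_pt_mul: "frob_pt (mul P k) = mul (frob_pt P) k"
  by (induction k) (simp_all add: mul.simps(2) frob_pt_add)

context
  fixes n j :: nat and t b :: "'k alg_closure ec_point"
  assumes n: "n > 0"
    and t: "t \<in> pts" "frob_pt t = t" and ord_t: "\<And>k. mul t k = Infinity \<longleftrightarrow> n dvd k"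
    and b: "b \<in> pts" "frob_pt b = b \<boxplus> mul t j"
begin

lemma funpow_frob_pt_orbit: "(frob_pt ^^ i) b = b \<boxplus> mul t (i * j)"
proof (induction i)
  case (Suc i)
  have "mul t (Suc i * j) = mul t j \<boxplus> mul t (i * j)" using t by (simp add: mul_add)
  thus ?case using Suc t b by (simp add: frob_pt_add frob_pt_mul ec_add_assoc)
qed (use b in simp)

text \<open>\<open>b\<close> is fixed by the \<open>n\<close>-th power of Frobenius, so its
  coordinates lie in the extension of degree \<open>n\<close>, where every Galois automorphism acts
  as a power of Frobenius.\<close>

lemma closed_point_eq: "closed_point b = range (\<lambda>i. b \<boxplus> mul t (i * j))"
proof (intro equalityI subsetI)
  fix Q assume "Q \<in> range (\<lambda>i. b \<boxplus> mul t (i * j))"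
  then obtain i where "Q = b \<boxplus> mul t (i * j)" by blast
  hence "Q = map_ec_point (frob_pow i) b" by (simp only: funpow_frob_pt flip: funpow_frob_pt_orbit)
  thus "Q \<in> closed_point b" unfolding closed_point_def using frob_pow_in_absolute_galois by blast
next
  fix Q assume "Q \<in> closed_point b"
  then obtain \<sigma> where \<sigma>: "Q = map_ec_point \<sigma> b" "\<sigma> \<in> absolute_galois" unfolding closed_point_def by blast
  obtain i where i: "\<And>x. x \<in> ext_field n \<Longrightarrow> \<sigma> x = frob_pow i x"
    by (rule ext_field_hom_eq_frob_pow[OF n, of \<sigma>]) (use \<sigma>(2) in \<open>auto simp: absolute_galois_def\<close>)
  have "mul t (n * j) = Infinity" unfolding ord_t by simp
  hence "map_ec_point (frob_pow n) b = b"
    using funpow_frob_pt_orbit[of n] b by (simp add: funpow_frob_pt)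
  hence "Q = map_ec_point (frob_pow i) b"
    unfolding \<sigma>(1) by (cases b) (simp_all add: i ext_field_iff)
  hence "Q = b \<boxplus> mul t (i * j)" using funpow_frob_pt_orbit[of i] by (simp add: funpow_frob_pt)
  thus "Q \<in> range (\<lambda>i. b \<boxplus> mul t (i * j))" by (rule range_eqI)
qed

text \<open>The orbit is a coset of the subgroup generated by \<open>j t\<close>, which by Bezout is
  also generated by \<open>gcd j n\<close> times \<open>t\<close>.\<close>

lemma card_closed_point: "card (closed_point b) = n div gcd j n"
proof -
  define d where "d = gcd j n"
  obtain j' where j': "j = d * j'" unfolding d_def by (meson dvdE gcd_dvd1)
  obtain n' where n': "n = d * n'" unfolding d_def by (meson dvdE gcd_dvd2)
  have d: "d > 0" using n n' by simp
  have mod: "mul t (k mod n) = mul t k" for k by (rule mul_mod) (simp_all add: t ord_t)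
  obtain f where f: "(f * j) mod n = d mod n" unfolding d_def by (rule ex_mult_mod_eq_gcd)
  have "range (\<lambda>i. b \<boxplus> mul t (i * j)) = (\<lambda>i. b \<boxplus> mul t (d * i)) ` {..<n'}"
  proof (intro equalityI subsetI)
    fix Q assume "Q \<in> range (\<lambda>i. b \<boxplus> mul t (i * j))"
    then obtain i where i: "Q = b \<boxplus> mul t (i * j)" by blast
    have "(i * j) mod n = (d * (i * j' mod n')) mod n"
      by (simp add: j' n' mult.left_commute flip: mult_mod_right)
    hence "Q = b \<boxplus> mul t (d * (i * j' mod n'))" using i mod by metis
    moreover have "i * j' mod n' < n'" using n n' by simp
    ultimately show "Q \<in> (\<lambda>i. b \<boxplus> mul t (d * i)) ` {..<n'}" by blast
  next
    fix Q assume "Q \<in> (\<lambda>i. b \<boxplus> mul t (d * i)) ` {..<n'}"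
    then obtain i where i: "Q = b \<boxplus> mul t (d * i)" by blast
    have "(f * i * j) mod n = ((f * j) mod n * i) mod n"
      by (simp only: mod_mult_left_eq) (simp only: mult_ac)
    also have "\<dots> = (d * i) mod n" unfolding f by (simp add: mod_mult_left_eq)
    finally have "mul t (d * i) = mul t (f * i * j)" using mod by metis
    hence "Q = b \<boxplus> mul t (f * i * j)" using i by simp
    thus "Q \<in> range (\<lambda>i. b \<boxplus> mul t (i * j))" by (rule range_eqI)
  qed
  moreover have "inj_on (\<lambda>i. b \<boxplus> mul t (d * i)) {..<n'}"
  proof (rule linorder_inj_onI')
    fix i k assume ik: "i \<in> {..<n'}" "k \<in> {..<n'}" "i < k"
    have "mul t (d * k) = mul t (d * i) \<boxplus> mul t (d * (k - i))"
      using t ik by (simp flip: mul_add add: diff_mult_distrib2)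
    moreover have "mul t (d * (k - i)) \<noteq> Infinity"
      unfolding ord_t using ik d by (auto simp: n' dest: dvd_imp_le)
    ultimately show "b \<boxplus> mul t (d * i) \<noteq> b \<boxplus> mul t (d * k)"
      using t b by (metis add_left_cancel ec_add_in_pts mul_in_pts add_left_neg_cancel(2) pt.r_one pt.one_closed)
  qed
  ultimately have "card (closed_point b) = n'" by (simp add: closed_point_eq card_image)
  moreover have "n div d = n'" by (subst n') (use d in simp)
  ultimately show ?thesis by (simp only: d_def)
qed

end
end

section \<open>From the covering to the complexity bounds\<close>

lemma (in cyclic_cover) seq_decomp: "seq_decomp n n1 n2 (top_map Infinity) (top_map u0) bot_map"
proof
  fix T :: "(nat \<Rightarrow> 'k alg_closure) \<Rightarrow> nat \<Rightarrow> 'k" and x :: "nat \<Rightarrow> 'k alg_closure"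
  assume T: "T \<in> {top_map Infinity, top_map u0}" and x: "x \<in> twisted_seqs n1 n2"
  obtain b where T_eq: "T = top_map b" and b: "b \<in> pts" "frob_pt b = b"
    using T pts0 frob_u by auto
  show "T x \<in> periodic_seqs n" unfolding T_eq by (rule top_map_periodic[OF b])
  show "T (\<lambda>k. x k + y k) k = T x k + T y k" if "y \<in> twisted_seqs n1 n2" for y k
    unfolding T_eq by (rule top_map_add[OF b x that])
  show "T (\<lambda>k. to_ac r * x k) k = r * T x k" for r k unfolding T_eq by (rule top_map_scale[OF b x])
  show "T (\<lambda>k. x (Suc k)) k = T x (Suc k)" for k unfolding T_eq by (rule top_map_shift[OF b x])
qed (fact bot_map_twisted bot_map_add bot_map_scale bot_map_shift bot_map_top_map)+

theorem theorem3:
  fixes Y X' :: "'k::finite_field weierstrass"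
    and t a u v :: "'k alg_closure ec_point"
    and C :: "'k alg_closure ec_point set"
    and \<rho> \<rho>_dual :: "'k alg_closure ec_point \<Rightarrow> 'k alg_closure ec_point"
    and n n1 n2 :: nat
  assumes "n \<ge> 2"
    and "elliptic_curve Y"
    and "t \<in> rat_points Y" and "group.ord (geom_group Y) t = n"
    and "C = generate (geom_group Y) {t}"
    and "elliptic_curve X'" and "quotient_isogeny Y C X' \<rho>"
    and "dual_isogeny Y X' n \<rho> \<rho>_dual"
    and "a \<in> rat_points X'"
    and "inertial_degree Y \<rho> n a n1" and "n2 = n div n1"
    and "u \<in> \<rho> ` rat_points Y" and "u \<noteq> Infinity"
    and "v \<in> rat_points X'"
    and "v \<otimes>\<^bsub>geom_group X'\<^esub> inv\<^bsub>geom_group X'\<^esub> a \<notin> isogeny_kernel X' \<rho>_dual"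
    and "u \<otimes>\<^bsub>geom_group X'\<^esub> inv\<^bsub>geom_group X'\<^esub> (v [^]\<^bsub>geom_group X'\<^esub> (2::nat))
           \<notin> isogeny_kernel X' \<rho>_dual"
  shows "nu_sym_twisted TYPE('k) n1 n2 \<le> 2 \<and> (n2 = 1 \<longrightarrow> nu_sym TYPE('k) n = 2)"
proof -
  interpret frob_curve Y using assms(2) by unfold_locales (simp add: elliptic_curve_def)
  interpret W: smooth_weierstrass "geom X'" using assms(6) by unfold_locales (simp add: elliptic_curve_def)
  have n0: "n > 0" using assms(1) by simp
  have t: "t \<in> pts" "frob_pt t = t" using assms(3) by (simp_all add: rat_points_iff)
  have ord_t: "mul t k = Infinity \<longleftrightarrow> n dvd k" for k
    using pt.pow_eq_id[of t k] t(1) assms(4) by (simp add: mul_eq_nat_pow)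
  have mod: "mul t (k mod n) = mul t k" for k by (rule mul_mod) (simp_all add: t ord_t)
  have C: "C = range (mul t)"
    unfolding assms(5) using pt.generate_pow_nat[of t] t assms(4) n0 by (auto simp: mul_eq_nat_pow)
  have "C \<subseteq> mul t ` {..<n}"
  proof
    fix c assume "c \<in> C"
    then obtain k where "c = mul t (k mod n)" unfolding C by (auto simp: mod)
    thus "c \<in> mul t ` {..<n}" using n0 by auto
  qed
  hence C_fin: "finite C" by (rule finite_subset) simp
  have C_pts: "C \<subseteq> pts" unfolding C using t by auto
  have mor: "curve_morphism Y X' \<rho>" and \<rho>0: "\<rho> Infinity = Infinity"
    and surj: "\<rho> ` pts = geom_points X'"
    and fib: "\<And>P Q. P \<in> pts \<Longrightarrow> Q \<in> pts \<Longrightarrow> \<rho> P = \<rho> Q \<longleftrightarrow> (\<exists>k. Q = P \<boxplus> mul t k)"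
    using assms(7) unfolding quotient_isogeny_def isogeny_def C ec_group_simps by auto
  have hom: "\<rho> (P \<boxplus> Q) = W.plus_pt (\<rho> P) (\<rho> Q)" if "P \<in> pts" "Q \<in> pts" for P Q
    by (rule quotient_isogeny_hom[OF _ _ assms(7) C_pts C_fin that]) unfold_locales
  have \<rho>_neg: "\<rho> (ec_neg (geom Y) P) = W.neg_pt (\<rho> P)" if "P \<in> pts" for P
  proof -
    have "W.plus_pt (\<rho> P) (\<rho> (ec_neg (geom Y) P)) = Infinity"
      using that \<rho>0 by (simp flip: hom add: add_eq_Infinity_iff)
    thus ?thesis by (simp add: W.add_eq_Infinity_iff)
  qed
  have \<rho>_pts: "\<rho> P \<in> geom_points X'" if "P \<in> pts" for P using surj that by blast
  \<comment> \<open>Frobenius commutes with \<open>\<rho>\<close> and fixes \<open>c\<close>, so it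
    maps a preimage into the same fibre, a coset of \<open>C\<close>.\<close>
  have lift: "\<exists>b k. b \<in> pts \<and> \<rho> b = c \<and> frob_pt b = b \<boxplus> mul t k" if c: "c \<in> rat_points X'" for c
  proof -
    have "c \<in> \<rho> ` pts" and fc: "frob_pt c = c" using c surj by (simp_all add: rat_points_iff)
    then obtain b where b: "b \<in> pts" "\<rho> b = c" by blast
    have "\<rho> b = \<rho> (frob_pt b)" using curve_morphism_frob[OF mor b(1)] b fc by simp
    moreover have "frob_pt b \<in> pts" using b by (simp add: frob_pt_in_pts_iff)
    ultimately show ?thesis using fib[of b "frob_pt b"] b by blast
  qed
  obtain a0 j where a0: "a0 \<in> pts" "\<rho> a0 = a" "frob_pt a0 = a0 \<boxplus> mul t j"
    using lift[OF assms(9)] by blast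
  obtain v0 m where v0: "v0 \<in> pts" "\<rho> v0 = v" "frob_pt v0 = v0 \<boxplus> mul t m"
    using lift[OF assms(14)] by blast
  obtain u0 where u0: "u0 \<in> pts" "\<rho> u0 = u" "frob_pt u0 = u0"
    using assms(12) by (auto simp: rat_points_iff)
  \<comment> \<open>The closed point of \<open>a0\<close> has degree \<open>n div gcd j n\<close>,
    so the inertial degree determines \<open>gcd j n\<close>, which turns out to be
    \<open>n2\<close>.\<close>
  have "closed_point a0 \<in> fiber_closed_points Y \<rho> a" using a0 by (auto simp: fiber_closed_points_def)
  hence n1: "n1 = n div gcd j n"
    using assms(10) card_closed_point[OF n0 t ord_t a0(1,3)] unfolding inertial_degree_def by auto
  obtain n' where n': "n = gcd j n * n'" by (meson dvdE gcd_dvd2)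
  have "n1 = n'" using n0 by (subst n1) (metis n' gcd_eq_0_iff gr_implies_not0 nonzero_mult_div_cancel_left)
  hence n1_n': "n = gcd j n * n1" using n' by simp
  moreover have "n1 > 0" using n0 n1_n' by (metis gr0I mult_0_right not_less0)
  ultimately have n2: "n2 = gcd j n" unfolding assms(11) by (metis nonzero_mult_div_cancel_right not_less0)
  have nn: "n = n1 * n2" using n1_n' unfolding n2 by (simp only: mult.commute)
  \<comment> \<open>\<open>t' = e t\<close> again generates \<open>C\<close>, and Frobenius
    translates \<open>a0\<close> by \<open>j t = n2 t'\<close>; the locale
    \<open>cyclic_cover\<close> asks for a translation by exactly \<open>n2\<close> times its
    generator.\<close>
  obtain e where e: "coprime e n" "(e * n2) mod n = j mod n"
    unfolding n2 by (rule ex_coprime_mult_gcd_mod_eq[OF n0])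
  define t' where "t' = mul t e"
  have mul_t': "mul t' k = mul t (e * k)" for k unfolding t'_def using t by (simp add: mul_mul)
  \<comment> \<open>\<open>f\<close> inverts \<open>e\<close> modulo \<open>n\<close>, so that
    \<open>m t\<close> is \<open>f * m\<close> times the new generator.\<close>
  obtain f where "(f * e) mod n = 1 mod n" using e(1) ex_mult_mod_eq_gcd[of e n] by auto
  hence "(e * (f * m)) mod n = m mod n" by (metis mod_mult_left_eq mult.assoc mult.commute mult_1)
  hence frob_v: "frob_pt v0 = v0 \<boxplus> mul t' (f * m)" unfolding mul_t' v0(3) using mod by metis
  have dual: "\<rho>_dual (\<rho> P) = mul P n" if "P \<in> pts" for P
    using assms(8) that by (simp add: dual_isogeny_def mul_eq_nat_pow)
  \<comment> \<open>The dual isogeny sends the image of \<open>P - Q\<close> to \<open>n\<close>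
    times \<open>P - Q\<close>; equal multiples would put that image into its kernel.\<close>
  have kernel: "mul Q n \<noteq> mul P n"
    if "P \<in> pts" "Q \<in> pts" "W.plus_pt (\<rho> P) (W.neg_pt (\<rho> Q)) \<notin> isogeny_kernel X' \<rho>_dual" for P Q
  proof
    assume eq: "mul Q n = mul P n"
    have "mul (P \<boxplus> ec_neg (geom Y) Q) n = Infinity"
      using that by (simp add: mul_distrib mul_neg eq add_eq_Infinity_iff)
    hence "\<rho> (P \<boxplus> ec_neg (geom Y) Q) \<in> isogeny_kernel X' \<rho>_dual"
      using that by (simp add: isogeny_kernel_def dual \<rho>_pts)
    thus False using that by (simp add: hom \<rho>_neg)
  qed
  have W_pts: "a \<in> geom_points X'" "v \<in> geom_points X'" using a0 v0 \<rho>_pts by blast+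
  interpret cc: cyclic_cover Y n n1 n2 "f * m" t' a0 v0 u0
  proof
    show "mul t' k = Infinity \<longleftrightarrow> n dvd k" for k
      using e(1) by (simp add: mul_t' ord_t coprime_dvd_mult_right_iff coprime_commute)
    show "frob_pt a0 = a0 \<boxplus> mul t' n2" unfolding mul_t' a0(3) using mod e(2) by metis
    show "u0 \<noteq> mul t' k" for k
    proof
      assume "u0 = mul t' k"
      hence "\<rho> Infinity = \<rho> u0" using fib[of Infinity u0] u0 by (auto simp: mul_t')
      thus False using \<rho>0 u0 assms(13) by simp
    qed
    show "mul a0 n \<noteq> mul v0 n"
      by (rule kernel) (use a0 v0 assms(15) W_pts in \<open>simp_all add: W.ec_group_simps W.inv_eq_ec_neg\<close>)
    \<comment> \<open>\<open>2 n\<close> times \<open>v0\<close> is read as \<open>n\<close> times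
      \<open>v0 + v0\<close>, a point above \<open>2v\<close>.\<close>
    have "mul (v0 \<boxplus> v0) n \<noteq> mul u0 n"
      by (rule kernel) (use u0 v0 assms(16) W_pts in
        \<open>simp_all add: W.ec_group_simps W.inv_eq_ec_neg hom W.mul_2 flip: W.mul_eq_nat_pow\<close>)
    thus "mul u0 n \<noteq> mul v0 (2 * n)" using v0 by (simp flip: mul_mul add: mul_2)
    show "t' \<in> pts" "frob_pt t' = t'" unfolding t'_def using t by (simp_all add: frob_pt_mul)
  qed (fact nn n0 a0 v0 u0 frob_v)+
  have "n1 > 0" "n2 > 0" using n0 nn by (auto intro: Nat.gr0I)
  hence "nu_sym_twisted TYPE('k) n1 n2 \<le> 2"
    using nu_sym_twisted_le_2[of n1 n2] cc.seq_decomp by (simp flip: nn)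
  moreover have "nu_sym TYPE('k) n = 2" if "n2 = 1"
  proof (rule antisym)
    have "n1 = n" using that nn by simp
    thus "nu_sym TYPE('k) n \<le> 2"
      using cc.seq_decomp by (intro nu_sym_le_2[OF n0]) (simp only: that)
  qed (rule nu_sym_ge_2[OF assms(1)])
  ultimately show ?thesis by blast
qed

end
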